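(* Let $\mathcal C$ be a join restriction category with local glueings. The equivalence $\Phi_g\colon\mathrm{peGpd}_c(\mathcal C)\simeq\mathrm{jiCat}/\!/_h\,\mathcal C\colon\Psi$ restricts to an equivalence $$\Phi_g\colon\mathrm{eGpd}_c(\mathcal C)\;\simeq\;\mathrm{PsGrp}(\mathcal C)\;\colon\Psi$$ between the category of étale internal groupoids and internal cofunctors in $\mathcal C$, and the category of complete $\mathcal C$-pseudogroups and their homomorphisms.
   Context: RESTRICTION CATEGORIES. A restriction category is a category with an operation assigning to each $f\colon A\to B$ a map $\bar f\colon A\to A$ such that $f\bar f=f$; $\bar f\bar g=\bar g\bar f$ and $\overline{g\bar f}=\bar g\bar f$ for $f\colon A\to B$, $g\colon A\to C$; and $\bar g f=f\,\overline{gf}$ for $f\colon A\to B$, $g\colon B\to C$. $\mathcal O(A)$ is the set of restriction idempotents on $A$ (maps $e\colon A\to A$ with $\bar e=e$). A map $f$ is total if $\bar f=1$. For parallel maps, $f\leqslant g$ iff $f=g\bar f$, and $f\smile g$ (compatible) iff $f\bar g=g\bar f$. A restriction functor satisfies $F\bar f=\overline{Ff}$; it is hyperconnected if each induced $\mathcal O(A)\to\mathcal O(FA)$ is an isomorphism. A join restriction category is a restriction category in which every pairwise-compatible family of parallel maps has a join for $\leqslant$, and these joins are preserved by precomposition. A partial isomorphism is a map $s\colon A\to B$ with a (necessarily unique) partial inverse $s^*\colon B\to A$: $s^*s=\bar s$, $ss^*=\overline{s^*}$. A local homeomorphism is a total map which is a join of partial isomorphisms. A local atlas on $X$ is a set $I$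 and a family $\varphi_{ij}\in\mathcal O(X)$ ($i,j\in I$) with $\varphi_{ij}=\varphi_{ji}$ and $\varphi_{jk}\varphi_{ij}\leqslant\varphi_{ik}$. A glueing of $\varphi$ is a local homeomorphism $p=\bigvee_i p_i\colon A\to X$, with each $p_i$ a partial isomorphism with partial inverse $s_i$, such that $\varphi_{ij}=p_js_i$. $\mathcal C$ has local glueings if every local atlas on every object has a glueing. A partial section of a total map $p\colon A\to X$ is a map $s\colon X\to A$ with $ps=\bar s$. PSEUDOGROUPS. An inverse category is a category in which every $s\colon A\to B$ has a unique $s^*\colon B\to A$ with $ss^*s=s$, $s^*ss^*=s^*$; it is a restriction category with $\bar s=s^*s$. Parallel maps are bicompatible if $s\smile t$ and $s^*\smile t^*$. A join inverse category is an inverse category in which every pairwise-bicompatible family of parallel maps has a join for $\leqslant$, preserved by precomposition; a join inverse monoid is a one-object one. For $X\in\mathcal C$, $\mathcal I(X)$ is the join inverse monoid of partial isomorphisms $X\to X$. $\mathrm{PsGrp}(\mathcal C)$ has: as objects, complete $\mathcal C$-pseudogroups $(S,X,\theta)$, comprising a join inverse monoid $S$, an object $X\in\mathcal C$ and a monoid homomorphism $\theta\colon S\to\mathcal I(X)$ restricting to an isomorphism between the idempotents of $S$ and those of $\mathcal I(X)$; as maps $(S,X,\theta)\to(T,Y,\gamma)$, pairs $(f,g)$ of a monoid homomorphism $f\colon S\to T$ and a total map $g\colon Y\to X$ in $\mathcal C$ with $\theta(s)g=g\gamma(f(s))$ for all $s\in S$. Thus $\mathrm{PsGrp}(\mathcal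 C)$ is the full subcategory of one-object objects of $\mathrm{jiCat}/\!/_h\,\mathcal C$, where the latter has as objects pairs $(\mathcal A,P)$ of a join inverse category and a hyperconnected restriction functor $P\colon\mathcal A\to\mathcal C$, and as maps $(\mathcal A,P)\to(\mathcal B,Q)$ pairs of a functor $F\colon\mathcal A\to\mathcal B$ and a natural transformation $\alpha\colon QF\Rightarrow P$ with total components. GROUPOIDS. For a set $I$, an $I$-partite internal category $\mathbb A$ in $\mathcal C$ comprises objects $A_i$; objects $A_{ij}$ with total maps $\sigma_{ij}\colon A_{ij}\to A_i$, $\tau_{ij}\colon A_{ij}\to A_j$, where $\sigma_{ij}$ admits pullbacks along all total maps; maps $\eta_i\colon A_i\to A_{ii}$ with $\sigma_{ii}\eta_i=1=\tau_{ii}\eta_i$; and maps $\mu_{ijk}\colon A_{jk}\times_{A_j}A_{ij}\to A_{ik}$ (domain the pullback of $\sigma_{jk}$ along $\tau_{ij}$) with $\sigma_{ik}\mu_{ijk}=\sigma_{ij}\pi_2$, $\tau_{ik}\mu_{ijk}=\tau_{jk}\pi_1$, satisfying $\mu_{iij}(1,\eta_i\sigma_{ij})=1=\mu_{ijj}(\eta_j\tau_{ij},1)$ and $\mu_{ik\ell}(1\times\mu_{ijk})=\mu_{ij\ell}(\mu_{jk\ell}\times 1)$. It is a groupoid if there are (necessarily unique) total maps $\iota_{ij}\colon A_{ij}\to A_{ji}$ with $\iota_{ij}\iota_{ji}=1$, $\sigma_{ji}\iota_{ij}=\tau_{ij}$ and $\mu_{iji}(\iota_{ij},1)=\eta_i\sigma_{ij}$;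 a groupoid is étale if every $\sigma_{ij}$ is a local homeomorphism. A partite cofunctor $F\colon\mathbb A\rightsquigarrow\mathbb B$ from an $I$-partite to a $J$-partite internal category comprises a function $I\to J$, $i\mapsto Fi$; total maps $F_i\colon B_{Fi}\to A_i$; and total maps $F_{ij}\colon A_{ij}\times_{A_i}B_{Fi}\to B_{Fi,Fj}$ (domain the pullback of $\sigma_{ij}$ along $F_i$) with $\sigma_{Fi,Fj}F_{ij}=\pi_2$, $F_j\tau_{Fi,Fj}F_{ij}=\tau_{ij}\pi_1$, $F_{ii}(\eta_iF_i,1)=\eta_{Fi}$, and $F_{ik}(\mu_{ijk}\times1)=\mu_{Fi,Fj,Fk}(F_{jk}\times1)(1\times F_{ij})$ on $A_{jk}\times_{A_j}A_{ij}\times_{A_i}B_{Fi}$ (using $A_{jk}\times_{A_j}B_{Fi,Fj}\cong(A_{jk}\times_{A_j}B_{Fj})\times_{B_{Fj}}B_{Fi,Fj}$). Composition: $(GF)i=G(Fi)$, $(GF)_i=F_iG_{Fi}$, $(GF)_{ij}=G_{Fi,Fj}(F_{ij}\times1)$ up to the canonical isomorphism of pullbacks. $\mathrm{peGpd}_c(\mathcal C)$ is the category of étale partite internal groupoids and partite cofunctors; $\mathrm{eGpd}_c(\mathcal C)$ is its full subcategory on the internal groupoids, i.e. the case where $I$ has one element. THE FUNCTORS. $\Phi_g(\mathbb A)=(\Phi_g\mathbb A,\pi_{\mathbb A})$: $\Phi_g\mathbb A$ has object-set $I$; maps $i\to j$ are partial sections $s$ of $\sigma_{ij}$ with $\tau_{ij}s$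 a partial isomorphism; identities are $\eta_i$; the composite of $s\colon i\to j$ and $t\colon j\to k$ is $\mu_{ijk}\circ\tau_{ij}^*(t)\circ s$ where $\tau_{ij}^*(t)=(t\tau_{ij},\overline{t\tau_{ij}})\colon A_{ij}\to A_{jk}\times_{A_j}A_{ij}$; $\pi_{\mathbb A}(i)=A_i$, $\pi_{\mathbb A}(s)=\tau_{ij}s$. A cofunctor $F$ is sent to the functor $i\mapsto Fi$, $s\mapsto F_{ij}\circ(sF_i,\overline{sF_i})$, with the transformation with components $F_i$. Given $(\mathcal A,P)$ and $f,g\in\mathcal A(i,j)$ put $[\![f=_Pg]\!]=\bigvee\{Pe: e\in\mathcal O(i),\ e\leqslant\bar f\bar g,\ fe=ge\}\in\mathcal O(Pi)$. $\Psi P$ is the $\mathrm{ob}(\mathcal A)$-partite groupoid with objects $Pi$; $\sigma_{ij}\colon\Psi P_{ij}\to Pi$ a glueing of the local atlas $([\![f=_Pg]\!])_{f,g\in\mathcal A(i,j)}$, with associated partial sections $s_f$; $\tau_{ij}$ unique with $\tau_{ij}s_f=Pf$; $\eta_i=s_{1_i}$; $\mu_{ijk}$ unique with $\mu_{ijk}\tau_{ij}^*(s_g)s_f=s_{gf}$. These give the equivalence $\mathrm{peGpd}_c(\mathcal C)\simeq\mathrm{jiCat}/\!/_h\,\mathcal C$, with $\Psi$ left adjoint to $\Phi_g$ via the unit $f\mapsto s_f$. *)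

theory Defs
  imports Main "HOL-Library.FuncSet"
begin

section \<open>Categories\<close>

text \<open>An arrow is a label together with its domain and codomain.  The label type is shared by all
  the categories below: a set of arrows with prescribed domain and codomain (a hom-set) is
  determined by a set of labels, so that ``a set'' can be read throughout as a set of labels.\<close>

datatype ('o, 'm) arr = Arr (Dom: 'o) (Lab: 'm) (Cod: 'o)

record ('o, 'm) cat =
  Ob :: "'o set"
  Mor :: "('o, 'm) arr set"
  Idt :: "'o \<Rightarrow> ('o, 'm) arr"
  Cmp :: "('o, 'm) arr \<Rightarrow> ('o, 'm) arr \<Rightarrow> ('o, 'm) arr"  (infixr "\<cdot>\<index>" 70)

definition Hom :: "('o, 'm, 'x) cat_scheme \<Rightarrow> 'o \<Rightarrow> 'o \<Rightarrow> ('o, 'm) arr set" where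
  "Hom C A B = {f \<in> Mor C. Dom f = A \<and> Cod f = B}"

locale category =
  fixes C :: "('o, 'm, 'x) cat_scheme" (structure)
  assumes dom_cod_ob: "f \<in> Mor C \<Longrightarrow> Dom f \<in> Ob C \<and> Cod f \<in> Ob C"
    and idt_hom: "A \<in> Ob C \<Longrightarrow> Idt C A \<in> Hom C A A"
    and cmp_hom: "f \<in> Hom C A B \<Longrightarrow> g \<in> Hom C B D \<Longrightarrow> g \<cdot> f \<in> Hom C A D"
    and cmp_idt: "f \<in> Hom C A B \<Longrightarrow> f \<cdot> Idt C A = f"
    and idt_cmp: "f \<in> Hom C A B \<Longrightarrow> Idt C B \<cdot> f = f"
    and cmp_assoc: "f \<in> Hom C A B \<Longrightarrow> g \<in> Hom C B D \<Longrightarrow> h \<in> Hom C D E \<Longrightarrow>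
      (h \<cdot> g) \<cdot> f = h \<cdot> (g \<cdot> f)"

record ('o, 'm, 'p, 'n) fnct =
  fo :: "'o \<Rightarrow> 'p"
  fm :: "('o, 'm) arr \<Rightarrow> ('p, 'n) arr"

definition is_functor ::
    "('o, 'm, 'x) cat_scheme \<Rightarrow> ('p, 'n, 'y) cat_scheme \<Rightarrow> ('o, 'm, 'p, 'n) fnct \<Rightarrow> bool" where
  "is_functor X Y F \<longleftrightarrow>
     (\<forall>A \<in> Ob X. fo F A \<in> Ob Y) \<and>
     (\<forall>f \<in> Mor X. fm F f \<in> Hom Y (fo F (Dom f)) (fo F (Cod f))) \<and>
     (\<forall>A \<in> Ob X. fm F (Idt X A) = Idt Y (fo F A)) \<and>
     (\<forall>f \<in> Mor X. \<forall>g \<in> Mor X. Cod f = Dom g \<longrightarrow>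
        fm F (g \<cdot>\<^bsub>X\<^esub> f) = fm F g \<cdot>\<^bsub>Y\<^esub> fm F f)"

definition fid :: "('o, 'm, 'o, 'm) fnct" where
  "fid = \<lparr>fo = (\<lambda>A. A), fm = (\<lambda>f. f)\<rparr>"

definition fcomp :: "('p, 'n, 'q, 'l) fnct \<Rightarrow> ('o, 'm, 'p, 'n) fnct \<Rightarrow> ('o, 'm, 'q, 'l) fnct" where
  "fcomp G F = \<lparr>fo = fo G \<circ> fo F, fm = fm G \<circ> fm F\<rparr>"

definition iso :: "('o, 'm, 'x) cat_scheme \<Rightarrow> ('o, 'm) arr \<Rightarrow> bool" where
  "iso X f \<longleftrightarrow> f \<in> Mor X \<and> (\<exists>g \<in> Hom X (Cod f) (Dom f).
     g \<cdot>\<^bsub>X\<^esub> f = Idt X (Dom f) \<and> f \<cdot>\<^bsub>X\<^esub> g = Idt X (Cod f))"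

definition natural_iso ::
    "('o, 'm, 'x) cat_scheme \<Rightarrow> ('p, 'n, 'y) cat_scheme \<Rightarrow>
     ('o, 'm, 'p, 'n) fnct \<Rightarrow> ('o, 'm, 'p, 'n) fnct \<Rightarrow> ('o \<Rightarrow> ('p, 'n) arr) \<Rightarrow> bool" where
  "natural_iso X Y F G \<eta> \<longleftrightarrow>
     (\<forall>A \<in> Ob X. \<eta> A \<in> Hom Y (fo F A) (fo G A) \<and> iso Y (\<eta> A)) \<and>
     (\<forall>f \<in> Mor X. fm G f \<cdot>\<^bsub>Y\<^esub> \<eta> (Dom f) = \<eta> (Cod f) \<cdot>\<^bsub>Y\<^esub> fm F f)"

text \<open>\<open>G\<close> is left adjoint to \<open>F\<close> with unit \<open>\<eta>\<close>, and both unit and counit are invertible.\<close>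

definition adjoint_equivalence ::
    "('o, 'm, 'x) cat_scheme \<Rightarrow> ('p, 'n, 'y) cat_scheme \<Rightarrow>
     ('o, 'm, 'p, 'n) fnct \<Rightarrow> ('p, 'n, 'o, 'm) fnct \<Rightarrow> ('p \<Rightarrow> ('p, 'n) arr) \<Rightarrow> bool" where
  "adjoint_equivalence X Y F G \<eta> \<longleftrightarrow>
     category X \<and> category Y \<and> is_functor X Y F \<and> is_functor Y X G \<and>
     natural_iso Y Y fid (fcomp F G) \<eta> \<and>
     (\<exists>\<epsilon>. natural_iso X X (fcomp G F) fid \<epsilon> \<and>
        (\<forall>A \<in> Ob X. fm F (\<epsilon> A) \<cdot>\<^bsub>Y\<^esub> \<eta> (fo F A) = Idt Y (fo F A)) \<and>
        (\<forall>B \<in> Ob Y. \<epsilon> (fo G B) \<cdot>\<^bsub>X\<^esub> fm G (\<eta> B) = Idt X (fo G B)))"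

definition full_subcategory ::
    "('o, 'm, 'x) cat_scheme \<Rightarrow> ('o, 'm, 'y) cat_scheme \<Rightarrow> bool" where
  "full_subcategory S T \<longleftrightarrow>
     Ob S \<subseteq> Ob T \<and> Mor S = {f \<in> Mor T. Dom f \<in> Ob S \<and> Cod f \<in> Ob S} \<and>
     (\<forall>A \<in> Ob S. Idt S A = Idt T A) \<and>
     (\<forall>f \<in> Mor S. \<forall>g \<in> Mor S. Cod f = Dom g \<longrightarrow> g \<cdot>\<^bsub>S\<^esub> f = g \<cdot>\<^bsub>T\<^esub> f)"

text \<open>Size.  ``Set'' (as opposed to ``class'') is read as ``of cardinality less than \<open>\<kappa>\<close>'', where
  the intended \<open>\<kappa>\<close> is the cardinality of the universe.  A bound is needed because, as in Freyd's
  theorem on small complete categories, glueing local atlases indexed by arbitrary sets of labels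
  would force every hom-set to be trivial.\<close>

definition small :: "'k rel \<Rightarrow> 'a set \<Rightarrow> bool" where
  "small \<kappa> S \<longleftrightarrow> (card_of S, \<kappa>) \<in> ordLess"

definition locally_small :: "'k rel \<Rightarrow> ('o, 'm, 'x) cat_scheme \<Rightarrow> bool" where
  "locally_small \<kappa> C \<longleftrightarrow> (\<forall>A \<in> Ob C. \<forall>B \<in> Ob C. small \<kappa> (Hom C A B))"


section \<open>Restriction categories\<close>

record ('o, 'm) rcat = "('o, 'm) cat" +
  Rst :: "('o, 'm) arr \<Rightarrow> ('o, 'm) arr"

locale restriction_category = category C for C :: "('o, 'm) rcat" (structure) +
  assumes rst_hom: "f \<in> Hom C A B \<Longrightarrow> Rst C f \<in> Hom C A A"
    and cmp_rst: "f \<in> Hom C A B \<Longrightarrow> f \<cdot> Rst C f = f"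
    and rst_commute: "f \<in> Hom C A B \<Longrightarrow> g \<in> Hom C A D \<Longrightarrow>
      Rst C f \<cdot> Rst C g = Rst C g \<cdot> Rst C f"
    and rst_cmp_rst: "f \<in> Hom C A B \<Longrightarrow> g \<in> Hom C A D \<Longrightarrow>
      Rst C (g \<cdot> Rst C f) = Rst C g \<cdot> Rst C f"
    and rst_cmp: "f \<in> Hom C A B \<Longrightarrow> g \<in> Hom C B D \<Longrightarrow>
      Rst C g \<cdot> f = f \<cdot> Rst C (g \<cdot> f)"

definition rst_idem :: "('o, 'm) rcat \<Rightarrow> 'o \<Rightarrow> ('o, 'm) arr set" where
  "rst_idem C A = {e \<in> Hom C A A. Rst C e = e}"

definition total_map :: "('o, 'm) rcat \<Rightarrow> ('o, 'm) arr \<Rightarrow> bool" where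
  "total_map C f \<longleftrightarrow> f \<in> Mor C \<and> Rst C f = Idt C (Dom f)"

definition parallel :: "('o, 'm) rcat \<Rightarrow> ('o, 'm) arr \<Rightarrow> ('o, 'm) arr \<Rightarrow> bool" where
  "parallel C f g \<longleftrightarrow> f \<in> Mor C \<and> g \<in> Mor C \<and> Dom f = Dom g \<and> Cod f = Cod g"

definition rle :: "('o, 'm) rcat \<Rightarrow> ('o, 'm) arr \<Rightarrow> ('o, 'm) arr \<Rightarrow> bool" where
  "rle C f g \<longleftrightarrow> parallel C f g \<and> f = g \<cdot>\<^bsub>C\<^esub> Rst C f"

definition compat :: "('o, 'm) rcat \<Rightarrow> ('o, 'm) arr \<Rightarrow> ('o, 'm) arr \<Rightarrow> bool" where
  "compat C f g \<longleftrightarrow> parallel C f g \<and> f \<cdot>\<^bsub>C\<^esub> Rst C g = g \<cdot>\<^bsub>C\<^esub> Rst C f"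

definition is_join ::
    "('o, 'm) rcat \<Rightarrow> 'o \<Rightarrow> 'o \<Rightarrow> ('o, 'm) arr set \<Rightarrow> ('o, 'm) arr \<Rightarrow> bool" where
  "is_join C A B F h \<longleftrightarrow> F \<subseteq> Hom C A B \<and> h \<in> Hom C A B \<and> (\<forall>f \<in> F. rle C f h) \<and>
     (\<forall>k \<in> Hom C A B. (\<forall>f \<in> F. rle C f k) \<longrightarrow> rle C h k)"

definition Join :: "('o, 'm) rcat \<Rightarrow> 'o \<Rightarrow> 'o \<Rightarrow> ('o, 'm) arr set \<Rightarrow> ('o, 'm) arr" where
  "Join C A B F = (THE h. is_join C A B F h)"

locale join_restriction_category = restriction_category C
    for C :: "('o, 'm) rcat" (structure) +
  assumes join_exists: "A \<in> Ob C \<Longrightarrow> B \<in> Ob C \<Longrightarrow> F \<subseteq> Hom C A B \<Longrightarrow>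
      (\<And>f g. f \<in> F \<Longrightarrow> g \<in> F \<Longrightarrow> compat C f g) \<Longrightarrow> \<exists>h. is_join C A B F h"
    and join_precomp: "(\<And>f g. f \<in> F \<Longrightarrow> g \<in> F \<Longrightarrow> compat C f g) \<Longrightarrow> is_join C A B F h \<Longrightarrow>
      k \<in> Hom C Z A \<Longrightarrow> is_join C Z B ((\<lambda>f. f \<cdot> k) ` F) (h \<cdot> k)"

definition restriction_functor ::
    "('o, 'm) rcat \<Rightarrow> ('p, 'n) rcat \<Rightarrow> ('o, 'm, 'p, 'n) fnct \<Rightarrow> bool" where
  "restriction_functor X Y F \<longleftrightarrow>
     is_functor X Y F \<and> (\<forall>f \<in> Mor X. fm F (Rst X f) = Rst Y (fm F f))"

definition hyperconnected ::
    "('o, 'm) rcat \<Rightarrow> ('p, 'n) rcat \<Rightarrow> ('o, 'm, 'p, 'n) fnct \<Rightarrow> bool" where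
  "hyperconnected X Y F \<longleftrightarrow>
     (\<forall>A \<in> Ob X. bij_betw (fm F) (rst_idem X A) (rst_idem Y (fo F A)))"

definition partial_inverse :: "('o, 'm) rcat \<Rightarrow> ('o, 'm) arr \<Rightarrow> ('o, 'm) arr \<Rightarrow> bool" where
  "partial_inverse C s t \<longleftrightarrow> s \<in> Mor C \<and> t \<in> Hom C (Cod s) (Dom s) \<and>
     t \<cdot>\<^bsub>C\<^esub> s = Rst C s \<and> s \<cdot>\<^bsub>C\<^esub> t = Rst C t"

definition partial_iso :: "('o, 'm) rcat \<Rightarrow> ('o, 'm) arr \<Rightarrow> bool" where
  "partial_iso C s \<longleftrightarrow> (\<exists>t. partial_inverse C s t)"

definition local_homeo :: "('o, 'm) rcat \<Rightarrow> ('o, 'm) arr \<Rightarrow> bool" where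
  "local_homeo C p \<longleftrightarrow> total_map C p \<and>
     (\<exists>F. (\<forall>s \<in> F. partial_iso C s) \<and> is_join C (Dom p) (Cod p) F p)"

definition local_atlas ::
    "('o, 'm) rcat \<Rightarrow> 'o \<Rightarrow> 'k set \<Rightarrow> ('k \<Rightarrow> 'k \<Rightarrow> ('o, 'm) arr) \<Rightarrow> bool" where
  "local_atlas C X I \<phi> \<longleftrightarrow> X \<in> Ob C \<and>
     (\<forall>i \<in> I. \<forall>j \<in> I. \<phi> i j \<in> rst_idem C X \<and> \<phi> i j = \<phi> j i) \<and>
     (\<forall>i \<in> I. \<forall>j \<in> I. \<forall>k \<in> I. rle C (\<phi> j k \<cdot>\<^bsub>C\<^esub> \<phi> i j) (\<phi> i k))"

text \<open>The glueing object is \<open>Dom p\<close>; \<open>q i\<close> and \<open>s i\<close> are the partial isomorphism of index \<open>i\<close>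
  and its partial inverse.\<close>

definition glueing ::
    "('o, 'm) rcat \<Rightarrow> 'o \<Rightarrow> 'k set \<Rightarrow> ('k \<Rightarrow> 'k \<Rightarrow> ('o, 'm) arr) \<Rightarrow>
     ('o, 'm) arr \<Rightarrow> ('k \<Rightarrow> ('o, 'm) arr) \<Rightarrow> ('k \<Rightarrow> ('o, 'm) arr) \<Rightarrow> bool" where
  "glueing C X I \<phi> p q s \<longleftrightarrow>
     local_homeo C p \<and> Cod p = X \<and>
     (\<forall>i \<in> I. partial_inverse C (q i) (s i)) \<and>
     is_join C (Dom p) X (q ` I) p \<and>
     (\<forall>i \<in> I. \<forall>j \<in> I. \<phi> i j = q j \<cdot>\<^bsub>C\<^esub> s i)"

definition has_local_glueings :: "'k rel \<Rightarrow> ('o, 'm) rcat \<Rightarrow> bool" where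
  "has_local_glueings \<kappa> C \<longleftrightarrow>
     (\<forall>X (I :: 'm set) \<phi>. small \<kappa> I \<longrightarrow> local_atlas C X I \<phi> \<longrightarrow> (\<exists>p q s. glueing C X I \<phi> p q s))"

definition partial_section :: "('o, 'm) rcat \<Rightarrow> ('o, 'm) arr \<Rightarrow> ('o, 'm) arr \<Rightarrow> bool" where
  "partial_section C p s \<longleftrightarrow> s \<in> Hom C (Cod p) (Dom p) \<and> p \<cdot>\<^bsub>C\<^esub> s = Rst C s"

text \<open>Pullbacks are taken in the category of all (not only total) maps of \<open>C\<close>, since pairings
  of partial maps are needed.\<close>

definition is_pullback ::
    "('o, 'm) rcat \<Rightarrow> ('o, 'm) arr \<Rightarrow> ('o, 'm) arr \<Rightarrow> ('o, 'm) arr \<Rightarrow> ('o, 'm) arr \<Rightarrow> bool" where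
  "is_pullback C f g p q \<longleftrightarrow>
     f \<in> Mor C \<and> g \<in> Mor C \<and> Cod f = Cod g \<and>
     p \<in> Hom C (Dom p) (Dom f) \<and> q \<in> Hom C (Dom p) (Dom g) \<and>
     f \<cdot>\<^bsub>C\<^esub> p = g \<cdot>\<^bsub>C\<^esub> q \<and>
     (\<forall>Z. \<forall>u \<in> Hom C Z (Dom f). \<forall>v \<in> Hom C Z (Dom g). f \<cdot>\<^bsub>C\<^esub> u = g \<cdot>\<^bsub>C\<^esub> v \<longrightarrow>
        (\<exists>!w. w \<in> Hom C Z (Dom p) \<and> p \<cdot>\<^bsub>C\<^esub> w = u \<and> q \<cdot>\<^bsub>C\<^esub> w = v))"

definition chosen_pullback ::
    "('o, 'm) rcat \<Rightarrow> ('o, 'm) arr \<Rightarrow> ('o, 'm) arr \<Rightarrow> ('o, 'm) arr \<times> ('o, 'm) arr" where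
  "chosen_pullback C f g = (SOME pq. is_pullback C f g (fst pq) (snd pq))"

definition pb1 :: "('o, 'm) rcat \<Rightarrow> ('o, 'm) arr \<Rightarrow> ('o, 'm) arr \<Rightarrow> ('o, 'm) arr" where
  "pb1 C f g = fst (chosen_pullback C f g)"

definition pb2 :: "('o, 'm) rcat \<Rightarrow> ('o, 'm) arr \<Rightarrow> ('o, 'm) arr \<Rightarrow> ('o, 'm) arr" where
  "pb2 C f g = snd (chosen_pullback C f g)"

definition pbo :: "('o, 'm) rcat \<Rightarrow> ('o, 'm) arr \<Rightarrow> ('o, 'm) arr \<Rightarrow> 'o" where
  "pbo C f g = Dom (pb1 C f g)"

text \<open>\<open>pair C f g u v\<close> is the map \<open>(u, v)\<close> into the pullback of \<open>f\<close> along \<open>g\<close>.\<close>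

definition pair ::
    "('o, 'm) rcat \<Rightarrow> ('o, 'm) arr \<Rightarrow> ('o, 'm) arr \<Rightarrow> ('o, 'm) arr \<Rightarrow> ('o, 'm) arr \<Rightarrow> ('o, 'm) arr" where
  "pair C f g u v = (THE w. w \<in> Hom C (Dom u) (pbo C f g) \<and>
     pb1 C f g \<cdot>\<^bsub>C\<^esub> w = u \<and> pb2 C f g \<cdot>\<^bsub>C\<^esub> w = v)"

text \<open>For a partial section \<open>s\<close> of \<open>p\<close>, the partial section \<open>g\<^sup>*(s)\<close> of the pullback of \<open>p\<close>
  along a total map \<open>g\<close>.\<close>

definition pull_section ::
    "('o, 'm) rcat \<Rightarrow> ('o, 'm) arr \<Rightarrow> ('o, 'm) arr \<Rightarrow> ('o, 'm) arr \<Rightarrow> ('o, 'm) arr" where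
  "pull_section C p g s = pair C p g (s \<cdot>\<^bsub>C\<^esub> g) (Rst C (s \<cdot>\<^bsub>C\<^esub> g))"


section \<open>Join inverse categories and complete pseudogroups\<close>

locale inverse_category = category A for A :: "('o, 'm) cat" (structure) +
  assumes inverse_ex1: "s \<in> Mor A \<Longrightarrow>
    \<exists>!t. t \<in> Hom A (Cod s) (Dom s) \<and> s \<cdot> t \<cdot> s = s \<and> t \<cdot> s \<cdot> t = t"

definition cinv :: "('o, 'm) cat \<Rightarrow> ('o, 'm) arr \<Rightarrow> ('o, 'm) arr" where
  "cinv A s = (THE t. t \<in> Hom A (Cod s) (Dom s) \<and>
     s \<cdot>\<^bsub>A\<^esub> t \<cdot>\<^bsub>A\<^esub> s = s \<and> t \<cdot>\<^bsub>A\<^esub> s \<cdot>\<^bsub>A\<^esub> t = t)"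

definition inv_rcat :: "('o, 'm) cat \<Rightarrow> ('o, 'm) rcat" where
  "inv_rcat A = \<lparr>Ob = Ob A, Mor = Mor A, Idt = Idt A, Cmp = Cmp A,
     Rst = (\<lambda>s. cinv A s \<cdot>\<^bsub>A\<^esub> s)\<rparr>"

definition bicompat :: "('o, 'm) cat \<Rightarrow> ('o, 'm) arr \<Rightarrow> ('o, 'm) arr \<Rightarrow> bool" where
  "bicompat A s t \<longleftrightarrow>
     compat (inv_rcat A) s t \<and> compat (inv_rcat A) (cinv A s) (cinv A t)"

locale join_inverse_category = inverse_category A for A :: "('o, 'm) cat" (structure) +
  assumes join_exists: "i \<in> Ob A \<Longrightarrow> j \<in> Ob A \<Longrightarrow> F \<subseteq> Hom A i j \<Longrightarrow>
      (\<And>s t. s \<in> F \<Longrightarrow> t \<in> F \<Longrightarrow> bicompat A s t) \<Longrightarrow> \<exists>h. is_join (inv_rcat A) i j F h"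
    and join_precomp: "(\<And>s t. s \<in> F \<Longrightarrow> t \<in> F \<Longrightarrow> bicompat A s t) \<Longrightarrow>
      is_join (inv_rcat A) i j F h \<Longrightarrow> k \<in> Hom A l i \<Longrightarrow>
      is_join (inv_rcat A) l j ((\<lambda>s. s \<cdot> k) ` F) (h \<cdot> k)"

text \<open>The data of an object \<open>(A, P)\<close> and of a map \<open>(F, \<alpha>)\<close> of \<open>jiCat //\<^sub>h C\<close>.  The components of a
  map are required to be extensional, so that equality of maps is equality on the domain.\<close>

type_synonym ('i, 'o, 'm) over_obj = "('i, 'm) cat \<times> ('i, 'm, 'o, 'm) fnct"
type_synonym ('i, 'o, 'm) over_map = "('i, 'm, 'i, 'm) fnct \<times> ('i \<Rightarrow> ('o, 'm) arr)"

definition over_object :: "'k rel \<Rightarrow> ('o, 'm) rcat \<Rightarrow> ('i, 'o, 'm) over_obj \<Rightarrow> bool" where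
  "over_object \<kappa> C = (\<lambda>(A, P).
     join_inverse_category A \<and> small \<kappa> (Ob A) \<and> locally_small \<kappa> A \<and>
     restriction_functor (inv_rcat A) C P \<and> hyperconnected (inv_rcat A) C P)"

definition over_hom ::
    "('o, 'm) rcat \<Rightarrow> ('i, 'o, 'm) over_obj \<Rightarrow> ('i, 'o, 'm) over_obj \<Rightarrow> ('i, 'o, 'm) over_map \<Rightarrow> bool" where
  "over_hom C = (\<lambda>(A, P) (B, Q) (F, \<alpha>).
     is_functor A B F \<and> fo F \<in> extensional (Ob A) \<and> fm F \<in> extensional (Mor A) \<and>
     \<alpha> \<in> extensional (Ob A) \<and>
     (\<forall>i \<in> Ob A. \<alpha> i \<in> Hom C (fo Q (fo F i)) (fo P i) \<and> total_map C (\<alpha> i)) \<and>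
     (\<forall>s \<in> Mor A. fm P s \<cdot>\<^bsub>C\<^esub> \<alpha> (Dom s) = \<alpha> (Cod s) \<cdot>\<^bsub>C\<^esub> fm Q (fm F s)))"

definition over_id :: "('o, 'm) rcat \<Rightarrow> ('i, 'o, 'm) over_obj \<Rightarrow> ('i, 'o, 'm) over_map" where
  "over_id C = (\<lambda>(A, P).
     (\<lparr>fo = (\<lambda>i \<in> Ob A. i), fm = (\<lambda>s \<in> Mor A. s)\<rparr>, \<lambda>i \<in> Ob A. Idt C (fo P i)))"

text \<open>The composite \<open>(G, \<beta>) \<circ> (F, \<alpha>)\<close>, with \<open>(F, \<alpha>)\<close> starting at the given object.\<close>

definition over_comp ::
    "('o, 'm) rcat \<Rightarrow> ('i, 'o, 'm) over_obj \<Rightarrow>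
     ('i, 'o, 'm) over_map \<Rightarrow> ('i, 'o, 'm) over_map \<Rightarrow> ('i, 'o, 'm) over_map" where
  "over_comp C = (\<lambda>(A, P) (G, \<beta>) (F, \<alpha>).
     (\<lparr>fo = (\<lambda>i \<in> Ob A. fo G (fo F i)), fm = (\<lambda>s \<in> Mor A. fm G (fm F s))\<rparr>,
      \<lambda>i \<in> Ob A. \<alpha> i \<cdot>\<^bsub>C\<^esub> \<beta> (fo F i)))"

definition jiCat_over ::
    "'k rel \<Rightarrow> ('o, 'm) rcat \<Rightarrow> (('i, 'o, 'm) over_obj, ('i, 'o, 'm) over_map) cat" where
  "jiCat_over \<kappa> C =
    \<lparr>Ob = {X. over_object \<kappa> C X},
     Mor = {Arr X f Y | X f Y. over_object \<kappa> C X \<and> over_object \<kappa> C Y \<and> over_hom C X Y f},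
     Idt = (\<lambda>X. Arr X (over_id C X) X),
     Cmp = (\<lambda>g f. Arr (Dom f) (over_comp C (Dom f) (Lab g) (Lab f)) (Cod g))\<rparr>"

text \<open>The join inverse monoid \<open>I(X)\<close> is this set under composition.\<close>

definition piso_monoid :: "('o, 'm) rcat \<Rightarrow> 'o \<Rightarrow> ('o, 'm) arr set" where
  "piso_monoid C X = {s \<in> Hom C X X. partial_iso C s}"

text \<open>A complete pseudogroup \<open>(S, X, \<theta>)\<close> is given as a pair \<open>(S, \<theta>)\<close>: the monoid \<open>S\<close> is a
  one-object category, say with object \<open>i\<close>, the object \<open>X\<close> is \<open>fo \<theta> i\<close>, and \<open>\<theta>\<close> is \<open>fm \<theta>\<close>.\<close>

definition complete_pseudogroup :: "'k rel \<Rightarrow> ('o, 'm) rcat \<Rightarrow> ('i, 'o, 'm) over_obj \<Rightarrow> bool" where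
  "complete_pseudogroup \<kappa> C = (\<lambda>(S, \<theta>). \<exists>i.
     Ob S = {i} \<and> join_inverse_category S \<and> small \<kappa> (Mor S) \<and>
     fo \<theta> i \<in> Ob C \<and>
     (\<forall>s \<in> Mor S. fm \<theta> s \<in> piso_monoid C (fo \<theta> i)) \<and>
     fm \<theta> (Idt S i) = Idt C (fo \<theta> i) \<and>
     (\<forall>s \<in> Mor S. \<forall>t \<in> Mor S. fm \<theta> (s \<cdot>\<^bsub>S\<^esub> t) = fm \<theta> s \<cdot>\<^bsub>C\<^esub> fm \<theta> t) \<and>
     bij_betw (fm \<theta>) {e \<in> Mor S. e \<cdot>\<^bsub>S\<^esub> e = e}
       {e \<in> piso_monoid C (fo \<theta> i). e \<cdot>\<^bsub>C\<^esub> e = e})"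

text \<open>A map \<open>(f, g)\<close> from \<open>(S, X, \<theta>)\<close> to \<open>(T, Y, \<gamma>)\<close>, with \<open>f = fm F\<close> and \<open>g = \<alpha> i\<close>.\<close>

definition pseudogroup_hom ::
    "('o, 'm) rcat \<Rightarrow> ('i, 'o, 'm) over_obj \<Rightarrow> ('i, 'o, 'm) over_obj \<Rightarrow> ('i, 'o, 'm) over_map \<Rightarrow> bool" where
  "pseudogroup_hom C = (\<lambda>(S, \<theta>) (T, \<gamma>) (F, \<alpha>). \<exists>i j.
     Ob S = {i} \<and> Ob T = {j} \<and> fo F = (\<lambda>x \<in> {i}. j) \<and>
     fm F \<in> Mor S \<rightarrow>\<^sub>E Mor T \<and> fm F (Idt S i) = Idt T j \<and>
     (\<forall>s \<in> Mor S. \<forall>t \<in> Mor S. fm F (s \<cdot>\<^bsub>S\<^esub> t) = fm F s \<cdot>\<^bsub>T\<^esub> fm F t) \<and>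
     \<alpha> \<in> extensional {i} \<and> \<alpha> i \<in> Hom C (fo \<gamma> j) (fo \<theta> i) \<and> total_map C (\<alpha> i) \<and>
     (\<forall>s \<in> Mor S. fm \<theta> s \<cdot>\<^bsub>C\<^esub> \<alpha> i = \<alpha> i \<cdot>\<^bsub>C\<^esub> fm \<gamma> (fm F s)))"

definition PsGrp ::
    "'k rel \<Rightarrow> ('o, 'm) rcat \<Rightarrow> (('i, 'o, 'm) over_obj, ('i, 'o, 'm) over_map) cat" where
  "PsGrp \<kappa> C =
    \<lparr>Ob = {X. complete_pseudogroup \<kappa> C X},
     Mor = {Arr X f Y | X f Y. complete_pseudogroup \<kappa> C X \<and> complete_pseudogroup \<kappa> C Y \<and>
              pseudogroup_hom C X Y f},
     Idt = (\<lambda>X. Arr X (over_id C X) X),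
     Cmp = (\<lambda>g f. Arr (Dom f) (over_comp C (Dom f) (Lab g) (Lab f)) (Cod g))\<rparr>"


section \<open>Partite internal groupoids and cofunctors\<close>

text \<open>\<open>obj i\<close> is the object \<open>A\<^sub>i\<close> and \<open>mob i j\<close> the object \<open>A\<^sub>i\<^sub>j\<close>.\<close>

record ('i, 'o, 'm) pcat =
  idx :: "'i set"
  obj :: "'i \<Rightarrow> 'o"
  mob :: "'i \<Rightarrow> 'i \<Rightarrow> 'o"
  src :: "'i \<Rightarrow> 'i \<Rightarrow> ('o, 'm) arr"
  tgt :: "'i \<Rightarrow> 'i \<Rightarrow> ('o, 'm) arr"
  unt :: "'i \<Rightarrow> ('o, 'm) arr"
  mul :: "'i \<Rightarrow> 'i \<Rightarrow> 'i \<Rightarrow> ('o, 'm) arr"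

text \<open>In the associativity axiom, \<open>A\<^sub>k\<^sub>l \<times> A\<^sub>j\<^sub>k \<times> A\<^sub>i\<^sub>j\<close> is bracketed to the right.\<close>

locale partite_category =
  fixes C :: "('o, 'm) rcat" (structure) and \<AA> :: "('i, 'o, 'm) pcat"
  assumes obj: "i \<in> idx \<AA> \<Longrightarrow> obj \<AA> i \<in> Ob C"
    and src: "i \<in> idx \<AA> \<Longrightarrow> j \<in> idx \<AA> \<Longrightarrow>
      src \<AA> i j \<in> Hom C (mob \<AA> i j) (obj \<AA> i) \<and> total_map C (src \<AA> i j)"
    and tgt: "i \<in> idx \<AA> \<Longrightarrow> j \<in> idx \<AA> \<Longrightarrow>
      tgt \<AA> i j \<in> Hom C (mob \<AA> i j) (obj \<AA> j) \<and> total_map C (tgt \<AA> i j)"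
    and src_pullback: "i \<in> idx \<AA> \<Longrightarrow> j \<in> idx \<AA> \<Longrightarrow> total_map C g \<Longrightarrow> Cod g = obj \<AA> i \<Longrightarrow>
      \<exists>p q. is_pullback C (src \<AA> i j) g p q"
    and unt: "i \<in> idx \<AA> \<Longrightarrow> unt \<AA> i \<in> Hom C (obj \<AA> i) (mob \<AA> i i)"
    and src_unt: "i \<in> idx \<AA> \<Longrightarrow> src \<AA> i i \<cdot> unt \<AA> i = Idt C (obj \<AA> i)"
    and tgt_unt: "i \<in> idx \<AA> \<Longrightarrow> tgt \<AA> i i \<cdot> unt \<AA> i = Idt C (obj \<AA> i)"
    and mul: "i \<in> idx \<AA> \<Longrightarrow> j \<in> idx \<AA> \<Longrightarrow> k \<in> idx \<AA> \<Longrightarrow>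
      mul \<AA> i j k \<in> Hom C (pbo C (src \<AA> j k) (tgt \<AA> i j)) (mob \<AA> i k)"
    and src_mul: "i \<in> idx \<AA> \<Longrightarrow> j \<in> idx \<AA> \<Longrightarrow> k \<in> idx \<AA> \<Longrightarrow>
      src \<AA> i k \<cdot> mul \<AA> i j k = src \<AA> i j \<cdot> pb2 C (src \<AA> j k) (tgt \<AA> i j)"
    and tgt_mul: "i \<in> idx \<AA> \<Longrightarrow> j \<in> idx \<AA> \<Longrightarrow> k \<in> idx \<AA> \<Longrightarrow>
      tgt \<AA> i k \<cdot> mul \<AA> i j k = tgt \<AA> j k \<cdot> pb1 C (src \<AA> j k) (tgt \<AA> i j)"
    and mul_unt_right: "i \<in> idx \<AA> \<Longrightarrow> j \<in> idx \<AA> \<Longrightarrow>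
      mul \<AA> i i j \<cdot> pair C (src \<AA> i j) (tgt \<AA> i i)
        (Idt C (mob \<AA> i j)) (unt \<AA> i \<cdot> src \<AA> i j) = Idt C (mob \<AA> i j)"
    and mul_unt_left: "i \<in> idx \<AA> \<Longrightarrow> j \<in> idx \<AA> \<Longrightarrow>
      mul \<AA> i j j \<cdot> pair C (src \<AA> j j) (tgt \<AA> i j)
        (unt \<AA> j \<cdot> tgt \<AA> i j) (Idt C (mob \<AA> i j)) = Idt C (mob \<AA> i j)"
    and mul_assoc: "i \<in> idx \<AA> \<Longrightarrow> j \<in> idx \<AA> \<Longrightarrow> k \<in> idx \<AA> \<Longrightarrow> l \<in> idx \<AA> \<Longrightarrow>
      (let \<pi>1 = pb1 C (src \<AA> j k) (tgt \<AA> i j); \<pi>2 = pb2 C (src \<AA> j k) (tgt \<AA> i j);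
           \<rho>1 = pb1 C (src \<AA> k l) (tgt \<AA> j k \<cdot> \<pi>1); \<rho>2 = pb2 C (src \<AA> k l) (tgt \<AA> j k \<cdot> \<pi>1)
       in mul \<AA> i k l \<cdot> pair C (src \<AA> k l) (tgt \<AA> i k) \<rho>1 (mul \<AA> i j k \<cdot> \<rho>2) =
          mul \<AA> i j l \<cdot> pair C (src \<AA> j l) (tgt \<AA> i j)
            (mul \<AA> j k l \<cdot> pair C (src \<AA> k l) (tgt \<AA> j k) \<rho>1 (\<pi>1 \<cdot> \<rho>2)) (\<pi>2 \<cdot> \<rho>2))"

definition partite_groupoid :: "('o, 'm) rcat \<Rightarrow> ('i, 'o, 'm) pcat \<Rightarrow> bool" where
  "partite_groupoid C \<AA> \<longleftrightarrow> partite_category C \<AA> \<and>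
     (\<exists>\<iota>. \<forall>i \<in> idx \<AA>. \<forall>j \<in> idx \<AA>.
        \<iota> i j \<in> Hom C (mob \<AA> i j) (mob \<AA> j i) \<and> total_map C (\<iota> i j) \<and>
        \<iota> i j \<cdot>\<^bsub>C\<^esub> \<iota> j i = Idt C (mob \<AA> j i) \<and>
        src \<AA> j i \<cdot>\<^bsub>C\<^esub> \<iota> i j = tgt \<AA> i j \<and>
        mul \<AA> i j i \<cdot>\<^bsub>C\<^esub> pair C (src \<AA> j i) (tgt \<AA> i j) (\<iota> i j) (Idt C (mob \<AA> i j)) =
          unt \<AA> i \<cdot>\<^bsub>C\<^esub> src \<AA> i j)"

definition etale_groupoid :: "'k rel \<Rightarrow> ('o, 'm) rcat \<Rightarrow> ('i, 'o, 'm) pcat \<Rightarrow> bool" where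
  "etale_groupoid \<kappa> C \<AA> \<longleftrightarrow> small \<kappa> (idx \<AA>) \<and> partite_groupoid C \<AA> \<and>
     (\<forall>i \<in> idx \<AA>. \<forall>j \<in> idx \<AA>. local_homeo C (src \<AA> i j))"

record ('i, 'o, 'm) cofunctor =
  cidx :: "'i \<Rightarrow> 'i"
  cob :: "'i \<Rightarrow> ('o, 'm) arr"
  cmor :: "'i \<Rightarrow> 'i \<Rightarrow> ('o, 'm) arr"

text \<open>As for \<open>over_hom\<close>, the components are extensional.  In the multiplication axiom,
  \<open>A\<^sub>j\<^sub>k \<times> A\<^sub>i\<^sub>j \<times> B\<^sub>F\<^sub>i\<close> is bracketed to the right.\<close>

locale partite_cofunctor =
  fixes C :: "('o, 'm) rcat" (structure)
    and \<AA> :: "('i, 'o, 'm) pcat" and \<BB> :: "('i, 'o, 'm) pcat" and F :: "('i, 'o, 'm) cofunctor"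
  assumes cidx: "cidx F \<in> idx \<AA> \<rightarrow>\<^sub>E idx \<BB>"
    and cob_ext: "cob F \<in> extensional (idx \<AA>)"
    and cmor_ext: "\<not> (i \<in> idx \<AA> \<and> j \<in> idx \<AA>) \<Longrightarrow> cmor F i j = undefined"
    and cob: "i \<in> idx \<AA> \<Longrightarrow>
      cob F i \<in> Hom C (obj \<BB> (cidx F i)) (obj \<AA> i) \<and> total_map C (cob F i)"
    and cmor: "i \<in> idx \<AA> \<Longrightarrow> j \<in> idx \<AA> \<Longrightarrow>
      cmor F i j \<in> Hom C (pbo C (src \<AA> i j) (cob F i)) (mob \<BB> (cidx F i) (cidx F j)) \<and>
      total_map C (cmor F i j)"
    and src_cmor: "i \<in> idx \<AA> \<Longrightarrow> j \<in> idx \<AA> \<Longrightarrow>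
      src \<BB> (cidx F i) (cidx F j) \<cdot> cmor F i j = pb2 C (src \<AA> i j) (cob F i)"
    and tgt_cmor: "i \<in> idx \<AA> \<Longrightarrow> j \<in> idx \<AA> \<Longrightarrow>
      cob F j \<cdot> tgt \<BB> (cidx F i) (cidx F j) \<cdot> cmor F i j =
        tgt \<AA> i j \<cdot> pb1 C (src \<AA> i j) (cob F i)"
    and cmor_unt: "i \<in> idx \<AA> \<Longrightarrow>
      cmor F i i \<cdot> pair C (src \<AA> i i) (cob F i)
        (unt \<AA> i \<cdot> cob F i) (Idt C (obj \<BB> (cidx F i))) = unt \<BB> (cidx F i)"
    and cmor_mul: "i \<in> idx \<AA> \<Longrightarrow> j \<in> idx \<AA> \<Longrightarrow> k \<in> idx \<AA> \<Longrightarrow>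
      (let \<pi>1 = pb1 C (src \<AA> i j) (cob F i); \<pi>2 = pb2 C (src \<AA> i j) (cob F i);
           \<rho>1 = pb1 C (src \<AA> j k) (tgt \<AA> i j \<cdot> \<pi>1); \<rho>2 = pb2 C (src \<AA> j k) (tgt \<AA> i j \<cdot> \<pi>1);
           i' = cidx F i; j' = cidx F j; k' = cidx F k
       in cmor F i k \<cdot> pair C (src \<AA> i k) (cob F i)
            (mul \<AA> i j k \<cdot> pair C (src \<AA> j k) (tgt \<AA> i j) \<rho>1 (\<pi>1 \<cdot> \<rho>2)) (\<pi>2 \<cdot> \<rho>2) =
          mul \<BB> i' j' k' \<cdot> pair C (src \<BB> j' k') (tgt \<BB> i' j')
            (cmor F j k \<cdot> pair C (src \<AA> j k) (cob F j) \<rho>1 (tgt \<BB> i' j' \<cdot> cmor F i j \<cdot> \<rho>2))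
            (cmor F i j \<cdot> \<rho>2))"

definition cof_id :: "('o, 'm) rcat \<Rightarrow> ('i, 'o, 'm) pcat \<Rightarrow> ('i, 'o, 'm) cofunctor" where
  "cof_id C \<AA> =
    \<lparr>cidx = (\<lambda>i \<in> idx \<AA>. i),
     cob = (\<lambda>i \<in> idx \<AA>. Idt C (obj \<AA> i)),
     cmor = (\<lambda>i j. if i \<in> idx \<AA> \<and> j \<in> idx \<AA>
               then pb1 C (src \<AA> i j) (Idt C (obj \<AA> i)) else undefined)\<rparr>"

text \<open>The composite \<open>G F\<close> of \<open>F\<close> from \<open>\<AA>\<close> to \<open>\<BB>\<close> and \<open>G\<close> starting at \<open>\<BB>\<close>.  Pairing with the
  projections of the pullback along \<open>F\<^sub>i G\<^sub>F\<^sub>i\<close> absorbs the canonical isomorphism of pullbacks.\<close>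

definition cof_comp ::
    "('o, 'm) rcat \<Rightarrow> ('i, 'o, 'm) pcat \<Rightarrow> ('i, 'o, 'm) pcat \<Rightarrow>
     ('i, 'o, 'm) cofunctor \<Rightarrow> ('i, 'o, 'm) cofunctor \<Rightarrow> ('i, 'o, 'm) cofunctor" where
  "cof_comp C \<AA> \<BB> G F =
    \<lparr>cidx = (\<lambda>i \<in> idx \<AA>. cidx G (cidx F i)),
     cob = (\<lambda>i \<in> idx \<AA>. cob F i \<cdot>\<^bsub>C\<^esub> cob G (cidx F i)),
     cmor = (\<lambda>i j. if i \<in> idx \<AA> \<and> j \<in> idx \<AA> then
        (let i' = cidx F i; j' = cidx F j;
             \<pi>1 = pb1 C (src \<AA> i j) (cob F i \<cdot>\<^bsub>C\<^esub> cob G i');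
             \<pi>2 = pb2 C (src \<AA> i j) (cob F i \<cdot>\<^bsub>C\<^esub> cob G i')
         in cmor G i' j' \<cdot>\<^bsub>C\<^esub> pair C (src \<BB> i' j') (cob G i')
              (cmor F i j \<cdot>\<^bsub>C\<^esub> pair C (src \<AA> i j) (cob F i) \<pi>1 (cob G i' \<cdot>\<^bsub>C\<^esub> \<pi>2)) \<pi>2)
        else undefined)\<rparr>"

definition peGpd :: "'k rel \<Rightarrow> ('o, 'm) rcat \<Rightarrow> (('i, 'o, 'm) pcat, ('i, 'o, 'm) cofunctor) cat" where
  "peGpd \<kappa> C =
    \<lparr>Ob = {\<AA>. etale_groupoid \<kappa> C \<AA>},
     Mor = {Arr \<AA> F \<BB> | \<AA> F \<BB>. etale_groupoid \<kappa> C \<AA> \<and> etale_groupoid \<kappa> C \<BB> \<and>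
              partite_cofunctor C \<AA> \<BB> F},
     Idt = (\<lambda>\<AA>. Arr \<AA> (cof_id C \<AA>) \<AA>),
     Cmp = (\<lambda>G F. Arr (Dom F) (cof_comp C (Dom F) (Cod F) (Lab G) (Lab F)) (Cod G))\<rparr>"

definition eGpd :: "'k rel \<Rightarrow> ('o, 'm) rcat \<Rightarrow> (('i, 'o, 'm) pcat, ('i, 'o, 'm) cofunctor) cat" where
  "eGpd \<kappa> C =
    \<lparr>Ob = {\<AA> \<in> Ob (peGpd \<kappa> C). is_singleton (idx \<AA>)},
     Mor = {F \<in> Mor (peGpd \<kappa> C). is_singleton (idx (Dom F)) \<and> is_singleton (idx (Cod F))},
     Idt = Idt (peGpd \<kappa> C),
     Cmp = Cmp (peGpd \<kappa> C)\<rparr>"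


section \<open>The functor \<open>\<Phi>\<^sub>g\<close>\<close>

text \<open>A map \<open>i \<rightarrow> j\<close> of \<open>\<Phi>\<^sub>g \<AA>\<close> has the same label as the partial section \<open>A\<^sub>i \<rightarrow> A\<^sub>i\<^sub>j\<close> of \<open>C\<close> that
  it stands for; \<open>sect\<close> recovers the latter.\<close>

definition sect :: "('i, 'o, 'm) pcat \<Rightarrow> ('i, 'm) arr \<Rightarrow> ('o, 'm) arr" where
  "sect \<AA> a = Arr (obj \<AA> (Dom a)) (Lab a) (mob \<AA> (Dom a) (Cod a))"

definition Phi_cat :: "('o, 'm) rcat \<Rightarrow> ('i, 'o, 'm) pcat \<Rightarrow> ('i, 'm) cat" where
  "Phi_cat C \<AA> =
    \<lparr>Ob = idx \<AA>,
     Mor = {a. Dom a \<in> idx \<AA> \<and> Cod a \<in> idx \<AA> \<and>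
               partial_section C (src \<AA> (Dom a) (Cod a)) (sect \<AA> a) \<and>
               partial_iso C (tgt \<AA> (Dom a) (Cod a) \<cdot>\<^bsub>C\<^esub> sect \<AA> a)},
     Idt = (\<lambda>i. Arr i (Lab (unt \<AA> i)) i),
     Cmp = (\<lambda>b a. let i = Dom a; j = Cod a; k = Cod b in
        Arr i (Lab (mul \<AA> i j k \<cdot>\<^bsub>C\<^esub>
                    pull_section C (src \<AA> j k) (tgt \<AA> i j) (sect \<AA> b) \<cdot>\<^bsub>C\<^esub> sect \<AA> a)) k)\<rparr>"

definition Phi_proj :: "('o, 'm) rcat \<Rightarrow> ('i, 'o, 'm) pcat \<Rightarrow> ('i, 'm, 'o, 'm) fnct" where
  "Phi_proj C \<AA> = \<lparr>fo = obj \<AA>, fm = (\<lambda>a. tgt \<AA> (Dom a) (Cod a) \<cdot>\<^bsub>C\<^esub> sect \<AA> a)\<rparr>"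

definition Phi_obj :: "('o, 'm) rcat \<Rightarrow> ('i, 'o, 'm) pcat \<Rightarrow> ('i, 'o, 'm) over_obj" where
  "Phi_obj C \<AA> = (Phi_cat C \<AA>, Phi_proj C \<AA>)"

definition Phi_map ::
    "('o, 'm) rcat \<Rightarrow> ('i, 'o, 'm) pcat \<Rightarrow> ('i, 'o, 'm) cofunctor \<Rightarrow> ('i, 'o, 'm) over_map" where
  "Phi_map C \<AA> F =
    (\<lparr>fo = (\<lambda>i \<in> idx \<AA>. cidx F i),
      fm = (\<lambda>a \<in> Mor (Phi_cat C \<AA>). let i = Dom a; j = Cod a in
        Arr (cidx F i)
          (Lab (cmor F i j \<cdot>\<^bsub>C\<^esub> pull_section C (src \<AA> i j) (cob F i) (sect \<AA> a)))
          (cidx F j))\<rparr>,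
     \<lambda>i \<in> idx \<AA>. cob F i)"

definition Phi_g ::
    "('o, 'm) rcat \<Rightarrow> (('i, 'o, 'm) pcat, ('i, 'o, 'm) cofunctor,
                      ('i, 'o, 'm) over_obj, ('i, 'o, 'm) over_map) fnct" where
  "Phi_g C =
    \<lparr>fo = Phi_obj C,
     fm = (\<lambda>F. Arr (Phi_obj C (Dom F)) (Phi_map C (Dom F) (Lab F)) (Phi_obj C (Cod F)))\<rparr>"


section \<open>The functor \<open>\<Psi>\<close>\<close>

definition eq_idem ::
    "('o, 'm) rcat \<Rightarrow> ('i, 'o, 'm) over_obj \<Rightarrow> ('i, 'm) arr \<Rightarrow> ('i, 'm) arr \<Rightarrow> ('o, 'm) arr" where
  "eq_idem C = (\<lambda>(A, P) f g. Join C (fo P (Dom f)) (fo P (Dom f))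
     {fm P e | e. e \<in> rst_idem (inv_rcat A) (Dom f) \<and>
        rle (inv_rcat A) e (Rst (inv_rcat A) f \<cdot>\<^bsub>A\<^esub> Rst (inv_rcat A) g) \<and>
        f \<cdot>\<^bsub>A\<^esub> e = g \<cdot>\<^bsub>A\<^esub> e})"

definition Psi_glueing ::
    "('o, 'm) rcat \<Rightarrow> ('i, 'o, 'm) over_obj \<Rightarrow> 'i \<Rightarrow> 'i \<Rightarrow>
     ('o, 'm) arr \<times> (('i, 'm) arr \<Rightarrow> ('o, 'm) arr) \<times> (('i, 'm) arr \<Rightarrow> ('o, 'm) arr)" where
  "Psi_glueing C = (\<lambda>(A, P) i j. SOME (p, q, s).
     glueing C (fo P i) (Hom A i j) (eq_idem C (A, P)) p q s)"

definition Psi_src :: "('o, 'm) rcat \<Rightarrow> ('i, 'o, 'm) over_obj \<Rightarrow> 'i \<Rightarrow> 'i \<Rightarrow> ('o, 'm) arr" where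
  "Psi_src C X i j = fst (Psi_glueing C X i j)"

text \<open>The partial section \<open>s\<^sub>f\<close>.\<close>

definition Psi_sec :: "('o, 'm) rcat \<Rightarrow> ('i, 'o, 'm) over_obj \<Rightarrow> ('i, 'm) arr \<Rightarrow> ('o, 'm) arr" where
  "Psi_sec C X f = snd (snd (Psi_glueing C X (Dom f) (Cod f))) f"

definition Psi_tgt :: "('o, 'm) rcat \<Rightarrow> ('i, 'o, 'm) over_obj \<Rightarrow> 'i \<Rightarrow> 'i \<Rightarrow> ('o, 'm) arr" where
  "Psi_tgt C = (\<lambda>(A, P) i j. THE t. t \<in> Hom C (Dom (Psi_src C (A, P) i j)) (fo P j) \<and>
     (\<forall>f \<in> Hom A i j. t \<cdot>\<^bsub>C\<^esub> Psi_sec C (A, P) f = fm P f))"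

definition Psi_mul :: "('o, 'm) rcat \<Rightarrow> ('i, 'o, 'm) over_obj \<Rightarrow> 'i \<Rightarrow> 'i \<Rightarrow> 'i \<Rightarrow> ('o, 'm) arr" where
  "Psi_mul C = (\<lambda>(A, P) i j k. THE m.
     m \<in> Hom C (pbo C (Psi_src C (A, P) j k) (Psi_tgt C (A, P) i j)) (Dom (Psi_src C (A, P) i k)) \<and>
     (\<forall>f \<in> Hom A i j. \<forall>g \<in> Hom A j k.
        m \<cdot>\<^bsub>C\<^esub> pull_section C (Psi_src C (A, P) j k) (Psi_tgt C (A, P) i j) (Psi_sec C (A, P) g)
          \<cdot>\<^bsub>C\<^esub> Psi_sec C (A, P) f = Psi_sec C (A, P) (g \<cdot>\<^bsub>A\<^esub> f)))"

definition Psi_obj :: "('o, 'm) rcat \<Rightarrow> ('i, 'o, 'm) over_obj \<Rightarrow> ('i, 'o, 'm) pcat" where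
  "Psi_obj C = (\<lambda>(A, P).
    \<lparr>idx = Ob A,
     obj = fo P,
     mob = (\<lambda>i j. Dom (Psi_src C (A, P) i j)),
     src = Psi_src C (A, P),
     tgt = Psi_tgt C (A, P),
     unt = (\<lambda>i. Psi_sec C (A, P) (Idt A i)),
     mul = Psi_mul C (A, P)\<rparr>)"

text \<open>The unit \<open>(A, P) \<rightarrow> \<Phi>\<^sub>g (\<Psi> (A, P))\<close>: the identity on objects, \<open>f \<mapsto> s\<^sub>f\<close> on maps, with
  identities as components of the transformation.\<close>

definition Psi_unit ::
    "('o, 'm) rcat \<Rightarrow> ('i, 'o, 'm) over_obj \<Rightarrow>
     (('i, 'o, 'm) over_obj, ('i, 'o, 'm) over_map) arr" where
  "Psi_unit C = (\<lambda>(A, P). Arr (A, P)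
     (\<lparr>fo = (\<lambda>i \<in> Ob A. i),
       fm = (\<lambda>f \<in> Mor A. Arr (Dom f) (Lab (Psi_sec C (A, P) f)) (Cod f))\<rparr>,
      \<lambda>i \<in> Ob A. Idt C (fo P i))
     (Phi_obj C (Psi_obj C (A, P))))"

text \<open>On maps, \<open>\<Psi>\<close> is determined by its values on objects and by naturality of the unit, as for
  any left adjoint.\<close>

definition Psi_map ::
    "'k rel \<Rightarrow> ('o, 'm) rcat \<Rightarrow> (('i, 'o, 'm) over_obj, ('i, 'o, 'm) over_map) arr \<Rightarrow>
     (('i, 'o, 'm) pcat, ('i, 'o, 'm) cofunctor) arr" where
  "Psi_map \<kappa> C h = (THE G. G \<in> Hom (peGpd \<kappa> C) (Psi_obj C (Dom h)) (Psi_obj C (Cod h)) \<and>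
     fm (Phi_g C) G \<cdot>\<^bsub>jiCat_over \<kappa> C\<^esub> Psi_unit C (Dom h) =
       Psi_unit C (Cod h) \<cdot>\<^bsub>jiCat_over \<kappa> C\<^esub> h)"

definition Psi ::
    "'k rel \<Rightarrow> ('o, 'm) rcat \<Rightarrow> (('i, 'o, 'm) over_obj, ('i, 'o, 'm) over_map,
                               ('i, 'o, 'm) pcat, ('i, 'o, 'm) cofunctor) fnct" where
  "Psi \<kappa> C = \<lparr>fo = Psi_obj C, fm = Psi_map \<kappa> C\<rparr>"

end

(* A cover is a local homeomorphism together with enough partial sections: maps out of its domain
   are determined by, and can be glued from, their composites with these sections.  For an etale
   groupoid the sections s of sigma with tau s a partial isomorphism cover sigma, so the axioms of
   a cofunctor can be tested, and its action defined, on such sections; hence Phi_g is fully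
   faithful.

   For an object (A, P), hyperconnectedness makes P an isomorphism on idempotents, and the glueing
   is such that s_f P(e) = s_g P(e) iff f e = g e, for every idempotent e in the domain of f.  So
   f |-> s_f is injective and all the structure of Psi (A, P) can be defined on the sections s_f.
   A section s of sigma with tau s a partial isomorphism is the join of restrictions of maps s_f;
   these restrictions come from bicompatible maps of A, whose join is sent to s.  Thus the unit is
   invertible, and with full faithfulness this gives the adjoint equivalence.  It restricts to the
   one-object case because both functors preserve the set of objects, and a complete pseudogroup is
   the same thing as a one-object object over C: an idempotent partial isomorphism is a restriction
   idempotent, so a homomorphism of monoids into partial isomorphisms preserves restrictions. *)

theory Submission
  imports Defs
begin

text \<open>Maps are partial, so each equation comes with a comparison of domains; the components of
  a pairing into a pullback must have the same domain, which is why composites of sections carry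
  explicit restrictions. To keep this manageable, the axioms of internal categories and cofunctors,
  stated on iterated pullbacks, are restated for arbitrary maps into the factors
  (\<open>gmul\<close>, \<open>capp\<close>); the projections are the generic instance.

  Covers carry their sections through composition and pullback, so maps out of iterated pullbacks
  can be tested on tuples of sections. Local glueings enter twice: they build the arrow objects of
  \<open>Psi_obj\<close>, and they provide the pullbacks of its source maps along total maps, each
  such pullback being a glueing itself.

  There are enough sections with partially invertible target because inversion in a groupoid
  exchanges source and target, so that the target maps are local homeomorphisms too.

  The functor \<open>P\<close> is injective on idempotents only. Hence equations in \<open>A\<close>
  are recovered from \<open>C\<close> by comparing domains: the glueing is arranged so that
  agreement of sections is governed by idempotents.\<close>

lemma HomD: "f \<in> Hom C A B \<Longrightarrow> f \<in> Mor C" "f \<in> Hom C A B \<Longrightarrow> Dom f = A" "f \<in> Hom C A B \<Longrightarrow> Cod f = B"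
  by (simp_all add: Hom_def)

section \<open>Composition in a category\<close>

context category
begin

lemma mor_cmp [simp]:
    "f \<in> Mor C \<Longrightarrow> g \<in> Mor C \<Longrightarrow> Cod f = Dom g \<Longrightarrow> g \<cdot> f \<in> Mor C"
  and dom_cmp [simp]:
    "f \<in> Mor C \<Longrightarrow> g \<in> Mor C \<Longrightarrow> Cod f = Dom g \<Longrightarrow> Dom (g \<cdot> f) = Dom f"
  and cod_cmp [simp]:
    "f \<in> Mor C \<Longrightarrow> g \<in> Mor C \<Longrightarrow> Cod f = Dom g \<Longrightarrow> Cod (g \<cdot> f) = Cod g"
  using cmp_hom[of f "Dom f" "Dom g" g "Cod g"] by (simp_all add: Hom_def)

lemma dom_ob [simp]: "f \<in> Mor C \<Longrightarrow> Dom f \<in> Ob C"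
  and cod_ob [simp]: "f \<in> Mor C \<Longrightarrow> Cod f \<in> Ob C"
  using dom_cod_ob by auto

lemma idt_simps [simp]:
  "A \<in> Ob C \<Longrightarrow> Idt C A \<in> Mor C" "A \<in> Ob C \<Longrightarrow> Dom (Idt C A) = A"
  "A \<in> Ob C \<Longrightarrow> Cod (Idt C A) = A"
  using idt_hom[of A] by (simp_all add: Hom_def)

lemma cmp_idt' [simp]: "f \<in> Mor C \<Longrightarrow> Dom f = A \<Longrightarrow> f \<cdot> Idt C A = f"
  and idt_cmp' [simp]: "f \<in> Mor C \<Longrightarrow> Cod f = A \<Longrightarrow> Idt C A \<cdot> f = f"
  using cmp_idt[of f A "Cod f"] idt_cmp[of f "Dom f" A] by (simp_all add: Hom_def)

lemma assoc [simp]: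
  "f \<in> Mor C \<Longrightarrow> g \<in> Mor C \<Longrightarrow> h \<in> Mor C \<Longrightarrow> Cod f = Dom g \<Longrightarrow> Cod g = Dom h \<Longrightarrow>
    (h \<cdot> g) \<cdot> f = h \<cdot> g \<cdot> f"
  using cmp_assoc[of f "Dom f" "Dom g" g "Dom h" h "Cod h"] by (simp add: Hom_def)

text \<open>Composites are normalised to the right, so the sides of an equation between two binary
  composites are no longer subterms once a factor \<open>f\<close> follows. This form applies the
  equation in that position; \<open>cmp_rw\<close> below does the same when the right side is a
  single map.\<close>

lemma cmp_reassoc:
  "h \<cdot> g = h' \<cdot> g' \<Longrightarrow> f \<in> Mor C \<Longrightarrow> g \<in> Mor C \<Longrightarrow> h \<in> Mor C \<Longrightarrow> g' \<in> Mor C \<Longrightarrow> h' \<in> Mor C \<Longrightarrow>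
    Cod f = Dom g \<Longrightarrow> Cod g = Dom h \<Longrightarrow> Cod f = Dom g' \<Longrightarrow> Cod g' = Dom h' \<Longrightarrow>
    h \<cdot> g \<cdot> f = h' \<cdot> g' \<cdot> f"
  using assoc[of f g h] assoc[of f g' h'] by simp

lemma iso_unique_inverse:
  assumes "f \<in> Mor C" "g \<in> Hom C (Cod f) (Dom f)" "h \<in> Hom C (Cod f) (Dom f)"
    and "g \<cdot> f = Idt C (Dom f)" "f \<cdot> h = Idt C (Cod f)"
  shows "g = h"
proof -
  have "g = g \<cdot> f \<cdot> h" using assms by (simp add: Hom_def)
  also have "... = (g \<cdot> f) \<cdot> h" using assms(1-3) by (simp add: Hom_def)
  finally show ?thesis using assms by (simp add: Hom_def)
qed

end

lemma functorD:
  assumes "is_functor X Y F"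
  shows "A \<in> Ob X \<Longrightarrow> fo F A \<in> Ob Y"
    and "f \<in> Mor X \<Longrightarrow> fm F f \<in> Mor Y"
    and "f \<in> Mor X \<Longrightarrow> Dom (fm F f) = fo F (Dom f)"
    and "f \<in> Mor X \<Longrightarrow> Cod (fm F f) = fo F (Cod f)"
    and "A \<in> Ob X \<Longrightarrow> fm F (Idt X A) = Idt Y (fo F A)"
    and "f \<in> Mor X \<Longrightarrow> g \<in> Mor X \<Longrightarrow> Cod f = Dom g \<Longrightarrow>
      fm F (g \<cdot>\<^bsub>X\<^esub> f) = fm F g \<cdot>\<^bsub>Y\<^esub> fm F f"
  using assms by (auto simp: is_functor_def Hom_def)

section \<open>Equivalences from full and faithful functors\<close>

definition fully_faithful ::
    "('o, 'm, 'x) cat_scheme \<Rightarrow> ('p, 'n, 'y) cat_scheme \<Rightarrow> ('o, 'm, 'p, 'n) fnct \<Rightarrow> bool" where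
  "fully_faithful X Y F \<longleftrightarrow>
     (\<forall>A \<in> Ob X. \<forall>B \<in> Ob X. bij_betw (fm F) (Hom X A B) (Hom Y (fo F A) (fo F B)))"

lemma fully_faithful_inj:
  assumes "fully_faithful X Y F" "f \<in> Hom X A B" "g \<in> Hom X A B" "A \<in> Ob X" "B \<in> Ob X"
    "fm F f = fm F g"
  shows "f = g"
  using assms unfolding fully_faithful_def bij_betw_def inj_on_def by blast

lemma fully_faithful_surj:
  assumes "fully_faithful X Y F" "A \<in> Ob X" "B \<in> Ob X" "h \<in> Hom Y (fo F A) (fo F B)"
  obtains g where "g \<in> Hom X A B" "fm F g = h"
  using assms unfolding fully_faithful_def bij_betw_def by (metis imageE)

text \<open>With \<open>u\<close> invertible, the equation says that \<open>fm F g\<close> is the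
  composite of \<open>v\<close>, \<open>h\<close> and the inverse of \<open>u\<close>, and a fully
  faithful functor attains that map exactly once. The definite description in \<open>Psi_map\<close>
  is an instance, with components of the unit for \<open>u\<close> and \<open>v\<close>.\<close>

lemma transport_unique:
  assumes X: "category X" and Y: "category Y" and F: "is_functor X Y F" and ff: "fully_faithful X Y F"
    and A: "A \<in> Ob X" "B \<in> Ob X"
    and u: "u \<in> Hom Y D (fo F A)" "iso Y u" and v: "v \<in> Hom Y E (fo F B)"
    and h: "h \<in> Hom Y D E"
  shows "\<exists>!g. g \<in> Hom X A B \<and> fm F g \<cdot>\<^bsub>Y\<^esub> u = v \<cdot>\<^bsub>Y\<^esub> h"
proof -
  interpret Y: category Y by fact
  from u obtain w where w: "w \<in> Hom Y (fo F A) D" "w \<cdot>\<^bsub>Y\<^esub> u = Idt Y D" "u \<cdot>\<^bsub>Y\<^esub> w = Idt Y (fo F A)"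
    by (auto simp: iso_def Hom_def)
  have "v \<cdot>\<^bsub>Y\<^esub> h \<cdot>\<^bsub>Y\<^esub> w \<in> Hom Y (fo F A) (fo F B)"
    using v h w(1) by (simp add: Hom_def)
  then obtain g where g: "g \<in> Hom X A B" "fm F g = v \<cdot>\<^bsub>Y\<^esub> h \<cdot>\<^bsub>Y\<^esub> w"
    using fully_faithful_surj[OF ff A] by metis
  show ?thesis
  proof (rule ex1I[of _ g])
    show "g \<in> Hom X A B \<and> fm F g \<cdot>\<^bsub>Y\<^esub> u = v \<cdot>\<^bsub>Y\<^esub> h"
      using g w u v h by (simp add: Hom_def)
    fix g' assume g': "g' \<in> Hom X A B \<and> fm F g' \<cdot>\<^bsub>Y\<^esub> u = v \<cdot>\<^bsub>Y\<^esub> h"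
    then have t: "fm F g' \<in> Hom Y (fo F A) (fo F B)" using functorD[OF F] by (simp add: Hom_def)
    have "fm F g' = (fm F g' \<cdot>\<^bsub>Y\<^esub> u) \<cdot>\<^bsub>Y\<^esub> w" using t u w by (simp add: Hom_def)
    also have "... = fm F g" using g' g(2) v h w(1) by (simp add: Hom_def)
    finally show "g' = g" using fully_faithful_inj[OF ff] g(1) g' A by metis
  qed
qed

text \<open>A map out of \<open>fo G D\<close> is determined by its image under \<open>F\<close>
  precomposed with the invertible unit. Hence naturality of the unit alone forces \<open>G\<close>
  to be functorial, and the counit, its naturality and its inverse are obtained from full
  faithfulness.\<close>

lemma adjoint_equivalenceI:
  assumes X: "category X" and Y: "category Y" and F: "is_functor X Y F" and ff: "fully_faithful X Y F"
    and G: "\<And>B. B \<in> Ob Y \<Longrightarrow> fo G B \<in> Ob X"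
    and \<eta>: "\<And>B. B \<in> Ob Y \<Longrightarrow> \<eta> B \<in> Hom Y B (fo F (fo G B)) \<and> iso Y (\<eta> B)"
    and Gm: "\<And>h. h \<in> Mor Y \<Longrightarrow> fm G h \<in> Hom X (fo G (Dom h)) (fo G (Cod h)) \<and>
      fm F (fm G h) \<cdot>\<^bsub>Y\<^esub> \<eta> (Dom h) = \<eta> (Cod h) \<cdot>\<^bsub>Y\<^esub> h"
  shows "adjoint_equivalence X Y F G \<eta>"
proof -
  interpret X: category X by fact
  interpret Y: category Y by fact
  note [simp] = functorD[OF F] G
  have \<eta>s [simp]: "\<eta> B \<in> Mor Y" "Dom (\<eta> B) = B" "Cod (\<eta> B) = fo F (fo G B)" if "B \<in> Ob Y" for B
    using \<eta>[OF that] by (auto simp: Hom_def)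
  have Gs [simp]: "fm G h \<in> Mor X" "Dom (fm G h) = fo G (Dom h)" "Cod (fm G h) = fo G (Cod h)"
    if "h \<in> Mor Y" for h using Gm[OF that] by (auto simp: Hom_def)
  have Gn: "fm F (fm G h) \<cdot>\<^bsub>Y\<^esub> \<eta> (Dom h) = \<eta> (Cod h) \<cdot>\<^bsub>Y\<^esub> h" if "h \<in> Mor Y" for h
    using Gm[OF that] by simp
  \<comment> \<open>The inverse \<open>w\<close> of the unit cancels it on the right; faithfulness
    then applies.\<close>
  have uniq: "g = g'" if g: "g \<in> Hom X (fo G D) A" "g' \<in> Hom X (fo G D) A"
    and D: "D \<in> Ob Y" and A: "A \<in> Ob X" and eq: "fm F g \<cdot>\<^bsub>Y\<^esub> \<eta> D = fm F g' \<cdot>\<^bsub>Y\<^esub> \<eta> D" for g g' D A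
  proof (rule fully_faithful_inj[OF ff g])
    obtain w where w: "w \<in> Hom Y (fo F (fo G D)) D" "\<eta> D \<cdot>\<^bsub>Y\<^esub> w = Idt Y (fo F (fo G D))"
      using \<eta>[OF D] by (auto simp: iso_def Hom_def)
    have "fm F k = (fm F k \<cdot>\<^bsub>Y\<^esub> \<eta> D) \<cdot>\<^bsub>Y\<^esub> w" if "k \<in> Hom X (fo G D) A" for k
      using that w D by (simp add: Hom_def)
    then show "fm F g = fm F g'" using g eq by metis
  qed (use D A in auto)
  have "fm G (Idt Y B) = Idt X (fo G B)" if B: "B \<in> Ob Y" for B
  proof (rule uniq[of _ B "fo G B"])
    show "fm F (fm G (Idt Y B)) \<cdot>\<^bsub>Y\<^esub> \<eta> B = fm F (Idt X (fo G B)) \<cdot>\<^bsub>Y\<^esub> \<eta> B"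
      using Gn[of "Idt Y B"] B by simp
  qed (use B in \<open>auto simp: Hom_def\<close>)
  moreover have "fm G (g \<cdot>\<^bsub>Y\<^esub> f) = fm G g \<cdot>\<^bsub>X\<^esub> fm G f" if f: "f \<in> Mor Y" "g \<in> Mor Y" "Cod f = Dom g" for f g
  proof (rule uniq[of _ "Dom f" "fo G (Cod g)"])
    have "fm F (fm G g \<cdot>\<^bsub>X\<^esub> fm G f) \<cdot>\<^bsub>Y\<^esub> \<eta> (Dom f) = fm F (fm G g) \<cdot>\<^bsub>Y\<^esub> \<eta> (Cod f) \<cdot>\<^bsub>Y\<^esub> f"
      using f Gn[of f] by simp
    also have "... = (fm F (fm G g) \<cdot>\<^bsub>Y\<^esub> \<eta> (Dom g)) \<cdot>\<^bsub>Y\<^esub> f" using f by simp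
    also have "... = \<eta> (Cod g) \<cdot>\<^bsub>Y\<^esub> g \<cdot>\<^bsub>Y\<^esub> f" using f Gn[of g] by simp
    also have "... = fm F (fm G (g \<cdot>\<^bsub>Y\<^esub> f)) \<cdot>\<^bsub>Y\<^esub> \<eta> (Dom f)" using Gn[of "g \<cdot>\<^bsub>Y\<^esub> f"] f by simp
    finally show "fm F (fm G (g \<cdot>\<^bsub>Y\<^esub> f)) \<cdot>\<^bsub>Y\<^esub> \<eta> (Dom f) = fm F (fm G g \<cdot>\<^bsub>X\<^esub> fm G f) \<cdot>\<^bsub>Y\<^esub> \<eta> (Dom f)"
      by simp
  qed (use f in \<open>auto simp: Hom_def\<close>)
  ultimately have fG: "is_functor Y X G" by (auto simp: is_functor_def Hom_def)
  \<comment> \<open>The counit is the transpose of the identity, that is, it is defined by one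
    triangle identity.\<close>
  have "\<exists>e. e \<in> Hom X (fo G (fo F A)) A \<and> fm F e \<cdot>\<^bsub>Y\<^esub> \<eta> (fo F A) = Idt Y (fo F A)" if "A \<in> Ob X" for A
    using transport_unique[OF X Y F ff, of "fo G (fo F A)" A "\<eta> (fo F A)" "fo F A" "Idt Y (fo F A)"
        "fo F A" "Idt Y (fo F A)"] that \<eta>[of "fo F A"] by (auto simp: Hom_def)
  then obtain \<epsilon> where \<epsilon>: "\<And>A. A \<in> Ob X \<Longrightarrow> \<epsilon> A \<in> Hom X (fo G (fo F A)) A"
    "\<And>A. A \<in> Ob X \<Longrightarrow> fm F (\<epsilon> A) \<cdot>\<^bsub>Y\<^esub> \<eta> (fo F A) = Idt Y (fo F A)" by metis
  have \<epsilon>s [simp]: "\<epsilon> A \<in> Mor X" "Dom (\<epsilon> A) = fo G (fo F A)" "Cod (\<epsilon> A) = A" if "A \<in> Ob X" for A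
    using \<epsilon>(1)[OF that] by (auto simp: Hom_def)
  \<comment> \<open>\<open>fm F (\<epsilon> A)\<close> is a left inverse and \<open>w\<close> a
    right inverse of the unit, so the two agree.\<close>
  have \<epsilon>\<eta>: "\<eta> (fo F A) \<cdot>\<^bsub>Y\<^esub> fm F (\<epsilon> A) = Idt Y (fo F (fo G (fo F A)))" if A: "A \<in> Ob X" for A
  proof -
    obtain w where w: "w \<in> Hom Y (fo F (fo G (fo F A))) (fo F A)"
      "\<eta> (fo F A) \<cdot>\<^bsub>Y\<^esub> w = Idt Y (fo F (fo G (fo F A)))"
      using \<eta>[of "fo F A"] A by (auto simp: iso_def Hom_def)
    have "fm F (\<epsilon> A) = w"
      by (rule Y.iso_unique_inverse[of "\<eta> (fo F A)"]) (use A w \<epsilon>(2) in \<open>auto simp: Hom_def\<close>)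
    then show ?thesis using w by simp
  qed
  have tri: "\<epsilon> (fo G B) \<cdot>\<^bsub>X\<^esub> fm G (\<eta> B) = Idt X (fo G B)" if B: "B \<in> Ob Y" for B
  proof (rule uniq[of _ B "fo G B"])
    have "fm F (\<epsilon> (fo G B) \<cdot>\<^bsub>X\<^esub> fm G (\<eta> B)) \<cdot>\<^bsub>Y\<^esub> \<eta> B =
        fm F (\<epsilon> (fo G B)) \<cdot>\<^bsub>Y\<^esub> fm F (fm G (\<eta> B)) \<cdot>\<^bsub>Y\<^esub> \<eta> (Dom (\<eta> B))" using B by simp
    also have "... = fm F (\<epsilon> (fo G B)) \<cdot>\<^bsub>Y\<^esub> \<eta> (fo F (fo G B)) \<cdot>\<^bsub>Y\<^esub> \<eta> B"
      using Gn[of "\<eta> B"] B by simp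
    also have "... = (fm F (\<epsilon> (fo G B)) \<cdot>\<^bsub>Y\<^esub> \<eta> (fo F (fo G B))) \<cdot>\<^bsub>Y\<^esub> \<eta> B" using B by simp
    finally show "fm F (\<epsilon> (fo G B) \<cdot>\<^bsub>X\<^esub> fm G (\<eta> B)) \<cdot>\<^bsub>Y\<^esub> \<eta> B = fm F (Idt X (fo G B)) \<cdot>\<^bsub>Y\<^esub> \<eta> B"
      using \<epsilon>(2)[of "fo G B"] B by simp
  qed (use B in \<open>auto simp: Hom_def\<close>)

  have "iso X (\<epsilon> A)" if A: "A \<in> Ob X" for A
  proof -
    \<comment> \<open>Fullness lifts the unit itself to a candidate for the inverse of the
      counit.\<close>
    have "\<eta> (fo F A) \<in> Hom Y (fo F A) (fo F (fo G (fo F A)))" using A \<eta> by simp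
    then obtain g where g: "g \<in> Hom X A (fo G (fo F A))" "fm F g = \<eta> (fo F A)"
      using fully_faithful_surj[OF ff, of A "fo G (fo F A)"] A by auto
    have "g \<cdot>\<^bsub>X\<^esub> \<epsilon> A = Idt X (fo G (fo F A))"
      by (rule fully_faithful_inj[OF ff, of _ "fo G (fo F A)" "fo G (fo F A)"])
        (use A g \<epsilon>\<eta>[OF A] in \<open>auto simp: Hom_def\<close>)
    moreover have "\<epsilon> A \<cdot>\<^bsub>X\<^esub> g = Idt X A"
      by (rule fully_faithful_inj[OF ff, of _ A A])
        (use A g \<epsilon>(2)[OF A] in \<open>auto simp: Hom_def\<close>)
    ultimately show ?thesis using g A by (auto simp: iso_def)
  qed
  moreover have "f \<cdot>\<^bsub>X\<^esub> \<epsilon> (Dom f) = \<epsilon> (Cod f) \<cdot>\<^bsub>X\<^esub> fm G (fm F f)" if f: "f \<in> Mor X" for f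
  proof (rule uniq[of _ "fo F (Dom f)" "Cod f"])
    have "fm F (\<epsilon> (Cod f) \<cdot>\<^bsub>X\<^esub> fm G (fm F f)) \<cdot>\<^bsub>Y\<^esub> \<eta> (fo F (Dom f)) =
        fm F (\<epsilon> (Cod f)) \<cdot>\<^bsub>Y\<^esub> fm F (fm G (fm F f)) \<cdot>\<^bsub>Y\<^esub> \<eta> (Dom (fm F f))" using f by simp
    also have "... = (fm F (\<epsilon> (Cod f)) \<cdot>\<^bsub>Y\<^esub> \<eta> (fo F (Cod f))) \<cdot>\<^bsub>Y\<^esub> fm F f"
      using Gn[of "fm F f"] f by simp
    also have "... = fm F f" using \<epsilon>(2) f by simp
    also have "... = fm F (f \<cdot>\<^bsub>X\<^esub> \<epsilon> (Dom f)) \<cdot>\<^bsub>Y\<^esub> \<eta> (fo F (Dom f))" using \<epsilon>(2) f by simp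
    finally show "fm F (f \<cdot>\<^bsub>X\<^esub> \<epsilon> (Dom f)) \<cdot>\<^bsub>Y\<^esub> \<eta> (fo F (Dom f)) =
        fm F (\<epsilon> (Cod f) \<cdot>\<^bsub>X\<^esub> fm G (fm F f)) \<cdot>\<^bsub>Y\<^esub> \<eta> (fo F (Dom f))" by simp
  qed (use f in \<open>auto simp: Hom_def\<close>)
  ultimately have "natural_iso X X (fcomp G F) fid \<epsilon>"
    using \<epsilon>(1) by (auto simp: natural_iso_def fcomp_def fid_def)
  moreover have "natural_iso Y Y fid (fcomp F G) \<eta>"
    using \<eta> Gn by (auto simp: natural_iso_def fcomp_def fid_def)
  ultimately show ?thesis
    unfolding adjoint_equivalence_def using X Y F fG \<epsilon>(2) tri by blast
qed

section \<open>Restriction of an adjoint equivalence to full subcategories\<close>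

lemma full_subcategory_Hom:
  assumes "full_subcategory S T" "A \<in> Ob S" "B \<in> Ob S"
  shows "Hom S A B = Hom T A B"
  using assms by (auto simp: full_subcategory_def Hom_def)

lemma full_subcategory_cmp:
  assumes "full_subcategory S T" "f \<in> Hom T A B" "g \<in> Hom T B D" "A \<in> Ob S" "B \<in> Ob S" "D \<in> Ob S"
  shows "g \<cdot>\<^bsub>S\<^esub> f = g \<cdot>\<^bsub>T\<^esub> f"
  using assms by (auto simp: full_subcategory_def Hom_def)

text \<open>\<open>full_subcategory\<close> fixes identities only at objects of \<open>S\<close> and
  composites only for composable maps of \<open>S\<close>. Every law is therefore transferred along
  these equations, after checking that the composites concerned lie in \<open>S\<close>
  again.\<close>

lemma full_subcategory_category:
  assumes S: "full_subcategory S T" and T: "category T"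
  shows "category S"
proof -
  interpret T: category T by fact
  note H = full_subcategory_Hom[OF S]
  have Ob: "A \<in> Ob T" if "A \<in> Ob S" for A using S that by (auto simp: full_subcategory_def)
  have I: "Idt S A = Idt T A" if "A \<in> Ob S" for A using S that by (auto simp: full_subcategory_def)
  have E: "A \<in> Ob S" "B \<in> Ob S" "f \<in> Hom T A B" if "f \<in> Hom S A B" for f A B
    using S that by (auto simp: full_subcategory_def Hom_def)
  have c: "g \<cdot>\<^bsub>S\<^esub> f = g \<cdot>\<^bsub>T\<^esub> f" if "f \<in> Hom S A B" "g \<in> Hom S B D" for f g A B D
    using full_subcategory_cmp[OF S] E that by blast
  have cH: "g \<cdot>\<^bsub>S\<^esub> f \<in> Hom S A D" if "f \<in> Hom S A B" "g \<in> Hom S B D" for f g A B D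
    using c[OF that] T.cmp_hom[OF E(3)[OF that(1)] E(3)[OF that(2)]] H E that by metis
  show ?thesis
  proof
    show "Dom f \<in> Ob S \<and> Cod f \<in> Ob S" if "f \<in> Mor S" for f
      using S that by (auto simp: full_subcategory_def)
    show iH: "Idt S A \<in> Hom S A A" if "A \<in> Ob S" for A
      using that H I Ob T.idt_hom by simp
    show "f \<cdot>\<^bsub>S\<^esub> Idt S A = f" if "f \<in> Hom S A B" for f A B
      using c[OF iH that] E[OF that] T.cmp_idt I by metis
    show "Idt S B \<cdot>\<^bsub>S\<^esub> f = f" if "f \<in> Hom S A B" for f A B
      using c[OF that iH] E[OF that] T.idt_cmp I by metis
    show "(h \<cdot>\<^bsub>S\<^esub> g) \<cdot>\<^bsub>S\<^esub> f = h \<cdot>\<^bsub>S\<^esub> g \<cdot>\<^bsub>S\<^esub> f"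
      if "f \<in> Hom S A B" "g \<in> Hom S B D" "h \<in> Hom S D E" for f g h A B D E
      using that c[OF that(1) cH[OF that(2,3)]] c[OF cH[OF that(1,2)] that(3)] c
        T.cmp_assoc[OF E(3)[OF that(1)] E(3)[OF that(2)] E(3)[OF that(3)]] by metis
  qed (use cH in blast)
qed

text \<open>Fullness puts the inverse, a map between objects of \<open>S\<close>, into
  \<open>S\<close> as well.\<close>

lemma full_subcategory_iso:
  assumes S: "full_subcategory S T" and f: "iso T f" "f \<in> Hom T A B" "A \<in> Ob S" "B \<in> Ob S"
  shows "iso S f"
proof -
  obtain g where g: "g \<in> Hom T B A" "g \<cdot>\<^bsub>T\<^esub> f = Idt T A" "f \<cdot>\<^bsub>T\<^esub> g = Idt T B"
    using f by (auto simp: iso_def Hom_def)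
  then show ?thesis
    using f full_subcategory_Hom[OF S] full_subcategory_cmp[OF S f(2) g(1)]
      full_subcategory_cmp[OF S g(1) f(2)] S
    by (auto simp: iso_def Hom_def full_subcategory_def intro!: bexI[of _ g])
qed

lemma is_functor_restrict:
  assumes K: "is_functor S U K" and S: "full_subcategory S' S" and U: "full_subcategory U' U"
    and O: "\<And>A. A \<in> Ob S' \<Longrightarrow> fo K A \<in> Ob U'"
  shows "is_functor S' U' K"
  unfolding is_functor_def
proof (intro conjI ballI impI)
  show "fo K A \<in> Ob U'" if "A \<in> Ob S'" for A using O that .
  fix f assume f: "f \<in> Mor S'"
  then have f': "f \<in> Mor S" "Dom f \<in> Ob S'" "Cod f \<in> Ob S'" using S by (auto simp: full_subcategory_def)
  then show Kf: "fm K f \<in> Hom U' (fo K (Dom f)) (fo K (Cod f))"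
    using functorD[OF K] full_subcategory_Hom[OF U] O by (simp add: Hom_def)
  fix g assume g: "g \<in> Mor S'" "Cod f = Dom g"
  then have g': "g \<in> Mor S" "Cod g \<in> Ob S'" using S by (auto simp: full_subcategory_def)
  show "fm K (g \<cdot>\<^bsub>S'\<^esub> f) = fm K g \<cdot>\<^bsub>U'\<^esub> fm K f"
    using functorD[OF K] f f' g g' full_subcategory_cmp[OF U, of "fm K f" _ "fo K (Cod f)" "fm K g"]
      full_subcategory_cmp[OF S, of f _ "Cod f" g] O by (simp add: Hom_def)
next
  show "fm K (Idt S' A) = Idt U' (fo K A)" if "A \<in> Ob S'" for A
    using that O functorD(5)[OF K] S U by (auto simp: full_subcategory_def)
qed

lemma natural_iso_restrict:
  assumes n: "natural_iso S S H K \<theta>" and S: "full_subcategory S' S"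
    and H: "is_functor S' S' H" and K: "is_functor S' S' K"
  shows "natural_iso S' S' H K \<theta>"
  unfolding natural_iso_def
proof (intro conjI ballI)
  fix A assume A: "A \<in> Ob S'"
  then have "\<theta> A \<in> Hom S (fo H A) (fo K A)" "iso S (\<theta> A)"
    using n S by (auto simp: natural_iso_def full_subcategory_def)
  then show "\<theta> A \<in> Hom S' (fo H A) (fo K A)" "iso S' (\<theta> A)"
    using full_subcategory_iso[OF S] full_subcategory_Hom[OF S] functorD(1)[OF H A] functorD(1)[OF K A] by auto
next
  fix f assume f: "f \<in> Mor S'"
  then have f': "f \<in> Mor S" "Dom f \<in> Ob S'" "Cod f \<in> Ob S'" using S by (auto simp: full_subcategory_def)
  have m: "Mor S' \<subseteq> Mor S" "Ob S' \<subseteq> Ob S" using S by (auto simp: full_subcategory_def)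
  have th: "\<theta> A \<in> Hom S (fo H A) (fo K A)" if "A \<in> Ob S'" for A using n m that by (auto simp: natural_iso_def)
  have "fm K f \<cdot>\<^bsub>S\<^esub> \<theta> (Dom f) = \<theta> (Cod f) \<cdot>\<^bsub>S\<^esub> fm H f" using n f' by (auto simp: natural_iso_def)
  moreover have "fm K f \<cdot>\<^bsub>S'\<^esub> \<theta> (Dom f) = fm K f \<cdot>\<^bsub>S\<^esub> \<theta> (Dom f)"
    by (rule full_subcategory_cmp[OF S th[of "Dom f"], where D = "fo K (Cod f)"])
      (use f f' m functorD[OF H] functorD[OF K] in \<open>auto simp: Hom_def subset_iff\<close>)
  moreover have "\<theta> (Cod f) \<cdot>\<^bsub>S'\<^esub> fm H f = \<theta> (Cod f) \<cdot>\<^bsub>S\<^esub> fm H f"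
    by (rule full_subcategory_cmp[OF S _ th[of "Cod f"], where A = "fo H (Dom f)"])
      (use f f' m functorD[OF H] functorD[OF K] in \<open>auto simp: Hom_def subset_iff\<close>)
  ultimately show "fm K f \<cdot>\<^bsub>S'\<^esub> \<theta> (Dom f) = \<theta> (Cod f) \<cdot>\<^bsub>S'\<^esub> fm H f" by simp
qed

lemma is_functor_fid: "category S \<Longrightarrow> is_functor S S fid"
  using category.dom_cod_ob by (auto simp: is_functor_def fid_def Hom_def)

lemma is_functor_fcomp:
  assumes "is_functor S U H" "is_functor U V K"
  shows "is_functor S V (fcomp K H)"
  using functorD[OF assms(1)] functorD[OF assms(2)] by (auto simp: is_functor_def fcomp_def Hom_def)

text \<open>Both functors preserve the chosen objects, so the components of unit and counit and
  their inverses lie between such objects; fullness keeps them, and composites agree with the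
  ambient ones. The one-object equivalence is obtained in this way.\<close>

lemma adjoint_equivalence_restrict:
  assumes E: "adjoint_equivalence X Y F G \<eta>"
    and X: "full_subcategory X' X" and Y: "full_subcategory Y' Y"
    and F: "\<And>A. A \<in> Ob X' \<Longrightarrow> fo F A \<in> Ob Y'" and G: "\<And>B. B \<in> Ob Y' \<Longrightarrow> fo G B \<in> Ob X'"
  shows "adjoint_equivalence X' Y' F G \<eta>"
proof -
  obtain \<epsilon> where cX: "category X" and cY: "category Y" and fF: "is_functor X Y F" and fG: "is_functor Y X G"
    and n\<eta>: "natural_iso Y Y fid (fcomp F G) \<eta>" and n\<epsilon>: "natural_iso X X (fcomp G F) fid \<epsilon>"
    and t1: "\<And>A. A \<in> Ob X \<Longrightarrow> fm F (\<epsilon> A) \<cdot>\<^bsub>Y\<^esub> \<eta> (fo F A) = Idt Y (fo F A)"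
    and t2: "\<And>B. B \<in> Ob Y \<Longrightarrow> \<epsilon> (fo G B) \<cdot>\<^bsub>X\<^esub> fm G (\<eta> B) = Idt X (fo G B)"
    using E by (auto simp: adjoint_equivalence_def)
  note cX' = full_subcategory_category[OF X cX] and cY' = full_subcategory_category[OF Y cY]
  note fF' = is_functor_restrict[OF fF X Y F] and fG' = is_functor_restrict[OF fG Y X G]
  note cF' = is_functor_fcomp[OF fF' fG'] is_functor_fcomp[OF fG' fF']
  have "natural_iso X' X' (fcomp G F) fid \<epsilon>"
    by (rule natural_iso_restrict[OF n\<epsilon> X]) (use cF' F G in \<open>auto intro: is_functor_fid[OF cX']\<close>)
  moreover have "natural_iso Y' Y' fid (fcomp F G) \<eta>"
    by (rule natural_iso_restrict[OF n\<eta> Y]) (use cF' F G in \<open>auto intro: is_functor_fid[OF cY']\<close>)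
  moreover have "fm F (\<epsilon> A) \<cdot>\<^bsub>Y'\<^esub> \<eta> (fo F A) = Idt Y' (fo F A)" if A: "A \<in> Ob X'" for A
  proof -
    have m: "A \<in> Ob X" "fo F A \<in> Ob Y" using A F X Y by (auto simp: full_subcategory_def)
    have "fm F (\<epsilon> A) \<cdot>\<^bsub>Y'\<^esub> \<eta> (fo F A) = fm F (\<epsilon> A) \<cdot>\<^bsub>Y\<^esub> \<eta> (fo F A)"
      by (rule full_subcategory_cmp[OF Y, where A = "fo F A" and B = "fo F (fo G (fo F A))" and D = "fo F A"])
        (use m A F G n\<eta> n\<epsilon> functorD[OF fF] in \<open>auto simp: natural_iso_def fid_def fcomp_def Hom_def\<close>)
    then show ?thesis using t1[OF m(1)] F[OF A] Y by (auto simp: full_subcategory_def)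
  qed
  moreover have "\<epsilon> (fo G B) \<cdot>\<^bsub>X'\<^esub> fm G (\<eta> B) = Idt X' (fo G B)" if B: "B \<in> Ob Y'" for B
  proof -
    have m: "B \<in> Ob Y" "fo G B \<in> Ob X" using B G X Y by (auto simp: full_subcategory_def)
    have "\<epsilon> (fo G B) \<cdot>\<^bsub>X'\<^esub> fm G (\<eta> B) = \<epsilon> (fo G B) \<cdot>\<^bsub>X\<^esub> fm G (\<eta> B)"
      by (rule full_subcategory_cmp[OF X, where A = "fo G B" and B = "fo G (fo F (fo G B))" and D = "fo G B"])
        (use m B F G n\<eta> n\<epsilon> functorD[OF fG] in \<open>auto simp: natural_iso_def fid_def fcomp_def Hom_def\<close>)
    then show ?thesis using t2[OF m(1)] G[OF B] X by (auto simp: full_subcategory_def)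
  qed
  ultimately show ?thesis
    using cX' cY' fF' fG' F G unfolding adjoint_equivalence_def by blast
qed

section \<open>Restriction categories\<close>

context restriction_category
begin

lemma rst_simps [simp]:
  "f \<in> Mor C \<Longrightarrow> Rst C f \<in> Mor C" "f \<in> Mor C \<Longrightarrow> Dom (Rst C f) = Dom f"
  "f \<in> Mor C \<Longrightarrow> Cod (Rst C f) = Dom f"
  using rst_hom[of f "Dom f" "Cod f"] by (auto simp: Hom_def)

lemma cmp_rst' [simp]: "f \<in> Mor C \<Longrightarrow> f \<cdot> Rst C f = f"
  using cmp_rst[of f "Dom f" "Cod f"] by (auto simp: Hom_def)

lemma cmp_rst_assoc [simp]: "f \<in> Mor C \<Longrightarrow> g \<in> Mor C \<Longrightarrow> Cod g = Dom f \<Longrightarrow> f \<cdot> Rst C f \<cdot> g = f \<cdot> g"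
  using assoc[of g "Rst C f" f] by simp

lemma rst_comm: "f \<in> Mor C \<Longrightarrow> g \<in> Mor C \<Longrightarrow> Dom f = Dom g \<Longrightarrow> Rst C f \<cdot> Rst C g = Rst C g \<cdot> Rst C f"
  using rst_commute[of f "Dom f" "Cod f" g "Cod g"] by (auto simp: Hom_def)

lemma rst_cmp_rst' [simp]:
  "f \<in> Mor C \<Longrightarrow> g \<in> Mor C \<Longrightarrow> Dom f = Dom g \<Longrightarrow> Rst C (g \<cdot> Rst C f) = Rst C g \<cdot> Rst C f"
  using rst_cmp_rst[of f "Dom f" "Cod f" g "Cod g"] by (auto simp: Hom_def)

lemma rst_slide:
  "f \<in> Mor C \<Longrightarrow> g \<in> Mor C \<Longrightarrow> Cod f = Dom g \<Longrightarrow> Rst C g \<cdot> f = f \<cdot> Rst C (g \<cdot> f)"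
  using rst_cmp[of f "Dom f" "Cod f" g "Cod g"] by (auto simp: Hom_def)

lemma rst_idt [simp]: "A \<in> Ob C \<Longrightarrow> Rst C (Idt C A) = Idt C A"
  using cmp_rst'[of "Idt C A"] by (simp del: cmp_rst' cmp_rst_assoc)

lemma rst_rst [simp]: "f \<in> Mor C \<Longrightarrow> Rst C (Rst C f) = Rst C f"
  using rst_cmp_rst'[of f "Idt C (Dom f)"] by simp

lemma rst_absorb:
  assumes "f \<in> Mor C" "g \<in> Mor C" "Cod f = Dom g"
  shows "Rst C (g \<cdot> f) \<cdot> Rst C f = Rst C (g \<cdot> f)" "Rst C f \<cdot> Rst C (g \<cdot> f) = Rst C (g \<cdot> f)"
proof -
  show *: "Rst C (g \<cdot> f) \<cdot> Rst C f = Rst C (g \<cdot> f)"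
    using rst_cmp_rst'[of f "g \<cdot> f"] assms by simp
  show "Rst C f \<cdot> Rst C (g \<cdot> f) = Rst C (g \<cdot> f)" using * rst_comm[of f "g \<cdot> f"] assms by simp
qed

lemma rst_cmp_same [simp]: "f \<in> Mor C \<Longrightarrow> Rst C f \<cdot> Rst C f = Rst C f"
  using rst_cmp_rst'[of f f] by simp

text \<open>Sliding turns the left side into \<open>Rst C (f \<cdot> Rst C (g \<cdot> f))\<close>,
  where \<open>Rst C f\<close> is absorbed. So the domain of \<open>g \<cdot> f\<close> depends on
  \<open>g\<close> only through the domain of \<open>g\<close>.\<close>

lemma rst_rst_cmp [simp]:
  assumes "f \<in> Mor C" "g \<in> Mor C" "Cod f = Dom g"
  shows "Rst C (Rst C g \<cdot> f) = Rst C (g \<cdot> f)"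
  using assms rst_absorb[of f g] rst_slide[of f g] by simp

lemma rst_cmp_total:
  assumes "f \<in> Mor C" "g \<in> Mor C" "Cod f = Dom g" "Rst C g = Idt C (Dom g)"
  shows "Rst C (g \<cdot> f) = Rst C f"
  using rst_rst_cmp[of f g] assms by (simp del: rst_rst_cmp)

lemma rst_cmp_idem:
  assumes "e \<in> Mor C" "g \<in> Mor C" "Dom e = Dom g" "Rst C e = e"
  shows "Rst C (g \<cdot> e) = Rst C g \<cdot> e"
  using rst_cmp_rst'[of e g] assms by simp

lemma rst_idem_iff: "e \<in> rst_idem C A \<longleftrightarrow> e \<in> Mor C \<and> Dom e = A \<and> Cod e = A \<and> Rst C e = e"
  by (auto simp: rst_idem_def Hom_def)

lemma rst_idemI: "e \<in> Mor C \<Longrightarrow> Dom e = A \<Longrightarrow> Cod e = A \<Longrightarrow> Rst C e = e \<Longrightarrow> e \<in> rst_idem C A"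
  by (simp add: rst_idem_iff)

lemma rst_in_idem [simp]: "f \<in> Mor C \<Longrightarrow> Dom f = A \<Longrightarrow> Rst C f \<in> rst_idem C A"
  by (simp add: rst_idem_iff)

lemma idt_in_idem [simp]: "A \<in> Ob C \<Longrightarrow> Idt C A \<in> rst_idem C A"
  by (simp add: rst_idem_iff)

lemma rst_idem_simps [simp]:
  "e \<in> rst_idem C A \<Longrightarrow> e \<in> Mor C" "e \<in> rst_idem C A \<Longrightarrow> Dom e = A" "e \<in> rst_idem C A \<Longrightarrow> Cod e = A"
  "e \<in> rst_idem C A \<Longrightarrow> Rst C e = e" "e \<in> rst_idem C A \<Longrightarrow> e \<cdot> e = e"
proof -
  assume "e \<in> rst_idem C A"
  then show "e \<in> Mor C" "Dom e = A" "Cod e = A" "Rst C e = e" by (simp_all add: rst_idem_iff)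
  then show "e \<cdot> e = e" by (metis rst_cmp_same)
qed

lemma idem_comm: "e \<in> rst_idem C A \<Longrightarrow> e' \<in> rst_idem C A \<Longrightarrow> e \<cdot> e' = e' \<cdot> e"
  using rst_comm[of e e'] by simp

lemma idem_cmp [simp]: "e \<in> rst_idem C A \<Longrightarrow> e' \<in> rst_idem C A \<Longrightarrow> e \<cdot> e' \<in> rst_idem C A"
  using rst_cmp_idem[of e' e] by (intro rst_idemI) simp_all

lemma idem_idem_assoc [simp]:
  "e \<in> rst_idem C A \<Longrightarrow> f \<in> Mor C \<Longrightarrow> Cod f = A \<Longrightarrow> e \<cdot> e \<cdot> f = e \<cdot> f"
  using assoc[of f e e] by simp

lemma idem_slide:
  "e \<in> rst_idem C A \<Longrightarrow> f \<in> Mor C \<Longrightarrow> Cod f = A \<Longrightarrow> e \<cdot> f = f \<cdot> Rst C (e \<cdot> f)"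
  using rst_slide[of f e] by simp

lemma rleI:
  "f \<in> Mor C \<Longrightarrow> g \<in> Mor C \<Longrightarrow> Dom f = Dom g \<Longrightarrow> Cod f = Cod g \<Longrightarrow> g \<cdot> Rst C f = f \<Longrightarrow> rle C f g"
  by (simp add: rle_def parallel_def)

lemma rleD:
  assumes "rle C f g"
  shows "f \<in> Mor C" "g \<in> Mor C" "Dom f = Dom g" "Cod f = Cod g" "g \<cdot> Rst C f = f"
  using assms by (simp_all add: rle_def parallel_def)

lemma rle_restrict: "e \<in> rst_idem C (Dom g) \<Longrightarrow> g \<in> Mor C \<Longrightarrow> rle C (g \<cdot> e) g"
  using rst_cmp_idem[of e g] by (intro rleI) auto

lemma rle_refl: "f \<in> Mor C \<Longrightarrow> rle C f f"
  by (intro rleI) auto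

lemma rle_rst:
  assumes "rle C f g" shows "Rst C g \<cdot> Rst C f = Rst C f" "rle C (Rst C f) (Rst C g)"
proof -
  note [simp] = rleD(1-4)[OF assms]
  show *: "Rst C g \<cdot> Rst C f = Rst C f" using rst_cmp_rst'[of f g] rleD(5)[OF assms] by simp
  show "rle C (Rst C f) (Rst C g)" using * by (intro rleI) auto
qed

text \<open>\<open>f\<close> is \<open>g\<close> cut down to the domain of \<open>f\<close>.
  Equality of joins is usually proved in this way, by comparing domains after an inequality has been
  found.\<close>

lemma rle_same_rst:
  assumes "rle C f g" "Rst C f = Rst C g" shows "f = g"
  using rleD[OF assms(1)] assms(2) by auto

lemma rle_antisym:
  assumes "rle C f g" "rle C g f" shows "f = g"
proof (rule rle_same_rst[OF assms(1)])
  show "Rst C f = Rst C g"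
    using rle_rst(1)[OF assms(1)] rle_rst(1)[OF assms(2)] rst_comm rleD(1-3)[OF assms(1)] by metis
qed

lemma rle_cmp_left:
  assumes "rle C f g" "k \<in> Mor C" "Dom k = Cod g" shows "rle C (k \<cdot> f) (k \<cdot> g)"
proof -
  note D = rleD[OF assms(1)]
  have "k \<cdot> f = (k \<cdot> g) \<cdot> Rst C f" using D assms by simp
  then show ?thesis using rle_restrict[of "Rst C f" "k \<cdot> g"] D assms by simp
qed

lemma rle_cmp_right:
  assumes "rle C f g" "k \<in> Mor C" "Cod k = Dom g" shows "rle C (f \<cdot> k) (g \<cdot> k)"
proof -
  note D = rleD[OF assms(1)]
  have "f \<cdot> k = (g \<cdot> Rst C f) \<cdot> k" using D by simp
  also have "... = g \<cdot> Rst C f \<cdot> k" using D(1-4) assms by (subst assoc) simp_all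
  also have "... = (g \<cdot> k) \<cdot> Rst C (f \<cdot> k)" using D assms rst_slide[of k f] by simp
  finally show ?thesis using D assms by (intro rleI) simp_all
qed

lemma rle_idem_iff:
  "e \<in> rst_idem C A \<Longrightarrow> e' \<in> rst_idem C A \<Longrightarrow> rle C e e' \<longleftrightarrow> e' \<cdot> e = e"
  using rleD(5)[of e e'] by (auto intro!: rleI)

lemma rle_idem: "rle C e e' \<Longrightarrow> e' \<in> rst_idem C A \<Longrightarrow> e \<in> rst_idem C A"
proof -
  assume a: "rle C e e'" "e' \<in> rst_idem C A"
  note D = rleD[OF a(1)]
  have "Rst C e = e" using rle_rst(1)[OF a(1)] D a(2) by simp
  then show ?thesis using D a(2) by (intro rst_idemI) simp_all
qed

lemma is_joinD:
  assumes "is_join C A B F h"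
  shows "F \<subseteq> Hom C A B" "h \<in> Mor C" "Dom h = A" "Cod h = B" "f \<in> F \<Longrightarrow> rle C f h"
    "k \<in> Hom C A B \<Longrightarrow> (\<And>f. f \<in> F \<Longrightarrow> rle C f k) \<Longrightarrow> rle C h k"
  using assms by (auto simp: is_join_def Hom_def)

lemma join_unique: "is_join C A B F h \<Longrightarrow> is_join C A B F h' \<Longrightarrow> h = h'"
  by (rule rle_antisym) (auto simp: is_join_def)

lemma Join_eq: "is_join C A B F h \<Longrightarrow> Join C A B F = h"
  unfolding Join_def using join_unique by blast

lemma compat_iff:
  "compat C f g \<longleftrightarrow> f \<in> Mor C \<and> g \<in> Mor C \<and> Dom f = Dom g \<and> Cod f = Cod g \<and> f \<cdot> Rst C g = g \<cdot> Rst C f"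
  by (auto simp: compat_def parallel_def)

text \<open>Both maps are \<open>h\<close> cut down to their domains, and restriction idempotents
  commute.\<close>

lemma bounded_compat:
  assumes "rle C f h" "rle C g h" shows "compat C f g"
proof -
  note D = rleD[OF assms(1)] rleD[OF assms(2)]
  have "f \<cdot> Rst C g = (h \<cdot> Rst C f) \<cdot> Rst C g" using D by simp
  also have "... = h \<cdot> Rst C f \<cdot> Rst C g" using D(1-4) D(6-9) by (subst assoc) simp_all
  also have "... = h \<cdot> Rst C g \<cdot> Rst C f" using rst_comm[of f g] D by simp
  also have "... = (h \<cdot> Rst C g) \<cdot> Rst C f" using D(1-4) D(6-9) by (subst assoc) simp_all
  also have "... = g \<cdot> Rst C f" using D by simp
  finally show ?thesis using D by (simp add: compat_iff)
qed

lemma partial_inverseD: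
  assumes "partial_inverse C s t"
  shows "s \<in> Mor C" "t \<in> Mor C" "Dom t = Cod s" "Cod t = Dom s" "t \<cdot> s = Rst C s" "s \<cdot> t = Rst C t"
  using assms by (auto simp: partial_inverse_def Hom_def)

lemma partial_inverseI:
  "s \<in> Mor C \<Longrightarrow> t \<in> Mor C \<Longrightarrow> Dom t = Cod s \<Longrightarrow> Cod t = Dom s \<Longrightarrow> t \<cdot> s = Rst C s \<Longrightarrow>
    s \<cdot> t = Rst C t \<Longrightarrow> partial_inverse C s t"
  by (auto simp: partial_inverse_def Hom_def)

lemma partial_inverse_sym: "partial_inverse C s t \<Longrightarrow> partial_inverse C t s"
  by (auto simp: partial_inverse_def Hom_def)

text \<open>For two partial inverses, \<open>t \<cdot> Rst C t' = t \<cdot> s \<cdot> t' = Rst C s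
  \<cdot> t' = t'\<close> by sliding, so each lies below the other.\<close>

lemma partial_inverse_unique:
  assumes "partial_inverse C s t" "partial_inverse C s t'" shows "t = t'"
proof -
  have le: "rle C t' t" if "partial_inverse C s t" "partial_inverse C s t'" for t t'
  proof -
    note D = partial_inverseD[OF that(1)] partial_inverseD[OF that(2)]
    have "t \<cdot> Rst C t' = t \<cdot> s \<cdot> t'" using D by simp
    also have "... = (t \<cdot> s) \<cdot> t'" using D(1-4) D(7-10) by simp
    also have "... = t' \<cdot> Rst C (s \<cdot> t')" using D rst_slide[of t' s] by simp
    also have "... = t'" using D by simp
    finally show ?thesis using D by (intro rleI) simp_all
  qed
  show ?thesis using rle_antisym le assms by blast
qed

lemma partial_inverse_idem: "e \<in> rst_idem C A \<Longrightarrow> partial_inverse C e e"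
  by (intro partial_inverseI) simp_all

lemma partial_inverse_cmp:
  assumes "partial_inverse C s s'" "partial_inverse C t t'" "Cod s = Dom t"
  shows "partial_inverse C (t \<cdot> s) (s' \<cdot> t')"
proof -
  \<comment> \<open>Swapping each map with its partial inverse exchanges the two equations of a
    partial inverse, so one computation serves for both.\<close>
  have half: "(s' \<cdot> t') \<cdot> t \<cdot> s = Rst C (t \<cdot> s)"
    if "partial_inverse C s s'" "partial_inverse C t t'" "Cod s = Dom t" for s s' t t'
  proof -
    note D = partial_inverseD[OF that(1)] partial_inverseD[OF that(2)]
    have "(s' \<cdot> t') \<cdot> t \<cdot> s = s' \<cdot> (t' \<cdot> t) \<cdot> s" using D(1-4) D(7-10) that(3) by simp
    also have "... = s' \<cdot> s \<cdot> Rst C (t \<cdot> s)" using D that(3) rst_slide[of s t] by simp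
    also have "... = (s' \<cdot> s) \<cdot> Rst C (t \<cdot> s)" using D(1-4) D(7-10) that(3) by simp
    also have "... = Rst C (t \<cdot> s)" using D that(3) rst_absorb[of s t] by simp
    finally show ?thesis .
  qed
  note D = partial_inverseD[OF assms(1)] partial_inverseD[OF assms(2)]
  show ?thesis
    using half[OF assms] half[OF partial_inverse_sym[OF assms(2)] partial_inverse_sym[OF assms(1)]] D(1-4) D(7-10) assms(3)
    by (intro partial_inverseI) simp_all
qed

lemma partial_iso_cmp: "partial_iso C s \<Longrightarrow> partial_iso C t \<Longrightarrow> Cod s = Dom t \<Longrightarrow> partial_iso C (t \<cdot> s)"
  unfolding partial_iso_def using partial_inverse_cmp by blast

lemma partial_iso_idem: "e \<in> rst_idem C A \<Longrightarrow> partial_iso C e"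
  unfolding partial_iso_def using partial_inverse_idem by blast

lemma total_iff: "total_map C f \<longleftrightarrow> f \<in> Mor C \<and> Rst C f = Idt C (Dom f)"
  by (simp add: total_map_def)

end

text \<open>A join restriction category has joins of compatible families, a join inverse category
  has joins of bicompatible ones. A family with an upper bound is both, so joins of bounded families
  form a common theory, applied to \<open>C\<close> and to \<open>inv_rcat A\<close> alike.\<close>

locale bounded_join_category = restriction_category C for C :: "('o, 'm) rcat" (structure) +
  assumes bounded_join: "F \<subseteq> Hom C A B \<Longrightarrow> k \<in> Hom C A B \<Longrightarrow> (\<And>f. f \<in> F \<Longrightarrow> rle C f k) \<Longrightarrow>
      \<exists>h. is_join C A B F h"
    and is_join_precomp: "is_join C A B F h \<Longrightarrow> k \<in> Hom C Z A \<Longrightarrow>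
      is_join C Z B ((\<lambda>f. f \<cdot> k) ` F) (h \<cdot> k)"

sublocale join_restriction_category \<subseteq> bounded_join_category
proof
  fix F A B k assume F: "F \<subseteq> Hom C A B" and k: "k \<in> Hom C A B" and "\<And>f. f \<in> F \<Longrightarrow> rle C f k"
  then have "compat C f g" if "f \<in> F" "g \<in> F" for f g using bounded_compat that by blast
  then show "\<exists>h. is_join C A B F h"
    using join_exists[OF _ _ F] k by (auto simp: Hom_def)
next
  fix F A B h k Z assume "is_join C A B F h" "k \<in> Hom C Z A"
  then show "is_join C Z B ((\<lambda>f. f \<cdot> k) ` F) (h \<cdot> k)"
    using join_precomp bounded_compat by (meson is_joinD(5))
qed

context bounded_join_category
begin

text \<open>Let \<open>d\<close> be the join of the restrictions. Cut down to \<open>d\<close>, the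
  map \<open>h\<close> is still an upper bound of \<open>F\<close>, so \<open>h\<close> lies below
  \<open>h \<cdot> d\<close> and its domain is contained in \<open>d\<close>; the other inclusion is
  monotonicity.\<close>

lemma join_rst:
  assumes "is_join C A B F h" shows "is_join C A A (Rst C ` F) (Rst C h)"
proof -
  note h = is_joinD[OF assms]
  have F: "f \<in> Mor C" "Dom f = A" "Cod f = B" if "f \<in> F" for f
    using h(1) that by (auto simp: Hom_def)
  have "Rst C ` F \<subseteq> Hom C A A" "Rst C h \<in> Hom C A A" using F h(2-4) by (auto simp: Hom_def)
  from bounded_join[OF this] obtain d where d: "is_join C A A (Rst C ` F) d"
    using rle_rst(2)[OF h(5)] by auto
  note d' = is_joinD[OF d]
  have "rle C d (Rst C h)" using d'(6)[of "Rst C h"] h(2-4) rle_rst(2)[OF h(5)] by (auto simp: Hom_def)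
  then have di: "d \<in> rst_idem C A" using rle_idem[of d "Rst C h" A] h(2-4) by simp
  have "rle C h (h \<cdot> d)"
  proof (rule h(6))
    fix f assume f: "f \<in> F"
    have "rle C (h \<cdot> Rst C f) (h \<cdot> d)" using rle_cmp_left[OF d'(5), of "Rst C f" h] f d'(4) h(2-4) by simp
    then show "rle C f (h \<cdot> d)" using rleD(5)[OF h(5)[OF f]] by simp
  qed (use h(2-4) di in \<open>simp add: Hom_def\<close>)
  then have "Rst C (h \<cdot> d) \<cdot> Rst C h = Rst C h" by (rule rle_rst)
  moreover have "Rst C (h \<cdot> d) = Rst C h \<cdot> d" using rst_cmp_idem[of d h] di h(2-4) by simp
  ultimately have "Rst C h \<cdot> d = Rst C h"
    using di h(2-4) idem_comm[of d A "Rst C h"] assoc[of "Rst C h" d "Rst C h"]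
      assoc[of d "Rst C h" "Rst C h"] by simp
  then have "d = Rst C h" using \<open>rle C d (Rst C h)\<close> di h(2-4) by (simp add: rle_def)
  then show ?thesis using d by simp
qed

text \<open>The join of \<open>F\<close> lies below \<open>h\<close> and has the same domain by
  \<open>join_rst\<close>, so it equals \<open>h\<close>. Recognising a join is thereby reduced to a
  join of idempotents.\<close>

lemma joinI:
  assumes F: "\<And>f. f \<in> F \<Longrightarrow> rle C f h" and h: "h \<in> Hom C A B"
    and j: "is_join C A A (Rst C ` F) (Rst C h)"
  shows "is_join C A B F h"
proof -
  have F': "F \<subseteq> Hom C A B" using F h rleD[of _ h] by (fastforce simp: Hom_def)
  then obtain n where n: "is_join C A B F n" using bounded_join[OF F' h F] by auto
  have "rle C n h" using is_joinD(6)[OF n h F] .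
  moreover have "Rst C n = Rst C h" using join_unique[OF join_rst[OF n] j] .
  ultimately show ?thesis using n rle_same_rst by metis
qed

text \<open>Preservation under precomposition is the axiom; postcomposition is derived from it. The
  domain of \<open>k \<cdot> f\<close> is that of \<open>f\<close> met with that of
  \<open>k \<cdot> h\<close>, so these domains join correctly because precomposition with
  \<open>Rst C (k \<cdot> h)\<close> preserves the join of the restrictions.\<close>

lemma join_postcomp:
  assumes "is_join C A B F h" "k \<in> Hom C B D"
  shows "is_join C A D ((\<lambda>f. k \<cdot> f) ` F) (k \<cdot> h)"
proof (rule joinI)
  note h = is_joinD[OF assms(1)]
  have k: "k \<in> Mor C" "Dom k = B" "Cod k = D" using assms(2) by (auto simp: Hom_def)
  have F: "f \<in> Mor C" "Dom f = A" "Cod f = B" if "f \<in> F" for f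
    using h(1) that by (auto simp: Hom_def)
  have eq: "Rst C f \<cdot> Rst C (k \<cdot> h) = Rst C (k \<cdot> f)" if f: "f \<in> F" for f
  proof -
    have "Rst C (k \<cdot> f) = Rst C ((k \<cdot> h) \<cdot> Rst C f)"
      using rleD(5)[OF h(5)[OF f]] h(2-4) k F[OF f] by simp
    also have "... = Rst C (k \<cdot> h) \<cdot> Rst C f" using h(2-4) k F[OF f] by (subst rst_cmp_rst') simp_all
    finally show ?thesis using rst_comm[of f "k \<cdot> h"] h(2-4) k F[OF f] by simp
  qed
  have "is_join C A A ((\<lambda>f. f \<cdot> Rst C (k \<cdot> h)) ` Rst C ` F) (Rst C h \<cdot> Rst C (k \<cdot> h))"
    by (rule is_join_precomp[OF join_rst[OF assms(1)]]) (use h(2-4) k in \<open>simp add: Hom_def\<close>)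
  moreover have "(\<lambda>f. f \<cdot> Rst C (k \<cdot> h)) ` Rst C ` F = Rst C ` (\<lambda>f. k \<cdot> f) ` F"
    using eq by (auto simp: image_image cong: image_cong)
  ultimately show "is_join C A A (Rst C ` (\<lambda>f. k \<cdot> f) ` F) (Rst C (k \<cdot> h))"
    using rst_absorb(2)[of h k] h(2-4) k by simp
  show "rle C f (k \<cdot> h)" if "f \<in> (\<lambda>f. k \<cdot> f) ` F" for f
    using that rle_cmp_left[OF h(5)] h(4) k by auto
qed (use assms is_joinD(2-4)[OF assms(1)] in \<open>simp add: Hom_def\<close>)

lemma join_eq:
  assumes "is_join C A B F h" "k \<in> Hom C B D" "k' \<in> Hom C B D" "\<And>f. f \<in> F \<Longrightarrow> k \<cdot> f = k' \<cdot> f"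
  shows "k \<cdot> h = k' \<cdot> h"
  using join_unique[OF join_postcomp[OF assms(1,2)]] join_postcomp[OF assms(1,3)] assms(4)
  by (metis (mono_tags, lifting) image_cong)

lemma join_eq_rst:
  assumes j: "is_join C A B F h" and u: "u \<in> Hom C A D" "v \<in> Hom C A D"
    and "\<And>f. f \<in> F \<Longrightarrow> u \<cdot> Rst C f = v \<cdot> Rst C f"
  shows "u \<cdot> Rst C h = v \<cdot> Rst C h"
  using join_eq[OF join_rst[OF j] u] assms(4) by auto

text \<open>A family of restriction idempotents is its own family of restrictions, so
  \<open>d\<close> and \<open>Rst C d\<close> are joins of the same family.\<close>

lemma join_idem:
  assumes "is_join C A A D d" "\<And>e. e \<in> D \<Longrightarrow> e \<in> rst_idem C A"
  shows "d \<in> rst_idem C A"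
proof -
  have "Rst C e = e" if "e \<in> D" for e using assms(2)[OF that] by simp
  then have "Rst C ` D = D" by simp
  then have "Rst C d = d" using join_unique[OF join_rst[OF assms(1)]] assms(1) by simp
  then show ?thesis using is_joinD(2-4)[OF assms(1)] by (intro rst_idemI) simp_all
qed

end

section \<open>Inverse categories\<close>

lemma inv_rcat_simps [simp]:
  "Ob (inv_rcat A) = Ob A" "Mor (inv_rcat A) = Mor A" "Idt (inv_rcat A) = Idt A"
  "Cmp (inv_rcat A) = Cmp A" "Rst (inv_rcat A) s = cinv A s \<cdot>\<^bsub>A\<^esub> s" "Hom (inv_rcat A) = Hom A"
  by (auto simp: inv_rcat_def Hom_def fun_eq_iff)

context inverse_category
begin

lemma cinv_props:
  assumes "s \<in> Mor A"
  shows "cinv A s \<in> Hom A (Cod s) (Dom s) \<and> s \<cdot> cinv A s \<cdot> s = s \<and> cinv A s \<cdot> s \<cdot> cinv A s = cinv A s"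
  unfolding cinv_def by (rule theI'[OF inverse_ex1[OF assms]])

lemma cinv_simps [simp]:
  "s \<in> Mor A \<Longrightarrow> cinv A s \<in> Mor A" "s \<in> Mor A \<Longrightarrow> Dom (cinv A s) = Cod s"
  "s \<in> Mor A \<Longrightarrow> Cod (cinv A s) = Dom s" "s \<in> Mor A \<Longrightarrow> s \<cdot> cinv A s \<cdot> s = s"
  "s \<in> Mor A \<Longrightarrow> cinv A s \<cdot> s \<cdot> cinv A s = cinv A s"
  using cinv_props[of s] by (auto simp: Hom_def)

lemma cinv_simps_assoc [simp]:
  assumes "s \<in> Mor A" "f \<in> Mor A"
  shows "Cod f = Dom s \<Longrightarrow> s \<cdot> cinv A s \<cdot> s \<cdot> f = s \<cdot> f"
    and "Cod f = Cod s \<Longrightarrow> cinv A s \<cdot> s \<cdot> cinv A s \<cdot> f = cinv A s \<cdot> f"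
proof -
  assume "Cod f = Dom s"
  then have "s \<cdot> cinv A s \<cdot> s \<cdot> f = (s \<cdot> cinv A s \<cdot> s) \<cdot> f"
    using assms by (simp del: cinv_simps(4,5))
  then show "s \<cdot> cinv A s \<cdot> s \<cdot> f = s \<cdot> f" using assms by (simp only: cinv_simps)
next
  assume "Cod f = Cod s"
  then have "cinv A s \<cdot> s \<cdot> cinv A s \<cdot> f = (cinv A s \<cdot> s \<cdot> cinv A s) \<cdot> f"
    using assms by (simp del: cinv_simps(4,5))
  then show "cinv A s \<cdot> s \<cdot> cinv A s \<cdot> f = cinv A s \<cdot> f" using assms by (simp only: cinv_simps)
qed

lemma cinv_eq:
  assumes "s \<in> Mor A" "t \<in> Mor A" "Dom t = Cod s" "Cod t = Dom s" "s \<cdot> t \<cdot> s = s" "t \<cdot> s \<cdot> t = t"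
  shows "cinv A s = t"
proof -
  have "t \<in> Hom A (Cod s) (Dom s) \<and> s \<cdot> t \<cdot> s = s \<and> t \<cdot> s \<cdot> t = t"
    using assms by (simp add: Hom_def)
  then show ?thesis using inverse_ex1[OF assms(1)] cinv_props[OF assms(1)] by blast
qed

lemma cinv_cinv [simp]: "s \<in> Mor A \<Longrightarrow> cinv A (cinv A s) = s"
  by (rule cinv_eq) simp_all

definition idem where "idem i e \<longleftrightarrow> e \<in> Mor A \<and> Dom e = i \<and> Cod e = i \<and> e \<cdot> e = e"

lemma idem_simps:
  assumes "idem i e" shows "e \<in> Mor A" "Dom e = i" "Cod e = i" "e \<cdot> e = e"
    "f \<in> Mor A \<Longrightarrow> Cod f = i \<Longrightarrow> e \<cdot> e \<cdot> f = e \<cdot> f"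
proof -
  show "e \<in> Mor A" "Dom e = i" "Cod e = i" "e \<cdot> e = e" using assms by (simp_all add: idem_def)
  then show "f \<in> Mor A \<Longrightarrow> Cod f = i \<Longrightarrow> e \<cdot> e \<cdot> f = e \<cdot> f" using assoc[of f e e] by simp
qed

lemma cinv_idem: "idem i e \<Longrightarrow> cinv A e = e"
  by (rule cinv_eq) (simp_all add: idem_simps)

text \<open>With \<open>x\<close> the inverse of \<open>e \<cdot> f\<close>, the map
  \<open>f \<cdot> x \<cdot> e\<close> is another one, so \<open>x = f \<cdot> x \<cdot> e\<close>,
  which is idempotent. An idempotent is its own inverse, so \<open>x = e \<cdot> f\<close>.\<close>

lemma idem_idem_cmp:
  assumes e: "idem i e" and f: "idem i f" shows "idem i (e \<cdot> f)"
proof -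
  note [simp] = idem_simps[OF e] idem_simps[OF f]
  define x where "x = cinv A (e \<cdot> f)"
  have x [simp]: "x \<in> Mor A" "Dom x = i" "Cod x = i" by (simp_all add: x_def)
  have x1: "e \<cdot> f \<cdot> x \<cdot> e \<cdot> f = e \<cdot> f" and x2: "x \<cdot> e \<cdot> f \<cdot> x = x"
    using cinv_simps(4,5)[of "e \<cdot> f"] by (simp_all add: x_def del: cinv_simps(4,5))
  have x2': "x \<cdot> e \<cdot> f \<cdot> x \<cdot> e = x \<cdot> e"
    using assoc[of e "e \<cdot> f \<cdot> x" x] x2 by simp
  have "cinv A (e \<cdot> f) = f \<cdot> x \<cdot> e"
    by (rule cinv_eq) (use x1 x2' in simp_all)
  then have xe: "x = f \<cdot> x \<cdot> e" by (simp add: x_def)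
  have "x \<cdot> x = (f \<cdot> x \<cdot> e) \<cdot> (f \<cdot> x \<cdot> e)" by (subst (1 2) xe) (rule refl)
  also have "... = f \<cdot> x \<cdot> e \<cdot> f \<cdot> x \<cdot> e" by simp
  also have "... = x" unfolding x2' by (rule xe[symmetric])
  finally have "idem i x" by (simp add: idem_def)
  then have "cinv A x = x" by (rule cinv_idem)
  moreover have "cinv A x = e \<cdot> f" by (simp add: x_def)
  ultimately show ?thesis using \<open>idem i x\<close> by simp
qed

text \<open>Both products are idempotent, which makes \<open>f \<cdot> e\<close> an inverse of
  \<open>e \<cdot> f\<close>; but an idempotent is its own inverse.\<close>

lemma idem_commute:
  assumes e: "idem i e" and f: "idem i f" shows "e \<cdot> f = f \<cdot> e"
proof -
  note [simp] = idem_simps[OF e] idem_simps[OF f]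
  have ef: "e \<cdot> f \<cdot> e \<cdot> f = e \<cdot> f" and fe: "f \<cdot> e \<cdot> f \<cdot> e = f \<cdot> e"
    using idem_simps(4)[OF idem_idem_cmp[OF e f]] idem_simps(4)[OF idem_idem_cmp[OF f e]] by simp_all
  have "cinv A (e \<cdot> f) = f \<cdot> e" by (rule cinv_eq) (use ef fe in simp_all)
  then show ?thesis using cinv_idem[OF idem_idem_cmp[OF e f]] by simp
qed

lemma idem_cinv_cmp [simp]:
  "s \<in> Mor A \<Longrightarrow> Dom s = i \<Longrightarrow> idem i (cinv A s \<cdot> s)" "s \<in> Mor A \<Longrightarrow> Cod s = i \<Longrightarrow> idem i (s \<cdot> cinv A s)"
  by (simp_all add: idem_def)

text \<open>The idempotents \<open>s \<cdot> cinv A s\<close> and \<open>cinv A t \<cdot> t\<close>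
  meet in the middle of the product; once they are commuted, the outer factors absorb them.\<close>

lemma cinv_cmp:
  assumes "s \<in> Mor A" "t \<in> Mor A" "Cod s = Dom t"
  shows "cinv A (t \<cdot> s) = cinv A s \<cdot> cinv A t"
proof (rule cinv_eq)
  have c: "(s \<cdot> cinv A s) \<cdot> (cinv A t \<cdot> t) = (cinv A t \<cdot> t) \<cdot> (s \<cdot> cinv A s)"
    by (rule idem_commute[of "Cod s"]) (use assms in auto)
  have "(t \<cdot> s) \<cdot> (cinv A s \<cdot> cinv A t) \<cdot> t \<cdot> s = t \<cdot> ((s \<cdot> cinv A s) \<cdot> (cinv A t \<cdot> t)) \<cdot> s"
    using assms by simp
  also have "... = t \<cdot> s" using assms by (subst c) simp
  finally show "(t \<cdot> s) \<cdot> (cinv A s \<cdot> cinv A t) \<cdot> t \<cdot> s = t \<cdot> s" .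
  have "(cinv A s \<cdot> cinv A t) \<cdot> (t \<cdot> s) \<cdot> cinv A s \<cdot> cinv A t =
      cinv A s \<cdot> ((cinv A t \<cdot> t) \<cdot> (s \<cdot> cinv A s)) \<cdot> cinv A t"
    using assms by simp
  also have "... = cinv A s \<cdot> cinv A t" using assms by (subst c[symmetric]) simp
  finally show "(cinv A s \<cdot> cinv A t) \<cdot> (t \<cdot> s) \<cdot> cinv A s \<cdot> cinv A t = cinv A s \<cdot> cinv A t" .
qed (use assms in simp_all)

text \<open>The axioms on two maps reduce to the commutation of idempotents of the forms
  \<open>cinv A s \<cdot> s\<close> and \<open>s \<cdot> cinv A s\<close>.\<close>

lemma inv_restriction_category: "restriction_category (inv_rcat A)"
proof
  fix f g X Y Z
  {
    assume "f \<in> Hom (inv_rcat A) X Y" "g \<in> Hom (inv_rcat A) X Z"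
    then have [simp]: "f \<in> Mor A" "g \<in> Mor A" "Dom f = X" "Dom g = X" by (auto simp: Hom_def)
    have c: "(cinv A f \<cdot> f) \<cdot> (cinv A g \<cdot> g) = (cinv A g \<cdot> g) \<cdot> (cinv A f \<cdot> f)"
      by (rule idem_commute[of X]) auto
    then show "Rst (inv_rcat A) f \<cdot>\<^bsub>inv_rcat A\<^esub> Rst (inv_rcat A) g =
        Rst (inv_rcat A) g \<cdot>\<^bsub>inv_rcat A\<^esub> Rst (inv_rcat A) f" by (simp del: assoc)
    have "cinv A (g \<cdot> cinv A f \<cdot> f) \<cdot> (g \<cdot> cinv A f \<cdot> f) = (cinv A f \<cdot> f) \<cdot> (cinv A g \<cdot> g) \<cdot> (cinv A f \<cdot> f)"
      by (simp add: cinv_cmp)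
    also have "... = (cinv A f \<cdot> f) \<cdot> (cinv A g \<cdot> g)" by (subst c[symmetric]) simp
    also note c
    finally show "Rst (inv_rcat A) (g \<cdot>\<^bsub>inv_rcat A\<^esub> Rst (inv_rcat A) f) =
        Rst (inv_rcat A) g \<cdot>\<^bsub>inv_rcat A\<^esub> Rst (inv_rcat A) f" by simp
  }
  {
    assume "f \<in> Hom (inv_rcat A) X Y" "g \<in> Hom (inv_rcat A) Y Z"
    then have [simp]: "f \<in> Mor A" "g \<in> Mor A" "Cod f = Y" "Dom g = Y" by (auto simp: Hom_def)
    have "f \<cdot> cinv A (g \<cdot> f) \<cdot> g \<cdot> f = ((f \<cdot> cinv A f) \<cdot> (cinv A g \<cdot> g)) \<cdot> f"
      by (simp add: cinv_cmp)
    also have "... = (cinv A g \<cdot> g) \<cdot> f" by (subst idem_commute[of Y]) simp_all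
    finally show "Rst (inv_rcat A) g \<cdot>\<^bsub>inv_rcat A\<^esub> f = f \<cdot>\<^bsub>inv_rcat A\<^esub> Rst (inv_rcat A) (g \<cdot>\<^bsub>inv_rcat A\<^esub> f)"
      by simp
  }
qed (auto simp: Hom_def)

lemma rst_idem_inv: "e \<in> rst_idem (inv_rcat A) i \<longleftrightarrow> idem i e"
proof
  assume "e \<in> rst_idem (inv_rcat A) i"
  then have e: "e \<in> Mor A" "Dom e = i" "Cod e = i" "cinv A e \<cdot> e = e" by (auto simp: rst_idem_def Hom_def)
  then show "idem i e" using idem_cinv_cmp(1)[of e i] by (simp only:)
next
  assume "idem i e"
  then show "e \<in> rst_idem (inv_rcat A) i"
    by (simp add: rst_idem_def Hom_def idem_simps cinv_idem)
qed

text \<open>Inversion is monotone: if \<open>s\<close> is \<open>h\<close> cut down to its domain,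
  then \<open>cinv A s\<close> is \<open>cinv A h\<close> followed by that idempotent, which slides
  to the right. So a common bound for \<open>s\<close> and \<open>t\<close> yields one for their
  inverses.\<close>

lemma bounded_bicompat:
  assumes "rle (inv_rcat A) s h" "rle (inv_rcat A) t h" shows "bicompat A s t"
proof -
  interpret R: restriction_category "inv_rcat A" by (rule inv_restriction_category)
  have le: "rle (inv_rcat A) (cinv A s) (cinv A h)" if "rle (inv_rcat A) s h" for s
  proof -
    note D = R.rleD[OF that]
    have "h \<cdot> cinv A s \<cdot> s = s" using D(5) by simp
    then have "cinv A s = cinv A (h \<cdot> cinv A s \<cdot> s)" by (simp only:)
    also have "... = (cinv A s \<cdot> s) \<cdot> cinv A h" using D(1-4) by (simp add: cinv_cmp)
    finally have "cinv A s = Rst (inv_rcat A) s \<cdot>\<^bsub>inv_rcat A\<^esub> cinv A h" by simp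
    also have "... = cinv A h \<cdot>\<^bsub>inv_rcat A\<^esub> Rst (inv_rcat A) (s \<cdot>\<^bsub>inv_rcat A\<^esub> cinv A h)"
      by (rule R.rst_slide) (use D in auto)
    finally have eq: "cinv A s = cinv A h \<cdot>\<^bsub>inv_rcat A\<^esub> Rst (inv_rcat A) (s \<cdot>\<^bsub>inv_rcat A\<^esub> cinv A h)" .
    show ?thesis
      by (subst eq, rule R.rle_restrict, rule R.rst_in_idem) (use D in auto)
  qed
  show ?thesis unfolding bicompat_def using R.bounded_compat[OF assms] R.bounded_compat[OF le le] assms by blast
qed

end

lemma (in join_inverse_category) bounded_join_category: "bounded_join_category (inv_rcat A)"
proof -
  interpret R: restriction_category "inv_rcat A" by (rule inv_restriction_category)
  show ?thesis
  proof
    fix F X Y k assume F: "F \<subseteq> Hom (inv_rcat A) X Y" and k: "k \<in> Hom (inv_rcat A) X Y"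
      and "\<And>f. f \<in> F \<Longrightarrow> rle (inv_rcat A) f k"
    then have "bicompat A s t" if "s \<in> F" "t \<in> F" for s t using bounded_bicompat that by blast
    then show "\<exists>h. is_join (inv_rcat A) X Y F h"
      using join_exists[of X Y F] F k by (auto simp: Hom_def)
  next
    fix F X Y h k Z assume "is_join (inv_rcat A) X Y F h" "k \<in> Hom (inv_rcat A) Z X"
    then show "is_join (inv_rcat A) Z Y ((\<lambda>f. f \<cdot>\<^bsub>inv_rcat A\<^esub> k) ` F) (h \<cdot>\<^bsub>inv_rcat A\<^esub> k)"
      using join_precomp[of F X Y h k Z] bounded_bicompat R.is_joinD(5) by simp blast
  qed
qed

text \<open>Once all maps are partial isomorphisms, idempotents are restriction idempotents, and an
  inverse in the equational sense is a partial inverse, hence unique. \<open>Phi_cat\<close> is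
  handled in this way: its restriction can be written down at once, while uniqueness of inverses is
  not visible.\<close>

lemma inverse_category_of_partial_isos:
  fixes A :: "('o, 'm) cat" and R :: "('o, 'm) rcat"
  assumes R: "restriction_category R"
    and eqs: "Ob R = Ob A" "Mor R = Mor A" "Idt R = Idt A" "Cmp R = Cmp A"
    and inv: "\<And>s. s \<in> Mor A \<Longrightarrow> \<exists>t. partial_inverse R s t"
  shows "inverse_category A"
    and "partial_inverse R s t \<Longrightarrow> cinv A s = t"
    and "s \<in> Mor A \<Longrightarrow> cinv A s \<cdot>\<^bsub>A\<^esub> s = Rst R s"
proof -
  interpret R: restriction_category R by fact
  note [simp] = eqs
  have H: "Hom A = Hom R" by (simp add: Hom_def fun_eq_iff)
  have cat: "category A"
  proof
    note c = R.dom_cod_ob R.idt_hom R.cmp_hom R.cmp_idt R.idt_cmp R.cmp_assoc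
    show "(h \<cdot>\<^bsub>A\<^esub> g) \<cdot>\<^bsub>A\<^esub> f = h \<cdot>\<^bsub>A\<^esub> g \<cdot>\<^bsub>A\<^esub> f"
      if "f \<in> Hom A X Y" "g \<in> Hom A Y Z" "h \<in> Hom A Z W" for f g h X Y Z W
      using c(6)[of f X Y g Z h W] that by (simp add: H)
    show "g \<cdot>\<^bsub>A\<^esub> f \<in> Hom A X Z" if "f \<in> Hom A X Y" "g \<in> Hom A Y Z" for f g X Y Z
      using c(3)[of f X Y g Z] that by (simp add: H)
  qed (use R.dom_cod_ob R.idt_hom R.cmp_idt R.idt_cmp in \<open>auto simp: H\<close>)
  \<comment> \<open>The partial inverse turns idempotence into
    \<open>Rst R e \<cdot> e = Rst R e\<close>, while sliding gives
    \<open>Rst R e \<cdot> e = e\<close>.\<close>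
  have idem: "e \<in> rst_idem R X" if e: "e \<in> Mor A" "Dom e = X" "Cod e = X" "e \<cdot>\<^bsub>A\<^esub> e = e" for e X
  proof -
    note that = e
    obtain e' where "partial_inverse R e e'" using inv e by blast
    note D = R.partial_inverseD[OF this, unfolded eqs]
    have "e' \<cdot>\<^bsub>A\<^esub> e \<cdot>\<^bsub>A\<^esub> e = (e' \<cdot>\<^bsub>A\<^esub> e) \<cdot>\<^bsub>A\<^esub> e" using R.assoc[of e e e'] D(1-4) that by simp
    then have a: "Rst R e \<cdot>\<^bsub>A\<^esub> e = Rst R e" using that D by simp
    have "Rst R e \<cdot>\<^bsub>A\<^esub> e = e \<cdot>\<^bsub>A\<^esub> Rst R (e \<cdot>\<^bsub>A\<^esub> e)" using R.rst_slide[of e e] that by simp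
    then have "Rst R e \<cdot>\<^bsub>A\<^esub> e = e" using that R.cmp_rst'[of e] by simp
    then show ?thesis using a that by (intro R.rst_idemI) simp_all
  qed
  have pi: "partial_inverse R s t"
    if s: "s \<in> Mor A" and t: "t \<in> Hom A (Cod s) (Dom s)" "s \<cdot>\<^bsub>A\<^esub> t \<cdot>\<^bsub>A\<^esub> s = s" "t \<cdot>\<^bsub>A\<^esub> s \<cdot>\<^bsub>A\<^esub> t = t" for s t
  proof -
    \<comment> \<open>\<open>t \<cdot> s\<close> is a restriction idempotent; the equation
      \<open>s \<cdot> t \<cdot> s = s\<close> puts \<open>Rst R s\<close> below it, and absorption
      gives the converse.\<close>
    have half: "t \<cdot>\<^bsub>A\<^esub> s = Rst R s"
      if s: "s \<in> Mor A" and t: "t \<in> Hom A (Cod s) (Dom s)" "s \<cdot>\<^bsub>A\<^esub> t \<cdot>\<^bsub>A\<^esub> s = s" "t \<cdot>\<^bsub>A\<^esub> s \<cdot>\<^bsub>A\<^esub> t = t" for s t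
    proof -
      have [simp]: "t \<in> Mor A" "Dom t = Cod s" "Cod t = Dom s" using t by (auto simp: Hom_def)
      interpret A: category A by fact
      have "t \<cdot>\<^bsub>A\<^esub> s \<in> rst_idem R (Dom s)"
        by (rule idem) (use s t in simp_all)
      note i = R.rst_idem_simps[OF this, unfolded eqs]
      have "Rst R (s \<cdot>\<^bsub>A\<^esub> (t \<cdot>\<^bsub>A\<^esub> s)) = Rst R s \<cdot>\<^bsub>A\<^esub> (t \<cdot>\<^bsub>A\<^esub> s)"
        using R.rst_cmp_idem[of "t \<cdot>\<^bsub>A\<^esub> s" s] i s by simp
      then have 1: "Rst R s = Rst R s \<cdot>\<^bsub>A\<^esub> (t \<cdot>\<^bsub>A\<^esub> s)" using t by simp
      have "Rst R (t \<cdot>\<^bsub>A\<^esub> s) \<cdot>\<^bsub>A\<^esub> Rst R s = Rst R (t \<cdot>\<^bsub>A\<^esub> s)" "Rst R s \<cdot>\<^bsub>A\<^esub> Rst R (t \<cdot>\<^bsub>A\<^esub> s) = Rst R (t \<cdot>\<^bsub>A\<^esub> s)"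
        using R.rst_absorb[of s t] s by simp_all
      then show ?thesis using 1 i by simp
    qed
    have [simp]: "t \<in> Mor A" "Dom t = Cod s" "Cod t = Dom s" using t by (auto simp: Hom_def)
    show ?thesis
      by (rule R.partial_inverseI) (use half[OF s t] half[of t s] s t in \<open>auto simp: Hom_def\<close>)
  qed
  have ip: "t \<in> Hom A (Cod s) (Dom s) \<and> s \<cdot>\<^bsub>A\<^esub> t \<cdot>\<^bsub>A\<^esub> s = s \<and> t \<cdot>\<^bsub>A\<^esub> s \<cdot>\<^bsub>A\<^esub> t = t"
    if "partial_inverse R s t" for s t
    using R.partial_inverseD[OF that, unfolded eqs] R.cmp_rst'[of s] R.cmp_rst'[of t] by (simp add: Hom_def)
  show ic: "inverse_category A"
  proof (intro inverse_category.intro inverse_category_axioms.intro cat)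
    fix s assume s: "s \<in> Mor A"
    then obtain t where t: "partial_inverse R s t" using inv by blast
    show "\<exists>!t. t \<in> Hom A (Cod s) (Dom s) \<and> s \<cdot>\<^bsub>A\<^esub> t \<cdot>\<^bsub>A\<^esub> s = s \<and> t \<cdot>\<^bsub>A\<^esub> s \<cdot>\<^bsub>A\<^esub> t = t"
      using ip[OF t] pi[OF s] R.partial_inverse_unique[OF t] by blast
  qed
  interpret I: inverse_category A by fact
  show eq: "cinv A s = t" if "partial_inverse R s t" for s t
    by (rule I.cinv_eq) (use ip[OF that] R.partial_inverseD(1)[OF that] in \<open>auto simp: Hom_def\<close>)
  show "cinv A s \<cdot>\<^bsub>A\<^esub> s = Rst R s" if "s \<in> Mor A"
    using inv[OF that] eq R.partial_inverseD(5) by fastforce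
qed

section \<open>Local homeomorphisms and their sections\<close>

text \<open>The idempotent \<open>d a\<close> is the image of the section \<open>s a\<close>: a
  sheet on which \<open>p\<close> is inverted by \<open>s a\<close>. The sheets join to the
  identity. Compared with a plain local homeomorphism, this keeps named sections at hand, indexed by
  a set of any type.\<close>

definition cover :: "('o, 'm) rcat \<Rightarrow> ('o, 'm) arr \<Rightarrow> 'k set \<Rightarrow> ('k \<Rightarrow> ('o, 'm) arr) \<Rightarrow> bool" where
  "cover C p I s \<longleftrightarrow> total_map C p \<and> (\<forall>a \<in> I. partial_section C p (s a)) \<and>
     (\<exists>d. (\<forall>a \<in> I. d a \<in> rst_idem C (Dom p) \<and> s a \<cdot>\<^bsub>C\<^esub> p \<cdot>\<^bsub>C\<^esub> d a = d a \<and> d a \<cdot>\<^bsub>C\<^esub> s a = s a) \<and>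
        is_join C (Dom p) (Dom p) (d ` I) (Idt C (Dom p)))"

context category
begin

lemma cmp_right: "h = k \<Longrightarrow> h \<cdot> x = k \<cdot> x" by simp

end

context join_restriction_category
begin

lemma partial_sectionD:
  assumes "partial_section C p s" "p \<in> Mor C"
  shows "s \<in> Mor C" "Dom s = Cod p" "Cod s = Dom p" "p \<cdot> s = Rst C s"
    "x \<in> Mor C \<Longrightarrow> Cod x = Cod p \<Longrightarrow> p \<cdot> s \<cdot> x = Rst C s \<cdot> x"
proof -
  show *: "s \<in> Mor C" "Dom s = Cod p" "Cod s = Dom p" "p \<cdot> s = Rst C s"
    using assms by (auto simp: partial_section_def Hom_def)
  show "p \<cdot> s \<cdot> x = Rst C s \<cdot> x" if "x \<in> Mor C" "Cod x = Cod p"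
    using cmp_right[OF *(4), of x] *(1-3) assms(2) that by simp
qed

lemma partial_sectionI:
  "s \<in> Mor C \<Longrightarrow> Dom s = Cod p \<Longrightarrow> Cod s = Dom p \<Longrightarrow> p \<cdot> s = Rst C s \<Longrightarrow> partial_section C p s"
  by (simp add: partial_section_def Hom_def)

end

locale covering = join_restriction_category C for C :: "('o, 'm) rcat" (structure) +
  fixes p :: "('o, 'm) arr" and I :: "'k set" and s d :: "'k \<Rightarrow> ('o, 'm) arr"
  assumes p_total [simp]: "p \<in> Mor C" "Rst C p = Idt C (Dom p)"
    and sec: "a \<in> I \<Longrightarrow> partial_section C p (s a)"
    and d_idem: "a \<in> I \<Longrightarrow> d a \<in> rst_idem C (Dom p)"
    and spd [simp]: "a \<in> I \<Longrightarrow> s a \<cdot> p \<cdot> d a = d a"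
    and ds [simp]: "a \<in> I \<Longrightarrow> d a \<cdot> s a = s a"
    and join_d: "is_join C (Dom p) (Dom p) (d ` I) (Idt C (Dom p))"
begin

lemmas s_simps [simp] = partial_sectionD[OF sec p_total(1)]
lemmas d_simps [simp] = rst_idem_simps[OF d_idem]

lemma spd_assoc [simp]:
  assumes "a \<in> I" "x \<in> Mor C" "Cod x = Dom p" shows "s a \<cdot> p \<cdot> d a \<cdot> x = d a \<cdot> x"
  using cmp_right[OF spd[OF assms(1)], of x] assms by (simp del: spd)

lemma ds_assoc [simp]:
  assumes "a \<in> I" "x \<in> Mor C" "Cod x = Cod p" shows "d a \<cdot> s a \<cdot> x = s a \<cdot> x"
  using cmp_right[OF ds[OF assms(1)], of x] assms by (simp del: ds)

end

context join_restriction_category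
begin

lemma coverE:
  assumes "cover C p I s" obtains d where "covering C p I s d"
proof -
  obtain d where "\<And>a. a \<in> I \<Longrightarrow> d a \<in> rst_idem C (Dom p)"
      "\<And>a. a \<in> I \<Longrightarrow> s a \<cdot> p \<cdot> d a = d a" "\<And>a. a \<in> I \<Longrightarrow> d a \<cdot> s a = s a"
      "is_join C (Dom p) (Dom p) (d ` I) (Idt C (Dom p))"
    using assms by (auto simp: cover_def)
  then have "covering C p I s d"
    using assms by unfold_locales (auto simp: cover_def total_iff)
  then show ?thesis using that by blast
qed

lemma coverI:
  assumes "p \<in> Mor C" "Rst C p = Idt C (Dom p)"
    and "\<And>a. a \<in> I \<Longrightarrow> s a \<in> Mor C \<and> Dom (s a) = Cod p \<and> Cod (s a) = Dom p \<and> p \<cdot> s a = Rst C (s a)"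
    and "\<And>a. a \<in> I \<Longrightarrow> d a \<in> rst_idem C (Dom p) \<and> s a \<cdot> p \<cdot> d a = d a \<and> d a \<cdot> s a = s a"
    and "is_join C (Dom p) (Dom p) (d ` I) (Idt C (Dom p))"
  shows "cover C p I s"
  unfolding cover_def total_iff using assms partial_sectionI by blast

lemma cover_total: "cover C p I s \<Longrightarrow> p \<in> Mor C" "cover C p I s \<Longrightarrow> Rst C p = Idt C (Dom p)"
  by (auto simp: cover_def total_iff)

lemma cover_section: "cover C p I s \<Longrightarrow> a \<in> I \<Longrightarrow> partial_section C p (s a)"
  by (auto simp: cover_def)

text \<open>On each sheet \<open>h \<cdot> d a = h \<cdot> s a \<cdot> p \<cdot> d a\<close>, and
  the sheets join to the identity.\<close>

lemma cover_eq:
  assumes c: "cover C p I s" and h: "h \<in> Hom C (Dom p) B" "k \<in> Hom C (Dom p) B"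
    and eq: "\<And>a. a \<in> I \<Longrightarrow> h \<cdot> s a = k \<cdot> s a"
  shows "h = k"
proof -
  obtain d where "covering C p I s d" using c by (rule coverE)
  then interpret covering C p I s d .
  have hk: "h \<in> Mor C" "Dom h = Dom p" "k \<in> Mor C" "Dom k = Dom p" using h by (auto simp: Hom_def)
  have "h \<cdot> d a = k \<cdot> d a" if a: "a \<in> I" for a
  proof -
    have "h \<cdot> d a = (h \<cdot> s a) \<cdot> p \<cdot> d a" using hk a by simp
    also have "... = k \<cdot> d a" unfolding eq[OF a] using hk a by simp
    finally show ?thesis .
  qed
  then have "h \<cdot> Idt C (Dom p) = k \<cdot> Idt C (Dom p)" by (intro join_eq[OF join_d h]) auto
  then show "h = k" using hk by simp
qed

text \<open>The map is the join of the \<open>h a \<cdot> p \<cdot> d a\<close>. Agreement is asked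
  for only on idempotents of the base over which the sections agree; this gives compatibility
  because on the overlap of two sheets their sections do agree. Totality of the result comes from
  \<open>h a\<close> and \<open>s a\<close> having the same domain.\<close>

lemma cover_glue_unique:
  assumes c: "cover C p I s"
    and h: "\<And>a. a \<in> I \<Longrightarrow> h a \<in> Hom C (Cod p) B" "\<And>a. a \<in> I \<Longrightarrow> Rst C (h a) = Rst C (s a)"
    and agree: "\<And>a b e. a \<in> I \<Longrightarrow> b \<in> I \<Longrightarrow> e \<in> rst_idem C (Cod p) \<Longrightarrow> Rst C (s a) \<cdot> e = e \<Longrightarrow>
      s a \<cdot> e = s b \<cdot> e \<Longrightarrow> h a \<cdot> e = h b \<cdot> e"
    and B: "B \<in> Ob C"
  shows "\<exists>!k. k \<in> Hom C (Dom p) B \<and> (\<forall>a \<in> I. k \<cdot> s a = h a)"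
    and "k \<in> Hom C (Dom p) B \<Longrightarrow> (\<And>a. a \<in> I \<Longrightarrow> k \<cdot> s a = h a) \<Longrightarrow> Rst C k = Idt C (Dom p)"
proof -
  obtain d where "covering C p I s d" using c by (rule coverE)
  then interpret covering C p I s d .
  have hs [simp]: "h a \<in> Mor C" "Dom (h a) = Cod p" "Cod (h a) = B" if "a \<in> I" for a
    using h(1)[OF that] by (auto simp: Hom_def)
  have ov: "h a \<cdot> p \<cdot> d a \<cdot> d b = h b \<cdot> p \<cdot> d b \<cdot> d a" if a: "a \<in> I" "b \<in> I" for a b
  proof -
    \<comment> \<open>The part of the base that \<open>s a\<close> sends into the sheet of
      \<open>s b\<close>; over it the two sections agree.\<close>
    define e where "e = Rst C (d b \<cdot> s a)"
    have [simp]: "e \<in> Mor C" "Dom e = Cod p" "Cod e = Cod p" "e \<in> rst_idem C (Cod p)"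
      using a by (simp_all add: e_def)
    have below: "Rst C (s a) \<cdot> e = e" unfolding e_def using rst_absorb(2)[of "s a" "d b"] a by simp
    have se: "d b \<cdot> s a = s a \<cdot> e" unfolding e_def using idem_slide[OF d_idem, of b "s a"] a by simp
    have pe: "p \<cdot> d b \<cdot> s a = e" using s_simps(5)[of a e] a below se by simp
    have "s b \<cdot> e = s b \<cdot> p \<cdot> d b \<cdot> s a" using pe by simp
    also have "... = d b \<cdot> s a" using spd_assoc[of b "s a"] a by simp
    finally have "s a \<cdot> e = s b \<cdot> e" using se by simp
    then have he: "h a \<cdot> e = h b \<cdot> e" by (rule agree[OF a _ below, rotated]) simp
    have pd: "p \<cdot> d b \<cdot> d a = e \<cdot> p \<cdot> d a"
    proof -
      have "e \<cdot> p \<cdot> d a = (p \<cdot> d b \<cdot> s a) \<cdot> p \<cdot> d a" using pe by simp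
      also have "... = p \<cdot> d b \<cdot> s a \<cdot> p \<cdot> d a" using a by simp
      finally show ?thesis using spd[OF a(1)] by simp
    qed
    have cm: "d a \<cdot> d b = d b \<cdot> d a" using idem_comm[OF d_idem d_idem] a by simp
    have "h a \<cdot> p \<cdot> d a \<cdot> d b = (h a \<cdot> e) \<cdot> p \<cdot> d a" using pd a cm by simp
    also have "... = h b \<cdot> p \<cdot> d b \<cdot> d a" unfolding he using pd a by simp
    finally show ?thesis .
  qed
  have r: "Rst C (h a \<cdot> p \<cdot> d a) = d a" if a: "a \<in> I" for a
  proof -
    have "Rst C (h a \<cdot> p \<cdot> d a) = Rst C (Rst C (h a) \<cdot> p \<cdot> d a)" using a by (subst rst_rst_cmp) simp_all
    also have "... = Rst C (s a \<cdot> p \<cdot> d a)" using a h(2)[OF a] by (subst h(2)[OF a], subst rst_rst_cmp) simp_all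
    finally show ?thesis using a spd by simp
  qed
  let ?F = "(\<lambda>a. h a \<cdot> p \<cdot> d a) ` I"
  have "compat C f g" if "f \<in> ?F" "g \<in> ?F" for f g
    using that ov r by (auto simp: compat_iff)
  moreover have "?F \<subseteq> Hom C (Dom p) B" by (auto simp: Hom_def)
  ultimately obtain k where k: "is_join C (Dom p) B ?F k"
    using join_exists[of "Dom p" B ?F] B by auto
  note k' = is_joinD(2-5)[OF k]
  have kd: "k \<cdot> d a = h a \<cdot> p \<cdot> d a" if a: "a \<in> I" for a
    using rleD(5)[OF k'(4), of "h a \<cdot> p \<cdot> d a"] a r[OF a] by simp
  have ks: "k \<cdot> s a = h a" if a: "a \<in> I" for a
  proof -
    have "k \<cdot> s a = (k \<cdot> d a) \<cdot> s a" using a ds k' by simp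
    also have "... = h a \<cdot> Rst C (h a)" using kd[OF a] a h(2)[OF a] by simp
    finally show ?thesis using a by simp
  qed
  have Rk: "Rst C k = Idt C (Dom p)"
  proof -
    have "Rst C ` ?F = d ` I" using r by (force simp: image_image)
    then show ?thesis using join_unique[OF join_rst[OF k]] join_d by simp
  qed
  have uniq: "k' = k" if "k' \<in> Hom C (Dom p) B" "\<And>a. a \<in> I \<Longrightarrow> k' \<cdot> s a = h a" for k'
  proof (rule cover_eq[OF c that(1), of k])
    show "k \<in> Hom C (Dom p) B" using k'(1-3) by (simp add: Hom_def)
    show "k' \<cdot> s a = k \<cdot> s a" if "a \<in> I" for a using \<open>\<And>a. a \<in> I \<Longrightarrow> k' \<cdot> s a = h a\<close> ks that by simp
  qed
  show "\<exists>!k. k \<in> Hom C (Dom p) B \<and> (\<forall>a \<in> I. k \<cdot> s a = h a)"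
  proof (rule ex1I[of _ k])
    show "k \<in> Hom C (Dom p) B \<and> (\<forall>a \<in> I. k \<cdot> s a = h a)" using k'(1-3) ks by (simp add: Hom_def)
  qed (use uniq in blast)
  show "Rst C k = Idt C (Dom p)" if "k \<in> Hom C (Dom p) B" "\<And>a. a \<in> I \<Longrightarrow> k \<cdot> s a = h a" for k
    using uniq[OF that] Rk by simp
qed

text \<open>The domains of the \<open>q a\<close> are the sheets. The last two facts together
  characterise \<open>\<phi> a b\<close> as the largest idempotent in the domain of
  \<open>s a\<close> over which \<open>s a\<close> and \<open>s b\<close> agree.\<close>

lemma glueing_cover:
  assumes g: "glueing C X I \<phi> p q s"
  shows "cover C p I s" "Cod p = X"
    and "a \<in> I \<Longrightarrow> Rst C (s a) = \<phi> a a"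
    and "a \<in> I \<Longrightarrow> b \<in> I \<Longrightarrow> s a \<cdot> \<phi> a b = s b \<cdot> \<phi> a b"
    and "a \<in> I \<Longrightarrow> b \<in> I \<Longrightarrow> e \<in> rst_idem C X \<Longrightarrow> Rst C (s a) \<cdot> e = e \<Longrightarrow> s a \<cdot> e = s b \<cdot> e \<Longrightarrow> \<phi> a b \<cdot> e = e"
proof -
  have p [simp]: "p \<in> Mor C" "Rst C p = Idt C (Dom p)" "Cod p = X"
    using g by (auto simp: glueing_def local_homeo_def total_iff)
  have j: "is_join C (Dom p) X (q ` I) p" using g by (simp add: glueing_def)
  have pinv: "partial_inverse C (q a) (s a)" if "a \<in> I" for a using g that by (simp add: glueing_def)
  have \<phi>: "\<phi> a b = q b \<cdot> s a" if "a \<in> I" "b \<in> I" for a b using g that by (simp add: glueing_def)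
  have q [simp]: "q a \<in> Mor C" "Dom (q a) = Dom p" "Cod (q a) = X" and qp: "p \<cdot> Rst C (q a) = q a" if "a \<in> I" for a
    using rleD[OF is_joinD(5)[OF j, of "q a"]] that by auto
  have s [simp]: "s a \<in> Mor C" "Dom (s a) = X" "Cod (s a) = Dom p" "s a \<cdot> q a = Rst C (q a)" "q a \<cdot> s a = Rst C (s a)"
    if "a \<in> I" for a using partial_inverseD[OF pinv[OF that]] q that by simp_all
  have sq: "s a \<cdot> q a \<cdot> x = Rst C (q a) \<cdot> x" if "a \<in> I" "x \<in> Mor C" "Cod x = Dom p" for a x
    using cmp_right[OF s(4)[OF that(1)], of x] that by (simp del: s(4))
  have qx: "p \<cdot> Rst C (q a) \<cdot> x = q a \<cdot> x" if "a \<in> I" "x \<in> Mor C" "Cod x = Dom p" for a x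
    using cmp_right[OF qp[OF that(1)], of x] that by simp
  have ds: "Rst C (q a) \<cdot> s a = s a" if "a \<in> I" for a using sq[of a "s a"] that by simp
  have ps: "p \<cdot> s a = Rst C (s a)" if a: "a \<in> I" for a
    using qx[of a "s a"] a ds[OF a] by simp
  show "cover C p I s"
  proof (rule coverI[of p I s "\<lambda>a. Rst C (q a)"])
    show "is_join C (Dom p) (Dom p) ((\<lambda>a. Rst C (q a)) ` I) (Idt C (Dom p))"
      using join_rst[OF j] by (simp add: image_image)
  qed (use ps ds qp in simp_all)
  show "Cod p = X" by simp
  show "Rst C (s a) = \<phi> a a" if "a \<in> I" using that \<phi> by simp
  \<comment> \<open>\<open>q b \<cdot> s a\<close> is a restriction idempotent because it is
    \<open>p\<close> applied to a restriction of the section \<open>s a\<close>.\<close>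
  have \<phi>i: "\<phi> a b = Rst C (q b \<cdot> s a)" if "a \<in> I" "b \<in> I" for a b
  proof -
    have "q b \<cdot> s a = p \<cdot> Rst C (q b) \<cdot> s a" using qx[of b "s a"] that by simp
    also have "... = p \<cdot> s a \<cdot> Rst C (q b \<cdot> s a)" using that rst_slide[of "s a" "q b"] by simp
    also have "... = Rst C (s a) \<cdot> Rst C (q b \<cdot> s a)"
      using cmp_right[OF ps[OF that(1)], of "Rst C (q b \<cdot> s a)"] that by simp
    finally show ?thesis using rst_absorb(2)[of "s a" "q b"] that \<phi> by simp
  qed
  show "s a \<cdot> \<phi> a b = s b \<cdot> \<phi> a b" if "a \<in> I" "b \<in> I"
  proof -
    have "s b \<cdot> \<phi> a b = Rst C (q b) \<cdot> s a" using sq[of b "s a"] \<phi> that by simp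
    also have "... = s a \<cdot> \<phi> a b" using rst_slide[of "s a" "q b"] \<phi>i that by simp
    finally show ?thesis by simp
  qed
  show "\<phi> a b \<cdot> e = e" if ab: "a \<in> I" "b \<in> I" and e: "e \<in> rst_idem C X" "Rst C (s a) \<cdot> e = e" "s a \<cdot> e = s b \<cdot> e"
  proof -
    note [simp] = rst_idem_simps[OF e(1)]
    have "\<phi> a b \<cdot> e = q b \<cdot> s a \<cdot> e" using ab \<phi> by simp
    also have "... = (q b \<cdot> s b) \<cdot> e" unfolding e(3) using ab by (simp del: s(5))
    also have "... = Rst C (s b \<cdot> e)" using ab rst_cmp_idem[of e "s b"] by simp
    also have "... = e" using ab e rst_cmp_idem[of e "s a"] by simp
    finally show ?thesis .
  qed
qed

text \<open>\<open>p\<close> is the join of its restrictions to the sheets, and each restriction has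
  the corresponding section as partial inverse.\<close>

lemma cover_local_homeo:
  assumes c: "cover C p I s" shows "local_homeo C p"
proof -
  obtain d where "covering C p I s d" using c by (rule coverE)
  then interpret covering C p I s d .
  have r: "Rst C (p \<cdot> d a) = d a" if "a \<in> I" for a using that rst_cmp_total[of "d a" p] by simp
  have "is_join C (Dom p) (Cod p) ((\<lambda>a. p \<cdot> d a) ` I) p"
  proof (rule joinI)
    show "rle C f p" if "f \<in> (\<lambda>a. p \<cdot> d a) ` I" for f using that rle_restrict d_idem by auto
    have "Rst C ` (\<lambda>a. p \<cdot> d a) ` I = d ` I" using r by (force simp: image_image)
    then show "is_join C (Dom p) (Dom p) (Rst C ` (\<lambda>a. p \<cdot> d a) ` I) (Rst C p)" using join_d by simp
  qed (use p_total in \<open>simp add: Hom_def\<close>)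
  moreover have "partial_iso C (p \<cdot> d a)" if a: "a \<in> I" for a
    unfolding partial_iso_def by (rule exI[of _ "s a"], rule partial_inverseI) (use a r[OF a] in simp_all)
  ultimately show ?thesis
    unfolding local_homeo_def total_iff by (intro conjI exI[of _ "(\<lambda>a. p \<cdot> d a) ` I"] ballI) auto
qed

text \<open>Indexed by themselves, the pieces make \<open>p\<close> a glueing of the atlas
  \<open>b \<cdot> t a\<close> that they induce.\<close>

lemma local_homeo_cover:
  assumes "local_homeo C p"
  obtains I :: "('o, 'm) arr set" and s where "cover C p I s"
proof -
  obtain F where F: "\<And>s. s \<in> F \<Longrightarrow> partial_iso C s" "is_join C (Dom p) (Cod p) F p"
    using assms by (auto simp: local_homeo_def)
  then obtain t where t: "\<And>s. s \<in> F \<Longrightarrow> partial_inverse C s (t s)" unfolding partial_iso_def by metis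
  have "glueing C (Cod p) F (\<lambda>a b. b \<cdot> t a) p (\<lambda>a. a) t"
    using assms t F(2) by (simp add: glueing_def)
  then show ?thesis using that glueing_cover(1) by blast
qed

text \<open>Locally \<open>t\<close> coincides with sections of the cover. So its image
  \<open>e\<close> is the join of the parts \<open>D a\<close> that it occupies in the sheets, and
  \<open>p\<close> inverts \<open>t\<close> there because it inverts each
  \<open>s a\<close>.\<close>

lemma cover_any_section:
  assumes c: "cover C p I s" and t: "partial_section C p t"
  shows "\<exists>e. e \<in> rst_idem C (Dom p) \<and> t \<cdot> p \<cdot> e = e \<and> e \<cdot> t = t \<and> partial_inverse C t (p \<cdot> e)"
proof -
  obtain d where "covering C p I s d" using c by (rule coverE)
  then interpret covering C p I s d .
  note t' [simp] = partial_sectionD[OF t p_total(1)]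
  \<comment> \<open>The part of the base that \<open>t\<close> sends into the sheet
    \<open>d a\<close>; over it \<open>t\<close> equals \<open>s a\<close>.\<close>
  define e where "e a = Rst C (d a \<cdot> t)" for a
  have e [simp]: "e a \<in> Mor C" "Dom (e a) = Cod p" "Cod (e a) = Cod p" "Rst C (e a) = e a"
    "e a \<in> rst_idem C (Cod p)" if "a \<in> I" for a
    using that by (simp_all add: e_def)
  have te: "t \<cdot> e a = d a \<cdot> t" if "a \<in> I" for a
    unfolding e_def using idem_slide[OF d_idem, of a t] that by simp
  have et: "Rst C t \<cdot> e a = e a" if "a \<in> I" for a
    unfolding e_def using that rst_absorb(2)[of t "d a"] by simp
  have ptd: "p \<cdot> d a \<cdot> t = e a" if "a \<in> I" for a
    using te[OF that, symmetric] et that by simp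
  have se: "t \<cdot> e a = s a \<cdot> e a" if a: "a \<in> I" for a
    using spd_assoc[of a t] ptd[OF a] te[OF a] a by simp
  \<comment> \<open>The image of \<open>t\<close> inside the sheet \<open>d a\<close>.\<close>
  define D where "D a = Rst C (e a \<cdot> p \<cdot> d a)" for a
  have D [simp]: "D a \<in> Mor C" "Dom (D a) = Dom p" "Cod (D a) = Dom p" "D a \<in> rst_idem C (Dom p)"
    "Rst C (D a) = D a" if "a \<in> I" for a
    using that by (simp_all add: D_def)
  have dD: "d a \<cdot> D a = D a" if a: "a \<in> I" for a
    unfolding D_def using rst_absorb(2)[of "d a" "e a \<cdot> p"] a by simp
  have pD: "p \<cdot> D a = e a \<cdot> p \<cdot> d a" if a: "a \<in> I" for a
  proof -
    have "e a \<cdot> p \<cdot> d a = (p \<cdot> d a) \<cdot> D a"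
      unfolding D_def by (rule idem_slide[where A = "Cod p"]) (use a in simp_all)
    then show ?thesis using dD a by simp
  qed
  have epD: "e a \<cdot> p \<cdot> D a = p \<cdot> D a" if a: "a \<in> I" for a
  proof -
    have "e a \<cdot> e a \<cdot> p \<cdot> d a = e a \<cdot> p \<cdot> d a"
      by (rule idem_idem_assoc[of "e a" "Cod p"]) (use a in simp_all)
    then show ?thesis using pD a by simp
  qed
  have tpD: "t \<cdot> p \<cdot> D a = D a" if a: "a \<in> I" for a
  proof -
    have "t \<cdot> p \<cdot> D a = (t \<cdot> e a) \<cdot> p \<cdot> D a" using epD[OF a] a by simp
    also have "... = s a \<cdot> p \<cdot> d a \<cdot> D a" unfolding se[OF a] using epD[OF a] dD[OF a] a by simp
    also have "... = D a" using spd_assoc[of a "D a"] dD[OF a] a by simp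
    finally show ?thesis .
  qed
  have "D ` I \<subseteq> Hom C (Dom p) (Dom p)" "Idt C (Dom p) \<in> Hom C (Dom p) (Dom p)" by (auto simp: Hom_def)
  moreover have "rle C f (Idt C (Dom p))" if f: "f \<in> D ` I" for f
  proof -
    obtain a where "a \<in> I" "f = D a" using f by auto
    then show ?thesis by (intro rleI) simp_all
  qed
  ultimately have "\<exists>E. is_join C (Dom p) (Dom p) (D ` I) E" by (rule bounded_join)
  then obtain E where E: "is_join C (Dom p) (Dom p) (D ` I) E" ..
  have Ei: "E \<in> rst_idem C (Dom p)" by (rule join_idem[OF E]) auto
  note E' [simp] = rst_idem_simps[OF Ei]
  have ED: "E \<cdot> D a = D a" if a: "a \<in> I" for a
    using rleD(5)[OF is_joinD(5)[OF E, of "D a"]] a by simp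
  have "(t \<cdot> p) \<cdot> E = Idt C (Dom p) \<cdot> E"
  proof (rule join_eq[OF E])
    fix f assume "f \<in> D ` I"
    then obtain a where "a \<in> I" "f = D a" by auto
    then show "(t \<cdot> p) \<cdot> f = Idt C (Dom p) \<cdot> f" using tpD by simp
  qed (simp_all add: Hom_def)
  then have 1: "t \<cdot> p \<cdot> E = E" by simp
  have Dt: "D a \<cdot> t = t \<cdot> e a" if a: "a \<in> I" for a
  proof -
    have "D a \<cdot> t = t \<cdot> Rst C ((e a \<cdot> p \<cdot> d a) \<cdot> t)"
      unfolding D_def using a by (subst rst_slide) simp_all
    also have "(e a \<cdot> p \<cdot> d a) \<cdot> t = e a \<cdot> e a" using ptd a by simp
    also have "... = e a" using a by (intro rst_idem_simps(5)[where A = "Cod p"]) simp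
    finally show ?thesis using a by simp
  qed
  have 2: "E \<cdot> t = t"
  proof -
    have jt: "is_join C (Cod p) (Dom p) ((\<lambda>f. f \<cdot> t) ` d ` I) (Idt C (Dom p) \<cdot> t)"
      by (rule is_join_precomp[OF join_d]) (simp add: Hom_def)
    have "E \<cdot> (Idt C (Dom p) \<cdot> t) = Idt C (Dom p) \<cdot> (Idt C (Dom p) \<cdot> t)"
    proof (rule join_eq[OF jt])
      fix f assume "f \<in> (\<lambda>f. f \<cdot> t) ` d ` I"
      then obtain a where a: "a \<in> I" "f = D a \<cdot> t" using Dt te by auto
      then show "E \<cdot> f = Idt C (Dom p) \<cdot> f" using cmp_right[OF ED[OF a(1)], of t] by simp
    qed (auto simp: Hom_def)
    then show ?thesis by simp
  qed
  have "Rst C (p \<cdot> E) = E" using rst_cmp_total[of E p] by simp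
  then have "partial_inverse C t (p \<cdot> E)"
    using 1 2 by (intro partial_inverseI) simp_all
  then show ?thesis using Ei 1 2 by blast
qed

text \<open>Each section in the enlarged family has an image by \<open>cover_any_section\<close>,
  and for a section already present this image is the old sheet, so the images still join to the
  identity. This serves to pass from some cover of a source map to the canonical one by all maps of
  \<open>Phi_cat\<close>.\<close>

lemma cover_extend:
  assumes c: "cover C p I s" and t: "\<And>b. b \<in> J \<Longrightarrow> partial_section C p (t b)"
    and sub: "\<And>a. a \<in> I \<Longrightarrow> \<exists>b \<in> J. t b = s a"
  shows "cover C p J t"
proof -
  obtain d where d: "\<And>a. a \<in> I \<Longrightarrow> d a \<in> rst_idem C (Dom p)" "\<And>a. a \<in> I \<Longrightarrow> s a \<cdot> p \<cdot> d a = d a"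
      "\<And>a. a \<in> I \<Longrightarrow> d a \<cdot> s a = s a"
      "is_join C (Dom p) (Dom p) (d ` I) (Idt C (Dom p))"
    using c by (auto simp: cover_def)
  note p [simp] = cover_total[OF c]
  obtain e where e: "\<And>b. b \<in> J \<Longrightarrow> e b \<in> rst_idem C (Dom p)" "\<And>b. b \<in> J \<Longrightarrow> t b \<cdot> p \<cdot> e b = e b"
      "\<And>b. b \<in> J \<Longrightarrow> e b \<cdot> t b = t b"
    using cover_any_section[OF c t] by metis
  \<comment> \<open>The image is determined by the section: each of the two idempotents fixes the
    section and therefore contains the other.\<close>
  have de: "e b = d a" if a: "a \<in> I" "b \<in> J" "t b = s a" for a b
  proof -
    note [simp] = rst_idem_simps[OF d(1)[OF a(1)]] rst_idem_simps[OF e(1)[OF a(2)]]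
      partial_sectionD(1-3)[OF t[OF a(2)] p(1)] partial_sectionD(1-3)[OF cover_section[OF c a(1)] p(1)]
    have "e b \<cdot> d a = (e b \<cdot> t b) \<cdot> p \<cdot> d a" using d(2)[OF a(1)] a(3)
      by (metis assoc mor_cmp dom_cmp cod_cmp p(1) \<open>d a \<in> Mor C\<close> \<open>e b \<in> Mor C\<close> \<open>t b \<in> Mor C\<close> \<open>Cod (d a) = Dom p\<close>
        \<open>Dom (e b) = Dom p\<close> \<open>Dom (t b) = Cod p\<close> \<open>Cod (t b) = Dom p\<close>)
    also have "... = d a" using e(3)[OF a(2)] d(2)[OF a(1)] a(3) by simp
    finally have 1: "e b \<cdot> d a = d a" .
    have "d a \<cdot> e b = (d a \<cdot> s a) \<cdot> p \<cdot> e b" using e(2)[OF a(2)] a(3)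
      by (metis assoc mor_cmp dom_cmp cod_cmp p(1) \<open>d a \<in> Mor C\<close> \<open>e b \<in> Mor C\<close> \<open>t b \<in> Mor C\<close> \<open>Cod (e b) = Dom p\<close>
        \<open>Dom (d a) = Dom p\<close> \<open>Dom (t b) = Cod p\<close> \<open>Cod (t b) = Dom p\<close>)
    also have "... = e b" using d(3)[OF a(1)] e(2)[OF a(2)] a(3) by simp
    finally show ?thesis using 1 idem_comm[OF d(1)[OF a(1)] e(1)[OF a(2)]] by simp
  qed
  show ?thesis
  proof (rule coverI[of p J t e])
    have e': "e b \<in> Mor C" "Dom (e b) = Dom p" "Cod (e b) = Dom p" "Rst C (e b) = e b" if "b \<in> J" for b
      using e(1)[OF that] by simp_all
    show "is_join C (Dom p) (Dom p) (e ` J) (Idt C (Dom p))"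
      unfolding is_join_def
    proof (intro conjI ballI impI)
      show "e ` J \<subseteq> Hom C (Dom p) (Dom p)" using e' by (auto simp: Hom_def)
      show "rle C f (Idt C (Dom p))" if f: "f \<in> e ` J" for f
      proof -
        obtain b where "b \<in> J" "f = e b" using f by auto
        then show ?thesis using e' by (intro rleI) simp_all
      qed
      fix k assume k: "k \<in> Hom C (Dom p) (Dom p)" "\<forall>f\<in>e ` J. rle C f k"
      have "rle C f k" if f: "f \<in> d ` I" for f
      proof -
        obtain a where a: "a \<in> I" "f = d a" using f by auto
        then obtain b where b: "b \<in> J" "t b = s a" using sub by blast
        show ?thesis using k(2) b(1) unfolding a(2) de[OF a(1) b, symmetric] by simp
      qed
      then show "rle C (Idt C (Dom p)) k" using is_joinD(6)[OF d(4) k(1)] by blast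
    qed (simp add: Hom_def)
  qed (use e partial_sectionD[OF t p(1)] p in auto)
qed

text \<open>The sheet of \<open>t b \<cdot> s a\<close> is the part of the sheet \<open>f b\<close>
  that \<open>r\<close> sends into the sheet \<open>d a\<close>. That these join to the identity is
  seen by joining over \<open>b\<close> for fixed \<open>a\<close>, and then over
  \<open>a\<close>.\<close>

lemma cover_cmp:
  assumes c: "cover C p I s" and r: "cover C r J t" and rp: "Cod r = Dom p"
  shows "cover C (p \<cdot> r) (I \<times> J) (\<lambda>(a, b). t b \<cdot> s a)"
proof -
  obtain d where "covering C p I s d" using c by (rule coverE)
  then interpret covering C p I s d .
  obtain f where "covering C r J t f" using r by (rule coverE)
  then interpret R: covering C r J t f .
  note [simp] = rp
  let ?g = "\<lambda>(a, b). f b \<cdot> Rst C (d a \<cdot> r)"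
  show ?thesis
  proof (rule coverI[of "p \<cdot> r" _ _ ?g])
    show "Rst C (p \<cdot> r) = Idt C (Dom (p \<cdot> r))" using rst_cmp_total[of r p] by simp
    fix x assume "x \<in> I \<times> J"
    then obtain a b where x: "x = (a, b)" and a: "a \<in> I" and b: "b \<in> J" by auto
    note [simp] = a b
    have "p \<cdot> r \<cdot> t b \<cdot> s a = p \<cdot> s a \<cdot> Rst C (t b \<cdot> s a)"
      using R.s_simps(5)[of b "s a"] rst_slide[of "s a" "t b"] by simp
    also have "... = Rst C (t b \<cdot> s a)"
      using s_simps(5)[of a "Rst C (t b \<cdot> s a)"] rst_absorb(2)[of "s a" "t b"] by simp
    finally have 1: "p \<cdot> r \<cdot> t b \<cdot> s a = Rst C (t b \<cdot> s a)" .
    then show "(case x of (a, b) \<Rightarrow> t b \<cdot> s a) \<in> Mor C \<and> Dom (case x of (a, b) \<Rightarrow> t b \<cdot> s a) = Cod (p \<cdot> r) \<and>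
        Cod (case x of (a, b) \<Rightarrow> t b \<cdot> s a) = Dom (p \<cdot> r) \<and>
        (p \<cdot> r) \<cdot> (case x of (a, b) \<Rightarrow> t b \<cdot> s a) = Rst C (case x of (a, b) \<Rightarrow> t b \<cdot> s a)"
      by (simp add: x)
    have gi: "f b \<cdot> Rst C (d a \<cdot> r) \<in> rst_idem C (Dom r)"
      by (intro idem_cmp R.d_idem) simp_all
    have com: "f b \<cdot> Rst C (d a \<cdot> r) = Rst C (d a \<cdot> r) \<cdot> f b"
      by (rule idem_comm[OF R.d_idem]) simp_all
    have sl: "d a \<cdot> r = r \<cdot> Rst C (d a \<cdot> r)" using idem_slide[OF d_idem, of a r] by simp
    have "t b \<cdot> s a \<cdot> p \<cdot> r \<cdot> f b \<cdot> Rst C (d a \<cdot> r) = t b \<cdot> s a \<cdot> p \<cdot> r \<cdot> Rst C (d a \<cdot> r) \<cdot> f b"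
      using com by simp
    also have "... = t b \<cdot> s a \<cdot> p \<cdot> (r \<cdot> Rst C (d a \<cdot> r)) \<cdot> f b" by simp
    also have "... = t b \<cdot> s a \<cdot> p \<cdot> d a \<cdot> r \<cdot> f b" unfolding sl[symmetric] by simp
    also have "... = t b \<cdot> (d a \<cdot> r) \<cdot> f b" using spd_assoc[of a "r \<cdot> f b"] by simp
    also have "... = t b \<cdot> (r \<cdot> Rst C (d a \<cdot> r)) \<cdot> f b" using sl by simp
    also have "... = t b \<cdot> r \<cdot> f b \<cdot> Rst C (d a \<cdot> r)" using com by simp
    also have "... = f b \<cdot> Rst C (d a \<cdot> r)" using R.spd_assoc[of b "Rst C (d a \<cdot> r)"] by simp
    finally have 2: "t b \<cdot> s a \<cdot> p \<cdot> r \<cdot> f b \<cdot> Rst C (d a \<cdot> r) = f b \<cdot> Rst C (d a \<cdot> r)" .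
    have "Rst C (d a \<cdot> r) \<cdot> t b = t b \<cdot> Rst C ((d a \<cdot> r) \<cdot> t b)" by (subst rst_slide) simp_all
    also have "(d a \<cdot> r) \<cdot> t b = d a \<cdot> Rst C (t b)" by simp
    also have "Rst C \<dots> = d a \<cdot> Rst C (t b)" by simp
    also have "... = Rst C (t b) \<cdot> d a" by (rule idem_comm[OF d_idem]) simp_all
    finally have tb: "Rst C (d a \<cdot> r) \<cdot> t b = t b \<cdot> d a" by simp
    have "Rst C (d a \<cdot> r) \<cdot> t b \<cdot> s a = (Rst C (d a \<cdot> r) \<cdot> t b) \<cdot> s a" by simp
    also have "... = t b \<cdot> s a" unfolding tb by simp
    finally have 3: "f b \<cdot> Rst C (d a \<cdot> r) \<cdot> t b \<cdot> s a = t b \<cdot> s a" using R.ds_assoc[of b "s a"] by simp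
    show "?g x \<in> rst_idem C (Dom (p \<cdot> r)) \<and>
       (case x of (a, b) \<Rightarrow> t b \<cdot> s a) \<cdot> (p \<cdot> r) \<cdot> ?g x = ?g x \<and>
       ?g x \<cdot> (case x of (a, b) \<Rightarrow> t b \<cdot> s a) = (case x of (a, b) \<Rightarrow> t b \<cdot> s a)"
      using gi 2 3 by (simp add: x)
  next
    have "is_join C (Dom r) (Dom r) (?g ` (I \<times> J)) (Idt C (Dom r))"
      unfolding is_join_def
    proof (intro conjI ballI impI)
      show "?g ` (I \<times> J) \<subseteq> Hom C (Dom r) (Dom r)" by (auto simp: Hom_def)
      have gi: "f b \<cdot> Rst C (d a \<cdot> r) \<in> rst_idem C (Dom r)" if "a \<in> I" "b \<in> J" for a b
        using that by (intro idem_cmp R.d_idem) simp_all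
      show "rle C h (Idt C (Dom r))" if "h \<in> ?g ` (I \<times> J)" for h
      proof -
        obtain a b where h: "a \<in> I" "b \<in> J" "h = f b \<cdot> Rst C (d a \<cdot> r)" using \<open>h \<in> _\<close> by auto
        note [simp] = rst_idem_simps[OF gi[OF h(1,2)], folded h(3)]
        show ?thesis by (rule rleI) simp_all
      qed
      fix k assume k: "k \<in> Hom C (Dom r) (Dom r)" "\<forall>h\<in>?g ` (I \<times> J). rle C h k"
      have le: "rle C (Rst C (d a \<cdot> r)) k" if a: "a \<in> I" for a
      proof -
        have "is_join C (Dom r) (Dom r) ((\<lambda>h. h \<cdot> Rst C (d a \<cdot> r)) ` f ` J) (Idt C (Dom r) \<cdot> Rst C (d a \<cdot> r))"
          by (rule is_join_precomp[OF R.join_d]) (use a in \<open>simp add: Hom_def\<close>)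
        from is_joinD(6)[OF this k(1)] show ?thesis using k(2) a by (force simp: image_image)
      qed
      have "is_join C (Dom r) (Dom p) ((\<lambda>h. h \<cdot> r) ` d ` I) (Idt C (Dom p) \<cdot> r)"
        by (rule is_join_precomp[OF join_d]) (simp add: Hom_def)
      from is_joinD(6)[OF join_rst[OF this] k(1)] show "rle C (Idt C (Dom r)) k" using le by auto
    qed (simp add: Hom_def)
    then show "is_join C (Dom (p \<cdot> r)) (Dom (p \<cdot> r)) (?g ` (I \<times> J)) (Idt C (Dom (p \<cdot> r)))" by simp
  qed simp
qed

end

section \<open>Pullbacks\<close>

text \<open>Both legs are required to be total; then the projections are total too, and a pairing
  has the domain of either of its components.\<close>

definition has_pb :: "('o, 'm) rcat \<Rightarrow> ('o, 'm) arr \<Rightarrow> ('o, 'm) arr \<Rightarrow> bool" where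
  "has_pb C f g \<longleftrightarrow> total_map C f \<and> total_map C g \<and> (\<exists>p q. is_pullback C f g p q)"

context category
begin

lemma cmp_rw:
  "h \<cdot> g = k \<Longrightarrow> f \<in> Mor C \<Longrightarrow> g \<in> Mor C \<Longrightarrow> h \<in> Mor C \<Longrightarrow> Cod g = Dom h \<Longrightarrow> Cod f = Dom g \<Longrightarrow>
    h \<cdot> g \<cdot> f = k \<cdot> f"
  using assoc[of f g h] by simp

end

context join_restriction_category
begin

lemma pb_is_pullback: "has_pb C f g \<Longrightarrow> is_pullback C f g (pb1 C f g) (pb2 C f g)"
proof -
  assume "has_pb C f g"
  then obtain pq where "is_pullback C f g (fst pq) (snd pq)" by (auto simp: has_pb_def)
  then show ?thesis unfolding pb1_def pb2_def chosen_pullback_def by (rule someI)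
qed

lemma has_pbD:
  assumes "has_pb C f g"
  shows "f \<in> Mor C" "Rst C f = Idt C (Dom f)" "g \<in> Mor C" "Rst C g = Idt C (Dom g)" "Cod f = Cod g"
  using assms pb_is_pullback[OF assms] by (auto simp: has_pb_def total_iff is_pullback_def)

lemma pb_simps [simp]:
  assumes "has_pb C f g"
  shows "pb1 C f g \<in> Mor C" "pb2 C f g \<in> Mor C" "Dom (pb1 C f g) = pbo C f g" "Dom (pb2 C f g) = pbo C f g"
    "Cod (pb1 C f g) = Dom f" "Cod (pb2 C f g) = Dom g" "pbo C f g \<in> Ob C"
  using pb_is_pullback[OF assms] dom_ob[of "pb1 C f g"] by (auto simp: is_pullback_def Hom_def pbo_def)

lemma pb_commutes: "has_pb C f g \<Longrightarrow> f \<cdot> pb1 C f g = g \<cdot> pb2 C f g"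
  using pb_is_pullback[of f g] by (simp add: is_pullback_def)

lemma pb_ex1:
  assumes "has_pb C f g" "u \<in> Mor C" "v \<in> Mor C" "Dom u = Dom v" "Cod u = Dom f" "Cod v = Dom g" "f \<cdot> u = g \<cdot> v"
  shows "\<exists>!w. w \<in> Hom C (Dom u) (pbo C f g) \<and> pb1 C f g \<cdot> w = u \<and> pb2 C f g \<cdot> w = v"
proof -
  have "\<forall>Z. \<forall>u \<in> Hom C Z (Dom f). \<forall>v \<in> Hom C Z (Dom g). f \<cdot> u = g \<cdot> v \<longrightarrow>
      (\<exists>!w. w \<in> Hom C Z (pbo C f g) \<and> pb1 C f g \<cdot> w = u \<and> pb2 C f g \<cdot> w = v)"
    using pb_is_pullback[OF assms(1)] unfolding is_pullback_def pbo_def by blast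
  moreover have "u \<in> Hom C (Dom u) (Dom f)" "v \<in> Hom C (Dom u) (Dom g)" using assms by (auto simp: Hom_def)
  ultimately show ?thesis using assms(7) by blast
qed

lemma pair_props:
  assumes "has_pb C f g" "u \<in> Mor C" "v \<in> Mor C" "Dom u = Dom v" "Cod u = Dom f" "Cod v = Dom g" "f \<cdot> u = g \<cdot> v"
  shows "pair C f g u v \<in> Mor C" "Dom (pair C f g u v) = Dom u" "Cod (pair C f g u v) = pbo C f g"
    "pb1 C f g \<cdot> pair C f g u v = u" "pb2 C f g \<cdot> pair C f g u v = v"
  using theI'[OF pb_ex1[OF assms]] unfolding pair_def[symmetric] by (auto simp: Hom_def)

lemma pair_unique:
  assumes pb: "has_pb C f g" and w: "w \<in> Mor C" "Cod w = pbo C f g"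
    and uv: "pb1 C f g \<cdot> w = u" "pb2 C f g \<cdot> w = v"
  shows "w = pair C f g u v"
proof -
  have D: "Dom u = Dom w" "u \<in> Mor C" "v \<in> Mor C" "Dom v = Dom w" "Cod u = Dom f" "Cod v = Dom g"
    using pb w uv by auto
  have "f \<cdot> u = (f \<cdot> pb1 C f g) \<cdot> w" using pb w has_pbD(1)[OF pb] unfolding uv(1)[symmetric] by simp
  also have "... = g \<cdot> v" using pb w has_pbD(3)[OF pb] unfolding uv(2)[symmetric] pb_commutes[OF pb] by simp
  finally have eq: "f \<cdot> u = g \<cdot> v" .
  have "\<exists>!w. w \<in> Hom C (Dom u) (pbo C f g) \<and> pb1 C f g \<cdot> w = u \<and> pb2 C f g \<cdot> w = v"
    by (rule pb_ex1[OF pb]) (use D eq in auto)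
  moreover have "w \<in> Hom C (Dom u) (pbo C f g) \<and> pb1 C f g \<cdot> w = u \<and> pb2 C f g \<cdot> w = v"
    using w D uv by (simp add: Hom_def)
  ultimately show ?thesis unfolding pair_def by (rule the1_equality[symmetric])
qed

lemma pb_jointly_monic:
  assumes pb: "has_pb C f g" and w: "w \<in> Mor C" "Cod w = pbo C f g" "w' \<in> Mor C" "Cod w' = pbo C f g"
    and "pb1 C f g \<cdot> w = pb1 C f g \<cdot> w'" "pb2 C f g \<cdot> w = pb2 C f g \<cdot> w'"
  shows "w = w'"
  using pair_unique[OF pb w(1,2) refl refl] pair_unique[OF pb w(3,4) refl refl] assms(6,7) by simp

lemma pair_pb [simp]: "has_pb C f g \<Longrightarrow> pair C f g (pb1 C f g) (pb2 C f g) = Idt C (pbo C f g)"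
  by (rule pair_unique[symmetric]) auto

lemma pair_cmp:
  assumes pb: "has_pb C f g" and u: "u \<in> Mor C" "v \<in> Mor C" "Dom u = Dom v" "Cod u = Dom f" "Cod v = Dom g" "f \<cdot> u = g \<cdot> v"
    and w: "w \<in> Mor C" "Cod w = Dom u"
  shows "pair C f g u v \<cdot> w = pair C f g (u \<cdot> w) (v \<cdot> w)"
proof (rule pair_unique[OF pb])
  note P = pair_props[OF pb u]
  show "pb1 C f g \<cdot> pair C f g u v \<cdot> w = u \<cdot> w"
    using cmp_rw[OF P(4), of w] P(1-3) pb u w by simp
  show "pb2 C f g \<cdot> pair C f g u v \<cdot> w = v \<cdot> w"
    using cmp_rw[OF P(5), of w] P(1-3) pb u w by simp
qed (use pair_props[OF pb u] w in auto)

text \<open>Since the legs are total, both projections have the same restriction. Precomposing with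
  it changes neither projection, so it is the identity by joint monicity.\<close>

lemma pb_total:
  assumes pb: "has_pb C f g"
  shows "Rst C (pb1 C f g) = Idt C (pbo C f g)" "Rst C (pb2 C f g) = Idt C (pbo C f g)"
proof -
  note H = has_pbD[OF pb]
  have "Rst C (pb1 C f g) = Rst C (f \<cdot> pb1 C f g)" using rst_cmp_total[of "pb1 C f g" f] H pb by simp
  also have "... = Rst C (pb2 C f g)" using rst_cmp_total[of "pb2 C f g" g] H pb pb_commutes[OF pb] by simp
  finally have eq: "Rst C (pb1 C f g) = Rst C (pb2 C f g)" .
  have "Rst C (pb1 C f g) = Idt C (pbo C f g)"
  proof (rule pb_jointly_monic[OF pb])
    show "pb2 C f g \<cdot> Rst C (pb1 C f g) = pb2 C f g \<cdot> Idt C (pbo C f g)" unfolding eq using pb by simp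
  qed (use pb in simp_all)
  then show "Rst C (pb1 C f g) = Idt C (pbo C f g)" "Rst C (pb2 C f g) = Idt C (pbo C f g)" using eq by auto
qed

lemma rst_pair:
  assumes pb: "has_pb C f g" and u: "u \<in> Mor C" "v \<in> Mor C" "Dom u = Dom v" "Cod u = Dom f" "Cod v = Dom g" "f \<cdot> u = g \<cdot> v"
  shows "Rst C (pair C f g u v) = Rst C v"
  using rst_cmp_total[of "pair C f g u v" "pb2 C f g"] pair_props[OF pb u] pb_total[OF pb] pb by simp

lemma pull_section_eq:
  assumes pb: "has_pb C p g" and s: "partial_section C p s"
  shows "p \<cdot> s \<cdot> g = g \<cdot> Rst C (s \<cdot> g)"
  using partial_sectionD[OF s] has_pbD[OF pb] rst_slide[of g s] by simp

text \<open>The pulled back section is defined where \<open>s \<cdot> g\<close> is, so its second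
  component is the restriction of that composite. The last fact gives its value at a generalised
  point \<open>x\<close>; the pairing there is the one in \<open>scomp\<close>.\<close>

lemma pull_section_props:
  assumes pb: "has_pb C p g" and s: "partial_section C p s"
  shows "pull_section C p g s \<in> Mor C" "Dom (pull_section C p g s) = Dom g"
    "Cod (pull_section C p g s) = pbo C p g"
    "pb1 C p g \<cdot> pull_section C p g s = s \<cdot> g" "pb2 C p g \<cdot> pull_section C p g s = Rst C (s \<cdot> g)"
    "Rst C (pull_section C p g s) = Rst C (s \<cdot> g)"
    "x \<in> Mor C \<Longrightarrow> Cod x = Dom g \<Longrightarrow> pull_section C p g s \<cdot> x = pair C p g (s \<cdot> g \<cdot> x) (x \<cdot> Rst C (s \<cdot> g \<cdot> x))"
proof -
  note [simp] = has_pbD[OF pb] partial_sectionD(1-4)[OF s]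
  have *: "s \<cdot> g \<in> Mor C" "Rst C (s \<cdot> g) \<in> Mor C" "Dom (s \<cdot> g) = Dom (Rst C (s \<cdot> g))"
      "Cod (s \<cdot> g) = Dom p" "Cod (Rst C (s \<cdot> g)) = Dom g" "p \<cdot> (s \<cdot> g) = g \<cdot> Rst C (s \<cdot> g)"
    using pull_section_eq[OF pb s] by simp_all
  note P = pair_props[OF pb *, folded pull_section_def]
  show "pull_section C p g s \<in> Mor C" "Dom (pull_section C p g s) = Dom g"
    "Cod (pull_section C p g s) = pbo C p g"
    "pb1 C p g \<cdot> pull_section C p g s = s \<cdot> g" "pb2 C p g \<cdot> pull_section C p g s = Rst C (s \<cdot> g)"
    using P by simp_all
  show "Rst C (pull_section C p g s) = Rst C (s \<cdot> g)"
    using rst_pair[OF pb *, folded pull_section_def] by simp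
  show "pull_section C p g s \<cdot> x = pair C p g (s \<cdot> g \<cdot> x) (x \<cdot> Rst C (s \<cdot> g \<cdot> x))"
    if "x \<in> Mor C" "Cod x = Dom g"
    using pair_cmp[OF pb *, folded pull_section_def, of x] that rst_slide[of x "s \<cdot> g"] by simp
qed

text \<open>The new sheets are the inverse images \<open>Rst C (d a \<cdot> pb1 C p g)\<close> of
  the old ones along the first projection.\<close>

lemma cover_pullback:
  assumes c: "cover C p I s" and pb: "has_pb C p g"
  shows "cover C (pb2 C p g) I (\<lambda>a. pull_section C p g (s a))"
proof -
  obtain d where "covering C p I s d" using c by (rule coverE)
  then interpret covering C p I s d .
  note [simp] = has_pbD[OF pb] pb_simps[OF pb] pb_total[OF pb]
  note P [simp] = pull_section_props(1-6)[OF pb sec]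
  have com: "p \<cdot> pb1 C p g = g \<cdot> pb2 C p g" by (rule pb_commutes[OF pb])
  have comx: "g \<cdot> pb2 C p g \<cdot> x = p \<cdot> pb1 C p g \<cdot> x" if "x \<in> Mor C" "Cod x = pbo C p g" for x
    using cmp_rw[OF com, of x] that by simp
  let ?d = "\<lambda>a. Rst C (d a \<cdot> pb1 C p g)"
  have dp: "d a \<cdot> pb1 C p g = pb1 C p g \<cdot> ?d a" if "a \<in> I" for a
    using idem_slide[OF d_idem, of a "pb1 C p g"] that by simp
  show ?thesis
  proof (rule coverI[of _ I _ ?d])
    fix a assume a: "a \<in> I"
    have "Rst C (s a \<cdot> g) \<in> rst_idem C (Dom g)" using a by simp
    show "pull_section C p g (s a) \<in> Mor C \<and> Dom (pull_section C p g (s a)) = Cod (pb2 C p g) \<and>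
        Cod (pull_section C p g (s a)) = Dom (pb2 C p g) \<and>
        pb2 C p g \<cdot> pull_section C p g (s a) = Rst C (pull_section C p g (s a))"
      using a by simp
    have r: "?d a = Rst C (s a \<cdot> g \<cdot> pb2 C p g \<cdot> ?d a)"
    proof -
      have "s a \<cdot> g \<cdot> pb2 C p g \<cdot> ?d a = s a \<cdot> p \<cdot> d a \<cdot> pb1 C p g" using comx a dp by simp
      then show ?thesis using a by simp
    qed
    have "pull_section C p g (s a) \<cdot> pb2 C p g \<cdot> ?d a = ?d a"
    proof (rule pb_jointly_monic[OF pb])
      have "pb1 C p g \<cdot> pull_section C p g (s a) \<cdot> pb2 C p g \<cdot> ?d a = s a \<cdot> g \<cdot> pb2 C p g \<cdot> ?d a"
        using cmp_rw[OF P(4)[OF a], of "pb2 C p g \<cdot> ?d a"] a by simp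
      also have "... = pb1 C p g \<cdot> ?d a" using comx a dp[symmetric] by simp
      finally show "pb1 C p g \<cdot> pull_section C p g (s a) \<cdot> pb2 C p g \<cdot> ?d a = pb1 C p g \<cdot> ?d a" .
      have "pb2 C p g \<cdot> pull_section C p g (s a) \<cdot> pb2 C p g \<cdot> ?d a = Rst C (s a \<cdot> g) \<cdot> pb2 C p g \<cdot> ?d a"
        using cmp_rw[OF P(5)[OF a], of "pb2 C p g \<cdot> ?d a"] a by simp
      also have "... = (pb2 C p g \<cdot> ?d a) \<cdot> Rst C (s a \<cdot> g \<cdot> pb2 C p g \<cdot> ?d a)"
        using rst_slide[of "pb2 C p g \<cdot> ?d a" "s a \<cdot> g"] a by simp
      also have "... = (pb2 C p g \<cdot> ?d a) \<cdot> ?d a" using r by simp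
      also have "... = pb2 C p g \<cdot> ?d a" using a by simp
      finally show "pb2 C p g \<cdot> pull_section C p g (s a) \<cdot> pb2 C p g \<cdot> ?d a = pb2 C p g \<cdot> ?d a" .
    qed (use a in simp_all)
    moreover have "?d a \<cdot> pull_section C p g (s a) = pull_section C p g (s a)"
    proof -
      have "?d a \<cdot> pull_section C p g (s a) =
          pull_section C p g (s a) \<cdot> Rst C ((d a \<cdot> pb1 C p g) \<cdot> pull_section C p g (s a))"
        by (rule rst_slide) (use a in simp_all)
      also have "(d a \<cdot> pb1 C p g) \<cdot> pull_section C p g (s a) = s a \<cdot> g" using a by simp
      also have "Rst C (s a \<cdot> g) = Rst C (pull_section C p g (s a))" using a by simp
      finally show ?thesis using a by (simp del: P(6))
    qed
    ultimately show "?d a \<in> rst_idem C (Dom (pb2 C p g)) \<and>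
        pull_section C p g (s a) \<cdot> pb2 C p g \<cdot> ?d a = ?d a \<and> ?d a \<cdot> pull_section C p g (s a) = pull_section C p g (s a)"
      using a by simp
  next
    have "is_join C (pbo C p g) (Dom p) ((\<lambda>h. h \<cdot> pb1 C p g) ` d ` I) (Idt C (Dom p) \<cdot> pb1 C p g)"
      by (rule is_join_precomp[OF join_d]) (simp add: Hom_def)
    from join_rst[OF this] show "is_join C (Dom (pb2 C p g)) (Dom (pb2 C p g)) (?d ` I) (Idt C (Dom (pb2 C p g)))"
      by (simp add: image_image)
  qed simp_all
qed

text \<open>Local glueings are given for index sets consisting of labels; an atlas indexed by
  another type is moved along an injection into labels. For hom-sets, taking the label is such an
  injection.\<close>

lemma small_glueing:
  fixes I :: "'a set" and \<kappa> :: "'k rel"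
  assumes G: "has_local_glueings \<kappa> C" and I: "small \<kappa> I" "inj_on (l :: 'a \<Rightarrow> 'm) I"
    and \<phi>: "local_atlas C X I \<phi>"
  shows "\<exists>p q s. glueing C X I \<phi> p q s"
proof -
  let ?i = "inv_into I l"
  have inv: "?i (l a) = a" if "a \<in> I" for a using I(2) that by simp
  have "small \<kappa> (l ` I)"
    using I(1) unfolding small_def using card_of_image ordLeq_ordLess_trans by blast
  moreover have "local_atlas C X (l ` I) (\<lambda>m n. \<phi> (?i m) (?i n))"
    using \<phi> inv by (auto simp: local_atlas_def)
  ultimately obtain p q s where g: "glueing C X (l ` I) (\<lambda>m n. \<phi> (?i m) (?i n)) p q s"
    using G unfolding has_local_glueings_def by blast
  have "glueing C X I \<phi> p (q \<circ> l) (s \<circ> l)"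
    using g inv by (auto simp: glueing_def image_comp)
  then show ?thesis by blast
qed

text \<open>The pullback is a local homeomorphism over \<open>Dom g\<close>, so it is built as a
  glueing in which two sections agree exactly where \<open>s a \<cdot> g\<close> and
  \<open>s b \<cdot> g\<close> do. The glueing map \<open>p'\<close> becomes the second projection;
  the first is the map \<open>k\<close> glued from the \<open>s a \<cdot> g\<close>.\<close>

lemma cover_has_pb:
  fixes I :: "'a set" and \<kappa> :: "'k rel"
  assumes c: "cover C p I s" and G: "has_local_glueings \<kappa> C" and I: "small \<kappa> I" "inj_on (l :: 'a \<Rightarrow> 'm) I"
    and g: "g \<in> Mor C" "Rst C g = Idt C (Dom g)" "Cod g = Cod p"
  shows "has_pb C p g"
proof -
  obtain d where "covering C p I s d" using c by (rule coverE)
  then interpret covering C p I s d .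
  note [simp] = g
  \<comment> \<open>The inverse image along \<open>g\<close> of the part of the base over which
    \<open>s a\<close> and \<open>s b\<close> agree.\<close>
  define \<phi> where "\<phi> a b = Rst C (d b \<cdot> s a \<cdot> g)" for a b
  have dsa: "d b \<cdot> s a = s a \<cdot> Rst C (d b \<cdot> s a)" if "a \<in> I" "b \<in> I" for a b
    using idem_slide[OF d_idem, of b "s a"] that by simp
  have pds: "p \<cdot> d b \<cdot> s a = Rst C (d b \<cdot> s a)" if "a \<in> I" "b \<in> I" for a b
    using dsa[OF that] s_simps(5)[of a "Rst C (d b \<cdot> s a)"] that rst_absorb(2)[of "s a" "d b"] by simp
  have dsb: "s b \<cdot> Rst C (d b \<cdot> s a) = d b \<cdot> s a" if "a \<in> I" "b \<in> I" for a b
    using pds[OF that] spd_assoc[of b "s a"] that by simp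
  have \<phi>1: "s a \<cdot> g \<cdot> \<phi> a b = d b \<cdot> s a \<cdot> g" if "a \<in> I" "b \<in> I" for a b
    unfolding \<phi>_def using idem_slide[OF d_idem, of b "s a \<cdot> g"] that by simp
  have \<phi>2: "s b \<cdot> g \<cdot> \<phi> a b = d b \<cdot> s a \<cdot> g" if "a \<in> I" "b \<in> I" for a b
  proof -
    have "g \<cdot> \<phi> a b = Rst C (d b \<cdot> s a) \<cdot> g" unfolding \<phi>_def using that by (subst rst_slide) simp_all
    then show ?thesis using cmp_rw[OF dsb[OF that], of g] that by simp
  qed
  have [simp]: "\<phi> a b \<in> rst_idem C (Dom g)" if "a \<in> I" "b \<in> I" for a b
    unfolding \<phi>_def using that by simp
  note \<phi>s [simp] = rst_idem_simps[OF this]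
  \<comment> \<open>\<open>\<phi> a b\<close> is maximal among the idempotents in the domain of
    \<open>s a \<cdot> g\<close> on which the two composites agree; symmetry and the cocycle
    inequality of the atlas follow from this.\<close>
  have below: "\<phi> a b \<cdot> e = e"
    if ab: "a \<in> I" "b \<in> I" and e: "e \<in> rst_idem C (Dom g)" "Rst C (s a \<cdot> g) \<cdot> e = e" "s a \<cdot> g \<cdot> e = s b \<cdot> g \<cdot> e" for a b e
  proof -
    note [simp] = rst_idem_simps[OF e(1)]
    have "\<phi> a b \<cdot> e = Rst C (d b \<cdot> s a \<cdot> g \<cdot> e)" unfolding \<phi>_def using ab rst_cmp_idem[of e "d b \<cdot> s a \<cdot> g"] by simp
    also have "... = Rst C (s a \<cdot> g \<cdot> e)" unfolding e(3) using ab by simp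
    also have "... = e" using ab e(2) rst_cmp_idem[of e "s a \<cdot> g"] by simp
    finally show ?thesis .
  qed
  have le1: "Rst C (s a \<cdot> g) \<cdot> \<phi> a b = \<phi> a b" if "a \<in> I" "b \<in> I" for a b
    unfolding \<phi>_def using rst_absorb(2)[of "s a \<cdot> g" "d b"] that by simp
  have sym: "\<phi> a b = \<phi> b a" if ab: "a \<in> I" "b \<in> I" for a b
  proof -
    have *: "\<phi> b a \<cdot> \<phi> a b = \<phi> a b" if ab: "a \<in> I" "b \<in> I" for a b
    proof (rule below)
      have "Rst C (s b \<cdot> g) \<cdot> \<phi> a b = Rst C (s b \<cdot> g \<cdot> \<phi> a b)" using ab rst_cmp_idem[of "\<phi> a b" "s b \<cdot> g"] by simp
      also have "... = \<phi> a b" unfolding \<phi>2[OF ab] by (simp add: \<phi>_def)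
      finally show "Rst C (s b \<cdot> g) \<cdot> \<phi> a b = \<phi> a b" .
      show "s b \<cdot> g \<cdot> \<phi> a b = s a \<cdot> g \<cdot> \<phi> a b" using \<phi>1 \<phi>2 ab by simp
    qed (use ab in simp_all)
    show ?thesis using *[OF ab] *[OF ab(2,1)] idem_comm[of "\<phi> a b" "Dom g" "\<phi> b a"] ab by simp
  qed
  have trans: "rle C (\<phi> b c \<cdot> \<phi> a b) (\<phi> a c)" if abc: "a \<in> I" "b \<in> I" "c \<in> I" for a b c
  proof -
    have i: "\<phi> b c \<cdot> \<phi> a b \<in> rst_idem C (Dom g)" using abc by simp
    have com: "\<phi> b c \<cdot> \<phi> a b = \<phi> a b \<cdot> \<phi> b c" using idem_comm[of "\<phi> b c" "Dom g" "\<phi> a b"] abc by simp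
    have "\<phi> a c \<cdot> \<phi> b c \<cdot> \<phi> a b = \<phi> b c \<cdot> \<phi> a b"
    proof (rule below)
      show "Rst C (s a \<cdot> g) \<cdot> \<phi> b c \<cdot> \<phi> a b = \<phi> b c \<cdot> \<phi> a b"
        unfolding com using cmp_rw[OF le1[OF abc(1,2)], of "\<phi> b c"] abc by simp
      have "s a \<cdot> g \<cdot> \<phi> b c \<cdot> \<phi> a b = (s a \<cdot> g \<cdot> \<phi> a b) \<cdot> \<phi> b c" unfolding com using abc by simp
      also have "... = (s b \<cdot> g \<cdot> \<phi> a b) \<cdot> \<phi> b c" unfolding \<phi>1[OF abc(1,2)] \<phi>2[OF abc(1,2)] ..
      also have "... = (s b \<cdot> g \<cdot> \<phi> b c) \<cdot> \<phi> a b" using com abc by simp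
      also have "... = (s c \<cdot> g \<cdot> \<phi> b c) \<cdot> \<phi> a b" unfolding \<phi>1[OF abc(2,3)] \<phi>2[OF abc(2,3)] ..
      finally show "s a \<cdot> g \<cdot> \<phi> b c \<cdot> \<phi> a b = s c \<cdot> g \<cdot> \<phi> b c \<cdot> \<phi> a b" using abc by simp
    qed (use abc i in simp_all)
    then show ?thesis using rle_idem_iff[OF i, of "\<phi> a c"] abc by simp
  qed
  have atlas: "local_atlas C (Dom g) I \<phi>"
    unfolding local_atlas_def using sym trans by simp
  obtain p' q' s' where gl: "glueing C (Dom g) I \<phi> p' q' s'" using small_glueing[OF G I atlas] by blast
  note gc = glueing_cover[OF gl]
  obtain d' where "covering C p' I s' d'" using gc(1) by (rule coverE)
  then interpret R: covering C p' I s' d' .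
  note [simp] = gc(2)
  have rs': "Rst C (s' a) = Rst C (s a \<cdot> g)" if "a \<in> I" for a using gc(3)[OF that] that by (simp add: \<phi>_def)
  have ag: "(s a \<cdot> g) \<cdot> e = (s b \<cdot> g) \<cdot> e"
    if ab: "a \<in> I" "b \<in> I" and e0: "e \<in> rst_idem C (Cod p')" and e: "Rst C (s' a) \<cdot> e = e" "s' a \<cdot> e = s' b \<cdot> e" for a b e
  proof -
    have e1: "e \<in> rst_idem C (Dom g)" using e0 by simp
    note [simp] = rst_idem_simps[OF e1]
    have *: "e = \<phi> a b \<cdot> e" using gc(5)[OF ab e1 e] by simp
    have "(s a \<cdot> g) \<cdot> e = (s a \<cdot> g \<cdot> \<phi> a b) \<cdot> e" using * ab by simp
    also have "... = (s b \<cdot> g \<cdot> \<phi> a b) \<cdot> e" unfolding \<phi>1[OF ab] \<phi>2[OF ab] ..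
    also have "... = (s b \<cdot> g) \<cdot> e" using * ab by simp
    finally show ?thesis .
  qed
  have sg: "s a \<cdot> g \<in> Hom C (Cod p') (Dom p)" "Rst C (s a \<cdot> g) = Rst C (s' a)" if "a \<in> I" for a
    using that rs' by (simp_all add: Hom_def)
  note glue = cover_glue_unique[OF gc(1), of "\<lambda>a. s a \<cdot> g" "Dom p", OF sg ag dom_ob[OF p_total(1)]]
  have ex: "\<exists>!k. k \<in> Hom C (Dom p') (Dom p) \<and> (\<forall>a \<in> I. k \<cdot> s' a = s a \<cdot> g)"
    by (rule glue(1)) blast+
  \<comment> \<open>The first projection of the pullback.\<close>
  then obtain k where k: "k \<in> Hom C (Dom p') (Dom p)" "\<And>a. a \<in> I \<Longrightarrow> k \<cdot> s' a = s a \<cdot> g" by blast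
  have rk: "Rst C k = Idt C (Dom p')"
    by (rule glue(2)) (assumption | rule k)+
  have km [simp]: "k \<in> Mor C" "Dom k = Dom p'" "Cod k = Dom p" using k(1) by (auto simp: Hom_def)
  note [simp] = k(2) rk
  have ks: "k \<cdot> s' a \<cdot> x = s a \<cdot> g \<cdot> x" if "a \<in> I" "x \<in> Mor C" "Cod x = Dom g" for a x
    using cmp_rw[OF k(2)[OF that(1)], of x] that by (simp del: k(2))
  have pk: "p \<cdot> k = g \<cdot> p'"
  proof (rule cover_eq[OF gc(1), of _ "Cod p"])
    fix a assume a: "a \<in> I"
    have "(p \<cdot> k) \<cdot> s' a = Rst C (s a) \<cdot> g" using a by simp
    also have "... = g \<cdot> Rst C (s a \<cdot> g)" using a by (subst rst_slide) simp_all
    finally show "(p \<cdot> k) \<cdot> s' a = (g \<cdot> p') \<cdot> s' a" using a rs'[OF a] by simp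
  qed (simp_all add: Hom_def)
  have pkx: "p \<cdot> k \<cdot> x = g \<cdot> p' \<cdot> x" if "x \<in> Mor C" "Cod x = Dom p'" for x
    using cmp_rw[OF pk, of x] that by simp
  \<comment> \<open>The sheet of \<open>s' a\<close> is the inverse image along \<open>k\<close> of
    the sheet of \<open>s a\<close>. Uniqueness of factorisations rests on this: wherever
    \<open>u\<close> lies in \<open>d a\<close>, a factorisation lies in \<open>d' a\<close> and so
    has to be \<open>s' a \<cdot> v\<close>.\<close>
  have dk: "d a \<cdot> k = k \<cdot> d' a" if a: "a \<in> I" for a
  proof (rule cover_eq[OF gc(1), of _ "Dom p"])
    fix b assume b: "b \<in> I"
    \<comment> \<open>\<open>s' b\<close> lies in the sheet of \<open>s' a\<close> exactly where the
      two sections agree, that is on \<open>\<phi> b a\<close>.\<close>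
    have e: "Rst C (d' a \<cdot> s' b) = \<phi> b a"
    proof (rule rle_antisym)
      have i: "Rst C (d' a \<cdot> s' b) \<in> rst_idem C (Dom g)" using a b by simp
      have 1: "s' b \<cdot> Rst C (d' a \<cdot> s' b) = d' a \<cdot> s' b"
        using idem_slide[OF R.d_idem, of a "s' b"] a b by simp
      have b1: "Rst C (s' b) \<cdot> Rst C (d' a \<cdot> s' b) = Rst C (d' a \<cdot> s' b)"
        using rst_absorb(2)[of "s' b" "d' a"] a b by simp
      have "p' \<cdot> d' a \<cdot> s' b = Rst C (d' a \<cdot> s' b)"
        using R.s_simps(5)[of b "Rst C (d' a \<cdot> s' b)"] a b 1 b1 by simp
      then have 2: "s' a \<cdot> Rst C (d' a \<cdot> s' b) = d' a \<cdot> s' b"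
        using R.spd_assoc[of a "s' b"] a b by simp
      have "\<phi> b a \<cdot> Rst C (d' a \<cdot> s' b) = Rst C (d' a \<cdot> s' b)"
        by (rule gc(5)) (use a b i b1 1 2 in simp_all)
      then show "rle C (Rst C (d' a \<cdot> s' b)) (\<phi> b a)" using rle_idem_iff[OF i, of "\<phi> b a"] a b by simp
      have "Rst C (d' a \<cdot> s' b) \<cdot> \<phi> b a = Rst C (d' a \<cdot> s' b \<cdot> \<phi> b a)"
        using rst_cmp_idem[of "\<phi> b a" "d' a \<cdot> s' b"] a b by simp
      also have "... = Rst C (s' b \<cdot> \<phi> b a)" using gc(4)[OF b a] a b by simp
      also have "... = \<phi> b a" using rst_cmp_idem[of "\<phi> b a" "s' b"] a b rs' le1 by simp
      finally show "rle C (\<phi> b a) (Rst C (d' a \<cdot> s' b))" using rle_idem_iff[OF _ i, of "\<phi> b a"] a b by simp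
    qed
    have "(k \<cdot> d' a) \<cdot> s' b = k \<cdot> s' b \<cdot> \<phi> b a"
      using idem_slide[OF R.d_idem, of a "s' b"] a b e by simp
    also have "... = (d a \<cdot> k) \<cdot> s' b" using ks a b \<phi>1 by simp
    finally show "(d a \<cdot> k) \<cdot> s' b = (k \<cdot> d' a) \<cdot> s' b" by simp
  qed (use a in \<open>simp_all add: Hom_def\<close>)
  have rdk: "Rst C (d a \<cdot> k) = d' a" if "a \<in> I" for a
    unfolding dk[OF that] using that rst_cmp_total[of "d' a" k] by simp
  have uni: "\<exists>!w. w \<in> Hom C Z (Dom p') \<and> k \<cdot> w = u \<and> p' \<cdot> w = v"
    if u: "u \<in> Hom C Z (Dom p)" and v: "v \<in> Hom C Z (Dom g)" and uv: "p \<cdot> u = g \<cdot> v" for Z u v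
  proof -
    have [simp]: "u \<in> Mor C" "Dom u = Z" "Cod u = Dom p" "v \<in> Mor C" "Dom v = Z" "Cod v = Dom g"
      using u v by (auto simp: Hom_def)
    have Z [simp]: "Z \<in> Ob C" using dom_ob[of u] by simp
    have uvx: "g \<cdot> v \<cdot> x = p \<cdot> u \<cdot> x" if "x \<in> Mor C" "Cod x = Z" for x
      using cmp_rw[OF uv, of x] that by simp
    \<comment> \<open>The part of \<open>Z\<close> that \<open>u\<close> sends into the sheet
      \<open>d a\<close>. There the factorisation is \<open>s' a \<cdot> v\<close>, and the pieces
      are joined to give \<open>w\<close>.\<close>
    define e where "e a = Rst C (d a \<cdot> u)" for a
    have e [simp]: "e a \<in> Mor C" "Dom (e a) = Z" "Cod (e a) = Z" "Rst C (e a) = e a" "e a \<in> rst_idem C Z" if "a \<in> I" for a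
      unfolding e_def using that by simp_all
    have ue: "u \<cdot> e a = d a \<cdot> u" if "a \<in> I" for a
      unfolding e_def using idem_slide[OF d_idem, of a u] that by simp
    have je: "is_join C Z Z (e ` I) (Rst C u)"
    proof -
      have "is_join C Z (Dom p) ((\<lambda>h. h \<cdot> u) ` d ` I) (Idt C (Dom p) \<cdot> u)"
        by (rule is_join_precomp[OF join_d u])
      from join_rst[OF this] show ?thesis by (simp add: image_image e_def)
    qed
    have sgv: "s a \<cdot> g \<cdot> v \<cdot> e a = u \<cdot> e a" if "a \<in> I" for a
      using uvx[of "e a"] ue that by simp
    have rsv: "Rst C (s' a \<cdot> v) \<cdot> e a = e a" if a: "a \<in> I" for a
    proof -
      have "Rst C (s' a \<cdot> v) \<cdot> e a = Rst C (s' a \<cdot> v \<cdot> e a)" using a rst_cmp_idem[of "e a" "s' a \<cdot> v"] by simp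
      also have "... = Rst C (k \<cdot> s' a \<cdot> v \<cdot> e a)" using a rst_cmp_total[of "s' a \<cdot> v \<cdot> e a" k] by simp
      also have "... = Rst C (u \<cdot> e a)" using sgv a ks by simp
      also have "... = e a" unfolding ue[OF a] by (simp add: e_def)
      finally show ?thesis .
    qed
    have rw: "Rst C (s' a \<cdot> v \<cdot> e a) = e a" if "a \<in> I" for a
      using rst_cmp_idem[of "e a" "s' a \<cdot> v"] rsv that by simp
    have ee: "e a \<cdot> e b = e b \<cdot> e a" if "a \<in> I" "b \<in> I" for a b using idem_comm[of "e a" Z "e b"] that by simp
    have ov: "s' a \<cdot> v \<cdot> e a \<cdot> e b = s' b \<cdot> v \<cdot> e b \<cdot> e a" if ab: "a \<in> I" "b \<in> I" for a b
    proof -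
      \<comment> \<open>On the overlap of two pieces, \<open>v\<close> takes its values in
        \<open>\<phi> a b\<close>, where \<open>s' a\<close> and \<open>s' b\<close> agree.\<close>
      have R: "Rst C (\<phi> a b \<cdot> v) \<cdot> e a \<cdot> e b = e a \<cdot> e b"
      proof -
        have "Rst C (\<phi> a b \<cdot> v) \<cdot> e a \<cdot> e b = Rst C ((d b \<cdot> s a \<cdot> g) \<cdot> v \<cdot> e a \<cdot> e b)"
          unfolding \<phi>_def using ab rst_idem_simps(4)[OF idem_cmp[of "e a" Z "e b"]] rst_cmp_idem[of "e a \<cdot> e b" "d b \<cdot> s a \<cdot> g \<cdot> v"] by simp
        also have "(d b \<cdot> s a \<cdot> g) \<cdot> v \<cdot> e a \<cdot> e b = d b \<cdot> u \<cdot> e a \<cdot> e b"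
          using cmp_rw[OF sgv[OF ab(1)], of "e b"] ab by simp
        also have "... = (d b \<cdot> u) \<cdot> e b \<cdot> e a" using ab ee by simp
        also have "... = u \<cdot> e b \<cdot> e a" unfolding ue[OF ab(2), symmetric]
          using ab idem_idem_assoc[of "e b" Z "e a"] by simp
        also have "... = (d b \<cdot> u) \<cdot> e a" using cmp_rw[OF ue[OF ab(2)], of "e a"] ab by simp
        also have "Rst C \<dots> = e a \<cdot> e b" using rst_cmp_idem[of "e a" "d b \<cdot> u"] ab ee by (simp add: e_def)
        finally show ?thesis .
      qed
      have sl: "\<phi> a b \<cdot> v = v \<cdot> Rst C (\<phi> a b \<cdot> v)" using idem_slide[of "\<phi> a b" "Dom g" v] ab by simp
      have "\<phi> a b \<cdot> v \<cdot> e a \<cdot> e b = (v \<cdot> Rst C (\<phi> a b \<cdot> v)) \<cdot> e a \<cdot> e b"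
        by (rule cmp_rw[OF sl]) (use ab in simp_all)
      also have "... = v \<cdot> Rst C (\<phi> a b \<cdot> v) \<cdot> e a \<cdot> e b" using ab by simp
      finally have v: "v \<cdot> e a \<cdot> e b = \<phi> a b \<cdot> v \<cdot> e a \<cdot> e b" unfolding R by simp
      have "s' a \<cdot> v \<cdot> e a \<cdot> e b = (s' a \<cdot> \<phi> a b) \<cdot> v \<cdot> e a \<cdot> e b" using v ab by simp
      also have "... = s' b \<cdot> \<phi> a b \<cdot> v \<cdot> e a \<cdot> e b" unfolding gc(4)[OF ab] using ab by simp
      also have "... = s' b \<cdot> v \<cdot> e b \<cdot> e a" using v ee ab by simp
      finally show ?thesis .
    qed
    let ?F = "(\<lambda>a. s' a \<cdot> v \<cdot> e a) ` I"
    have "compat C x y" if "x \<in> ?F" "y \<in> ?F" for x y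
      using that ov rw by (auto simp: compat_iff)
    moreover have "?F \<subseteq> Hom C Z (Dom p')" by (auto simp: Hom_def)
    ultimately obtain w where w: "is_join C Z (Dom p') ?F w"
      using join_exists[of Z "Dom p'" ?F] by auto
    have [simp]: "w \<in> Mor C" "Dom w = Z" "Cod w = Dom p'" using is_joinD(2-4)[OF w] by auto
    have we: "w \<cdot> e a = s' a \<cdot> v \<cdot> e a" if "a \<in> I" for a
      using rleD(5)[OF is_joinD(5)[OF w, of "s' a \<cdot> v \<cdot> e a"]] that rw[OF that] by simp
    have "Rst C ` ?F = e ` I" using rw by (force simp: image_image)
    then have Rw: "Rst C w = Rst C u" using join_unique[OF join_rst[OF w]] je by simp
    \<comment> \<open>Both legs are total, so \<open>u\<close> and \<open>v\<close> have the same
      domain; by \<open>je\<close> it is the join of the \<open>e a\<close>.\<close>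
    have Rv: "Rst C v = Rst C u"
      using rst_cmp_total[of v g] rst_cmp_total[of u p] uv by simp
    have eqI: "x = y" if "x \<in> Hom C Z D" "y \<in> Hom C Z D" "Rst C x = Rst C u" "Rst C y = Rst C u"
      "\<And>a. a \<in> I \<Longrightarrow> x \<cdot> e a = y \<cdot> e a" for x y D
    proof -
      have [simp]: "x \<in> Mor C" "Dom x = Z" "y \<in> Mor C" "Dom y = Z" using that(1,2) by (auto simp: Hom_def)
      have "x \<cdot> Rst C u = y \<cdot> Rst C u" by (rule join_eq[OF je that(1,2)]) (use that(5) in auto)
      then show ?thesis using cmp_rst'[of x] cmp_rst'[of y] that(3,4) by simp
    qed
    have kw: "k \<cdot> w = u"
    proof (rule eqI)
      show "(k \<cdot> w) \<cdot> e a = u \<cdot> e a" if "a \<in> I" for a using we[OF that] that ks sgv by simp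
      show "Rst C (k \<cdot> w) = Rst C u" using rst_cmp_total[of w k] Rw by simp
    qed (simp_all add: Hom_def)
    have pw: "p' \<cdot> w = v"
    proof (rule eqI)
      fix a assume a: "a \<in> I"
      have "(p' \<cdot> w) \<cdot> e a = Rst C (s' a) \<cdot> v \<cdot> e a" using we[OF a] a by simp
      also have "... = (v \<cdot> Rst C (s' a \<cdot> v)) \<cdot> e a" using rst_slide[of v "s' a"] a
        by (metis (no_types, lifting) R.s_simps(1,2) \<open>Cod v = Dom g\<close> \<open>Dom v = Z\<close> \<open>v \<in> Mor C\<close> assoc e(1,3) gc(2) rst_simps)
      also have "... = v \<cdot> e a" using rsv[OF a] a by simp
      finally show "(p' \<cdot> w) \<cdot> e a = v \<cdot> e a" .
    next
      show "Rst C (p' \<cdot> w) = Rst C u" using rst_cmp_total[of w p'] Rw by simp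
    qed (simp_all add: Hom_def Rv)
    show ?thesis
    proof (rule ex1I[of _ w])
      show "w \<in> Hom C Z (Dom p') \<and> k \<cdot> w = u \<and> p' \<cdot> w = v" using kw pw by (simp add: Hom_def)
      fix x assume x: "x \<in> Hom C Z (Dom p') \<and> k \<cdot> x = u \<and> p' \<cdot> x = v"
      then have [simp]: "x \<in> Mor C" "Dom x = Z" "Cod x = Dom p'" by (auto simp: Hom_def)
      show "x = w"
      proof (rule eqI)
        fix a assume a: "a \<in> I"
        have "e a = Rst C ((d a \<cdot> k) \<cdot> x)" unfolding e_def using x a by simp
        also have "... = Rst C (Rst C (d a \<cdot> k) \<cdot> x)" using a by (intro rst_rst_cmp[symmetric]) simp_all
        also have "... = Rst C (d' a \<cdot> x)" unfolding rdk[OF a] ..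
        finally have "x \<cdot> e a = d' a \<cdot> x" using idem_slide[OF R.d_idem, of a x] a by simp
        moreover have "d' a \<cdot> x = s' a \<cdot> p' \<cdot> d' a \<cdot> x" using a by simp
        ultimately have "x \<cdot> e a = s' a \<cdot> p' \<cdot> x \<cdot> e a" by simp
        also have "... = s' a \<cdot> (p' \<cdot> x) \<cdot> e a" using a by simp
        finally show "x \<cdot> e a = w \<cdot> e a" using x we[OF a] by simp
      next
        show "Rst C x = Rst C u" using x rst_cmp_total[of x k] by auto
      qed (simp_all add: Hom_def Rw)
    qed
  qed
  have "is_pullback C p g k p'"
    unfolding is_pullback_def using pk uni by (auto simp: Hom_def)
  then show ?thesis unfolding has_pb_def total_iff by auto
qed

end

section \<open>Internal categories on generalised elements\<close>

text \<open>The product of \<open>u : Z \<rightarrow> A\<^sub>j\<^sub>k\<close> and \<open>v : Z \<rightarrow> A\<^sub>i\<^sub>j\<close>, for \<open>\<sigma> u = \<tau> v\<close>.\<close>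

definition gmul ::
    "('o, 'm) rcat \<Rightarrow> ('i, 'o, 'm) pcat \<Rightarrow> 'i \<Rightarrow> 'i \<Rightarrow> 'i \<Rightarrow> ('o, 'm) arr \<Rightarrow> ('o, 'm) arr \<Rightarrow> ('o, 'm) arr" where
  "gmul C AA i j k u v = mul AA i j k \<cdot>\<^bsub>C\<^esub> pair C (src AA j k) (tgt AA i j) u v"

text \<open>Composition in \<open>Phi_cat\<close> at the level of \<open>C\<close>. Both components
  of the pairing need the same domain, so \<open>s\<close> is cut down to the part on whose targets
  \<open>t\<close> is defined.\<close>

definition scomp ::
    "('o, 'm) rcat \<Rightarrow> ('i, 'o, 'm) pcat \<Rightarrow> 'i \<Rightarrow> 'i \<Rightarrow> 'i \<Rightarrow> ('o, 'm) arr \<Rightarrow> ('o, 'm) arr \<Rightarrow> ('o, 'm) arr" where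
  "scomp C AA i j k t s =
     gmul C AA i j k (t \<cdot>\<^bsub>C\<^esub> tgt AA i j \<cdot>\<^bsub>C\<^esub> s) (s \<cdot>\<^bsub>C\<^esub> Rst C (t \<cdot>\<^bsub>C\<^esub> tgt AA i j \<cdot>\<^bsub>C\<^esub> s))"

locale internal_category = join_restriction_category C + partite_category C AA
  for C :: "('o, 'm) rcat" (structure) and AA :: "('i, 'o, 'm) pcat"
begin

lemma src_simps [simp]:
  assumes "i \<in> idx AA" "j \<in> idx AA"
  shows "src AA i j \<in> Mor C" "Dom (src AA i j) = mob AA i j" "Cod (src AA i j) = obj AA i"
    "Rst C (src AA i j) = Idt C (mob AA i j)"
  using src[OF assms] by (auto simp: Hom_def total_iff)

lemma tgt_simps [simp]:
  assumes "i \<in> idx AA" "j \<in> idx AA"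
  shows "tgt AA i j \<in> Mor C" "Dom (tgt AA i j) = mob AA i j" "Cod (tgt AA i j) = obj AA j"
    "Rst C (tgt AA i j) = Idt C (mob AA i j)"
  using tgt[OF assms] by (auto simp: Hom_def total_iff)

lemma ob_simps [simp]:
  "i \<in> idx AA \<Longrightarrow> obj AA i \<in> Ob C" "i \<in> idx AA \<Longrightarrow> j \<in> idx AA \<Longrightarrow> mob AA i j \<in> Ob C"
  using obj dom_ob[of "src AA i j"] by auto

lemma unt_simps [simp]:
  assumes "i \<in> idx AA"
  shows "unt AA i \<in> Mor C" "Dom (unt AA i) = obj AA i" "Cod (unt AA i) = mob AA i i"
    "src AA i i \<cdot> unt AA i = Idt C (obj AA i)" "tgt AA i i \<cdot> unt AA i = Idt C (obj AA i)"
  using unt[OF assms] src_unt[OF assms] tgt_unt[OF assms] by (auto simp: Hom_def)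

lemma unt_assoc [simp]:
  assumes "i \<in> idx AA" "x \<in> Mor C" "Cod x = obj AA i"
  shows "src AA i i \<cdot> unt AA i \<cdot> x = x" "tgt AA i i \<cdot> unt AA i \<cdot> x = x"
  using cmp_rw[OF unt_simps(4)[OF assms(1)], of x] cmp_rw[OF unt_simps(5)[OF assms(1)], of x] assms by simp_all

lemma rst_src_cmp [simp]:
  assumes "i \<in> idx AA" "j \<in> idx AA" "x \<in> Mor C" "Cod x = mob AA i j"
  shows "Rst C (src AA i j \<cdot> x) = Rst C x" "Rst C (tgt AA i j \<cdot> x) = Rst C x"
  using rst_cmp_total[of x "src AA i j"] rst_cmp_total[of x "tgt AA i j"] assms by simp_all

lemma rst_unt [simp]: "i \<in> idx AA \<Longrightarrow> Rst C (unt AA i) = Idt C (obj AA i)"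
  using rst_src_cmp(1)[of i i "unt AA i"] by simp

lemma rst_unt_cmp [simp]: "i \<in> idx AA \<Longrightarrow> x \<in> Mor C \<Longrightarrow> Cod x = obj AA i \<Longrightarrow> Rst C (unt AA i \<cdot> x) = Rst C x"
  using rst_cmp_total[of x "unt AA i"] by simp

lemma src_has_pb:
  assumes "i \<in> idx AA" "j \<in> idx AA" "g \<in> Mor C" "Rst C g = Idt C (Dom g)" "Cod g = obj AA i"
  shows "has_pb C (src AA i j) g"
  using src_pullback[OF assms(1,2), of g] assms by (simp add: has_pb_def total_iff)

lemma mul_pb [simp]: "i \<in> idx AA \<Longrightarrow> j \<in> idx AA \<Longrightarrow> k \<in> idx AA \<Longrightarrow> has_pb C (src AA j k) (tgt AA i j)"
  by (rule src_has_pb) simp_all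

lemma mul_simps [simp]:
  assumes "i \<in> idx AA" "j \<in> idx AA" "k \<in> idx AA"
  shows "mul AA i j k \<in> Mor C" "Dom (mul AA i j k) = pbo C (src AA j k) (tgt AA i j)" "Cod (mul AA i j k) = mob AA i k"
  using mul[OF assms] by (auto simp: Hom_def)

context
  fixes i j k u v
  assumes ijk [simp]: "i \<in> idx AA" "j \<in> idx AA" "k \<in> idx AA"
    and uv [simp]: "u \<in> Mor C" "v \<in> Mor C" "Dom u = Dom v" "Cod u = mob AA j k" "Cod v = mob AA i j"
    and st: "src AA j k \<cdot> u = tgt AA i j \<cdot> v"
begin

lemma gpair [simp]:
  "pair C (src AA j k) (tgt AA i j) u v \<in> Mor C" "Dom (pair C (src AA j k) (tgt AA i j) u v) = Dom v"
  "Cod (pair C (src AA j k) (tgt AA i j) u v) = pbo C (src AA j k) (tgt AA i j)"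
  "pb1 C (src AA j k) (tgt AA i j) \<cdot> pair C (src AA j k) (tgt AA i j) u v = u"
  "pb2 C (src AA j k) (tgt AA i j) \<cdot> pair C (src AA j k) (tgt AA i j) u v = v"
  by (rule pair_props[OF mul_pb] | subst pair_props[OF mul_pb] | simp add: st)+

lemma gmul_simps:
  shows "gmul C AA i j k u v \<in> Mor C" "Dom (gmul C AA i j k u v) = Dom v" "Cod (gmul C AA i j k u v) = mob AA i k"
    and "src AA i k \<cdot> gmul C AA i j k u v = src AA i j \<cdot> v" "tgt AA i k \<cdot> gmul C AA i j k u v = tgt AA j k \<cdot> u"
    and "Rst C (gmul C AA i j k u v) = Rst C v"
proof -
  show *: "gmul C AA i j k u v \<in> Mor C" "Dom (gmul C AA i j k u v) = Dom v" "Cod (gmul C AA i j k u v) = mob AA i k"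
    by (simp_all add: gmul_def)
  show s: "src AA i k \<cdot> gmul C AA i j k u v = src AA i j \<cdot> v"
    using cmp_rw[OF src_mul[OF ijk], of "pair C (src AA j k) (tgt AA i j) u v"] by (simp add: gmul_def)
  show "tgt AA i k \<cdot> gmul C AA i j k u v = tgt AA j k \<cdot> u"
    using cmp_rw[OF tgt_mul[OF ijk], of "pair C (src AA j k) (tgt AA i j) u v"] by (simp add: gmul_def)
  have "Rst C (gmul C AA i j k u v) = Rst C (src AA i k \<cdot> gmul C AA i j k u v)" using * by simp
  then show "Rst C (gmul C AA i j k u v) = Rst C v" unfolding s by simp
qed

lemma gmul_cmp:
  assumes [simp]: "w \<in> Mor C" "Cod w = Dom v"
  shows "gmul C AA i j k u v \<cdot> w = gmul C AA i j k (u \<cdot> w) (v \<cdot> w)"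
  using pair_cmp[OF mul_pb[OF ijk], of u v w] st by (simp add: gmul_def)

end

text \<open>The unit axioms are the case of an identity arrow; precomposing with \<open>u\<close>
  gives the general case.\<close>

lemma gmul_unt:
  assumes [simp]: "i \<in> idx AA" "j \<in> idx AA" "u \<in> Mor C" "Cod u = mob AA i j"
  shows "gmul C AA i i j u (unt AA i \<cdot> src AA i j \<cdot> u) = u"
    and "gmul C AA i j j (unt AA j \<cdot> tgt AA i j \<cdot> u) u = u"
proof -
  have "gmul C AA i i j (Idt C (mob AA i j)) (unt AA i \<cdot> src AA i j) \<cdot> u = u"
    using mul_unt_right[of i j] by (simp add: gmul_def)
  then show "gmul C AA i i j u (unt AA i \<cdot> src AA i j \<cdot> u) = u"
    by (subst (asm) gmul_cmp) simp_all
  have "gmul C AA i j j (unt AA j \<cdot> tgt AA i j) (Idt C (mob AA i j)) \<cdot> u = u"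
    using mul_unt_left[of i j] by (simp add: gmul_def)
  then show "gmul C AA i j j (unt AA j \<cdot> tgt AA i j \<cdot> u) u = u"
    by (subst (asm) gmul_cmp) simp_all
qed

text \<open>The axiom lives on the triple pullback. Precomposing it with the map \<open>?q\<close>
  that \<open>u\<close>, \<open>v\<close>, \<open>w\<close> induce gives the law for arbitrary
  factors.\<close>

lemma gmul_assoc:
  assumes ijk [simp]: "i \<in> idx AA" "j \<in> idx AA" "k \<in> idx AA" "l \<in> idx AA"
    and uv [simp]: "u \<in> Mor C" "v \<in> Mor C" "w \<in> Mor C" "Dom u = Dom w" "Dom v = Dom w"
      "Cod u = mob AA k l" "Cod v = mob AA j k" "Cod w = mob AA i j"
    and st: "src AA k l \<cdot> u = tgt AA j k \<cdot> v" "src AA j k \<cdot> v = tgt AA i j \<cdot> w"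
  shows "gmul C AA i k l u (gmul C AA i j k v w) = gmul C AA i j l (gmul C AA j k l u v) w"
proof -
  let ?p1 = "pb1 C (src AA j k) (tgt AA i j)" and ?p2 = "pb2 C (src AA j k) (tgt AA i j)"
  let ?g = "tgt AA j k \<cdot> ?p1"
  have pb [simp]: "has_pb C (src AA k l) ?g"
  proof (rule src_has_pb)
    show "Rst C ?g = Idt C (Dom ?g)" using pb_total(1)[of "src AA j k" "tgt AA i j"] by simp
  qed simp_all
  let ?r1 = "pb1 C (src AA k l) ?g" and ?r2 = "pb2 C (src AA k l) ?g"
  have r: "src AA k l \<cdot> ?r1 = tgt AA j k \<cdot> ?p1 \<cdot> ?r2" using pb_commutes[OF pb] by simp
  have p: "src AA j k \<cdot> ?p1 \<cdot> ?r2 = tgt AA i j \<cdot> ?p2 \<cdot> ?r2"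
    using cmp_rw[OF pb_commutes[OF mul_pb[of i j k]], of ?r2] by simp
  let ?p = "pair C (src AA j k) (tgt AA i j) v w"
  note P [simp] = gpair[of i j k v w, OF ijk(1-3) uv(2,3,5,7,8) st(2)]
  have P' [simp]: "?p1 \<cdot> ?p = v" "?p2 \<cdot> ?p = w" by simp_all
  have c: "src AA k l \<cdot> u = ?g \<cdot> ?p" using st(1) by simp
  let ?q = "pair C (src AA k l) ?g u ?p"
  have "u \<in> Mor C" "?p \<in> Mor C" "Dom u = Dom ?p" "Cod u = Dom (src AA k l)" "Cod ?p = Dom ?g" by simp_all
  note Q [simp] = pair_props[OF pb this c]
  have m: "tgt AA i k \<cdot> mul AA i j k \<cdot> ?r2 = tgt AA j k \<cdot> ?p1 \<cdot> ?r2"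
    using cmp_rw[OF tgt_mul[of i j k], of ?r2] by simp
  have "gmul C AA i k l ?r1 (mul AA i j k \<cdot> ?r2) = gmul C AA i j l (gmul C AA j k l ?r1 (?p1 \<cdot> ?r2)) (?p2 \<cdot> ?r2)"
    using mul_assoc[OF ijk] unfolding Let_def gmul_def by simp
  then have "gmul C AA i k l ?r1 (mul AA i j k \<cdot> ?r2) \<cdot> ?q =
      gmul C AA i j l (gmul C AA j k l ?r1 (?p1 \<cdot> ?r2)) (?p2 \<cdot> ?r2) \<cdot> ?q" by simp
  moreover have "gmul C AA i k l ?r1 (mul AA i j k \<cdot> ?r2) \<cdot> ?q = gmul C AA i k l u (gmul C AA i j k v w)"
    using r m by (subst gmul_cmp) (simp_all add: gmul_def[of _ _ i j k])
  moreover have "gmul C AA i j l (gmul C AA j k l ?r1 (?p1 \<cdot> ?r2)) (?p2 \<cdot> ?r2) \<cdot> ?q =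
      gmul C AA i j l (gmul C AA j k l ?r1 (?p1 \<cdot> ?r2) \<cdot> ?q) ((?p2 \<cdot> ?r2) \<cdot> ?q)"
    using r p by (intro gmul_cmp) (simp_all add: gmul_simps)
  moreover have "gmul C AA j k l ?r1 (?p1 \<cdot> ?r2) \<cdot> ?q = gmul C AA j k l u v"
    using r by (subst gmul_cmp) simp_all
  ultimately show ?thesis by simp
qed

abbreviation psec where "psec i j s \<equiv> partial_section C (src AA i j) s"

lemma psecD:
  assumes "psec i j s" "i \<in> idx AA" "j \<in> idx AA"
  shows "s \<in> Mor C" "Dom s = obj AA i" "Cod s = mob AA i j" "src AA i j \<cdot> s = Rst C s"
    "x \<in> Mor C \<Longrightarrow> Cod x = obj AA i \<Longrightarrow> src AA i j \<cdot> s \<cdot> x = Rst C s \<cdot> x"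
  using partial_sectionD[OF assms(1)] assms(2,3) by simp_all

context
  fixes i j k s t
  assumes ijk [simp]: "i \<in> idx AA" "j \<in> idx AA" "k \<in> idx AA" and s: "psec i j s" and t: "psec j k t"
begin

lemma scomp_aux:
  "src AA j k \<cdot> t \<cdot> tgt AA i j \<cdot> s = tgt AA i j \<cdot> s \<cdot> Rst C (t \<cdot> tgt AA i j \<cdot> s)"
  using psecD[OF s] psecD[OF t] rst_slide[of "tgt AA i j \<cdot> s" t] by simp

lemma scomp_simps:
  shows "scomp C AA i j k t s \<in> Mor C" "Dom (scomp C AA i j k t s) = obj AA i" "Cod (scomp C AA i j k t s) = mob AA i k"
    "Rst C (scomp C AA i j k t s) = Rst C (t \<cdot> tgt AA i j \<cdot> s)"
    "tgt AA i k \<cdot> scomp C AA i j k t s = tgt AA j k \<cdot> t \<cdot> tgt AA i j \<cdot> s"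
    "psec i k (scomp C AA i j k t s)"
proof -
  note [simp] = psecD[OF s] psecD[OF t]
  let ?u = "t \<cdot> tgt AA i j \<cdot> s" let ?v = "s \<cdot> Rst C ?u"
  have "?u \<in> Mor C" "?v \<in> Mor C" "Dom ?u = Dom ?v" "Cod ?u = mob AA j k" "Cod ?v = mob AA i j"
    "src AA j k \<cdot> ?u = tgt AA i j \<cdot> ?v" using scomp_aux by simp_all
  note G = gmul_simps[OF ijk this, folded scomp_def]
  show 1: "scomp C AA i j k t s \<in> Mor C" "Dom (scomp C AA i j k t s) = obj AA i" "Cod (scomp C AA i j k t s) = mob AA i k"
    using G(1-3) by simp_all
  have sub: "Rst C s \<cdot> Rst C ?u = Rst C ?u" using rst_absorb(2)[of s "t \<cdot> tgt AA i j"] by simp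
  show 2: "Rst C (scomp C AA i j k t s) = Rst C ?u" using G(6) sub by simp
  show "tgt AA i k \<cdot> scomp C AA i j k t s = tgt AA j k \<cdot> t \<cdot> tgt AA i j \<cdot> s" using G(5) by simp
  show "psec i k (scomp C AA i j k t s)"
    by (rule partial_sectionI) (use 1 2 G(4) sub in simp_all)
qed

end

text \<open>Both sides are triple products of the same maps: \<open>b\<close>, which is
  \<open>r\<close> applied after the other two, and \<open>a\<close> and \<open>s\<close>, all on
  the common domain \<open>z\<close> where the three sections can be applied in turn.
  \<open>gmul_assoc\<close> then compares them.\<close>

lemma scomp_assoc:
  assumes ijk [simp]: "i \<in> idx AA" "j \<in> idx AA" "k \<in> idx AA" "l \<in> idx AA"
    and s: "psec i j s" and t: "psec j k t" and r: "psec k l r"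
  shows "scomp C AA i j l (scomp C AA j k l r t) s = scomp C AA i k l r (scomp C AA i j k t s)"
proof -
  note S [simp] = psecD[OF s ijk(1,2)] and T [simp] = psecD[OF t ijk(2,3)] and R [simp] = psecD[OF r ijk(3,4)]
  note ts = scomp_simps[OF ijk(1-3) s t] and rt = scomp_simps[OF ijk(2-4) t r]
  define x where "x = tgt AA i j \<cdot> s"
  define a where "a = t \<cdot> x"
  define y where "y = tgt AA j k \<cdot> t"
  define ry where "ry = r \<cdot> y"
  define b where "b = ry \<cdot> x"
  define z where "z = Rst C b"
  have x [simp]: "x \<in> Mor C" "Dom x = obj AA i" "Cod x = obj AA j" by (simp_all add: x_def)
  have a [simp]: "a \<in> Mor C" "Dom a = obj AA i" "Cod a = mob AA j k" by (simp_all add: a_def)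
  have y [simp]: "y \<in> Mor C" "Dom y = obj AA j" "Cod y = obj AA k" by (simp_all add: y_def)
  have ry [simp]: "ry \<in> Mor C" "Dom ry = obj AA j" "Cod ry = mob AA k l" by (simp_all add: ry_def)
  have b [simp]: "b \<in> Mor C" "Dom b = obj AA i" "Cod b = mob AA k l" by (simp_all add: b_def)
  have z [simp]: "z \<in> Mor C" "Dom z = obj AA i" "Cod z = obj AA i" by (simp_all add: z_def)
  have yx: "y \<cdot> x = tgt AA j k \<cdot> a" by (simp add: y_def a_def)
  have b': "b = r \<cdot> tgt AA j k \<cdot> a" by (simp add: b_def ry_def yx)
  have xz: "Rst C ry \<cdot> x = x \<cdot> z" unfolding z_def b_def by (rule rst_slide) simp_all
  have az: "Rst C a \<cdot> z = z"
    unfolding z_def b' using rst_absorb(2)[of a "r \<cdot> tgt AA j k"] by simp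
  have A: "src AA k l \<cdot> b = tgt AA j k \<cdot> a \<cdot> z"
  proof -
    have "src AA k l \<cdot> b = Rst C r \<cdot> tgt AA j k \<cdot> a" unfolding b' by (rule R(5)) simp_all
    also have "... = (tgt AA j k \<cdot> a) \<cdot> z" unfolding z_def b' by (rule rst_slide) simp_all
    finally show ?thesis by simp
  qed
  have ax: "src AA j k \<cdot> a = x \<cdot> Rst C a" unfolding a_def using T(5)[of x] rst_slide[of x t] by simp
  have B: "src AA j k \<cdot> a \<cdot> z = tgt AA i j \<cdot> s \<cdot> z"
    using cmp_rw[OF ax, of z] az by (simp add: x_def)
  have t1: "scomp C AA j k l r t = gmul C AA j k l ry (t \<cdot> Rst C ry)"
    unfolding scomp_def y_def[symmetric] ry_def[symmetric] ..
  have st1: "src AA k l \<cdot> ry = tgt AA j k \<cdot> t \<cdot> Rst C ry"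
    using scomp_aux[OF ijk(2-4) t r] by (simp only: y_def[symmetric] ry_def[symmetric])
  have Y: "scomp C AA j k l r t \<cdot> x = gmul C AA j k l b (a \<cdot> z)"
  proof -
    have "scomp C AA j k l r t \<cdot> x = gmul C AA j k l (ry \<cdot> x) ((t \<cdot> Rst C ry) \<cdot> x)"
      unfolding t1 by (rule gmul_cmp[OF ijk(2-4) _ _ _ _ _ st1]) simp_all
    also have "(t \<cdot> Rst C ry) \<cdot> x = t \<cdot> Rst C ry \<cdot> x" by simp
    also have "... = a \<cdot> z" unfolding xz a_def by simp
    finally show ?thesis unfolding b_def .
  qed
  have RY: "Rst C (scomp C AA j k l r t \<cdot> x) = z"
  proof -
    have "Rst C (scomp C AA j k l r t \<cdot> x) = Rst C (a \<cdot> z)"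
      unfolding Y by (rule gmul_simps(6)[OF ijk(2-4) _ _ _ _ _ A]) simp_all
    also have "... = Rst C a \<cdot> z" unfolding z_def by (rule rst_cmp_rst') simp_all
    finally show ?thesis unfolding az .
  qed
  have L: "scomp C AA i j l (scomp C AA j k l r t) s = gmul C AA i j l (gmul C AA j k l b (a \<cdot> z)) (s \<cdot> z)"
    unfolding scomp_def[of _ _ i j l] x_def[symmetric] RY by (simp only: Y)
  have t2: "scomp C AA i j k t s = gmul C AA i j k a (s \<cdot> Rst C a)"
    unfolding scomp_def x_def[symmetric] a_def[symmetric] ..
  have st2: "src AA j k \<cdot> a = tgt AA i j \<cdot> s \<cdot> Rst C a"
    using scomp_aux[OF ijk(1-3) s t] by (simp only: x_def[symmetric] a_def[symmetric])
  have X: "scomp C AA i j k t s \<cdot> z = gmul C AA i j k (a \<cdot> z) (s \<cdot> z)"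
  proof -
    have "scomp C AA i j k t s \<cdot> z = gmul C AA i j k (a \<cdot> z) ((s \<cdot> Rst C a) \<cdot> z)"
      unfolding t2 by (rule gmul_cmp[OF ijk(1-3) _ _ _ _ _ st2]) simp_all
    also have "(s \<cdot> Rst C a) \<cdot> z = s \<cdot> Rst C a \<cdot> z" by simp
    finally show ?thesis unfolding az .
  qed
  have "tgt AA i k \<cdot> scomp C AA i j k t s = tgt AA j k \<cdot> a" using ts(5) by (simp only: a_def x_def)
  then have R: "scomp C AA i k l r (scomp C AA i j k t s) = gmul C AA i k l b (gmul C AA i j k (a \<cdot> z) (s \<cdot> z))"
    unfolding scomp_def[of _ _ i k l] by (simp only: b'[symmetric] z_def[symmetric] X)
  show ?thesis unfolding L R
    by (rule gmul_assoc[OF ijk _ _ _ _ _ _ _ _ A B, symmetric]) simp_all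
qed

text \<open>The sections \<open>unt AA i \<cdot> e\<close> become the idempotents of
  \<open>Phi_cat\<close>. Composing with one on the right cuts a section down to \<open>e\<close>,
  on the left to the inverse image of \<open>e\<close> along its target.\<close>

lemma psec_unt:
  assumes [simp]: "i \<in> idx AA" "e \<in> rst_idem C (obj AA i)"
  shows "psec i i (unt AA i \<cdot> e)"
  using rst_idem_simps[OF assms(2)] by (intro partial_sectionI) simp_all

lemma scomp_unt_right:
  assumes [simp]: "i \<in> idx AA" "j \<in> idx AA" and s: "psec i j s" and e: "e \<in> rst_idem C (obj AA i)"
  shows "scomp C AA i i j s (unt AA i \<cdot> e) = s \<cdot> e"
proof -
  note [simp] = psecD[OF s] rst_idem_simps[OF e]
  have "e \<cdot> Rst C (s \<cdot> e) = Rst C (s \<cdot> e)"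
  proof -
    have "Rst C (s \<cdot> e) = Rst C s \<cdot> e" using rst_cmp_idem[of e s] by simp
    also have "... = e \<cdot> Rst C s" by (rule idem_comm[OF _ e]) simp
    finally show ?thesis using idem_idem_assoc[OF e, of "Rst C s"] by simp
  qed
  then have "scomp C AA i i j s (unt AA i \<cdot> e) = gmul C AA i i j (s \<cdot> e) (unt AA i \<cdot> src AA i j \<cdot> s \<cdot> e)"
    using rst_cmp_idem[of e s] by (simp add: scomp_def)
  then show ?thesis using gmul_unt(1)[of i j "s \<cdot> e"] by simp
qed

lemma scomp_unt_left:
  assumes [simp]: "i \<in> idx AA" "j \<in> idx AA" and s: "psec i j s" and e: "e \<in> rst_idem C (obj AA j)"
  shows "scomp C AA i j j (unt AA j \<cdot> e) s = s \<cdot> Rst C (e \<cdot> tgt AA i j \<cdot> s)"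
proof -
  note [simp] = psecD[OF s] rst_idem_simps[OF e]
  let ?r = "Rst C (e \<cdot> tgt AA i j \<cdot> s)"
  have "e \<cdot> tgt AA i j \<cdot> s = tgt AA i j \<cdot> s \<cdot> ?r" using idem_slide[OF e, of "tgt AA i j \<cdot> s"] by simp
  then have "scomp C AA i j j (unt AA j \<cdot> e) s = gmul C AA i j j (unt AA j \<cdot> tgt AA i j \<cdot> s \<cdot> ?r) (s \<cdot> ?r)"
    by (simp add: scomp_def)
  then show ?thesis using gmul_unt(2)[of i j "s \<cdot> ?r"] by simp
qed

section \<open>The category of sections\<close>

lemma sect_simps [simp]:
  "Dom (sect AA a) = obj AA (Dom a)" "Cod (sect AA a) = mob AA (Dom a) (Cod a)"
  by (simp_all add: sect_def)

lemma sect_Arr: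
  "Dom u = obj AA i \<Longrightarrow> Cod u = mob AA i j \<Longrightarrow> sect AA (Arr i (Lab u) j) = u"
  by (cases u) (simp add: sect_def)

lemma sect_inj: "Dom a = Dom b \<Longrightarrow> Cod a = Cod b \<Longrightarrow> sect AA a = sect AA b \<Longrightarrow> a = b"
  by (cases a; cases b) (simp add: sect_def)

lemma phi_ob [simp]: "Ob (Phi_cat C AA) = idx AA"
  by (simp add: Phi_cat_def)

lemma phi_mor: "a \<in> Mor (Phi_cat C AA) \<longleftrightarrow> Dom a \<in> idx AA \<and> Cod a \<in> idx AA \<and>
    psec (Dom a) (Cod a) (sect AA a) \<and> partial_iso C (tgt AA (Dom a) (Cod a) \<cdot> sect AA a)"
  by (simp add: Phi_cat_def)

lemma phi_idt: "i \<in> idx AA \<Longrightarrow> sect AA (Idt (Phi_cat C AA) i) = unt AA i"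
    "Dom (Idt (Phi_cat C AA) i) = i" "Cod (Idt (Phi_cat C AA) i) = i"
  by (simp_all add: Phi_cat_def sect_Arr)

lemma phi_morD:
  assumes "a \<in> Mor (Phi_cat C AA)"
  shows "Dom a \<in> idx AA" "Cod a \<in> idx AA" "psec (Dom a) (Cod a) (sect AA a)"
    "partial_iso C (tgt AA (Dom a) (Cod a) \<cdot> sect AA a)" "sect AA a \<in> Mor C"
    "src AA (Dom a) (Cod a) \<cdot> sect AA a = Rst C (sect AA a)"
  using assms psecD(1,4)[of "Dom a" "Cod a" "sect AA a"] by (simp_all add: phi_mor)

lemma phi_ArrI:
  assumes "i \<in> idx AA" "j \<in> idx AA" "psec i j u" "partial_iso C (tgt AA i j \<cdot> u)"
  shows "Arr i (Lab u) j \<in> Mor (Phi_cat C AA)" "sect AA (Arr i (Lab u) j) = u"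
  using assms psecD[OF assms(3,1,2)] sect_Arr[of u i j] by (simp_all add: phi_mor)

abbreviation phi_comp (infixr "\<odot>" 70) where "g \<odot> f \<equiv> g \<cdot>\<^bsub>Phi_cat C AA\<^esub> f"

lemma phi_cmp:
  assumes a: "a \<in> Mor (Phi_cat C AA)" and b: "b \<in> Mor (Phi_cat C AA)" and ab: "Cod a = Dom b"
  shows "b \<odot> a \<in> Mor (Phi_cat C AA)"
    "Dom (b \<odot> a) = Dom a" "Cod (b \<odot> a) = Cod b"
    "sect AA (b \<odot> a) = scomp C AA (Dom a) (Cod a) (Cod b) (sect AA b) (sect AA a)"
proof -
  note A [simp] = phi_morD[OF a] and B [simp] = phi_morD[OF b]
  let ?c = "scomp C AA (Dom a) (Cod a) (Cod b) (sect AA b) (sect AA a)"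
  have b': "psec (Cod a) (Cod b) (sect AA b)" using B(3) ab by simp
  have "mul AA (Dom a) (Cod a) (Cod b) \<cdot> pull_section C (src AA (Cod a) (Cod b)) (tgt AA (Dom a) (Cod a)) (sect AA b) \<cdot> sect AA a = ?c"
    unfolding scomp_def gmul_def
    by (subst pull_section_props(7)) (use b' in simp_all)
  then have c: "b \<odot> a = Arr (Dom a) (Lab ?c) (Cod b)"
    by (simp add: Phi_cat_def Let_def ab)
  note S = scomp_simps[OF A(1,2) B(2) A(3) b']
  have "partial_iso C (tgt AA (Dom a) (Cod b) \<cdot> ?c)"
    unfolding S(5) using partial_iso_cmp[OF A(4) B(4)] ab by simp
  note R = phi_ArrI[OF A(1) B(2) S(6) this]
  show "b \<odot> a \<in> Mor (Phi_cat C AA)"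
    "Dom (b \<odot> a) = Dom a" "Cod (b \<odot> a) = Cod b"
    "sect AA (b \<odot> a) = ?c"
    using R by (simp_all add: c)
qed

definition phi_unt where "phi_unt i e = Arr i (Lab (unt AA i \<cdot> e)) i"

lemma phi_unt:
  assumes "i \<in> idx AA" "e \<in> rst_idem C (obj AA i)"
  shows "phi_unt i e \<in> Mor (Phi_cat C AA)" "Dom (phi_unt i e) = i" "Cod (phi_unt i e) = i"
    "sect AA (phi_unt i e) = unt AA i \<cdot> e"
proof -
  have "partial_iso C (tgt AA i i \<cdot> unt AA i \<cdot> e)"
    using assms partial_iso_idem[OF assms(2)] rst_idem_simps[OF assms(2)] by simp
  note R = phi_ArrI[OF assms(1,1) psec_unt[OF assms] this, folded phi_unt_def]
  show "phi_unt i e \<in> Mor (Phi_cat C AA)" "Dom (phi_unt i e) = i" "Cod (phi_unt i e) = i"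
    "sect AA (phi_unt i e) = unt AA i \<cdot> e" using R by (simp_all add: phi_unt_def)
qed

text \<open>Restriction in \<open>Phi_cat\<close>, read off from the domain of the underlying
  section before inverses are available; \<open>phi_cinv\<close> later identifies it with the
  restriction defined from inverses.\<close>

definition phi_rst where "phi_rst a = phi_unt (Dom a) (Rst C (sect AA a))"

lemma phi_rst:
  assumes "a \<in> Mor (Phi_cat C AA)"
  shows "phi_rst a \<in> Mor (Phi_cat C AA)" "Dom (phi_rst a) = Dom a" "Cod (phi_rst a) = Dom a"
    "sect AA (phi_rst a) = unt AA (Dom a) \<cdot> Rst C (sect AA a)"
  unfolding phi_rst_def by (rule phi_unt; use phi_morD[OF assms] in simp)+

lemma phi_cmp_unt:
  assumes "a \<in> Mor (Phi_cat C AA)" "e \<in> rst_idem C (obj AA (Dom a))"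
  shows "sect AA (a \<odot> phi_unt (Dom a) e) = sect AA a \<cdot> e"
  using phi_cmp(4)[of "phi_unt (Dom a) e" a] phi_unt[of "Dom a" e] assms phi_morD[OF assms(1)]
    scomp_unt_right[of "Dom a" "Cod a" "sect AA a" e] by simp

definition phi_rcat where
  "phi_rcat = \<lparr>Ob = idx AA, Mor = Mor (Phi_cat C AA), Idt = Idt (Phi_cat C AA),
     Cmp = Cmp (Phi_cat C AA), Rst = phi_rst\<rparr>"

lemma phi_rcat_simps [simp]:
  "Ob phi_rcat = idx AA" "Mor phi_rcat = Mor (Phi_cat C AA)" "Idt phi_rcat = Idt (Phi_cat C AA)"
  "Cmp phi_rcat = Cmp (Phi_cat C AA)" "Rst phi_rcat = phi_rst" "Hom phi_rcat = Hom (Phi_cat C AA)"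
  by (auto simp: phi_rcat_def Hom_def fun_eq_iff)

text \<open>A map of \<open>Phi_cat\<close> is determined by its endpoints and its section, so each
  axiom becomes an equation of sections in \<open>C\<close>, settled by the formulas for
  \<open>scomp\<close> with a unit cut down to an idempotent.\<close>

lemma phi_restriction_category: "restriction_category phi_rcat"
proof
  note [simp] = phi_cmp(1-3) phi_rst(1-3)
  fix f g X Y Z
  show "Dom f \<in> Ob phi_rcat \<and> Cod f \<in> Ob phi_rcat" if "f \<in> Mor phi_rcat"
    using that phi_morD by simp
  show idt: "Idt phi_rcat X \<in> Hom phi_rcat X X" if "X \<in> Ob phi_rcat" for X
  proof -
    have "Idt (Phi_cat C AA) X = phi_unt X (Idt C (obj AA X))" using that by (simp add: Phi_cat_def phi_unt_def)
    then show ?thesis using phi_unt[of X "Idt C (obj AA X)"] that by (simp add: Hom_def)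
  qed
  show "g \<cdot>\<^bsub>phi_rcat\<^esub> f \<in> Hom phi_rcat X Z" if "f \<in> Hom phi_rcat X Y" "g \<in> Hom phi_rcat Y Z"
    using that by (auto simp: Hom_def)
  show "(h \<cdot>\<^bsub>phi_rcat\<^esub> g) \<cdot>\<^bsub>phi_rcat\<^esub> f = h \<cdot>\<^bsub>phi_rcat\<^esub> g \<cdot>\<^bsub>phi_rcat\<^esub> f"
    if "f \<in> Hom phi_rcat X Y" "g \<in> Hom phi_rcat Y Z" "h \<in> Hom phi_rcat Z W" for h W
  proof (rule sect_inj)
    have [simp]: "f \<in> Mor (Phi_cat C AA)" "g \<in> Mor (Phi_cat C AA)" "h \<in> Mor (Phi_cat C AA)"
      and *: "Dom g = Cod f" "Dom h = Cod g"
      using that by (auto simp: Hom_def)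
    show "sect AA ((h \<cdot>\<^bsub>phi_rcat\<^esub> g) \<cdot>\<^bsub>phi_rcat\<^esub> f) = sect AA (h \<cdot>\<^bsub>phi_rcat\<^esub> g \<cdot>\<^bsub>phi_rcat\<^esub> f)"
      using * scomp_assoc[of "Dom f" "Dom g" "Dom h" "Cod h" "sect AA f" "sect AA g" "sect AA h"]
        phi_morD[of f] phi_morD[of g] phi_morD[of h] by (simp add: phi_cmp(4))
  qed (use that in \<open>simp_all add: Hom_def\<close>)
  show "f \<cdot>\<^bsub>phi_rcat\<^esub> Idt phi_rcat X = f" if "f \<in> Hom phi_rcat X Y"
  proof -
    have f [simp]: "f \<in> Mor (Phi_cat C AA)" "Dom f = X" using that by (auto simp: Hom_def)
    have X: "X \<in> idx AA" using phi_morD(1)[OF f(1)] by simp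
    then have I: "Idt (Phi_cat C AA) X = phi_unt (Dom f) (Idt C (obj AA X))" by (simp add: Phi_cat_def phi_unt_def)
    show ?thesis
      by (rule sect_inj) (use phi_cmp_unt[OF f(1), of "Idt C (obj AA X)"] phi_unt[OF X, of "Idt C (obj AA X)"] X phi_morD[OF f(1)] in \<open>simp_all add: I\<close>)
  qed
  show "Idt phi_rcat Y \<cdot>\<^bsub>phi_rcat\<^esub> f = f" if "f \<in> Hom phi_rcat X Y"
  proof -
    have f [simp]: "f \<in> Mor (Phi_cat C AA)" "Cod f = Y" using that by (auto simp: Hom_def)
    have Y [simp]: "Y \<in> idx AA" using phi_morD(2)[OF f(1)] by simp
    have I: "Idt (Phi_cat C AA) Y \<in> Mor (Phi_cat C AA)" using idt[of Y] Y by (simp add: Hom_def)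
    have "scomp C AA (Dom f) Y Y (unt AA Y \<cdot> Idt C (obj AA Y)) (sect AA f) = sect AA f"
      using scomp_unt_left[of "Dom f" Y "sect AA f" "Idt C (obj AA Y)"] phi_morD[OF f(1)] by simp
    then show ?thesis
      by (intro sect_inj) (use I phi_morD[OF f(1)] in \<open>simp_all add: phi_cmp(4) phi_idt\<close>)
  qed
  show "Rst phi_rcat f \<in> Hom phi_rcat X X" if "f \<in> Hom phi_rcat X Y"
    using that by (auto simp: Hom_def)
  show "f \<cdot>\<^bsub>phi_rcat\<^esub> Rst phi_rcat f = f" if "f \<in> Hom phi_rcat X Y"
  proof (rule sect_inj)
    have f: "f \<in> Mor (Phi_cat C AA)" using that by (auto simp: Hom_def)
    show "sect AA (f \<cdot>\<^bsub>phi_rcat\<^esub> Rst phi_rcat f) = sect AA f"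
      using phi_cmp_unt[OF f, of "Rst C (sect AA f)"] phi_morD[OF f] by (simp add: phi_rst_def)
  qed (use that in \<open>auto simp: Hom_def\<close>)
  have rr: "sect AA (phi_rst f \<cdot>\<^bsub>phi_rcat\<^esub> phi_rst g) = unt AA X \<cdot> Rst C (sect AA f) \<cdot> Rst C (sect AA g)"
    if "f \<in> Mor (Phi_cat C AA)" "g \<in> Mor (Phi_cat C AA)" "Dom f = X" "Dom g = X" for f g X
    using phi_cmp_unt[OF phi_rst(1)[OF that(1)], of "Rst C (sect AA g)"] phi_morD[OF that(1)] phi_morD[OF that(2)] that
      phi_rst[OF that(1)] by (simp add: phi_rst_def[of g])
  show "Rst phi_rcat f \<cdot>\<^bsub>phi_rcat\<^esub> Rst phi_rcat g = Rst phi_rcat g \<cdot>\<^bsub>phi_rcat\<^esub> Rst phi_rcat f"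
    if "f \<in> Hom phi_rcat X Y" "g \<in> Hom phi_rcat X Z"
  proof (rule sect_inj)
    have f: "f \<in> Mor (Phi_cat C AA)" "Dom f = X" and g: "g \<in> Mor (Phi_cat C AA)" "Dom g = X"
      using that by (auto simp: Hom_def)
    have "Rst C (sect AA f) \<cdot> Rst C (sect AA g) = Rst C (sect AA g) \<cdot> Rst C (sect AA f)"
      by (rule rst_comm) (use f g phi_morD[OF f(1)] phi_morD[OF g(1)] in simp_all)
    then show "sect AA (Rst phi_rcat f \<cdot>\<^bsub>phi_rcat\<^esub> Rst phi_rcat g) = sect AA (Rst phi_rcat g \<cdot>\<^bsub>phi_rcat\<^esub> Rst phi_rcat f)"
      using rr[OF f(1) g(1) f(2) g(2)] rr[OF g(1) f(1) g(2) f(2)] by simp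
  qed (use that in \<open>simp_all add: Hom_def\<close>)
  show "Rst phi_rcat (g \<cdot>\<^bsub>phi_rcat\<^esub> Rst phi_rcat f) = Rst phi_rcat g \<cdot>\<^bsub>phi_rcat\<^esub> Rst phi_rcat f"
    if "f \<in> Hom phi_rcat X Y" "g \<in> Hom phi_rcat X Z"
  proof (rule sect_inj)
    have f: "f \<in> Mor (Phi_cat C AA)" "Dom f = X" and g: "g \<in> Mor (Phi_cat C AA)" "Dom g = X"
      using that by (auto simp: Hom_def)
    note [simp] = phi_morD[OF f(1)] phi_morD[OF g(1)]
    have "sect AA (g \<cdot>\<^bsub>phi_rcat\<^esub> phi_rst f) = sect AA g \<cdot> Rst C (sect AA f)"
      using phi_cmp_unt[OF g(1), of "Rst C (sect AA f)"] f g by (simp add: phi_rst_def)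
    then show "sect AA (Rst phi_rcat (g \<cdot>\<^bsub>phi_rcat\<^esub> Rst phi_rcat f)) =
        sect AA (Rst phi_rcat g \<cdot>\<^bsub>phi_rcat\<^esub> Rst phi_rcat f)"
      using rr[OF g(1) f(1) g(2) f(2)] f g by (simp add: phi_rst(4))
  qed (use that in \<open>simp_all add: Hom_def\<close>)
  show "Rst phi_rcat g \<cdot>\<^bsub>phi_rcat\<^esub> f = f \<cdot>\<^bsub>phi_rcat\<^esub> Rst phi_rcat (g \<cdot>\<^bsub>phi_rcat\<^esub> f)"
    if "f \<in> Hom phi_rcat X Y" "g \<in> Hom phi_rcat Y Z"
  proof (rule sect_inj)
    have f: "f \<in> Mor (Phi_cat C AA)" "Dom g = Cod f" and g: "g \<in> Mor (Phi_cat C AA)"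
      using that by (auto simp: Hom_def)
    note F [simp] = phi_morD[OF f(1)] and G [simp] = phi_morD[OF g]
    let ?r = "Rst C (sect AA g \<cdot> tgt AA (Dom f) (Cod f) \<cdot> sect AA f)"
    have "sect AA (f \<cdot>\<^bsub>phi_rcat\<^esub> Rst phi_rcat (g \<cdot>\<^bsub>phi_rcat\<^esub> f)) = sect AA f \<cdot> Rst C (sect AA (g \<cdot>\<^bsub>phi_rcat\<^esub> f))"
      using phi_cmp_unt[OF f(1), of "Rst C (sect AA (g \<cdot>\<^bsub>phi_rcat\<^esub> f))"] f g phi_morD(5)[OF phi_cmp(1)[OF f(1) g]]
      by (simp add: phi_rst_def)
    also have "Rst C (sect AA (g \<cdot>\<^bsub>phi_rcat\<^esub> f)) = ?r"
      using f g scomp_simps(4)[OF F(1,2) G(2) F(3), of "sect AA g"] G(3) by (simp add: phi_cmp(4))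
    also have "sect AA f \<cdot> ?r = sect AA (Rst phi_rcat g \<cdot>\<^bsub>phi_rcat\<^esub> f)"
      using scomp_unt_left[OF F(1,2,3), of "Rst C (sect AA g)"] f g G by (simp add: phi_cmp(4) phi_rst)
    finally show "sect AA (Rst phi_rcat g \<cdot>\<^bsub>phi_rcat\<^esub> f) = sect AA (f \<cdot>\<^bsub>phi_rcat\<^esub> Rst phi_rcat (g \<cdot>\<^bsub>phi_rcat\<^esub> f))"
      by simp
  qed (use that in \<open>simp_all add: Hom_def\<close>)
qed

end

context join_restriction_category
begin

text \<open>The sheets of a cover are also sections of the identity. Composing another cover with
  this one cuts its sections down to these sheets.\<close>

lemma cover_refine_idt:
  assumes "covering C p J t d" shows "cover C (Idt C (Dom p)) J d"
proof -
  interpret covering C p J t d by fact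
  show ?thesis by (rule coverI[of _ _ _ d]) (use join_d d_idem in simp_all)
qed

lemma cover_iso:
  assumes f: "f \<in> Mor C" and g: "g \<in> Hom C (Cod f) (Dom f)" "f \<cdot> g = Idt C (Cod f)" "g \<cdot> f = Idt C (Dom f)"
  shows "cover C f {()} (\<lambda>_. g)"
proof (rule coverI[of _ _ _ "\<lambda>_. Idt C (Dom f)"])
  have [simp]: "g \<in> Mor C" "Dom g = Cod f" "Cod g = Dom f" using g by (auto simp: Hom_def)
  have R: "Rst C x = Idt C (Dom x)" if "x \<in> Mor C" "y \<in> Mor C" "Cod x = Dom y" "y \<cdot> x = Idt C (Dom x)" for x y
    using rst_absorb(1)[of x y] that by simp
  show "Rst C f = Idt C (Dom f)" using R[of f g] f g by simp
  have "Rst C g = Idt C (Cod f)" using R[of g f] f g by simp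
  then show "a \<in> {()} \<Longrightarrow> g \<in> Mor C \<and> Dom g = Cod f \<and> Cod g = Dom f \<and> f \<cdot> g = Rst C g" for a
    using g by simp
  show "is_join C (Dom f) (Dom f) ((\<lambda>_. Idt C (Dom f)) ` {()}) (Idt C (Dom f))"
    using f by (auto simp: is_join_def Hom_def rle_refl)
qed (use f g in \<open>simp_all add: Hom_def\<close>)

text \<open>The inverse is the join \<open>k\<close> of the partial inverses, which exists as they
  are compatible. On each piece \<open>k \<cdot> f = Rst C f\<close>, because \<open>k\<close>
  extends the inverse of \<open>f\<close>.\<close>

lemma partial_iso_join:
  assumes j: "is_join C A B F h" and g: "\<And>f. f \<in> F \<Longrightarrow> partial_inverse C f (g f)"
    and comp: "\<And>f f'. f \<in> F \<Longrightarrow> f' \<in> F \<Longrightarrow> compat C (g f) (g f')"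
  shows "partial_iso C h"
proof -
  note h [simp] = is_joinD(2-4)[OF j]
  have F: "f \<in> Mor C" "Dom f = A" "Cod f = B" if "f \<in> F" for f
    using is_joinD(1)[OF j] that by (auto simp: Hom_def)
  have "A \<in> Ob C" "B \<in> Ob C" using dom_ob[OF h(1)] cod_ob[OF h(1)] by simp_all
  moreover have "g ` F \<subseteq> Hom C B A" using partial_inverseD[OF g] F by (auto simp: Hom_def)
  moreover have "compat C x y" if "x \<in> g ` F" "y \<in> g ` F" for x y using comp that by auto
  ultimately obtain k where k: "is_join C B A (g ` F) k" using join_exists[of B A "g ` F"] by blast
  have half: "k \<cdot> h = Rst C h" if j: "is_join C A B F h" and k: "is_join C B A G k"
    and FG: "\<And>f. f \<in> F \<Longrightarrow> \<exists>g \<in> G. partial_inverse C f g" for A B F G h k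
  proof -
    note [simp] = is_joinD(2-4)[OF j] is_joinD(2-4)[OF k]
    have "(k \<cdot> h) \<cdot> Rst C h = Rst C h \<cdot> Rst C h"
    proof (rule join_eq_rst[OF j])
      fix f assume f: "f \<in> F"
      then obtain g where g: "g \<in> G" "partial_inverse C f g" using FG by blast
      note P [simp] = partial_inverseD[OF g(2)]
      note hf = rleD[OF is_joinD(5)[OF j f]] and kg = rleD[OF is_joinD(5)[OF k g(1)]]
      have "k \<cdot> f = k \<cdot> f \<cdot> Rst C f" by simp
      also have "... = k \<cdot> (f \<cdot> g) \<cdot> f" using P(1-5) by (simp del: P(6))
      also have "... = (k \<cdot> Rst C g) \<cdot> f" using kg(1-4) by simp
      also have "... = Rst C f" unfolding kg(5) by simp
      finally have "k \<cdot> f = Rst C f" .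
      then show "(k \<cdot> h) \<cdot> Rst C f = Rst C h \<cdot> Rst C f"
        using hf rle_rst(1)[OF is_joinD(5)[OF j f]] by simp
    qed (simp_all add: Hom_def)
    then show ?thesis by simp
  qed
  have 1: "k \<cdot> h = Rst C h" by (rule half[OF j k]) (use g in blast)
  have 2: "h \<cdot> k = Rst C k" by (rule half[OF k j]) (use partial_inverse_sym[OF g] in blast)
  show ?thesis unfolding partial_iso_def
    by (rule exI[of _ k], rule partial_inverseI) (use 1 2 is_joinD(2-4)[OF k] in simp_all)
qed

end

section \<open>The sections of an etale groupoid form a join inverse category\<close>

locale internal_groupoid = internal_category C AA
  for C :: "('o, 'm) rcat" (structure) and AA :: "('i, 'o, 'm) pcat" +
  fixes \<iota> :: "'i \<Rightarrow> 'i \<Rightarrow> ('o, 'm) arr"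
  assumes inv: "i \<in> idx AA \<Longrightarrow> j \<in> idx AA \<Longrightarrow>
      \<iota> i j \<in> Hom C (mob AA i j) (mob AA j i) \<and> total_map C (\<iota> i j) \<and>
      \<iota> i j \<cdot> \<iota> j i = Idt C (mob AA j i) \<and> src AA j i \<cdot> \<iota> i j = tgt AA i j \<and>
      mul AA i j i \<cdot> pair C (src AA j i) (tgt AA i j) (\<iota> i j) (Idt C (mob AA i j)) = unt AA i \<cdot> src AA i j"
    and homeo: "i \<in> idx AA \<Longrightarrow> j \<in> idx AA \<Longrightarrow> local_homeo C (src AA i j)"

lemma etale_groupoid_internal:
  assumes "etale_groupoid \<kappa> C AA" "join_restriction_category C"
  obtains \<iota> where "internal_groupoid C AA \<iota>"
proof -
  have p: "partite_category C AA" using assms by (simp add: etale_groupoid_def partite_groupoid_def)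
  obtain \<iota> where i: "\<forall>i \<in> idx AA. \<forall>j \<in> idx AA.
      \<iota> i j \<in> Hom C (mob AA i j) (mob AA j i) \<and> total_map C (\<iota> i j) \<and>
      \<iota> i j \<cdot>\<^bsub>C\<^esub> \<iota> j i = Idt C (mob AA j i) \<and> src AA j i \<cdot>\<^bsub>C\<^esub> \<iota> i j = tgt AA i j \<and>
      mul AA i j i \<cdot>\<^bsub>C\<^esub> pair C (src AA j i) (tgt AA i j) (\<iota> i j) (Idt C (mob AA i j)) = unt AA i \<cdot>\<^bsub>C\<^esub> src AA i j"
    using assms(1) unfolding etale_groupoid_def partite_groupoid_def by blast
  have "internal_groupoid C AA \<iota>"
  proof (intro internal_groupoid.intro internal_category.intro internal_groupoid_axioms.intro)
    show "local_homeo C (src AA i j)" if "i \<in> idx AA" "j \<in> idx AA" for i j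
      using assms(1) that by (simp add: etale_groupoid_def)
  qed (use p assms(2) i in blast)+
  then show ?thesis using that by blast
qed

context internal_groupoid
begin

lemma inv_simps [simp]:
  assumes "i \<in> idx AA" "j \<in> idx AA"
  shows "\<iota> i j \<in> Mor C" "Dom (\<iota> i j) = mob AA i j" "Cod (\<iota> i j) = mob AA j i"
    "Rst C (\<iota> i j) = Idt C (mob AA i j)" "\<iota> j i \<cdot> \<iota> i j = Idt C (mob AA i j)"
    "src AA j i \<cdot> \<iota> i j = tgt AA i j"
  using inv[OF assms] inv[OF assms(2,1)] by (auto simp: Hom_def total_iff)

lemma inv_assoc [simp]:
  assumes "i \<in> idx AA" "j \<in> idx AA" "x \<in> Mor C" "Cod x = mob AA i j"
  shows "\<iota> j i \<cdot> \<iota> i j \<cdot> x = x" "src AA j i \<cdot> \<iota> i j \<cdot> x = tgt AA i j \<cdot> x"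
    "tgt AA j i \<cdot> \<iota> i j \<cdot> x = src AA i j \<cdot> x" "Rst C (\<iota> i j \<cdot> x) = Rst C x"
proof -
  show 1: "\<iota> j i \<cdot> \<iota> i j \<cdot> x = x"
    using cmp_rw[OF inv_simps(5)[OF assms(1,2)], of x] assms by simp
  show "src AA j i \<cdot> \<iota> i j \<cdot> x = tgt AA i j \<cdot> x"
    using cmp_rw[OF inv_simps(6)[OF assms(1,2)], of x] assms by simp
  show "tgt AA j i \<cdot> \<iota> i j \<cdot> x = src AA i j \<cdot> x"
    using cmp_rw[OF inv_simps(6)[OF assms(2,1)], of "\<iota> i j \<cdot> x"] assms 1 by simp
  show "Rst C (\<iota> i j \<cdot> x) = Rst C x"
    using rst_cmp_total[of x "\<iota> i j"] assms by simp
qed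

text \<open>The second law is the first at \<open>\<iota> i j \<cdot> u\<close>, inversion being an
  involution that exchanges source and target.\<close>

lemma gmul_inv:
  assumes [simp]: "i \<in> idx AA" "j \<in> idx AA" "u \<in> Mor C" "Cod u = mob AA i j"
  shows "gmul C AA i j i (\<iota> i j \<cdot> u) u = unt AA i \<cdot> src AA i j \<cdot> u"
    and "gmul C AA j i j u (\<iota> i j \<cdot> u) = unt AA j \<cdot> tgt AA i j \<cdot> u"
proof -
  have *: "gmul C AA i j i (\<iota> i j \<cdot> u) u = unt AA i \<cdot> src AA i j \<cdot> u"
    if [simp]: "i \<in> idx AA" "j \<in> idx AA" "u \<in> Mor C" "Cod u = mob AA i j" for i j u
  proof -
    have "gmul C AA i j i (\<iota> i j) (Idt C (mob AA i j)) \<cdot> u = (unt AA i \<cdot> src AA i j) \<cdot> u"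
      using inv[of i j] by (simp add: gmul_def)
    then show ?thesis by (subst (asm) gmul_cmp) simp_all
  qed
  show "gmul C AA i j i (\<iota> i j \<cdot> u) u = unt AA i \<cdot> src AA i j \<cdot> u" by (rule *) simp_all
  show "gmul C AA j i j u (\<iota> i j \<cdot> u) = unt AA j \<cdot> tgt AA i j \<cdot> u"
    using *[of j i "\<iota> i j \<cdot> u"] by simp
qed

text \<open>The target \<open>tgt AA i j = src AA j i \<cdot> \<iota> i j\<close> is a local
  homeomorphism as well. Sections covering the source, cut down to the sheets of the target, have
  partial isomorphisms as composites with the target. They still cover, and all other maps of
  \<open>Phi_cat\<close> may be added by \<open>cover_extend\<close>.\<close>

lemma section_cover:
  assumes [simp]: "i \<in> idx AA" "j \<in> idx AA"
  shows "cover C (src AA i j) (Hom (Phi_cat C AA) i j) (sect AA)"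
proof -
  obtain I :: "('o, 'm) arr set" and s where c: "cover C (src AA i j) I s"
    using local_homeo_cover[OF homeo[of i j]] by auto
  obtain J :: "('o, 'm) arr set" and t where cJ: "cover C (src AA j i) J t"
    using local_homeo_cover[OF homeo[of j i]] by auto
  have "cover C (\<iota> i j) {()} (\<lambda>_. \<iota> j i)"
    by (rule cover_iso) (simp_all add: Hom_def)
  from cover_cmp[OF cJ this] have "cover C (tgt AA i j) (J \<times> {()}) (\<lambda>(a, b). \<iota> j i \<cdot> t a)" by simp
  then obtain d where "covering C (tgt AA i j) (J \<times> {()}) (\<lambda>(a, b). \<iota> j i \<cdot> t a) d" by (rule coverE)
  then interpret T: covering C "tgt AA i j" "J \<times> {()}" "\<lambda>(a, b). \<iota> j i \<cdot> t a" d .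
  have "cover C (Idt C (mob AA i j)) (J \<times> {()}) d" using cover_refine_idt[OF T.covering_axioms] by simp
  from cover_cmp[OF c this] have cc: "cover C (src AA i j) (I \<times> (J \<times> {()})) (\<lambda>(a, b). d b \<cdot> s a)" by simp
  show ?thesis
  proof (rule cover_extend[OF cc])
    show "psec i j (sect AA a)" if "a \<in> Hom (Phi_cat C AA) i j" for a
      using phi_morD(3)[of a] that by (auto simp: Hom_def)
    fix x assume x: "x \<in> I \<times> (J \<times> {()})"
    then obtain a b where ab: "x = (a, b)" "a \<in> I" "b \<in> J \<times> {()}" by blast
    have ps: "psec i j (d b \<cdot> s a)" using cover_section[OF cc x] ab by simp
    note S [simp] = psecD(1-3)[OF cover_section[OF c ab(2)], OF assms]
    obtain e where "partial_inverse C (s a) (src AA i j \<cdot> e)"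
      using cover_any_section[OF c cover_section[OF c ab(2)]] by blast
    then have 1: "partial_iso C (s a)" by (auto simp: partial_iso_def)
    have d [simp]: "d b \<in> Mor C" "Dom (d b) = mob AA i j" "Cod (d b) = mob AA i j"
      using T.d_simps(1-3)[OF ab(3)] by simp_all
    have "partial_inverse C (tgt AA i j \<cdot> d b) ((\<lambda>(a, b). \<iota> j i \<cdot> t a) b)"
      by (rule partial_inverseI)
        (use T.s_simps(1-4)[OF ab(3)] T.spd[OF ab(3)] T.ds[OF ab(3)] T.d_simps[OF ab(3)] rst_cmp_total[of "d b" "tgt AA i j"]
          in simp_all)
    then have 2: "partial_iso C (tgt AA i j \<cdot> d b)" by (auto simp: partial_iso_def)
    have "partial_iso C (tgt AA i j \<cdot> d b \<cdot> s a)" using partial_iso_cmp[OF 1 2] by simp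
    note A = phi_ArrI[OF assms ps this]
    then have "Arr i (Lab (d b \<cdot> s a)) j \<in> Hom (Phi_cat C AA) i j" by (simp add: Hom_def)
    then show "\<exists>b \<in> Hom (Phi_cat C AA) i j. sect AA b = (case x of (a, b) \<Rightarrow> d b \<cdot> s a)"
      using A(2) ab by (intro bexI[of _ "Arr i (Lab (d b \<cdot> s a)) j"]) simp_all
  qed
qed

text \<open>With \<open>r\<close> the partial inverse of \<open>tgt AA i j \<cdot> s\<close>, the
  inverse of \<open>s\<close> is \<open>\<iota> i j \<cdot> s \<cdot> r\<close>: go back along
  \<open>r\<close>, take the arrow given by \<open>s\<close>, and invert it.\<close>

lemma phi_partial_inverse:
  assumes a: "a \<in> Mor (Phi_cat C AA)"
  shows "\<exists>b. partial_inverse phi_rcat a b"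
proof -
  interpret R: restriction_category phi_rcat by (rule phi_restriction_category)
  define i j s where "i = Dom a" and "j = Cod a" and "s = sect AA a"
  note A = phi_morD[OF a, folded i_def j_def, folded s_def]
  note [simp] = A(1,2) and S [simp] = psecD[OF A(3,1,2)]
  obtain r where r: "partial_inverse C (tgt AA i j \<cdot> s) r" using A(4) by (auto simp: partial_iso_def)
  note r' = partial_inverseD[OF r]
  have r1 [simp]: "r \<in> Mor C" "Dom r = obj AA j" "Cod r = obj AA i" using r'(2-4) by simp_all
  have r2: "r \<cdot> tgt AA i j \<cdot> s = Rst C s" "tgt AA i j \<cdot> s \<cdot> r = Rst C r" using r'(5,6) by simp_all
  have r3: "Rst C s \<cdot> r = r" using cmp_rw[OF r'(5), of r] r2 by simp
  have Rsr: "Rst C (s \<cdot> r) = Rst C r" using rst_src_cmp(2)[of i j "s \<cdot> r"] r2 by simp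
  let ?t = "\<iota> i j \<cdot> s \<cdot> r"
  have ts: "src AA j i \<cdot> ?t = Rst C r" "tgt AA j i \<cdot> ?t = r" "Rst C ?t = Rst C r"
    using r2 r3 Rsr by simp_all
  have pt: "psec j i ?t" by (rule partial_sectionI) (use ts in simp_all)
  have "partial_iso C (tgt AA j i \<cdot> ?t)"
    unfolding ts partial_iso_def using partial_inverse_sym[OF r] by blast
  note B = phi_ArrI[OF A(2,1) pt this]
  define b where "b = Arr j (Lab ?t) i"
  have b: "b \<in> Mor (Phi_cat C AA)" "sect AA b = ?t" "Dom b = j" "Cod b = i" using B by (simp_all add: b_def)
  have tt: "?t \<cdot> tgt AA i j \<cdot> s = \<iota> i j \<cdot> s" using r2 by simp
  have "scomp C AA i j i ?t s = gmul C AA i j i (\<iota> i j \<cdot> s) s" unfolding scomp_def tt by simp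
  then have 1: "scomp C AA i j i ?t s = unt AA i \<cdot> Rst C s" using gmul_inv(1)[of i j s] by simp
  have "s \<cdot> tgt AA j i \<cdot> ?t = s \<cdot> r" unfolding ts ..
  moreover have "?t \<cdot> Rst C (s \<cdot> r) = \<iota> i j \<cdot> s \<cdot> r" unfolding Rsr by simp
  ultimately have "scomp C AA j i j s ?t = gmul C AA j i j (s \<cdot> r) (\<iota> i j \<cdot> s \<cdot> r)" by (simp only: scomp_def)
  then have 2: "scomp C AA j i j s ?t = unt AA j \<cdot> Rst C r" using gmul_inv(2)[of i j "s \<cdot> r"] r2 by simp
  have "partial_inverse phi_rcat a b"
  proof (rule R.partial_inverseI)
    show "b \<cdot>\<^bsub>phi_rcat\<^esub> a = Rst phi_rcat a"
      by (rule sect_inj)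
        (use phi_cmp[OF a b(1)] phi_rst[OF a] b 1 in \<open>simp_all add: i_def[symmetric] j_def[symmetric] s_def[symmetric]\<close>)
    show "a \<cdot>\<^bsub>phi_rcat\<^esub> b = Rst phi_rcat b"
      by (rule sect_inj)
        (use phi_cmp[OF b(1) a] phi_rst[OF b(1)] b 2 ts in \<open>simp_all add: i_def[symmetric] j_def[symmetric] s_def[symmetric]\<close>)
  qed (use a b in \<open>simp_all add: i_def j_def\<close>)
  then show ?thesis by blast
qed

lemma phi_inverse_category: "inverse_category (Phi_cat C AA)"
  and phi_cinv: "a \<in> Mor (Phi_cat C AA) \<Longrightarrow> cinv (Phi_cat C AA) a \<odot> a = phi_rst a"
proof -
  have *: "Ob phi_rcat = Ob (Phi_cat C AA)" by simp
  note I = inverse_category_of_partial_isos[OF phi_restriction_category *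
      phi_rcat_simps(2-4) phi_partial_inverse]
  show "inverse_category (Phi_cat C AA)" by (rule I(1))
  show "a \<in> Mor (Phi_cat C AA) \<Longrightarrow> cinv (Phi_cat C AA) a \<odot> a = phi_rst a"
    using I(3) by simp
qed

sublocale Phi: inverse_category "Phi_cat C AA" by (rule phi_inverse_category)
sublocale PhiR: restriction_category "inv_rcat (Phi_cat C AA)" by (rule Phi.inv_restriction_category)

lemma phi_cmp_rst:
  assumes "a \<in> Mor (Phi_cat C AA)" "b \<in> Mor (Phi_cat C AA)" "Dom a = Dom b"
  shows "sect AA (b \<odot> phi_rst a) = sect AA b \<cdot> Rst C (sect AA a)"
    "Dom (b \<odot> phi_rst a) = Dom a" "Cod (b \<odot> phi_rst a) = Cod b"
  using phi_cmp_unt[OF assms(2), of "Rst C (sect AA a)"] phi_cmp(2,3)[OF phi_rst(1)[OF assms(1)] assms(2)]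
    phi_morD[OF assms(1)] phi_rst[OF assms(1)] assms(3) by (simp_all add: phi_rst_def)

lemma phi_rle:
  "rle (inv_rcat (Phi_cat C AA)) a b \<longleftrightarrow> a \<in> Mor (Phi_cat C AA) \<and> b \<in> Mor (Phi_cat C AA) \<and>
     Dom a = Dom b \<and> Cod a = Cod b \<and> rle C (sect AA a) (sect AA b)"
proof (cases "a \<in> Mor (Phi_cat C AA) \<and> b \<in> Mor (Phi_cat C AA) \<and> Dom a = Dom b \<and> Cod a = Cod b")
  case True
  then have t: "a \<in> Mor (Phi_cat C AA)" "b \<in> Mor (Phi_cat C AA)" "Dom a = Dom b" "Cod a = Cod b" by auto
  have "a = b \<odot> phi_rst a \<longleftrightarrow> sect AA a = sect AA b \<cdot> Rst C (sect AA a)"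
    using phi_cmp_rst[OF t(1-3)] sect_inj[of a "b \<odot> phi_rst a"] t by auto
  then show ?thesis using t phi_morD(5)[OF t(1)] phi_morD(5)[OF t(2)]
    by (simp add: rle_def parallel_def phi_cinv)
next
  case False
  then show ?thesis by (auto simp: rle_def parallel_def)
qed

lemma phi_compat:
  assumes "compat (inv_rcat (Phi_cat C AA)) a b"
  shows "compat C (sect AA a) (sect AA b)"
proof -
  have t: "a \<in> Mor (Phi_cat C AA)" "b \<in> Mor (Phi_cat C AA)" "Dom a = Dom b" "Cod a = Cod b"
    "a \<odot> phi_rst b = b \<odot> phi_rst a"
    using assms by (auto simp: PhiR.compat_iff phi_cinv)
  show ?thesis
    using phi_cmp_rst(1)[OF t(1-3)] phi_cmp_rst(1)[OF t(2,1) t(3)[symmetric]] t phi_morD(5)[OF t(1)] phi_morD(5)[OF t(2)]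
    by (simp add: compat_iff)
qed

lemma proj_simps [simp]:
  "fo (Phi_proj C AA) = obj AA" "fm (Phi_proj C AA) a = tgt AA (Dom a) (Cod a) \<cdot> sect AA a"
  by (simp_all add: Phi_proj_def)

lemma proj_functor: "is_functor (Phi_cat C AA) C (Phi_proj C AA)"
proof -
  have "tgt AA (Dom f) (Cod g) \<cdot> sect AA (g \<odot> f) =
      (tgt AA (Dom g) (Cod g) \<cdot> sect AA g) \<cdot> tgt AA (Dom f) (Cod f) \<cdot> sect AA f"
    if f: "f \<in> Mor (Phi_cat C AA)" and g: "g \<in> Mor (Phi_cat C AA)" and fg: "Cod f = Dom g" for f g
    using scomp_simps(5)[of "Dom f" "Cod f" "Cod g" "sect AA f" "sect AA g"] phi_morD[OF f] phi_morD[OF g] fg phi_cmp(4)[OF f g fg]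
    by simp
  then show ?thesis
    unfolding is_functor_def using phi_morD by (simp add: Hom_def phi_idt phi_cmp(2,3))
qed

lemma proj_rst:
  assumes a: "a \<in> Mor (Phi_cat C AA)"
  shows "fm (Phi_proj C AA) (phi_rst a) = Rst C (sect AA a)"
    "Rst C (fm (Phi_proj C AA) a) = Rst C (sect AA a)"
  using phi_rst[OF a] phi_morD[OF a] by simp_all

lemma proj_restriction_functor: "restriction_functor (inv_rcat (Phi_cat C AA)) C (Phi_proj C AA)"
proof -
  have "is_functor (inv_rcat (Phi_cat C AA)) C (Phi_proj C AA)"
    using proj_functor by (simp add: is_functor_def)
  then show ?thesis unfolding restriction_functor_def using proj_rst phi_cinv by simp
qed

lemma phi_idem:
  assumes [simp]: "i \<in> idx AA"
  shows "rst_idem (inv_rcat (Phi_cat C AA)) i = phi_unt i ` rst_idem C (obj AA i)"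
proof (intro equalityI subsetI)
  fix a assume "a \<in> rst_idem (inv_rcat (Phi_cat C AA)) i"
  then have a: "a \<in> Mor (Phi_cat C AA)" "Dom a = i" "cinv (Phi_cat C AA) a \<odot> a = a"
    unfolding rst_idem_def Hom_def inv_rcat_simps by blast+
  have "phi_rst a = a" using a(3) unfolding phi_cinv[OF a(1)] .
  with a(1,2) show "a \<in> phi_unt i ` rst_idem C (obj AA i)"
    using phi_morD(5)[OF a(1)] by (intro image_eqI[of _ _ "Rst C (sect AA a)"]) (simp_all add: phi_rst_def)
next
  fix a assume "a \<in> phi_unt i ` rst_idem C (obj AA i)"
  then obtain e where e: "e \<in> rst_idem C (obj AA i)" "a = phi_unt i e" by blast
  note p = phi_unt[OF assms e(1), folded e(2)]
  have "Rst C (unt AA i \<cdot> e) = e" by (metis rst_unt_cmp assms rst_idem_simps(1,3,4) e(1))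
  then have "phi_rst a = a" by (simp only: phi_rst_def p e(2)[symmetric])
  with phi_cinv[OF p(1)] have "cinv (Phi_cat C AA) a \<odot> a = a" by (rule trans)
  then show "a \<in> rst_idem (inv_rcat (Phi_cat C AA)) i"
    unfolding rst_idem_def Hom_def inv_rcat_simps using p(1-3) by blast
qed

lemma proj_unt: "i \<in> idx AA \<Longrightarrow> e \<in> rst_idem C (obj AA i) \<Longrightarrow> fm (Phi_proj C AA) (phi_unt i e) = e"
  by (simp add: phi_unt)

text \<open>On idempotents \<open>phi_unt i\<close> is inverse to the projection, since the target
  of a unit is the identity.\<close>

lemma proj_hyperconnected: "hyperconnected (inv_rcat (Phi_cat C AA)) C (Phi_proj C AA)"
  unfolding hyperconnected_def
proof
  fix i assume "i \<in> Ob (inv_rcat (Phi_cat C AA))"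
  then have [simp]: "i \<in> idx AA" by simp
  show "bij_betw (fm (Phi_proj C AA)) (rst_idem (inv_rcat (Phi_cat C AA)) i) (rst_idem C (fo (Phi_proj C AA) i))"
    unfolding phi_idem[OF \<open>i \<in> idx AA\<close>] proj_simps(1)
  proof (rule bij_betw_byWitness[of _ "phi_unt i"])
    show "fm (Phi_proj C AA) ` phi_unt i ` rst_idem C (obj AA i) \<subseteq> rst_idem C (obj AA i)"
      using proj_unt[of i] by (auto simp del: proj_simps(2))
  qed (simp_all add: proj_unt del: proj_simps(2))
qed

text \<open>By \<open>phi_rle\<close> the order of \<open>Phi_cat\<close> is the order of the
  underlying sections.\<close>

lemma phi_joinI:
  assumes F: "F \<subseteq> Hom (Phi_cat C AA) i j" and h: "h \<in> Hom (Phi_cat C AA) i j"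
    and j: "is_join C (obj AA i) (mob AA i j) (sect AA ` F) (sect AA h)"
  shows "is_join (inv_rcat (Phi_cat C AA)) i j F h"
  unfolding is_join_def
proof (intro conjI ballI impI)
  show "rle (inv_rcat (Phi_cat C AA)) f h" if "f \<in> F" for f
    using that F h is_joinD(5)[OF j, of "sect AA f"] by (auto simp: phi_rle Hom_def)
  fix k assume k: "k \<in> Hom (inv_rcat (Phi_cat C AA)) i j" "\<forall>f\<in>F. rle (inv_rcat (Phi_cat C AA)) f k"
  have k': "k \<in> Mor (Phi_cat C AA)" "Dom k = i" "Cod k = j" using k(1) by (auto simp: Hom_def)
  have "rle C (sect AA h) (sect AA k)"
    by (rule is_joinD(6)[OF j]) (use k k' phi_morD(5)[OF k'(1)] in \<open>auto simp: Hom_def phi_rle\<close>)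
  then show "rle (inv_rcat (Phi_cat C AA)) h k" using h k' by (auto simp: phi_rle Hom_def)
qed (use F h in simp_all)

text \<open>A join of sections of the source is again a section, because postcomposition preserves
  joins. Its composite with the target is a partial isomorphism by \<open>partial_iso_join\<close>;
  the compatibility of inverses required there is the second half of bicompatibility, transported by
  the projection functor.\<close>

lemma phi_join_exists:
  assumes i [simp]: "i \<in> idx AA" and j [simp]: "j \<in> idx AA" and F: "F \<subseteq> Hom (Phi_cat C AA) i j"
    and bi: "\<And>s t. s \<in> F \<Longrightarrow> t \<in> F \<Longrightarrow> bicompat (Phi_cat C AA) s t"
  shows "\<exists>h \<in> Hom (Phi_cat C AA) i j. is_join C (obj AA i) (mob AA i j) (sect AA ` F) (sect AA h)"
proof -
  have F': "a \<in> Mor (Phi_cat C AA)" "Dom a = i" "Cod a = j" if "a \<in> F" for a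
    using F that by (auto simp: Hom_def)
  have Fs: "sect AA a \<in> Mor C" "src AA i j \<cdot> sect AA a = Rst C (sect AA a)" if "a \<in> F" for a
    using phi_morD(5,6)[OF F'(1)[OF that]] F'[OF that] by simp_all
  have "sect AA ` F \<subseteq> Hom C (obj AA i) (mob AA i j)" using Fs F' by (auto simp: Hom_def)
  moreover have "compat C x y" if "x \<in> sect AA ` F" "y \<in> sect AA ` F" for x y
    using that bi phi_compat by (auto simp: bicompat_def)
  ultimately obtain s where s: "is_join C (obj AA i) (mob AA i j) (sect AA ` F) s"
    using join_exists[of "obj AA i" "mob AA i j" "sect AA ` F"] by auto
  note s' [simp] = is_joinD(2-4)[OF s]
  have "is_join C (obj AA i) (obj AA i) ((\<lambda>x. src AA i j \<cdot> x) ` sect AA ` F) (src AA i j \<cdot> s)"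
    by (rule join_postcomp[OF s]) (simp add: Hom_def)
  moreover have "(\<lambda>x. src AA i j \<cdot> x) ` sect AA ` F = Rst C ` sect AA ` F"
    using Fs(2) by (simp add: image_image)
  ultimately have "src AA i j \<cdot> s = Rst C s" using join_unique[OF _ join_rst[OF s]] by simp
  then have ps: "psec i j s" by (intro partial_sectionI) simp_all
  have jt: "is_join C (obj AA i) (obj AA j) ((\<lambda>x. tgt AA i j \<cdot> x) ` sect AA ` F) (tgt AA i j \<cdot> s)"
    by (rule join_postcomp[OF s]) (simp add: Hom_def)
  define P where "P = fm (Phi_proj C AA)"
  have P: "P a \<in> Mor C" "Dom (P a) = obj AA (Dom a)" "Cod (P a) = obj AA (Cod a)" if "a \<in> Mor (Phi_cat C AA)" for a
    using functorD(2-4)[OF proj_functor that] by (simp_all add: P_def)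
  have PR: "P (cinv (Phi_cat C AA) a \<odot> a) = Rst C (P a)" if "a \<in> Mor (Phi_cat C AA)" for a
    using proj_restriction_functor that by (simp add: restriction_functor_def P_def)
  have Pc: "P (g \<odot> f) = P g \<cdot> P f" if "f \<in> Mor (Phi_cat C AA)" "g \<in> Mor (Phi_cat C AA)" "Cod f = Dom g" for f g
    using functorD(6)[OF proj_functor that] by (simp only: P_def)
  have Pinv: "partial_inverse C (P a) (P (cinv (Phi_cat C AA) a))" if a: "a \<in> Mor (Phi_cat C AA)" for a
  proof (rule partial_inverseI)
    show "P (cinv (Phi_cat C AA) a) \<cdot> P a = Rst C (P a)" using Pc[of a "cinv (Phi_cat C AA) a"] PR a by simp
    show "P a \<cdot> P (cinv (Phi_cat C AA) a) = Rst C (P (cinv (Phi_cat C AA) a))"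
      using Pc[of "cinv (Phi_cat C AA) a" a] PR[of "cinv (Phi_cat C AA) a"] a by simp
  qed (use P a in simp_all)
  have Pcompat: "compat C (P a) (P b)" if ab: "compat (inv_rcat (Phi_cat C AA)) a b" for a b
  proof -
    have t: "a \<in> Mor (Phi_cat C AA)" "b \<in> Mor (Phi_cat C AA)" "Dom a = Dom b" "Cod a = Cod b"
      "a \<odot> (cinv (Phi_cat C AA) b \<odot> b) =
       b \<odot> (cinv (Phi_cat C AA) a \<odot> a)"
      using ab by (simp_all add: PhiR.compat_iff)
    have "P a \<cdot> Rst C (P b) = P b \<cdot> Rst C (P a)"
      using arg_cong[OF t(5), of P] Pc[of "cinv (Phi_cat C AA) b \<odot> b" a]
        Pc[of "cinv (Phi_cat C AA) a \<odot> a" b] PR t(1-4) by (simp add: PR)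
    then show ?thesis using P[OF t(1)] P[OF t(2)] t(3,4) by (simp add: compat_iff)
  qed
  have "partial_iso C (tgt AA i j \<cdot> s)"
  proof (rule partial_iso_join[OF jt])
    \<comment> \<open>The pieces of the join are maps of \<open>C\<close>, so the partial inverse is
      expressed as a function of such a map; by uniqueness it is the image of
      \<open>cinv\<close>.\<close>
    let ?g = "\<lambda>x. THE y. partial_inverse C x y"
    have g: "?g (P a) = P (cinv (Phi_cat C AA) a)" if "a \<in> Mor (Phi_cat C AA)" for a
      using Pinv[OF that] partial_inverse_unique by blast
    have x: "\<exists>a \<in> F. f = P a" if "f \<in> (\<lambda>x. tgt AA i j \<cdot> x) ` sect AA ` F" for f
      using that F' by (force simp: P_def)
    show "partial_inverse C f (?g f)" if "f \<in> (\<lambda>x. tgt AA i j \<cdot> x) ` sect AA ` F" for f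
      using x[OF that] g F' Pinv by auto
    show "compat C (?g f) (?g f')" if f: "f \<in> (\<lambda>x. tgt AA i j \<cdot> x) ` sect AA ` F" "f' \<in> (\<lambda>x. tgt AA i j \<cdot> x) ` sect AA ` F" for f f'
    proof -
      obtain a a' where a: "a \<in> F" "f = P a" "a' \<in> F" "f' = P a'" using x[OF f(1)] x[OF f(2)] by blast
      have "compat C (P (cinv (Phi_cat C AA) a)) (P (cinv (Phi_cat C AA) a'))"
        using Pcompat bi[OF a(1,3)] by (simp add: bicompat_def)
      then show ?thesis using a g F' by simp
    qed
  qed
  note A = phi_ArrI[OF i j ps this]
  show ?thesis
    by (rule bexI[of _ "Arr i (Lab s) j"]) (use A s in \<open>simp_all add: Hom_def\<close>)
qed

text \<open>As joins are unique, every join of \<open>Phi_cat\<close> has the join in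
  \<open>C\<close> as its section. Precomposition with \<open>k\<close> changes domains as
  precomposition in \<open>C\<close> with \<open>tgt AA l i \<cdot> sect AA k\<close> does, so the
  second axiom follows from the one of \<open>C\<close> by \<open>joinI\<close>.\<close>

lemma phi_join_inverse_category: "join_inverse_category (Phi_cat C AA)"
proof
  fix i j F assume ij: "i \<in> Ob (Phi_cat C AA)" "j \<in> Ob (Phi_cat C AA)" and F: "F \<subseteq> Hom (Phi_cat C AA) i j"
    and bi: "\<And>s t. s \<in> F \<Longrightarrow> t \<in> F \<Longrightarrow> bicompat (Phi_cat C AA) s t"
  obtain h where h: "h \<in> Hom (Phi_cat C AA) i j" "is_join C (obj AA i) (mob AA i j) (sect AA ` F) (sect AA h)"
    using phi_join_exists[OF ij[unfolded phi_ob] F bi] by blast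
  show "\<exists>h. is_join (inv_rcat (Phi_cat C AA)) i j F h"
    by (rule exI, rule phi_joinI[OF F h])
next
  fix F i j h k l
  assume bi: "\<And>s t. s \<in> F \<Longrightarrow> t \<in> F \<Longrightarrow> bicompat (Phi_cat C AA) s t"
    and J: "is_join (inv_rcat (Phi_cat C AA)) i j F h" and k: "k \<in> Hom (Phi_cat C AA) l i"
  have F: "F \<subseteq> Hom (Phi_cat C AA) i j" using PhiR.is_joinD(1)[OF J] by simp
  have h: "h \<in> Mor (Phi_cat C AA)" "Dom h = i" "Cod h = j" using PhiR.is_joinD(2-4)[OF J] by simp_all
  note k' = HomD[OF k]
  have idx [simp]: "i \<in> idx AA" "j \<in> idx AA" "l \<in> idx AA" using phi_morD(1,2)[OF h(1)] phi_morD(1)[OF k'(1)] h k' by auto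
  obtain h' where h': "h' \<in> Hom (Phi_cat C AA) i j" "is_join C (obj AA i) (mob AA i j) (sect AA ` F) (sect AA h')"
    using phi_join_exists[OF idx(1,2) F bi] by blast
  have "h' = h" using PhiR.join_unique[OF phi_joinI[OF F h'] J] .
  then have jC: "is_join C (obj AA i) (mob AA i j) (sect AA ` F) (sect AA h)" using h' by simp
  have F': "a \<in> Mor (Phi_cat C AA)" "Dom a = i" "Cod a = j" if "a \<in> F" for a
    using F that by (auto simp: Hom_def)
  have hk: "h \<odot> k \<in> Hom (Phi_cat C AA) l j" using phi_cmp(1-3)[OF k'(1) h(1)] h k' by (simp add: Hom_def)
  have Rs: "Rst C (sect AA (a \<odot> k)) = Rst C (sect AA a \<cdot> tgt AA l i \<cdot> sect AA k)"
    if "a \<in> Mor (Phi_cat C AA)" "Dom a = i" "Cod a = j" for a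
    using phi_cmp(4)[OF k'(1) that(1)] scomp_simps(4)[of l i j "sect AA k" "sect AA a"] phi_morD(3)[OF k'(1)] phi_morD(3)[OF that(1)] that k'
    by simp
  show "is_join (inv_rcat (Phi_cat C AA)) l j ((\<lambda>s. s \<odot> k) ` F) (h \<odot> k)"
  proof (rule phi_joinI[OF _ hk], goal_cases)
    case 1
    then show ?case using F' k' phi_cmp(1-3)[OF k'(1)] by (auto simp: Hom_def)
  next
    case 2
    show ?case
    proof (rule joinI)
      fix f assume "f \<in> sect AA ` (\<lambda>s. s \<odot> k) ` F"
      then obtain a where a: "a \<in> F" "f = sect AA (a \<odot> k)" by blast
      have "rle (inv_rcat (Phi_cat C AA)) (a \<cdot>\<^bsub>inv_rcat (Phi_cat C AA)\<^esub> k) (h \<cdot>\<^bsub>inv_rcat (Phi_cat C AA)\<^esub> k)"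
        by (rule PhiR.rle_cmp_right[OF PhiR.is_joinD(5)[OF J a(1)]]) (use k' h in simp_all)
      then show "rle C f (sect AA (h \<odot> k))" using a by (simp add: phi_rle)
    next
      show "sect AA (h \<odot> k) \<in> Hom C (obj AA l) (mob AA l j)"
        using hk phi_morD(5)[of "h \<odot> k"] by (simp add: Hom_def)
      have "is_join C (obj AA l) (mob AA i j) ((\<lambda>x. x \<cdot> tgt AA l i \<cdot> sect AA k) ` sect AA ` F) (sect AA h \<cdot> tgt AA l i \<cdot> sect AA k)"
        by (rule is_join_precomp[OF jC]) (use k' phi_morD(5)[OF k'(1)] in \<open>simp add: Hom_def\<close>)
      from join_rst[OF this] show "is_join C (obj AA l) (obj AA l) (Rst C ` sect AA ` (\<lambda>s. s \<odot> k) ` F)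
          (Rst C (sect AA (h \<odot> k)))"
        using Rs F' h by (simp add: image_image)
    qed
  qed
qed

text \<open>Smallness of hom-sets is inherited from \<open>C\<close>, into whose hom-sets
  \<open>sect AA\<close> embeds them.\<close>

lemma phi_over_object:
  assumes "small \<kappa> (idx AA)" "locally_small \<kappa> C"
  shows "over_object \<kappa> C (Phi_obj C AA)"
proof -
  have "small \<kappa> (Hom (Phi_cat C AA) i j)" if [simp]: "i \<in> idx AA" "j \<in> idx AA" for i j
  proof -
    have "inj_on (sect AA) (Hom (Phi_cat C AA) i j)"
      by (rule inj_onI, rule sect_inj) (auto simp: Hom_def)
    moreover have "sect AA ` Hom (Phi_cat C AA) i j \<subseteq> Hom C (obj AA i) (mob AA i j)"
      using phi_morD(5) by (auto simp: Hom_def)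
    moreover have "small \<kappa> (Hom C (obj AA i) (mob AA i j))" using assms(2) by (simp add: locally_small_def)
    ultimately show ?thesis unfolding small_def using card_of_ordLeqI ordLeq_ordLess_trans
      by (metis (no_types, lifting) card_of_ordLeq)
  qed
  then show ?thesis
    unfolding over_object_def Phi_obj_def
    using phi_join_inverse_category proj_restriction_functor proj_hyperconnected assms(1)
    by (simp add: locally_small_def)
qed

end

section \<open>The category over \<open>C\<close>\<close>

lemma over_objectD:
  assumes "over_object \<kappa> C (A, P)"
  shows "join_inverse_category A" "category A" "is_functor A C P" "small \<kappa> (Ob A)" "locally_small \<kappa> A"
    "restriction_functor (inv_rcat A) C P" "hyperconnected (inv_rcat A) C P"
proof -
  show j: "join_inverse_category A" and "small \<kappa> (Ob A)" "locally_small \<kappa> A"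
    and r: "restriction_functor (inv_rcat A) C P" and "hyperconnected (inv_rcat A) C P"
    using assms by (auto simp: over_object_def)
  show "category A" using j by (simp add: join_inverse_category_def inverse_category_def)
  show "is_functor A C P" using r by (simp add: restriction_functor_def is_functor_def)
qed

lemma over_homD:
  assumes "over_hom C (A, P) (B, Q) (F, \<alpha>)"
  shows "is_functor A B F" "fo F \<in> extensional (Ob A)" "fm F \<in> extensional (Mor A)" "\<alpha> \<in> extensional (Ob A)"
    "i \<in> Ob A \<Longrightarrow> \<alpha> i \<in> Mor C" "i \<in> Ob A \<Longrightarrow> Dom (\<alpha> i) = fo Q (fo F i)" "i \<in> Ob A \<Longrightarrow> Cod (\<alpha> i) = fo P i"
    "i \<in> Ob A \<Longrightarrow> Rst C (\<alpha> i) = Idt C (fo Q (fo F i))"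
    "s \<in> Mor A \<Longrightarrow> fm P s \<cdot>\<^bsub>C\<^esub> \<alpha> (Dom s) = \<alpha> (Cod s) \<cdot>\<^bsub>C\<^esub> fm Q (fm F s)"
  using assms by (auto simp: over_hom_def Hom_def total_map_def)

lemma over_homI:
  assumes "is_functor A B F" "fo F \<in> extensional (Ob A)" "fm F \<in> extensional (Mor A)" "\<alpha> \<in> extensional (Ob A)"
    "\<And>i. i \<in> Ob A \<Longrightarrow> \<alpha> i \<in> Mor C \<and> Dom (\<alpha> i) = fo Q (fo F i) \<and> Cod (\<alpha> i) = fo P i \<and> Rst C (\<alpha> i) = Idt C (fo Q (fo F i))"
    "\<And>s. s \<in> Mor A \<Longrightarrow> fm P s \<cdot>\<^bsub>C\<^esub> \<alpha> (Dom s) = \<alpha> (Cod s) \<cdot>\<^bsub>C\<^esub> fm Q (fm F s)"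
  shows "over_hom C (A, P) (B, Q) (F, \<alpha>)"
  using assms by (auto simp: over_hom_def Hom_def total_map_def)

lemma jiCat_simps [simp]:
  "Ob (jiCat_over \<kappa> C) = {X. over_object \<kappa> C X}"
  "Arr X f Y \<in> Mor (jiCat_over \<kappa> C) \<longleftrightarrow> over_object \<kappa> C X \<and> over_object \<kappa> C Y \<and> over_hom C X Y f"
  "Idt (jiCat_over \<kappa> C) X = Arr X (over_id C X) X"
  "Arr Y g Z \<cdot>\<^bsub>jiCat_over \<kappa> C\<^esub> Arr X f Y' = Arr X (over_comp C X g f) Z"
  by (auto simp: jiCat_over_def simp del: split_paired_Ex)

lemma jiCat_mor:
  assumes "h \<in> Mor (jiCat_over \<kappa> C)"
  obtains A P B Q F \<alpha> where "h = Arr (A, P) (F, \<alpha>) (B, Q)" "over_object \<kappa> C (A, P)" "over_object \<kappa> C (B, Q)"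
    "over_hom C (A, P) (B, Q) (F, \<alpha>)"
proof -
  obtain X f Y where "h = Arr X f Y" "over_object \<kappa> C X" "over_object \<kappa> C Y" "over_hom C X Y f"
    using assms by (simp add: jiCat_over_def del: split_paired_Ex) blast
  then show ?thesis using that by (cases X; cases f; cases Y) simp
qed

context restriction_category
begin

lemma over_id_hom:
  assumes "over_object \<kappa> C (A, P)" shows "over_hom C (A, P) (A, P) (over_id C (A, P))"
proof -
  interpret A: category A using over_objectD(2)[OF assms] .
  note P = functorD[OF over_objectD(3)[OF assms]]
  show ?thesis unfolding over_id_def prod.case
    by (rule over_homI) (use P in \<open>auto simp: is_functor_def Hom_def\<close>)
qed

lemma over_comp_hom:
  assumes X: "over_object \<kappa> C (A, P)" and Y: "over_object \<kappa> C (B, Q)" and Z: "over_object \<kappa> C (D, R)"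
    and f: "over_hom C (A, P) (B, Q) (F, \<alpha>)" and g: "over_hom C (B, Q) (D, R) (G, \<beta>)"
  shows "over_hom C (A, P) (D, R) (over_comp C (A, P) (G, \<beta>) (F, \<alpha>))"
proof -
  interpret A: category A using over_objectD(2)[OF X] .
  note P = functorD[OF over_objectD(3)[OF X]] and Q = functorD[OF over_objectD(3)[OF Y]] and R = functorD[OF over_objectD(3)[OF Z]]
  note f' = over_homD[OF f] and g' = over_homD[OF g]
  note F = functorD[OF f'(1)] and G = functorD[OF g'(1)]
  show ?thesis unfolding over_comp_def prod.case
  proof (rule over_homI)
    show "is_functor A D \<lparr>fo = \<lambda>i\<in>Ob A. fo G (fo F i), fm = \<lambda>s\<in>Mor A. fm G (fm F s)\<rparr>"
      using F G by (auto simp: is_functor_def Hom_def)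
    fix s assume s: "s \<in> Mor A"
    let ?i = "Dom s" and ?j = "Cod s"
    have [simp]: "\<alpha> ?i \<in> Mor C" "\<alpha> ?j \<in> Mor C" "Dom (\<alpha> ?i) = fo Q (fo F ?i)" "Dom (\<alpha> ?j) = fo Q (fo F ?j)"
       "Cod (\<alpha> ?i) = fo P ?i" "Cod (\<alpha> ?j) = fo P ?j"
      using f'(5,6,7)[of ?i] f'(5,6,7)[of ?j] s by simp_all
    have [simp]: "\<beta> (fo F ?i) \<in> Mor C" "\<beta> (fo F ?j) \<in> Mor C" "Dom (\<beta> (fo F ?i)) = fo R (fo G (fo F ?i))"
       "Dom (\<beta> (fo F ?j)) = fo R (fo G (fo F ?j))" "Cod (\<beta> (fo F ?i)) = fo Q (fo F ?i)" "Cod (\<beta> (fo F ?j)) = fo Q (fo F ?j)"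
      using g'(5,6,7)[of "fo F ?i"] g'(5,6,7)[of "fo F ?j"] s F(1) by simp_all
    have "fm P s \<cdot> \<alpha> ?i \<cdot> \<beta> (fo F ?i) = (\<alpha> ?j \<cdot> fm Q (fm F s)) \<cdot> \<beta> (fo F ?i)"
      by (rule cmp_rw[OF f'(9)[OF s]]) (use s P in simp_all)
    also have "... = \<alpha> ?j \<cdot> fm Q (fm F s) \<cdot> \<beta> (Dom (fm F s))"
      using s F Q by simp
    also have "... = (\<alpha> ?j \<cdot> \<beta> (fo F ?j)) \<cdot> fm R (fm G (fm F s))"
      unfolding g'(9)[OF F(2)[OF s]] using s F R G by simp
    finally show "fm P s \<cdot> (\<lambda>i\<in>Ob A. \<alpha> i \<cdot> \<beta> (fo F i)) ?i =
        (\<lambda>i\<in>Ob A. \<alpha> i \<cdot> \<beta> (fo F i)) ?j \<cdot> fm R (fm \<lparr>fo = \<lambda>i\<in>Ob A. fo G (fo F i), fm = \<lambda>s\<in>Mor A. fm G (fm F s)\<rparr> s)"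
      using s by simp
  next
    fix i assume i: "i \<in> Ob A"
    then show "(\<lambda>i\<in>Ob A. \<alpha> i \<cdot> \<beta> (fo F i)) i \<in> Mor C \<and>
         Dom ((\<lambda>i\<in>Ob A. \<alpha> i \<cdot> \<beta> (fo F i)) i) = fo R (fo \<lparr>fo = \<lambda>i\<in>Ob A. fo G (fo F i), fm = \<lambda>s\<in>Mor A. fm G (fm F s)\<rparr> i) \<and>
         Cod ((\<lambda>i\<in>Ob A. \<alpha> i \<cdot> \<beta> (fo F i)) i) = fo P i \<and>
         Rst C ((\<lambda>i\<in>Ob A. \<alpha> i \<cdot> \<beta> (fo F i)) i) = Idt C (fo R (fo \<lparr>fo = \<lambda>i\<in>Ob A. fo G (fo F i), fm = \<lambda>s\<in>Mor A. fm G (fm F s)\<rparr> i))"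
      using f'(5-8)[OF i] g'(5-8)[OF F(1)[OF i]] rst_cmp_total[of "\<beta> (fo F i)" "\<alpha> i"] by simp
  qed simp_all
qed

text \<open>Functors and components are extensional, so the laws hold as equations between functions
  also outside the objects and maps of the source.\<close>

lemma jiCat_category: "category (jiCat_over \<kappa> C :: (('i, 'o, 'm) over_obj, ('i, 'o, 'm) over_map) cat)"
proof
  fix f g h :: "(('i, 'o, 'm) over_obj, ('i, 'o, 'm) over_map) arr" and X Y Z W :: "('i, 'o, 'm) over_obj"
  show "Dom f \<in> Ob (jiCat_over \<kappa> C) \<and> Cod f \<in> Ob (jiCat_over \<kappa> C)" if "f \<in> Mor (jiCat_over \<kappa> C)"
    using that by (elim jiCat_mor) simp
  show "Idt (jiCat_over \<kappa> C) X \<in> Hom (jiCat_over \<kappa> C) X X" if "X \<in> Ob (jiCat_over \<kappa> C)"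
    using that over_id_hom by (cases X) (simp add: Hom_def)
  {
    assume "f \<in> Hom (jiCat_over \<kappa> C) X Y"
    then obtain A P B Q F \<alpha> where f: "f = Arr (A, P) (F, \<alpha>) (B, Q)" "X = (A, P)" "Y = (B, Q)"
      "over_object \<kappa> C (A, P)" "over_object \<kappa> C (B, Q)" "over_hom C (A, P) (B, Q) (F, \<alpha>)"
      by (auto simp: Hom_def elim!: jiCat_mor)
    interpret A: category A using over_objectD(2)[OF f(4)] .
    note f' = over_homD[OF f(6)] and F = functorD[OF over_homD(1)[OF f(6)]]
    have [simp]: "(\<lambda>i\<in>Ob A. fo F i) = fo F" "(\<lambda>s\<in>Mor A. fm F s) = fm F" "(\<lambda>i\<in>Ob A. \<alpha> i) = \<alpha>"
      using f'(2-4) by (simp_all add: extensional_restrict)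
    have [simp]: "(\<lambda>i\<in>Ob A. if fo F i \<in> Ob B then fo F i else undefined) = fo F"
      "(\<lambda>s\<in>Mor A. if fm F s \<in> Mor B then fm F s else undefined) = fm F"
      using f'(2,3) F(1,2) by (auto simp: fun_eq_iff extensional_def restrict_def)
    show "f \<cdot>\<^bsub>jiCat_over \<kappa> C\<^esub> Idt (jiCat_over \<kappa> C) X = f"
    proof -
      have "(\<lambda>i\<in>Ob A. fo F ((\<lambda>i\<in>Ob A. i) i)) = fo F" "(\<lambda>s\<in>Mor A. fm F ((\<lambda>s\<in>Mor A. s) s)) = fm F"
        "(\<lambda>i\<in>Ob A. (\<lambda>i\<in>Ob A. Idt C (fo P i)) i \<cdot> \<alpha> ((\<lambda>i\<in>Ob A. i) i)) = \<alpha>"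
        using f'(2-7) by (auto simp: fun_eq_iff extensional_def restrict_def)
      then show ?thesis using f by (simp add: over_comp_def over_id_def)
    qed
    show "Idt (jiCat_over \<kappa> C) Y \<cdot>\<^bsub>jiCat_over \<kappa> C\<^esub> f = f"
    proof -
      have "(\<lambda>i\<in>Ob A. (\<lambda>i\<in>Ob B. i) (fo F i)) = fo F" "(\<lambda>s\<in>Mor A. (\<lambda>s\<in>Mor B. s) (fm F s)) = fm F"
        "(\<lambda>i\<in>Ob A. \<alpha> i \<cdot> (\<lambda>i\<in>Ob B. Idt C (fo Q i)) (fo F i)) = \<alpha>"
        using f'(2-7) F(1,2) by (auto simp: fun_eq_iff extensional_def restrict_def)
      then show ?thesis using f by (simp add: over_comp_def over_id_def)
    qed
    {
      assume "g \<in> Hom (jiCat_over \<kappa> C) Y Z"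
      then obtain D R G \<beta> where g: "g = Arr (B, Q) (G, \<beta>) (D, R)" "Z = (D, R)"
        "over_object \<kappa> C (D, R)" "over_hom C (B, Q) (D, R) (G, \<beta>)"
        using f(3) by (auto simp: Hom_def elim!: jiCat_mor)
      note g' = over_homD[OF g(4)] and G = functorD[OF over_homD(1)[OF g(4)]]
      show "g \<cdot>\<^bsub>jiCat_over \<kappa> C\<^esub> f \<in> Hom (jiCat_over \<kappa> C) X Z"
        using over_comp_hom[OF f(4,5) g(3) f(6) g(4)] f g by (simp add: Hom_def)
      assume "h \<in> Hom (jiCat_over \<kappa> C) Z W"
      then obtain E S H \<gamma> where h: "h = Arr (D, R) (H, \<gamma>) (E, S)" "W = (E, S)"
        "over_object \<kappa> C (E, S)" "over_hom C (D, R) (E, S) (H, \<gamma>)"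
        using g(2) by (auto simp: Hom_def elim!: jiCat_mor)
      note h' = over_homD[OF h(4)]
      have "over_comp C (A, P) (over_comp C (B, Q) (H, \<gamma>) (G, \<beta>)) (F, \<alpha>) =
          over_comp C (A, P) (H, \<gamma>) (over_comp C (A, P) (G, \<beta>) (F, \<alpha>))"
        using F G f'(5-7) g'(5-7) h'(5-7)
        by (auto simp: over_comp_def fun_eq_iff restrict_def)
      then show "(h \<cdot>\<^bsub>jiCat_over \<kappa> C\<^esub> g) \<cdot>\<^bsub>jiCat_over \<kappa> C\<^esub> f = h \<cdot>\<^bsub>jiCat_over \<kappa> C\<^esub> g \<cdot>\<^bsub>jiCat_over \<kappa> C\<^esub> f"
        unfolding f g h by (simp add: over_comp_def)
    }
  }
qed

end

section \<open>Cofunctors on generalised elements\<close>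

text \<open>The action on generalised elements: \<open>u\<close> is an arrow of \<open>AA\<close>
  and \<open>y\<close> a point of \<open>BB\<close> over the source of \<open>u\<close>, as
  expressed by \<open>cdom\<close>. The value is the lifted arrow of \<open>BB\<close> starting at
  \<open>y\<close>.\<close>

definition capp ::
    "('o, 'm) rcat \<Rightarrow> ('i, 'o, 'm) pcat \<Rightarrow> ('i, 'o, 'm) cofunctor \<Rightarrow> 'i \<Rightarrow> 'i \<Rightarrow>
     ('o, 'm) arr \<Rightarrow> ('o, 'm) arr \<Rightarrow> ('o, 'm) arr" where
  "capp C AA F i j u y = cmor F i j \<cdot>\<^bsub>C\<^esub> pair C (src AA i j) (cob F i) u y"

definition cdom ::
    "('o, 'm) rcat \<Rightarrow> ('i, 'o, 'm) pcat \<Rightarrow> ('i, 'o, 'm) pcat \<Rightarrow> ('i, 'o, 'm) cofunctor \<Rightarrow> 'i \<Rightarrow> 'i \<Rightarrow>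
     ('o, 'm) arr \<Rightarrow> ('o, 'm) arr \<Rightarrow> bool" where
  "cdom C AA BB F i j u y \<longleftrightarrow> u \<in> Mor C \<and> y \<in> Mor C \<and> Dom u = Dom y \<and> Cod u = mob AA i j \<and>
     Cod y = obj BB (cidx F i) \<and> src AA i j \<cdot>\<^bsub>C\<^esub> u = cob F i \<cdot>\<^bsub>C\<^esub> y"

text \<open>The typed data of a cofunctor without its equations, so that data just obtained by
  glueing can be put in before their equations are tested on sections.\<close>

locale cofunctor_data = A: internal_category C AA + B: internal_category C BB
  for C :: "('o, 'm) rcat" (structure) and AA BB :: "('i, 'o, 'm) pcat" +
  fixes F :: "('i, 'o, 'm) cofunctor"
  assumes idx_F: "cidx F \<in> idx AA \<rightarrow>\<^sub>E idx BB"
    and ext_F: "cob F \<in> extensional (idx AA)" "\<not> (i \<in> idx AA \<and> j \<in> idx AA) \<Longrightarrow> cmor F i j = undefined"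
    and cob_F: "i \<in> idx AA \<Longrightarrow> cob F i \<in> Hom C (obj BB (cidx F i)) (obj AA i) \<and> total_map C (cob F i)"
    and cmor_F: "i \<in> idx AA \<Longrightarrow> j \<in> idx AA \<Longrightarrow>
      cmor F i j \<in> Hom C (pbo C (src AA i j) (cob F i)) (mob BB (cidx F i) (cidx F j))"
begin

lemma cidx_in [simp]: "i \<in> idx AA \<Longrightarrow> cidx F i \<in> idx BB"
  using idx_F by auto

lemma cob_simps [simp]:
  assumes "i \<in> idx AA"
  shows "cob F i \<in> Mor C" "Dom (cob F i) = obj BB (cidx F i)" "Cod (cob F i) = obj AA i"
    "Rst C (cob F i) = Idt C (obj BB (cidx F i))"
  using cob_F[OF assms] by (auto simp: Hom_def A.total_iff)

lemma rst_cob_cmp [simp]: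
  "i \<in> idx AA \<Longrightarrow> x \<in> Mor C \<Longrightarrow> Cod x = obj BB (cidx F i) \<Longrightarrow> Rst C (cob F i \<cdot> x) = Rst C x"
  using A.rst_cmp_total[of x "cob F i"] by simp

lemma pbF [simp]: "i \<in> idx AA \<Longrightarrow> j \<in> idx AA \<Longrightarrow> has_pb C (src AA i j) (cob F i)"
  by (rule A.src_has_pb) simp_all

lemma cmor_simps [simp]:
  assumes "i \<in> idx AA" "j \<in> idx AA"
  shows "cmor F i j \<in> Mor C" "Dom (cmor F i j) = pbo C (src AA i j) (cob F i)"
    "Cod (cmor F i j) = mob BB (cidx F i) (cidx F j)"
  using cmor_F[OF assms] by (auto simp: Hom_def)

lemma cpair:
  assumes ij [simp]: "i \<in> idx AA" "j \<in> idx AA" and c: "cdom C AA BB F i j u y"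
  shows "pair C (src AA i j) (cob F i) u y \<in> Mor C" "Dom (pair C (src AA i j) (cob F i) u y) = Dom y"
    "Cod (pair C (src AA i j) (cob F i) u y) = pbo C (src AA i j) (cob F i)"
    "pb1 C (src AA i j) (cob F i) \<cdot> pair C (src AA i j) (cob F i) u y = u"
    "pb2 C (src AA i j) (cob F i) \<cdot> pair C (src AA i j) (cob F i) u y = y"
  using A.pair_props[OF pbF[OF ij], of u y] c by (simp_all add: cdom_def)

lemma capp_simps:
  assumes "i \<in> idx AA" "j \<in> idx AA" "cdom C AA BB F i j u y"
  shows "capp C AA F i j u y \<in> Mor C" "Dom (capp C AA F i j u y) = Dom y"
    "Cod (capp C AA F i j u y) = mob BB (cidx F i) (cidx F j)"
  using cpair[OF assms] assms by (simp_all add: capp_def)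

lemma cdom_cmp:
  assumes ij [simp]: "i \<in> idx AA" "j \<in> idx AA" and c: "cdom C AA BB F i j u y"
    and w [simp]: "w \<in> Mor C" "Cod w = Dom y"
  shows "cdom C AA BB F i j (u \<cdot> w) (y \<cdot> w)" "capp C AA F i j u y \<cdot> w = capp C AA F i j (u \<cdot> w) (y \<cdot> w)"
proof -
  have c' [simp]: "u \<in> Mor C" "y \<in> Mor C" "Dom u = Dom y" "Cod u = mob AA i j" "Cod y = obj BB (cidx F i)"
    and e: "src AA i j \<cdot> u = cob F i \<cdot> y" using c by (simp_all add: cdom_def)
  have "src AA i j \<cdot> u \<cdot> w = cob F i \<cdot> y \<cdot> w" using A.cmp_rw[OF e, of w] by simp
  then show "cdom C AA BB F i j (u \<cdot> w) (y \<cdot> w)" by (simp add: cdom_def)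
  show "capp C AA F i j u y \<cdot> w = capp C AA F i j (u \<cdot> w) (y \<cdot> w)"
    using A.pair_cmp[OF pbF[OF ij], of u y w] e cpair[OF ij c] by (simp add: capp_def)
qed

abbreviation (input) "gen1 i j \<equiv> pb1 C (src AA i j) (cob F i)"
abbreviation (input) "gen2 i j \<equiv> pb2 C (src AA i j) (cob F i)"

lemma cdom_gen:
  assumes ij [simp]: "i \<in> idx AA" "j \<in> idx AA"
  shows "cdom C AA BB F i j (gen1 i j) (gen2 i j)" "capp C AA F i j (gen1 i j) (gen2 i j) = cmor F i j"
proof -
  show "cdom C AA BB F i j (gen1 i j) (gen2 i j)"
    using A.pb_commutes[OF pbF[OF ij]] A.pb_simps[OF pbF[OF ij]] by (simp add: cdom_def)
  show "capp C AA F i j (gen1 i j) (gen2 i j) = cmor F i j"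
    by (simp add: capp_def)
qed

end

text \<open>The cofunctor axioms for arbitrary elements in place of pullback projections. In this
  form cofunctors compose without canonical isomorphisms of pullbacks.\<close>

locale internal_cofunctor = cofunctor_data +
  assumes capp_src: "i \<in> idx AA \<Longrightarrow> j \<in> idx AA \<Longrightarrow> cdom C AA BB F i j u y \<Longrightarrow>
      src BB (cidx F i) (cidx F j) \<cdot> capp C AA F i j u y = y"
    and capp_tgt: "i \<in> idx AA \<Longrightarrow> j \<in> idx AA \<Longrightarrow> cdom C AA BB F i j u y \<Longrightarrow>
      cob F j \<cdot> tgt BB (cidx F i) (cidx F j) \<cdot> capp C AA F i j u y = tgt AA i j \<cdot> u"
    and capp_unt: "i \<in> idx AA \<Longrightarrow> y \<in> Mor C \<Longrightarrow> Cod y = obj BB (cidx F i) \<Longrightarrow>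
      capp C AA F i i (unt AA i \<cdot> cob F i \<cdot> y) y = unt BB (cidx F i) \<cdot> y"
    and capp_gmul: "i \<in> idx AA \<Longrightarrow> j \<in> idx AA \<Longrightarrow> k \<in> idx AA \<Longrightarrow> cdom C AA BB F i j v y \<Longrightarrow>
      u \<in> Mor C \<Longrightarrow> Dom u = Dom y \<Longrightarrow> Cod u = mob AA j k \<Longrightarrow> src AA j k \<cdot> u = tgt AA i j \<cdot> v \<Longrightarrow>
      capp C AA F i k (gmul C AA i j k u v) y =
        gmul C BB (cidx F i) (cidx F j) (cidx F k)
          (capp C AA F j k u (tgt BB (cidx F i) (cidx F j) \<cdot> capp C AA F i j v y)) (capp C AA F i j v y)"
begin

lemma capp_rst:
  assumes [simp]: "i \<in> idx AA" "j \<in> idx AA" and c: "cdom C AA BB F i j u y"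
  shows "Rst C (capp C AA F i j u y) = Rst C y"
  using B.rst_src_cmp(1)[of "cidx F i" "cidx F j" "capp C AA F i j u y"] capp_simps[OF assms] capp_src[OF assms] by simp

text \<open>The original axioms are the present ones at the generic elements, the pullback
  projections.\<close>

lemma is_partite_cofunctor: "partite_cofunctor C AA BB F"
proof
  fix i j k
  show "cidx F \<in> idx AA \<rightarrow>\<^sub>E idx BB" "cob F \<in> extensional (idx AA)" using idx_F ext_F by auto
  show "cmor F i j = undefined" if "\<not> (i \<in> idx AA \<and> j \<in> idx AA)" using ext_F(2) that .
  assume i [simp]: "i \<in> idx AA"
  show "cob F i \<in> Hom C (obj BB (cidx F i)) (obj AA i) \<and> total_map C (cob F i)" using cob_F i .
  have "capp C AA F i i (unt AA i \<cdot> cob F i \<cdot> Idt C (obj BB (cidx F i))) (Idt C (obj BB (cidx F i))) =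
      unt BB (cidx F i) \<cdot> Idt C (obj BB (cidx F i))" by (rule capp_unt) simp_all
  then show "cmor F i i \<cdot> pair C (src AA i i) (cob F i) (unt AA i \<cdot> cob F i) (Idt C (obj BB (cidx F i))) =
      unt BB (cidx F i)" by (simp add: capp_def)
  assume j [simp]: "j \<in> idx AA"
  note g = cdom_gen[OF i j]
  note pb [simp] = A.pb_simps[OF pbF[OF i j]]
  show "cmor F i j \<in> Hom C (pbo C (src AA i j) (cob F i)) (mob BB (cidx F i) (cidx F j)) \<and> total_map C (cmor F i j)"
    using cmor_F[OF i j] capp_rst[OF i j g(1)] A.pb_total(2)[OF pbF[OF i j]] g(2) by (simp add: A.total_iff)
  show "src BB (cidx F i) (cidx F j) \<cdot> cmor F i j = gen2 i j" using capp_src[OF i j g(1)] g(2) by simp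
  show "cob F j \<cdot> tgt BB (cidx F i) (cidx F j) \<cdot> cmor F i j = tgt AA i j \<cdot> gen1 i j" using capp_tgt[OF i j g(1)] g(2) by simp
  assume k [simp]: "k \<in> idx AA"
  let ?g = "tgt AA i j \<cdot> gen1 i j"
  have pb' [simp]: "has_pb C (src AA j k) ?g"
  proof (rule A.src_has_pb)
    show "Rst C ?g = Idt C (Dom ?g)" using A.pb_total(1)[OF pbF[OF i j]] by simp
  qed simp_all
  let ?r1 = "pb1 C (src AA j k) ?g" and ?r2 = "pb2 C (src AA j k) ?g"
  note [simp] = A.pb_simps[OF pb']
  note c = cdom_cmp[OF i j g(1), of ?r2]
  have e: "src AA j k \<cdot> ?r1 = tgt AA i j \<cdot> gen1 i j \<cdot> ?r2" using A.pb_commutes[OF pb'] by simp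
  have m: "cmor F i j \<cdot> ?r2 = capp C AA F i j (gen1 i j \<cdot> ?r2) (gen2 i j \<cdot> ?r2)" using c(2) g(2) by simp
  have "capp C AA F i k (gmul C AA i j k ?r1 (gen1 i j \<cdot> ?r2)) (gen2 i j \<cdot> ?r2) =
      gmul C BB (cidx F i) (cidx F j) (cidx F k)
        (capp C AA F j k ?r1 (tgt BB (cidx F i) (cidx F j) \<cdot> cmor F i j \<cdot> ?r2)) (cmor F i j \<cdot> ?r2)"
    unfolding m by (rule capp_gmul[OF i j k]) (use c(1) e in simp_all)
  then show "let \<pi>1 = pb1 C (src AA i j) (cob F i); \<pi>2 = pb2 C (src AA i j) (cob F i);
           \<rho>1 = pb1 C (src AA j k) (tgt AA i j \<cdot> \<pi>1); \<rho>2 = pb2 C (src AA j k) (tgt AA i j \<cdot> \<pi>1);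
           i' = cidx F i; j' = cidx F j; k' = cidx F k
       in cmor F i k \<cdot> pair C (src AA i k) (cob F i)
            (mul AA i j k \<cdot> pair C (src AA j k) (tgt AA i j) \<rho>1 (\<pi>1 \<cdot> \<rho>2)) (\<pi>2 \<cdot> \<rho>2) =
          mul BB i' j' k' \<cdot> pair C (src BB j' k') (tgt BB i' j')
            (cmor F j k \<cdot> pair C (src AA j k) (cob F j) \<rho>1 (tgt BB i' j' \<cdot> cmor F i j \<cdot> \<rho>2))
            (cmor F i j \<cdot> \<rho>2)"
    unfolding Let_def capp_def gmul_def .
qed

end

text \<open>Each law is its axiom precomposed with the map that the given elements induce into the
  pullback; for multiplicativity this is the map \<open>?q\<close> into the triple pullback.\<close>

lemma internal_cofunctorI:
  fixes C :: "('o, 'm) rcat" (structure)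
  assumes A: "internal_category C AA" and B: "internal_category C BB" and F: "partite_cofunctor C AA BB F"
  shows "internal_cofunctor C AA BB F"
proof -
  interpret A: internal_category C AA by fact
  interpret B: internal_category C BB by fact
  interpret F: partite_cofunctor C AA BB F by fact
  interpret cofunctor_data C AA BB F
    by unfold_locales (use F.cidx F.cob_ext F.cmor_ext F.cob F.cmor in blast)+
  show ?thesis
  proof
    fix i j k u v y
    assume i [simp]: "i \<in> idx AA"
    {
      assume y [simp]: "y \<in> Mor C" "Cod y = obj BB (cidx F i)"
      have c: "cdom C AA BB F i i (unt AA i \<cdot> cob F i) (Idt C (obj BB (cidx F i)))"
        by (simp add: cdom_def)
      have "capp C AA F i i (unt AA i \<cdot> cob F i) (Idt C (obj BB (cidx F i))) \<cdot> y = unt BB (cidx F i) \<cdot> y"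
        using F.cmor_unt[OF i] by (simp add: capp_def)
      then show "capp C AA F i i (unt AA i \<cdot> cob F i \<cdot> y) y = unt BB (cidx F i) \<cdot> y"
        using cdom_cmp(2)[OF i i c, of y] by simp
    }
    assume j [simp]: "j \<in> idx AA"
    note [simp] = A.pb_simps[OF pbF[OF i j]]
    {
      assume c: "cdom C AA BB F i j u y"
      note p [simp] = cpair[OF i j c]
      show "src BB (cidx F i) (cidx F j) \<cdot> capp C AA F i j u y = y"
        using A.cmp_rw[OF F.src_cmor[OF i j], of "pair C (src AA i j) (cob F i) u y"] by (simp add: capp_def)
      have "cob F j \<cdot> (tgt BB (cidx F i) (cidx F j) \<cdot> cmor F i j) \<cdot> pair C (src AA i j) (cob F i) u y =
          (tgt AA i j \<cdot> gen1 i j) \<cdot> pair C (src AA i j) (cob F i) u y"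
        by (rule A.cmp_rw[OF F.tgt_cmor[OF i j]]) simp_all
      then show "cob F j \<cdot> tgt BB (cidx F i) (cidx F j) \<cdot> capp C AA F i j u y = tgt AA i j \<cdot> u"
        by (simp add: capp_def)
    }
    assume k [simp]: "k \<in> idx AA" and c: "cdom C AA BB F i j v y"
      and u [simp]: "u \<in> Mor C" "Dom u = Dom y" "Cod u = mob AA j k" and e: "src AA j k \<cdot> u = tgt AA i j \<cdot> v"
    have v [simp]: "v \<in> Mor C" "y \<in> Mor C" "Dom v = Dom y" "Cod v = mob AA i j" "Cod y = obj BB (cidx F i)"
      and vy: "src AA i j \<cdot> v = cob F i \<cdot> y"
      using c by (simp_all add: cdom_def)
    let ?g = "tgt AA i j \<cdot> gen1 i j"
    have pb' [simp]: "has_pb C (src AA j k) ?g"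
    proof (rule A.src_has_pb)
      show "Rst C ?g = Idt C (Dom ?g)" using A.pb_total(1)[OF pbF[OF i j]] by simp
    qed simp_all
    let ?r1 = "pb1 C (src AA j k) ?g" and ?r2 = "pb2 C (src AA j k) ?g"
    note [simp] = A.pb_simps[OF pb']
    let ?p = "pair C (src AA i j) (cob F i) v y"
    note p [simp] = cpair[OF i j c]
    let ?q = "pair C (src AA j k) ?g u ?p"
    have "u \<in> Mor C" "?p \<in> Mor C" "Dom u = Dom ?p" "Cod u = Dom (src AA j k)" "Cod ?p = Dom ?g"
       "src AA j k \<cdot> u = ?g \<cdot> ?p" using e by simp_all
    note q [simp] = A.pair_props[OF pb' this]
    define c1 where "c1 = cmor F i j \<cdot> ?r2"
    define x where "x = gen1 i j \<cdot> ?r2"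
    define z where "z = gen2 i j \<cdot> ?r2"
    have xz [simp]: "x \<in> Mor C" "Dom x = pbo C (src AA j k) ?g" "Cod x = mob AA i j"
      "z \<in> Mor C" "Dom z = pbo C (src AA j k) ?g" "Cod z = obj BB (cidx F i)"
      "c1 \<in> Mor C" "Dom c1 = pbo C (src AA j k) ?g" "Cod c1 = mob BB (cidx F i) (cidx F j)"
      by (simp_all add: x_def z_def c1_def)
    have xq: "x \<cdot> ?q = v" "z \<cdot> ?q = y" "c1 \<cdot> ?q = capp C AA F i j v y"
      by (simp_all add: x_def z_def c1_def capp_def)
    have e1: "src AA j k \<cdot> ?r1 = tgt AA i j \<cdot> x" using A.pb_commutes[OF pb'] by (simp add: x_def)
    have e2: "src AA i j \<cdot> x = cob F i \<cdot> z"
      using A.cmp_rw[OF A.pb_commutes[OF pbF[OF i j]], of ?r2] by (simp add: x_def z_def)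
    have e3: "cob F j \<cdot> tgt BB (cidx F i) (cidx F j) \<cdot> c1 = src AA j k \<cdot> ?r1"
    proof -
      have "cob F j \<cdot> (tgt BB (cidx F i) (cidx F j) \<cdot> cmor F i j) \<cdot> ?r2 = ?g \<cdot> ?r2"
        by (rule A.cmp_rw[OF F.tgt_cmor[OF i j]]) simp_all
      then show ?thesis using e1 by (simp add: c1_def x_def)
    qed
    have e4: "src BB (cidx F i) (cidx F j) \<cdot> c1 = z"
      using A.cmp_rw[OF F.src_cmor[OF i j], of ?r2] by (simp add: c1_def z_def)
    have M: "capp C AA F i k (gmul C AA i j k ?r1 x) z =
        gmul C BB (cidx F i) (cidx F j) (cidx F k) (capp C AA F j k ?r1 (tgt BB (cidx F i) (cidx F j) \<cdot> c1)) c1"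
      using F.cmor_mul[OF i j k] unfolding Let_def capp_def gmul_def x_def z_def c1_def .
    note Gx = A.gmul_simps[OF i j k, of ?r1 x, simplified, OF e1]
    have d1: "cdom C AA BB F i k (gmul C AA i j k ?r1 x) z" using Gx e2 by (simp add: cdom_def)
    have d2: "cdom C AA BB F j k ?r1 (tgt BB (cidx F i) (cidx F j) \<cdot> c1)" using e3 by (simp add: cdom_def)
    let ?c2 = "capp C AA F j k ?r1 (tgt BB (cidx F i) (cidx F j) \<cdot> c1)"
    have s2: "src BB (cidx F j) (cidx F k) \<cdot> ?c2 = tgt BB (cidx F i) (cidx F j) \<cdot> c1"
    proof -
      note [simp] = A.pb_simps[OF pbF[OF j k]] and p2 [simp] = cpair[OF j k d2]
      show ?thesis
        using A.cmp_rw[OF F.src_cmor[OF j k], of "pair C (src AA j k) (cob F j) ?r1 (tgt BB (cidx F i) (cidx F j) \<cdot> c1)"]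
        by (simp add: capp_def)
    qed
    have "capp C AA F i k (gmul C AA i j k ?r1 x) z \<cdot> ?q = capp C AA F i k (gmul C AA i j k ?r1 x \<cdot> ?q) (z \<cdot> ?q)"
      by (rule cdom_cmp(2)[OF i k d1]) simp_all
    also have "gmul C AA i j k ?r1 x \<cdot> ?q = gmul C AA i j k (?r1 \<cdot> ?q) (x \<cdot> ?q)"
      by (rule A.gmul_cmp[OF i j k _ _ _ _ _ e1]) simp_all
    also have "?r1 \<cdot> ?q = u" by simp
    finally have L: "capp C AA F i k (gmul C AA i j k ?r1 x) z \<cdot> ?q = capp C AA F i k (gmul C AA i j k u v) y"
      unfolding xq .
    have "gmul C BB (cidx F i) (cidx F j) (cidx F k) ?c2 c1 \<cdot> ?q = gmul C BB (cidx F i) (cidx F j) (cidx F k) (?c2 \<cdot> ?q) (c1 \<cdot> ?q)"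
      by (rule B.gmul_cmp[OF _ _ _ _ _ _ _ _ s2]) (simp_all add: capp_simps[OF j k d2])
    also have "?c2 \<cdot> ?q = capp C AA F j k (?r1 \<cdot> ?q) ((tgt BB (cidx F i) (cidx F j) \<cdot> c1) \<cdot> ?q)"
      by (rule cdom_cmp(2)[OF j k d2]) simp_all
    also have "(tgt BB (cidx F i) (cidx F j) \<cdot> c1) \<cdot> ?q = tgt BB (cidx F i) (cidx F j) \<cdot> c1 \<cdot> ?q" by simp
    also have "?r1 \<cdot> ?q = u" by simp
    finally show "capp C AA F i k (gmul C AA i j k u v) y =
        gmul C BB (cidx F i) (cidx F j) (cidx F k)
          (capp C AA F j k u (tgt BB (cidx F i) (cidx F j) \<cdot> capp C AA F i j v y)) (capp C AA F i j v y)"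
      using L unfolding M xq by simp
  qed
qed

text \<open>Evaluating the action at the pullback projections recovers \<open>cmor\<close>; outside
  the index set all components have the fixed default value.\<close>

lemma cofunctor_eqI:
  assumes F: "internal_cofunctor C AA BB F" and G: "internal_cofunctor C AA BB G"
    and idx: "\<And>i. i \<in> idx AA \<Longrightarrow> cidx F i = cidx G i" and cob: "\<And>i. i \<in> idx AA \<Longrightarrow> cob F i = cob G i"
    and capp: "\<And>i j u y. i \<in> idx AA \<Longrightarrow> j \<in> idx AA \<Longrightarrow> cdom C AA BB F i j u y \<Longrightarrow>
      capp C AA F i j u y = capp C AA G i j u y"
  shows "F = G"
proof (rule cofunctor.equality)
  interpret F: internal_cofunctor C AA BB F by fact
  interpret G: internal_cofunctor C AA BB G by fact
  show "cidx F = cidx G" by (rule PiE_ext[OF F.idx_F G.idx_F idx])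
  show "cob F = cob G" by (rule extensionalityI[OF F.ext_F(1) G.ext_F(1) cob])
  show "cmor F = cmor G"
  proof (intro ext)
    fix i j
    show "cmor F i j = cmor G i j"
    proof (cases "i \<in> idx AA \<and> j \<in> idx AA")
      case True
      then have ij: "i \<in> idx AA" "j \<in> idx AA" by auto
      show ?thesis
        using capp[OF ij F.cdom_gen(1)[OF ij]] F.cdom_gen(2)[OF ij] G.cdom_gen(2)[OF ij] cob[OF ij(1)] by simp
    qed (simp add: F.ext_F(2) G.ext_F(2))
  qed
qed simp

lemma cof_id_internal:
  fixes C :: "('o, 'm) rcat" (structure)
  assumes A: "internal_category C AA"
  shows "internal_cofunctor C AA AA (cof_id C AA)"
    and "i \<in> idx AA \<Longrightarrow> j \<in> idx AA \<Longrightarrow> cdom C AA AA (cof_id C AA) i j u y \<Longrightarrow>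
      capp C AA (cof_id C AA) i j u y = u"
proof -
  interpret A: internal_category C AA by fact
  have K [simp]: "cidx (cof_id C AA) i = i" "cob (cof_id C AA) i = Idt C (obj AA i)" if "i \<in> idx AA" for i
    using that by (simp_all add: cof_id_def)
  have pb [simp]: "has_pb C (src AA i j) (Idt C (obj AA i))" if "i \<in> idx AA" "j \<in> idx AA" for i j
    by (rule A.src_has_pb) (use that in simp_all)
  have Km [simp]: "cmor (cof_id C AA) i j = pb1 C (src AA i j) (Idt C (obj AA i))" if "i \<in> idx AA" "j \<in> idx AA" for i j
    using that by (simp add: cof_id_def)
  interpret K: cofunctor_data C AA AA "cof_id C AA"
  proof
    show "cidx (cof_id C AA) \<in> idx AA \<rightarrow>\<^sub>E idx AA" by (auto simp: cof_id_def)
    show "cob (cof_id C AA) \<in> extensional (idx AA)" by (simp add: cof_id_def)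
    show "cmor (cof_id C AA) i j = undefined" if "\<not> (i \<in> idx AA \<and> j \<in> idx AA)" for i j
      using that by (auto simp: cof_id_def)
  qed (simp_all add: Hom_def A.total_iff)
  have *: "capp C AA (cof_id C AA) i j u y = u" "src AA i j \<cdot> u = y"
    if ij: "i \<in> idx AA" "j \<in> idx AA" "cdom C AA AA (cof_id C AA) i j u y" for i j u y
    using K.cpair[OF ij] ij by (simp_all add: capp_def cdom_def)
  show "i \<in> idx AA \<Longrightarrow> j \<in> idx AA \<Longrightarrow> cdom C AA AA (cof_id C AA) i j u y \<Longrightarrow>
      capp C AA (cof_id C AA) i j u y = u" by (rule *(1))
  show "internal_cofunctor C AA AA (cof_id C AA)"
  proof
    fix i j k u v y
    assume i [simp]: "i \<in> idx AA"
    show "capp C AA (cof_id C AA) i i (unt AA i \<cdot> cob (cof_id C AA) i \<cdot> y) y = unt AA (cidx (cof_id C AA) i) \<cdot> y"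
      if "y \<in> Mor C" "Cod y = obj AA (cidx (cof_id C AA) i)"
      using *(1)[of i i "unt AA i \<cdot> y" y] that by (simp add: cdom_def)
    assume j [simp]: "j \<in> idx AA"
    show "src AA (cidx (cof_id C AA) i) (cidx (cof_id C AA) j) \<cdot> capp C AA (cof_id C AA) i j u y = y"
      and "cob (cof_id C AA) j \<cdot> tgt AA (cidx (cof_id C AA) i) (cidx (cof_id C AA) j) \<cdot> capp C AA (cof_id C AA) i j u y =
        tgt AA i j \<cdot> u"
      if "cdom C AA AA (cof_id C AA) i j u y"
      using *[OF i j that] that by (simp_all add: cdom_def)
    assume k [simp]: "k \<in> idx AA"
    assume c: "cdom C AA AA (cof_id C AA) i j v y" and u: "u \<in> Mor C" "Dom u = Dom y" "Cod u = mob AA j k"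
      and st: "src AA j k \<cdot> u = tgt AA i j \<cdot> v"
    have v: "v \<in> Mor C" "y \<in> Mor C" "Dom v = Dom y" "Cod v = mob AA i j" "Cod y = obj AA i" "src AA i j \<cdot> v = y"
      using c *(2)[OF i j c] by (simp_all add: cdom_def)
    note g = A.gmul_simps[OF i j k u(1) v(1) _ u(3) v(4) st]
    have 1: "capp C AA (cof_id C AA) i k (gmul C AA i j k u v) y = gmul C AA i j k u v"
      by (rule *(1)[OF i k]) (use g u v in \<open>simp add: cdom_def\<close>)
    have 2: "capp C AA (cof_id C AA) j k u (tgt AA i j \<cdot> v) = u"
      by (rule *(1)[OF j k]) (use u v st in \<open>simp add: cdom_def\<close>)
    show "capp C AA (cof_id C AA) i k (gmul C AA i j k u v) y =
        gmul C AA (cidx (cof_id C AA) i) (cidx (cof_id C AA) j) (cidx (cof_id C AA) k)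
          (capp C AA (cof_id C AA) j k u (tgt AA (cidx (cof_id C AA) i) (cidx (cof_id C AA) j) \<cdot>
            capp C AA (cof_id C AA) i j v y)) (capp C AA (cof_id C AA) i j v y)"
      using 1 2 *(1)[OF i j c] by simp
  qed
qed

text \<open>The composite first acts by \<open>F\<close> over the image of \<open>y\<close> under
  \<open>G\<close>, then by \<open>G\<close> over \<open>y\<close>; the second action is defined
  because the first result has source \<open>cob G (cidx F i) \<cdot> y\<close>. With this formula
  each law for the composite is the law of \<open>F\<close> followed by that of
  \<open>G\<close>.\<close>

lemma cof_comp_internal:
  fixes C :: "('o, 'm) rcat" (structure)
  assumes F: "internal_cofunctor C AA BB F" and G: "internal_cofunctor C BB DD G"
  shows "internal_cofunctor C AA DD (cof_comp C AA BB G F)"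
    and "i \<in> idx AA \<Longrightarrow> j \<in> idx AA \<Longrightarrow> cdom C AA DD (cof_comp C AA BB G F) i j u y \<Longrightarrow>
      capp C AA (cof_comp C AA BB G F) i j u y =
        capp C BB G (cidx F i) (cidx F j) (capp C AA F i j u (cob G (cidx F i) \<cdot> y)) y"
proof -
  interpret F: internal_cofunctor C AA BB F by fact
  interpret G: internal_cofunctor C BB DD G by fact
  define K where "K = cof_comp C AA BB G F"
  have K [simp]: "cidx K i = cidx G (cidx F i)" "cob K i = cob F i \<cdot> cob G (cidx F i)" if "i \<in> idx AA" for i
    using that by (simp_all add: K_def cof_comp_def)
  have Km: "cmor K i j = capp C BB G (cidx F i) (cidx F j)
       (capp C AA F i j (pb1 C (src AA i j) (cob K i)) (cob G (cidx F i) \<cdot> pb2 C (src AA i j) (cob K i))) (pb2 C (src AA i j) (cob K i))"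
    if "i \<in> idx AA" "j \<in> idx AA" for i j
    using that by (simp add: K_def cof_comp_def capp_def Let_def)
  have d: "cdom C AA BB F i j u (cob G (cidx F i) \<cdot> y)"
      "cdom C BB DD G (cidx F i) (cidx F j) (capp C AA F i j u (cob G (cidx F i) \<cdot> y)) y"
    if ij: "i \<in> idx AA" "j \<in> idx AA" and c: "cdom C AA DD K i j u y" for i j u y
  proof -
    show 1: "cdom C AA BB F i j u (cob G (cidx F i) \<cdot> y)" using c ij by (simp add: cdom_def)
    show "cdom C BB DD G (cidx F i) (cidx F j) (capp C AA F i j u (cob G (cidx F i) \<cdot> y)) y"
      using c ij F.capp_simps[OF ij 1] F.capp_src[OF ij 1] by (simp add: cdom_def)
  qed
  have pb [simp]: "has_pb C (src AA i j) (cob K i)" if "i \<in> idx AA" "j \<in> idx AA" for i j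
    by (rule F.A.src_has_pb) (use that in simp_all)
  have gen: "cdom C AA DD K i j (pb1 C (src AA i j) (cob K i)) (pb2 C (src AA i j) (cob K i))"
    if ij: "i \<in> idx AA" "j \<in> idx AA" for i j
    using F.A.pb_commutes[OF pb[OF ij]] F.A.pb_simps[OF pb[OF ij]] ij by (simp add: cdom_def)
  interpret K: cofunctor_data C AA DD K
  proof
    show "cidx K \<in> idx AA \<rightarrow>\<^sub>E idx DD" by (auto simp: K_def cof_comp_def)
    show "cob K \<in> extensional (idx AA)" by (simp add: K_def cof_comp_def)
    show "cmor K i j = undefined" if "\<not> (i \<in> idx AA \<and> j \<in> idx AA)" for i j
      using that by (auto simp: K_def cof_comp_def)
    show "cob K i \<in> Hom C (obj DD (cidx K i)) (obj AA i) \<and> total_map C (cob K i)" if "i \<in> idx AA" for i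
      using that by (simp add: Hom_def F.A.total_iff)
    show "cmor K i j \<in> Hom C (pbo C (src AA i j) (cob K i)) (mob DD (cidx K i) (cidx K j))"
      if ij: "i \<in> idx AA" "j \<in> idx AA" for i j
      unfolding Km[OF ij]
      using G.capp_simps[OF _ _ d(2)[OF ij gen[OF ij]]] F.A.pb_simps[OF pb[OF ij]] ij by (simp add: Hom_def)
  qed
  have cK: "capp C AA K i j u y = capp C BB G (cidx F i) (cidx F j) (capp C AA F i j u (cob G (cidx F i) \<cdot> y)) y"
    if ij: "i \<in> idx AA" "j \<in> idx AA" and c: "cdom C AA DD K i j u y" for i j u y
  proof -
    let ?p = "pair C (src AA i j) (cob K i) u y" and ?x = "pb1 C (src AA i j) (cob K i)" and ?z = "pb2 C (src AA i j) (cob K i)"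
    note [simp] = K.cpair[OF ij c] and pbs [simp] = F.A.pb_simps[OF pb[OF ij]] and ij' [simp] = ij
    have "capp C AA K i j u y = capp C BB G (cidx F i) (cidx F j) (capp C AA F i j ?x (cob G (cidx F i) \<cdot> ?z)) ?z \<cdot> ?p"
      unfolding capp_def[of C AA K] Km[OF ij] ..
    also have "... = capp C BB G (cidx F i) (cidx F j) (capp C AA F i j ?x (cob G (cidx F i) \<cdot> ?z) \<cdot> ?p) (?z \<cdot> ?p)"
      by (rule G.cdom_cmp(2)[OF _ _ d(2)[OF ij gen[OF ij]]]) (simp_all del: K(2))
    also have "capp C AA F i j ?x (cob G (cidx F i) \<cdot> ?z) \<cdot> ?p = capp C AA F i j (?x \<cdot> ?p) ((cob G (cidx F i) \<cdot> ?z) \<cdot> ?p)"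
      by (rule F.cdom_cmp(2)[OF ij d(1)[OF ij gen[OF ij]]]) (simp_all del: K(2))
    finally show ?thesis by (simp del: K(2))
  qed
  show "i \<in> idx AA \<Longrightarrow> j \<in> idx AA \<Longrightarrow> cdom C AA DD (cof_comp C AA BB G F) i j u y \<Longrightarrow>
      capp C AA (cof_comp C AA BB G F) i j u y =
        capp C BB G (cidx F i) (cidx F j) (capp C AA F i j u (cob G (cidx F i) \<cdot> y)) y"
    using cK unfolding K_def .
  have "internal_cofunctor C AA DD K"
  proof
    fix i j k u v y
    assume i [simp]: "i \<in> idx AA"
    show "capp C AA K i i (unt AA i \<cdot> cob K i \<cdot> y) y = unt DD (cidx K i) \<cdot> y"
      if y: "y \<in> Mor C" "Cod y = obj DD (cidx K i)"
    proof -
      have y' [simp]: "y \<in> Mor C" "Cod y = obj DD (cidx G (cidx F i))" using y by simp_all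
      have c: "cdom C AA DD K i i (unt AA i \<cdot> cob K i \<cdot> y) y" by (simp add: cdom_def)
      show ?thesis using cK[OF i i c] F.capp_unt[OF i, of "cob G (cidx F i) \<cdot> y"] G.capp_unt[of "cidx F i" y] by simp
    qed
    assume j [simp]: "j \<in> idx AA"
    {
      assume c: "cdom C AA DD K i j u y"
      note d' = d[OF i j c]
      show "src DD (cidx K i) (cidx K j) \<cdot> capp C AA K i j u y = y"
        using cK[OF i j c] G.capp_src[OF _ _ d'(2)] by simp
      show "cob K j \<cdot> tgt DD (cidx K i) (cidx K j) \<cdot> capp C AA K i j u y = tgt AA i j \<cdot> u"
        using cK[OF i j c] G.capp_tgt[OF _ _ d'(2)] F.capp_tgt[OF i j d'(1)] G.capp_simps[OF _ _ d'(2)] by simp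
    }
    assume k [simp]: "k \<in> idx AA"
    assume c: "cdom C AA DD K i j v y" and u: "u \<in> Mor C" "Dom u = Dom y" "Cod u = mob AA j k"
      and st: "src AA j k \<cdot> u = tgt AA i j \<cdot> v"
    note d' = d[OF i j c]
    have y [simp]: "y \<in> Mor C" "Cod y = obj DD (cidx G (cidx F i))" and v: "v \<in> Mor C" "Dom v = Dom y" "Cod v = mob AA i j"
      and vy: "src AA i j \<cdot> v = cob F i \<cdot> cob G (cidx F i) \<cdot> y" using c by (simp_all add: cdom_def)
    note g = F.A.gmul_simps[OF i j k u(1) v(1) _ u(3) v(3) st]
    define v' where "v' = capp C AA F i j v (cob G (cidx F i) \<cdot> y)"
    define y2 where "y2 = tgt DD (cidx K i) (cidx K j) \<cdot> capp C AA K i j v y"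
    note v's = F.capp_simps[OF i j d'(1), folded v'_def]
    note Gs = G.capp_simps[OF _ _ d'(2), folded v'_def]
    have cKv: "capp C AA K i j v y = capp C BB G (cidx F i) (cidx F j) v' y" using cK[OF i j c] by (simp only: v'_def)
    have y2s: "y2 \<in> Mor C" "Dom y2 = Dom y" "Cod y2 = obj DD (cidx G (cidx F j))"
      using Gs by (simp_all add: y2_def cKv)
    have y2t: "cob G (cidx F j) \<cdot> y2 = tgt BB (cidx F i) (cidx F j) \<cdot> v'"
      using G.capp_tgt[OF _ _ d'(2)] by (simp add: y2_def cKv v'_def)
    have Ft: "cob F j \<cdot> tgt BB (cidx F i) (cidx F j) \<cdot> v' = tgt AA i j \<cdot> v"
      using F.capp_tgt[OF i j d'(1)] by (simp add: v'_def)
    have c1: "cdom C AA DD K i k (gmul C AA i j k u v) y" using g vy u v by (simp add: cdom_def)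
    have c2: "cdom C AA DD K j k u y2" using y2s y2t Ft st u by (simp add: cdom_def)
    have c3: "cdom C AA BB F j k u (tgt BB (cidx F i) (cidx F j) \<cdot> v')" using v's u Ft st by (simp add: cdom_def)
    note w = F.capp_simps[OF j k c3] and ws = F.capp_src[OF j k c3]
    have "capp C AA K i k (gmul C AA i j k u v) y =
        capp C BB G (cidx F i) (cidx F k) (capp C AA F i k (gmul C AA i j k u v) (cob G (cidx F i) \<cdot> y)) y"
      by (rule cK[OF i k c1])
    also have "capp C AA F i k (gmul C AA i j k u v) (cob G (cidx F i) \<cdot> y) =
        gmul C BB (cidx F i) (cidx F j) (cidx F k) (capp C AA F j k u (tgt BB (cidx F i) (cidx F j) \<cdot> v')) v'"
      unfolding v'_def by (rule F.capp_gmul[OF i j k d'(1)]) (use u st in simp_all)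
    also have "capp C BB G (cidx F i) (cidx F k) \<dots> y =
        gmul C DD (cidx G (cidx F i)) (cidx G (cidx F j)) (cidx G (cidx F k))
          (capp C BB G (cidx F j) (cidx F k) (capp C AA F j k u (tgt BB (cidx F i) (cidx F j) \<cdot> v'))
            (tgt DD (cidx G (cidx F i)) (cidx G (cidx F j)) \<cdot> capp C BB G (cidx F i) (cidx F j) v' y))
          (capp C BB G (cidx F i) (cidx F j) v' y)"
      by (rule G.capp_gmul[OF _ _ _ d'(2)[folded v'_def]]) (use w ws v's in simp_all)
    also have "capp C BB G (cidx F j) (cidx F k) (capp C AA F j k u (tgt BB (cidx F i) (cidx F j) \<cdot> v'))
            (tgt DD (cidx G (cidx F i)) (cidx G (cidx F j)) \<cdot> capp C BB G (cidx F i) (cidx F j) v' y) = capp C AA K j k u y2"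
      using cK[OF j k c2] y2t by (simp add: y2_def cKv)
    finally show "capp C AA K i k (gmul C AA i j k u v) y =
        gmul C DD (cidx K i) (cidx K j) (cidx K k)
          (capp C AA K j k u (tgt DD (cidx K i) (cidx K j) \<cdot> capp C AA K i j v y)) (capp C AA K i j v y)"
      by (simp add: y2_def cKv)
  qed
  then show "internal_cofunctor C AA DD (cof_comp C AA BB G F)" by (simp add: K_def)
qed

lemma peGpd_simps [simp]:
  "Ob (peGpd \<kappa> C) = {AA. etale_groupoid \<kappa> C AA}"
  "Arr AA F BB \<in> Mor (peGpd \<kappa> C) \<longleftrightarrow> etale_groupoid \<kappa> C AA \<and> etale_groupoid \<kappa> C BB \<and> partite_cofunctor C AA BB F"
  "Idt (peGpd \<kappa> C) AA = Arr AA (cof_id C AA) AA"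
  "Arr BB' G DD \<cdot>\<^bsub>peGpd \<kappa> C\<^esub> Arr AA F BB = Arr AA (cof_comp C AA BB G F) DD"
  by (auto simp: peGpd_def)

lemma peGpd_mor:
  assumes "h \<in> Mor (peGpd \<kappa> C)" "join_restriction_category C"
  obtains AA F BB where "h = Arr AA F BB" "etale_groupoid \<kappa> C AA" "etale_groupoid \<kappa> C BB"
    "internal_cofunctor C AA BB F"
proof -
  obtain AA F BB where h: "h = Arr AA F BB" "etale_groupoid \<kappa> C AA" "etale_groupoid \<kappa> C BB" "partite_cofunctor C AA BB F"
    using assms(1) by (auto simp: peGpd_def)
  have "internal_category C AA" "internal_category C BB"
    using h(2,3) assms(2) by (simp_all add: etale_groupoid_def partite_groupoid_def internal_category_def)
  then have "internal_cofunctor C AA BB F" using internal_cofunctorI h(2-4) by blast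
  then show ?thesis using that h by blast
qed

context join_restriction_category
begin

lemma etale_internal: "etale_groupoid \<kappa> C AA \<Longrightarrow> internal_category C AA"
  by (simp add: etale_groupoid_def partite_groupoid_def internal_category_def join_restriction_category_axioms)

lemma peGpd_ArrI:
  "etale_groupoid \<kappa> C AA \<Longrightarrow> etale_groupoid \<kappa> C BB \<Longrightarrow> internal_cofunctor C AA BB F \<Longrightarrow> Arr AA F BB \<in> Hom (peGpd \<kappa> C) AA BB"
  using internal_cofunctor.is_partite_cofunctor by (simp add: Hom_def)

lemma peGpd_HomE:
  assumes "f \<in> Hom (peGpd \<kappa> C) AA BB"
  obtains F where "f = Arr AA F BB" "etale_groupoid \<kappa> C AA" "etale_groupoid \<kappa> C BB" "internal_cofunctor C AA BB F"
proof -
  have "f \<in> Mor (peGpd \<kappa> C)" "Dom f = AA" "Cod f = BB" using assms by (auto simp: Hom_def)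
  then show ?thesis using that by (elim peGpd_mor[OF _ join_restriction_category_axioms]) auto
qed

text \<open>Cofunctors are compared through their actions on elements by
  \<open>cofunctor_eqI\<close>; the formulas for identities and composites turn each law into an
  evaluation.\<close>

lemma peGpd_category: "category (peGpd \<kappa> C :: (('i, 'o, 'm) pcat, ('i, 'o, 'm) cofunctor) cat)"
proof
  fix f g h :: "(('i, 'o, 'm) pcat, ('i, 'o, 'm) cofunctor) arr" and X Y Z W :: "('i, 'o, 'm) pcat"
  show "Dom f \<in> Ob (peGpd \<kappa> C) \<and> Cod f \<in> Ob (peGpd \<kappa> C)" if "f \<in> Mor (peGpd \<kappa> C)"
    using that by (elim peGpd_mor[OF _ join_restriction_category_axioms]) simp
  show "Idt (peGpd \<kappa> C) X \<in> Hom (peGpd \<kappa> C) X X" if "X \<in> Ob (peGpd \<kappa> C)"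
    using that cof_id_internal(1)[OF etale_internal] by (auto intro!: peGpd_ArrI)
  {
    assume "f \<in> Hom (peGpd \<kappa> C) X Y"
    then obtain F where f: "f = Arr X F Y" "etale_groupoid \<kappa> C X" "etale_groupoid \<kappa> C Y" "internal_cofunctor C X Y F"
      by (rule peGpd_HomE)
    interpret F: internal_cofunctor C X Y F by fact
    note iX = cof_id_internal[OF etale_internal[OF f(2)]] and iY = cof_id_internal[OF etale_internal[OF f(3)]]
    have iXs: "cidx (cof_id C X) i = i" "cob (cof_id C X) i = Idt C (obj X i)" if "i \<in> idx X" for i
      using that by (simp_all add: cof_id_def)
    have iYs: "cidx (cof_id C Y) i = i" "cob (cof_id C Y) i = Idt C (obj Y i)" if "i \<in> idx Y" for i
      using that by (simp_all add: cof_id_def)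
    have "cof_comp C X X F (cof_id C X) = F"
    proof (rule cofunctor_eqI[OF cof_comp_internal(1)[OF iX(1) f(4)] f(4)])
      fix i assume [simp]: "i \<in> idx X"
      show 1: "cidx (cof_comp C X X F (cof_id C X)) i = cidx F i" "cob (cof_comp C X X F (cof_id C X)) i = cob F i"
        by (simp_all add: cof_comp_def iXs)
      fix j u y assume [simp]: "j \<in> idx X" and c: "cdom C X Y (cof_comp C X X F (cof_id C X)) i j u y"
      have "cdom C X X (cof_id C X) i j u (cob F i \<cdot> y)" using c 1 iXs by (simp add: cdom_def)
      then show "capp C X (cof_comp C X X F (cof_id C X)) i j u y = capp C X F i j u y"
        using cof_comp_internal(2)[OF iX(1) f(4) _ _ c] iX(2) iXs by simp
    qed
    then show "f \<cdot>\<^bsub>peGpd \<kappa> C\<^esub> Idt (peGpd \<kappa> C) X = f" by (simp add: f)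
    have "cof_comp C X Y (cof_id C Y) F = F"
    proof (rule cofunctor_eqI[OF cof_comp_internal(1)[OF f(4) iY(1)] f(4)])
      fix i assume [simp]: "i \<in> idx X"
      show 1: "cidx (cof_comp C X Y (cof_id C Y) F) i = cidx F i" "cob (cof_comp C X Y (cof_id C Y) F) i = cob F i"
        by (simp_all add: cof_comp_def iYs)
      fix j u y assume [simp]: "j \<in> idx X" and c: "cdom C X Y (cof_comp C X Y (cof_id C Y) F) i j u y"
      have c': "cdom C X Y F i j u y" using c 1 by (simp add: cdom_def)
      have y [simp]: "y \<in> Mor C" "Cod y = obj Y (cidx F i)" using c' by (simp_all add: cdom_def)
      have "cdom C Y Y (cof_id C Y) (cidx F i) (cidx F j) (capp C X F i j u y) y"
        using F.capp_simps[OF _ _ c'] F.capp_src[OF _ _ c'] iYs by (simp add: cdom_def)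
      then show "capp C X (cof_comp C X Y (cof_id C Y) F) i j u y = capp C X F i j u y"
        using cof_comp_internal(2)[OF f(4) iY(1) _ _ c] iY(2) iYs by simp
    qed
    then show "Idt (peGpd \<kappa> C) Y \<cdot>\<^bsub>peGpd \<kappa> C\<^esub> f = f" by (simp add: f)
    {
      assume "g \<in> Hom (peGpd \<kappa> C) Y Z"
      then obtain G where g: "g = Arr Y G Z" "etale_groupoid \<kappa> C Y" "etale_groupoid \<kappa> C Z" "internal_cofunctor C Y Z G"
        by (rule peGpd_HomE)
      interpret G: internal_cofunctor C Y Z G by fact
      note GF = cof_comp_internal[OF f(4) g(4)]
      show "g \<cdot>\<^bsub>peGpd \<kappa> C\<^esub> f \<in> Hom (peGpd \<kappa> C) X Z"
        using peGpd_ArrI[OF f(2) g(3) GF(1)] by (simp add: f g)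
      assume "h \<in> Hom (peGpd \<kappa> C) Z W"
      then obtain H where h: "h = Arr Z H W" "etale_groupoid \<kappa> C Z" "etale_groupoid \<kappa> C W" "internal_cofunctor C Z W H"
        by (rule peGpd_HomE)
      interpret H: internal_cofunctor C Z W H by fact
      note HG = cof_comp_internal[OF g(4) h(4)]
      note L = cof_comp_internal[OF f(4) HG(1)] and R = cof_comp_internal[OF GF(1) h(4)]
      let ?L = "cof_comp C X Y (cof_comp C Y Z H G) F" and ?R = "cof_comp C X Z H (cof_comp C X Y G F)"
      have "?L = ?R"
      proof (rule cofunctor_eqI[OF L(1) R(1)])
        fix i assume i [simp]: "i \<in> idx X"
        let ?i = "cidx F i" let ?i' = "cidx G ?i"
        have s: "cidx (cof_comp C Y Z H G) ?i = cidx H ?i'" "cob (cof_comp C Y Z H G) ?i = cob G ?i \<cdot> cob H ?i'"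
          "cidx (cof_comp C X Y G F) i = ?i'" "cob (cof_comp C X Y G F) i = cob F i \<cdot> cob G ?i"
          by (simp_all add: cof_comp_def)
        show 1: "cidx ?L i = cidx ?R i"
          and 2: "cob ?L i = cob ?R i"
          by (simp_all add: cof_comp_def)
        have cL: "cidx ?L i = cidx H ?i'"
          "cob ?L i = cob F i \<cdot> cob G ?i \<cdot> cob H ?i'"
          by (simp_all add: cof_comp_def)
        fix j u y assume j [simp]: "j \<in> idx X" and c: "cdom C X W ?L i j u y"
        have c': "cdom C X W ?R i j u y" using c 1 2 by (simp add: cdom_def)
        have y [simp]: "y \<in> Mor C" "Cod y = obj W (cidx H ?i')" and e: "src X i j \<cdot> u = cob F i \<cdot> cob G ?i \<cdot> cob H ?i' \<cdot> y"
          and u: "u \<in> Mor C" "Dom u = Dom y" "Cod u = mob X i j"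
          using c cL by (simp_all add: cdom_def)
        have sj: "cidx (cof_comp C X Y G F) j = cidx G (cidx F j)" by (simp add: cof_comp_def)
        let ?v = "capp C X F i j u (cob G ?i \<cdot> cob H ?i' \<cdot> y)"
        have d1: "cdom C X Y F i j u (cob G ?i \<cdot> cob H ?i' \<cdot> y)" using e u by (simp add: cdom_def)
        have d2: "cdom C Y W (cof_comp C Y Z H G) ?i (cidx F j) ?v y"
          using F.capp_simps[OF i j d1] F.capp_src[OF i j d1] s by (simp add: cdom_def)
        have d3: "cdom C X Z (cof_comp C X Y G F) i j u (cob H ?i' \<cdot> y)" using e u s by (simp add: cdom_def)
        show "capp C X ?L i j u y = capp C X ?R i j u y"
          using L(2)[OF i j c] R(2)[OF i j c'] HG(2)[OF _ _ d2] GF(2)[OF i j d3] s sj by simp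
      qed
      then show "(h \<cdot>\<^bsub>peGpd \<kappa> C\<^esub> g) \<cdot>\<^bsub>peGpd \<kappa> C\<^esub> f = h \<cdot>\<^bsub>peGpd \<kappa> C\<^esub> g \<cdot>\<^bsub>peGpd \<kappa> C\<^esub> f"
        unfolding f g h by simp
    }
  }
qed

end

section \<open>Cofunctors and sections\<close>

definition fsec ::
    "('o, 'm) rcat \<Rightarrow> ('i, 'o, 'm) pcat \<Rightarrow> ('i, 'o, 'm) cofunctor \<Rightarrow> 'i \<Rightarrow> 'i \<Rightarrow> ('o, 'm) arr \<Rightarrow> ('o, 'm) arr" where
  "fsec C AA F i j s = cmor F i j \<cdot>\<^bsub>C\<^esub> pull_section C (src AA i j) (cob F i) s"

context cofunctor_data
begin

lemma fsec_capp: "fsec C AA F i j s = capp C AA F i j (s \<cdot> cob F i) (Rst C (s \<cdot> cob F i))"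
  by (simp add: fsec_def capp_def pull_section_def)

context
  fixes i j s
  assumes ij [simp]: "i \<in> idx AA" "j \<in> idx AA" and s: "A.psec i j s"
begin

lemma cdom_fsec: "cdom C AA BB F i j (s \<cdot> cob F i) (Rst C (s \<cdot> cob F i))"
proof -
  note [simp] = A.psecD[OF s ij]
  have "Rst C s \<cdot> cob F i = cob F i \<cdot> Rst C (s \<cdot> cob F i)" by (rule A.rst_slide) simp_all
  then show ?thesis by (simp add: cdom_def)
qed

lemma fsec_mor:
  "fsec C AA F i j s \<in> Mor C" "Dom (fsec C AA F i j s) = obj BB (cidx F i)"
  "Cod (fsec C AA F i j s) = mob BB (cidx F i) (cidx F j)"
  using capp_simps[OF ij cdom_fsec] A.psecD[OF s ij] by (simp_all add: fsec_capp)

lemma fsec_cmp: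
  assumes w [simp]: "w \<in> Mor C" "Cod w = obj BB (cidx F i)"
  shows "fsec C AA F i j s \<cdot> w = capp C AA F i j (s \<cdot> cob F i \<cdot> w) (w \<cdot> Rst C (s \<cdot> cob F i \<cdot> w))"
proof -
  note [simp] = A.psecD(1-3)[OF s ij]
  have "Rst C (s \<cdot> cob F i) \<cdot> w = w \<cdot> Rst C ((s \<cdot> cob F i) \<cdot> w)" by (rule A.rst_slide) simp_all
  then show ?thesis unfolding fsec_capp using cdom_cmp(2)[OF ij cdom_fsec, of w] by simp
qed

end

text \<open>Preparation for the image of a composite. After reindexing along \<open>cob F i\<close>,
  the first section becomes \<open>x\<close>, the second applied to its target becomes
  \<open>b\<close>, and \<open>y\<close> is the domain on which their product is formed.\<close>

lemma scomp_cob: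
  assumes ijk [simp]: "i \<in> idx AA" "j \<in> idx AA" "k \<in> idx AA" and s: "A.psec i j s" and t: "A.psec j k t"
    and x_def: "x = s \<cdot> cob F i" and bx: "b = t \<cdot> tgt AA i j \<cdot> x" and yb: "y = Rst C b"
  shows "scomp C AA i j k t s \<cdot> cob F i = gmul C AA i j k b (x \<cdot> y)"
    and "Rst C (scomp C AA i j k t s \<cdot> cob F i) = y"
    and "Rst C x \<cdot> y = y" and "src AA j k \<cdot> b = tgt AA i j \<cdot> x \<cdot> y"
    and "x \<in> Mor C" "Dom x = obj BB (cidx F i)" "Cod x = mob AA i j"
    and "b \<in> Mor C" "Dom b = obj BB (cidx F i)" "Cod b = mob AA j k"
    and "y \<in> Mor C" "Dom y = obj BB (cidx F i)" "Cod y = obj BB (cidx F i)" "Rst C y = y"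
    and "src AA i j \<cdot> x \<cdot> y = cob F i \<cdot> y"
proof -
  note S [simp] = A.psecD[OF s ijk(1,2)] and T [simp] = A.psecD[OF t ijk(2,3)]
  define u where "u = t \<cdot> tgt AA i j \<cdot> s"
  have u [simp]: "u \<in> Mor C" "Dom u = obj AA i" "Cod u = mob AA j k" by (simp_all add: u_def)
  show x [simp]: "x \<in> Mor C" "Dom x = obj BB (cidx F i)" "Cod x = mob AA i j" by (simp_all add: x_def)
  have tx [simp]: "tgt AA i j \<cdot> x \<in> Mor C" "Dom (tgt AA i j \<cdot> x) = obj BB (cidx F i)" "Cod (tgt AA i j \<cdot> x) = obj AA j" by simp_all
  have bu: "b = u \<cdot> cob F i" by (simp add: bx x_def u_def)
  show b [simp]: "b \<in> Mor C" "Dom b = obj BB (cidx F i)" "Cod b = mob AA j k" by (simp_all add: bu)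
  show y [simp]: "y \<in> Mor C" "Dom y = obj BB (cidx F i)" "Cod y = obj BB (cidx F i)" "Rst C y = y" by (simp_all add: yb)
  show xy: "Rst C x \<cdot> y = y" unfolding yb bx using A.rst_absorb(2)[of x "t \<cdot> tgt AA i j"] by simp
  have "src AA j k \<cdot> b = Rst C t \<cdot> tgt AA i j \<cdot> x" unfolding bx by simp
  also have "... = (tgt AA i j \<cdot> x) \<cdot> y" unfolding yb bx by (rule A.rst_slide) simp_all
  finally show sb: "src AA j k \<cdot> b = tgt AA i j \<cdot> x \<cdot> y" by simp
  have "(s \<cdot> Rst C u) \<cdot> cob F i = s \<cdot> Rst C u \<cdot> cob F i" by simp
  also have "Rst C u \<cdot> cob F i = cob F i \<cdot> y" unfolding yb bu by (rule A.rst_slide) simp_all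
  also have "s \<cdot> cob F i \<cdot> y = x \<cdot> y" by (simp add: x_def)
  finally have sy: "(s \<cdot> Rst C u) \<cdot> cob F i = x \<cdot> y" .
  have sc: "scomp C AA i j k t s = gmul C AA i j k u (s \<cdot> Rst C u)" unfolding scomp_def u_def ..
  have st: "src AA j k \<cdot> u = tgt AA i j \<cdot> s \<cdot> Rst C u" unfolding u_def by (rule A.scomp_aux[OF ijk s t])
  show G: "scomp C AA i j k t s \<cdot> cob F i = gmul C AA i j k b (x \<cdot> y)"
    unfolding sc bu sy[symmetric] by (rule A.gmul_cmp[OF ijk _ _ _ _ _ st]) simp_all
  have "Rst C (gmul C AA i j k b (x \<cdot> y)) = Rst C (x \<cdot> y)"
    by (rule A.gmul_simps(6)[OF ijk _ _ _ _ _ sb]) simp_all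
  also have "... = y" using A.rst_cmp_idem[of y x] xy by simp
  finally show "Rst C (scomp C AA i j k t s \<cdot> cob F i) = y" unfolding G .
  have "src AA i j \<cdot> x = cob F i \<cdot> Rst C x"
    using cdom_fsec[OF ijk(1,2) s] by (simp add: cdom_def x_def)
  from A.cmp_rw[OF this, of y] show "src AA i j \<cdot> x \<cdot> y = cob F i \<cdot> y" using xy by simp
qed

text \<open>A cofunctor out of an etale groupoid is determined by its action on sections, and its
  axioms may be checked there.\<close>

lemma internal_cofunctor_by_sections:
  assumes G: "internal_groupoid C AA \<iota>"
    and src: "\<And>i j a. i \<in> idx AA \<Longrightarrow> j \<in> idx AA \<Longrightarrow> a \<in> Hom (Phi_cat C AA) i j \<Longrightarrow>
      B.psec (cidx F i) (cidx F j) (fsec C AA F i j (sect AA a)) \<and>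
      Rst C (fsec C AA F i j (sect AA a)) = Rst C (sect AA a \<cdot> cob F i)"
    and tgt: "\<And>i j a. i \<in> idx AA \<Longrightarrow> j \<in> idx AA \<Longrightarrow> a \<in> Hom (Phi_cat C AA) i j \<Longrightarrow>
      cob F j \<cdot> tgt BB (cidx F i) (cidx F j) \<cdot> fsec C AA F i j (sect AA a) = tgt AA i j \<cdot> sect AA a \<cdot> cob F i"
    and unt: "\<And>i. i \<in> idx AA \<Longrightarrow> fsec C AA F i i (unt AA i) = unt BB (cidx F i)"
    and cmp: "\<And>i j k a b. i \<in> idx AA \<Longrightarrow> j \<in> idx AA \<Longrightarrow> k \<in> idx AA \<Longrightarrow>
      a \<in> Hom (Phi_cat C AA) i j \<Longrightarrow> b \<in> Hom (Phi_cat C AA) j k \<Longrightarrow>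
      fsec C AA F i k (scomp C AA i j k (sect AA b) (sect AA a)) =
        scomp C BB (cidx F i) (cidx F j) (cidx F k) (fsec C AA F j k (sect AA b)) (fsec C AA F i j (sect AA a))"
  shows "internal_cofunctor C AA BB F"
proof (rule internal_cofunctorI)
  show "internal_category C AA" "internal_category C BB" by unfold_locales
  interpret G: internal_groupoid C AA \<iota> by fact
  have cov: "cover C (pb2 C (src AA i j) (cob F i)) (Hom (Phi_cat C AA) i j) (\<lambda>a. pull_section C (src AA i j) (cob F i) (sect AA a))"
    if "i \<in> idx AA" "j \<in> idx AA" for i j
    by (rule A.cover_pullback[OF G.section_cover]) (use that in simp_all)
  have ps: "A.psec i j (sect AA a)" if "a \<in> Hom (Phi_cat C AA) i j" for a i j
    using A.phi_morD(3)[of a] that by (auto simp: Hom_def)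
  show "partite_cofunctor C AA BB F"
  proof
    fix i j k
    show "cidx F \<in> idx AA \<rightarrow>\<^sub>E idx BB" "cob F \<in> extensional (idx AA)" using idx_F ext_F by auto
    show "cmor F i j = undefined" if "\<not> (i \<in> idx AA \<and> j \<in> idx AA)" using ext_F(2) that .
    assume i [simp]: "i \<in> idx AA"
    show "cob F i \<in> Hom C (obj BB (cidx F i)) (obj AA i) \<and> total_map C (cob F i)" using cob_F i .
    show "cmor F i i \<cdot> pair C (src AA i i) (cob F i) (unt AA i \<cdot> cob F i) (Idt C (obj BB (cidx F i))) = unt BB (cidx F i)"
      using unt[OF i] by (simp add: fsec_def pull_section_def)
    assume j [simp]: "j \<in> idx AA"
    let ?p1 = "pb1 C (src AA i j) (cob F i)" and ?p2 = "pb2 C (src AA i j) (cob F i)"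
    note pb [simp] = A.pb_simps[OF pbF[OF i j]]
    note P = A.pull_section_props[OF pbF[OF i j] ps]
    have cs: "src BB (cidx F i) (cidx F j) \<cdot> cmor F i j = ?p2"
    proof (rule A.cover_eq[OF cov[OF i j], of _ "obj BB (cidx F i)"])
      fix a assume a: "a \<in> Hom (Phi_cat C AA) i j"
      have "src BB (cidx F i) (cidx F j) \<cdot> fsec C AA F i j (sect AA a) = Rst C (sect AA a \<cdot> cob F i)"
        using src[OF i j a] B.psecD(4)[of "cidx F i" "cidx F j"] by simp
      then show "(src BB (cidx F i) (cidx F j) \<cdot> cmor F i j) \<cdot> pull_section C (src AA i j) (cob F i) (sect AA a) =
          ?p2 \<cdot> pull_section C (src AA i j) (cob F i) (sect AA a)"
        using P(1-5)[OF a] by (simp add: fsec_def)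
    qed (simp_all add: Hom_def)
    have "Rst C (cmor F i j) = Rst C (src BB (cidx F i) (cidx F j) \<cdot> cmor F i j)" by simp
    then have cR: "Rst C (cmor F i j) = Idt C (pbo C (src AA i j) (cob F i))"
      unfolding cs using A.pb_total(2)[OF pbF[OF i j]] by simp
    show "cmor F i j \<in> Hom C (pbo C (src AA i j) (cob F i)) (mob BB (cidx F i) (cidx F j)) \<and> total_map C (cmor F i j)"
      using cR by (simp add: Hom_def A.total_iff)
    show "src BB (cidx F i) (cidx F j) \<cdot> cmor F i j = ?p2" by (rule cs)
    have ct: "cob F j \<cdot> tgt BB (cidx F i) (cidx F j) \<cdot> cmor F i j = tgt AA i j \<cdot> ?p1"
    proof (rule A.cover_eq[OF cov[OF i j], of _ "obj AA j"])
      fix a assume a: "a \<in> Hom (Phi_cat C AA) i j"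
      show "(cob F j \<cdot> tgt BB (cidx F i) (cidx F j) \<cdot> cmor F i j) \<cdot> pull_section C (src AA i j) (cob F i) (sect AA a) =
          (tgt AA i j \<cdot> ?p1) \<cdot> pull_section C (src AA i j) (cob F i) (sect AA a)"
        using P(1-5)[OF a] tgt[OF i j a] by (simp add: fsec_def)
    qed (simp_all add: Hom_def)
    then show "cob F j \<cdot> tgt BB (cidx F i) (cidx F j) \<cdot> cmor F i j = tgt AA i j \<cdot> ?p1" .
    assume k [simp]: "k \<in> idx AA"
    let ?i = "cidx F i" and ?j = "cidx F j" and ?k = "cidx F k"
    let ?g = "tgt AA i j \<cdot> ?p1"
    have pb' [simp]: "has_pb C (src AA j k) ?g"
    proof (rule A.src_has_pb)
      show "Rst C ?g = Idt C (Dom ?g)" using A.pb_total(1)[OF pbF[OF i j]] by simp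
    qed simp_all
    let ?r1 = "pb1 C (src AA j k) ?g" and ?r2 = "pb2 C (src AA j k) ?g"
    let ?W = "pbo C (src AA j k) ?g"
    note [simp] = A.pb_simps[OF pb']
    have covW: "cover C ?r2 (Hom (Phi_cat C AA) j k) (\<lambda>b. pull_section C (src AA j k) ?g (sect AA b))"
      by (rule A.cover_pullback[OF G.section_cover]) simp_all
    \<comment> \<open>Composable pairs of sections cover the pullback on which multiplicativity is
      stated, so the two sides are compared on each pair.\<close>
    have cov2: "cover C (?p2 \<cdot> ?r2) (Hom (Phi_cat C AA) i j \<times> Hom (Phi_cat C AA) j k)
        (\<lambda>(a, b). pull_section C (src AA j k) ?g (sect AA b) \<cdot> pull_section C (src AA i j) (cob F i) (sect AA a))"
      by (rule A.cover_cmp[OF cov[OF i j] covW]) simp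
    note W = A.pull_section_props[OF pb' ps]
    define u where "u = ?p1 \<cdot> ?r2"
    define z where "z = ?p2 \<cdot> ?r2"
    define c where "c = cmor F i j \<cdot> ?r2"
    define tc where "tc = tgt BB ?i ?j \<cdot> c"
    have [simp]: "u \<in> Mor C" "Dom u = ?W" "Cod u = mob AA i j" "z \<in> Mor C" "Dom z = ?W" "Cod z = obj BB ?i"
      "c \<in> Mor C" "Dom c = ?W" "Cod c = mob BB ?i ?j" "tc \<in> Mor C" "Dom tc = ?W" "Cod tc = obj BB ?j"
      by (simp_all add: u_def z_def c_def tc_def)
    have e1: "src AA j k \<cdot> ?r1 = tgt AA i j \<cdot> u" using A.pb_commutes[OF pb'] by (simp add: u_def)
    have e2: "src AA i j \<cdot> u = cob F i \<cdot> z"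
      using A.cmp_rw[OF A.pb_commutes[OF pbF[OF i j]], of ?r2] by (simp add: u_def z_def)
    have e3: "cob F j \<cdot> tc = src AA j k \<cdot> ?r1"
    proof -
      have "(cob F j \<cdot> tgt BB ?i ?j \<cdot> cmor F i j) \<cdot> ?r2 = (tgt AA i j \<cdot> ?p1) \<cdot> ?r2" unfolding ct ..
      then show ?thesis using e1 by (simp add: tc_def c_def u_def)
    qed
    have "?r1 \<in> Mor C" "u \<in> Mor C" "Dom ?r1 = Dom u" "Cod ?r1 = mob AA j k" "Cod u = mob AA i j" by simp_all
    note Gx = A.gmul_simps[OF i j k this e1]
    define g where "g = gmul C AA i j k ?r1 u"
    have g: "g \<in> Mor C" "Dom g = ?W" "Cod g = mob AA i k" "src AA i k \<cdot> g = src AA i j \<cdot> u"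
      using Gx by (simp_all add: g_def)
    have d1: "cdom C AA BB F i k g z" using g e2 by (simp add: cdom_def)
    have d2: "cdom C AA BB F j k ?r1 tc" using e3 by (simp add: cdom_def)
    define c2 where "c2 = capp C AA F j k ?r1 tc"
    have c2: "c2 \<in> Mor C" "Dom c2 = ?W" "Cod c2 = mob BB ?j ?k" using capp_simps[OF j k d2] by (simp_all add: c2_def)
    have s2: "src BB ?j ?k \<cdot> c2 = tgt BB ?i ?j \<cdot> c"
    proof -
      note [simp] = A.pb_simps[OF pbF[OF j k]]
      have "src BB ?j ?k \<cdot> cmor F j k = pb2 C (src AA j k) (cob F j)"
      proof (rule A.cover_eq[OF cov[OF j k], of _ "obj BB (cidx F j)"])
        fix a assume a: "a \<in> Hom (Phi_cat C AA) j k"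
        have "src BB (cidx F j) (cidx F k) \<cdot> fsec C AA F j k (sect AA a) = Rst C (sect AA a \<cdot> cob F j)"
          using src[OF j k a] B.psecD(4)[of "cidx F j" "cidx F k"] by simp
        then show "(src BB (cidx F j) (cidx F k) \<cdot> cmor F j k) \<cdot> pull_section C (src AA j k) (cob F j) (sect AA a) =
            pb2 C (src AA j k) (cob F j) \<cdot> pull_section C (src AA j k) (cob F j) (sect AA a)"
          using A.pull_section_props(1-5)[OF pbF[OF j k] ps[OF a]] by (simp add: fsec_def)
      qed (simp_all add: Hom_def)
      then show ?thesis
        using A.cmp_rw[of "src BB ?j ?k" "cmor F j k" "pb2 C (src AA j k) (cob F j)" "pair C (src AA j k) (cob F j) ?r1 tc"]
          cpair[OF j k d2] by (simp add: c2_def capp_def tc_def)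
    qed
    note Gc = B.gmul_simps[OF cidx_in[OF i] cidx_in[OF j] cidx_in[OF k] c2(1) _ _ c2(3) _ s2]
    have "capp C AA F i k g z = gmul C BB ?i ?j ?k c2 c"
    proof (rule A.cover_eq[OF cov2, of _ "mob BB ?i ?k"])
      show "capp C AA F i k g z \<in> Hom C (Dom (?p2 \<cdot> ?r2)) (mob BB ?i ?k)"
        using capp_simps[OF i k d1] by (simp add: Hom_def)
      show "gmul C BB ?i ?j ?k c2 c \<in> Hom C (Dom (?p2 \<cdot> ?r2)) (mob BB ?i ?k)"
        using Gc(1-3) c2 by (simp add: Hom_def)
      fix ab assume "ab \<in> Hom (Phi_cat C AA) i j \<times> Hom (Phi_cat C AA) j k"
      then obtain a b where ab: "ab = (a, b)" and a: "a \<in> Hom (Phi_cat C AA) i j" and b: "b \<in> Hom (Phi_cat C AA) j k" by blast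
      define s t where "s = sect AA a" and "t = sect AA b"
      have s: "A.psec i j s" and t: "A.psec j k t" using ps a b by (auto simp: s_def t_def)
      note S [simp] = A.psecD(1-3)[OF s i j] and T [simp] = A.psecD(1-3)[OF t j k]
      define x B y where "x = s \<cdot> cob F i" and "B = t \<cdot> tgt AA i j \<cdot> x" and "y = Rst C B"
      note K = scomp_cob[OF i j k s t x_def B_def y_def]
      note [simp] = K(5-14)
      define p where "p = pull_section C (src AA i j) (cob F i) s"
      define q where "q = pull_section C (src AA j k) ?g t"
      note Pp = P[OF a, folded s_def, folded p_def] and Pq = W[OF b, folded t_def, folded q_def]
      have p [simp]: "p \<in> Mor C" "Dom p = obj BB ?i" "Cod p = pbo C (src AA i j) (cob F i)" using Pp by simp_all
      have q [simp]: "q \<in> Mor C" "Dom q = pbo C (src AA i j) (cob F i)" "Cod q = ?W" using Pq by simp_all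
      have tg: "t \<cdot> ?g \<cdot> p = B" using Pp(4) by (simp add: B_def x_def)
      \<comment> \<open>\<open>q \<cdot> p\<close> is the point of that pullback given by the two
        sections; this and the following equations compute its components.\<close>
      have r1q: "?r1 \<cdot> q \<cdot> p = B"
        using A.cmp_rw[OF Pq(4), of p] tg by simp
      have r2q: "?r2 \<cdot> q \<cdot> p = p \<cdot> y"
      proof -
        have "?r2 \<cdot> q \<cdot> p = Rst C (t \<cdot> ?g) \<cdot> p" by (rule A.cmp_rw[OF Pq(5)]) simp_all
        also have "... = p \<cdot> Rst C ((t \<cdot> ?g) \<cdot> p)" by (rule A.rst_slide) simp_all
        also have "(t \<cdot> ?g) \<cdot> p = B" using tg by simp
        finally show ?thesis by (simp only: y_def[symmetric])
      qed
      have uq: "u \<cdot> q \<cdot> p = x \<cdot> y"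
      proof -
        have "u \<cdot> q \<cdot> p = (?p1 \<cdot> p) \<cdot> y" using r2q by (simp add: u_def)
        then show ?thesis using Pp(4) by (simp add: x_def)
      qed
      have zq: "z \<cdot> q \<cdot> p = y"
      proof -
        have "z \<cdot> q \<cdot> p = (?p2 \<cdot> p) \<cdot> y" using r2q by (simp add: z_def)
        then show ?thesis using Pp(5) K(3) by (simp add: x_def)
      qed
      define h where "h = fsec C AA F i j s"
      have h [simp]: "h \<in> Mor C" "Dom h = obj BB ?i" "Cod h = mob BB ?i ?j" using fsec_mor[OF i j s] by (simp_all add: h_def)
      have cq: "c \<cdot> q \<cdot> p = h \<cdot> y"
      proof -
        have "c \<cdot> q \<cdot> p = (cmor F i j \<cdot> p) \<cdot> y" using r2q by (simp add: c_def)
        then show ?thesis by (simp add: h_def fsec_def p_def)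
      qed
      have th: "cob F j \<cdot> tgt BB ?i ?j \<cdot> h = tgt AA i j \<cdot> x"
        using tgt[OF i j a] by (simp add: h_def s_def x_def)
      define l where "l = fsec C AA F j k t"
      have l [simp]: "l \<in> Mor C" "Dom l = obj BB ?j" "Cod l = mob BB ?j ?k" using fsec_mor[OF j k t] by (simp_all add: l_def)
      have lth: "l \<cdot> tgt BB ?i ?j \<cdot> h = capp C AA F j k B (tgt BB ?i ?j \<cdot> h \<cdot> y)"
      proof -
        have "l \<cdot> (tgt BB ?i ?j \<cdot> h) = capp C AA F j k (t \<cdot> cob F j \<cdot> (tgt BB ?i ?j \<cdot> h))
            ((tgt BB ?i ?j \<cdot> h) \<cdot> Rst C (t \<cdot> cob F j \<cdot> (tgt BB ?i ?j \<cdot> h)))"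
          unfolding l_def by (rule fsec_cmp[OF j k t]) simp_all
        then show ?thesis unfolding th B_def[symmetric] y_def[symmetric] by simp
      qed
      have c2q: "c2 \<cdot> q \<cdot> p = l \<cdot> tgt BB ?i ?j \<cdot> h"
      proof -
        have "c2 \<cdot> (q \<cdot> p) = capp C AA F j k (?r1 \<cdot> (q \<cdot> p)) (tc \<cdot> (q \<cdot> p))"
          unfolding c2_def by (rule cdom_cmp(2)[OF j k d2]) simp_all
        also have "tc \<cdot> (q \<cdot> p) = tgt BB ?i ?j \<cdot> h \<cdot> y" using cq by (simp add: tc_def)
        finally show ?thesis unfolding r1q lth .
      qed
      have "capp C AA F i k g z \<cdot> (q \<cdot> p) = capp C AA F i k (g \<cdot> (q \<cdot> p)) (z \<cdot> (q \<cdot> p))"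
        by (rule cdom_cmp(2)[OF i k d1]) simp_all
      also have "g \<cdot> (q \<cdot> p) = gmul C AA i j k (?r1 \<cdot> (q \<cdot> p)) (u \<cdot> (q \<cdot> p))"
        unfolding g_def by (rule A.gmul_cmp[OF i j k _ _ _ _ _ e1]) simp_all
      also have "... = scomp C AA i j k t s \<cdot> cob F i" unfolding r1q uq K(1) ..
      also have "z \<cdot> (q \<cdot> p) = Rst C (scomp C AA i j k t s \<cdot> cob F i)" unfolding zq K(2) ..
      also have "capp C AA F i k (scomp C AA i j k t s \<cdot> cob F i) \<dots> = scomp C BB ?i ?j ?k l h"
        unfolding fsec_capp[symmetric] using cmp[OF i j k a b] by (simp add: s_def t_def l_def h_def)
      finally have L: "capp C AA F i k g z \<cdot> (q \<cdot> p) = scomp C BB ?i ?j ?k l h" .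
      have ba: "b \<cdot>\<^bsub>Phi_cat C AA\<^esub> a \<in> Hom (Phi_cat C AA) i k" "sect AA (b \<cdot>\<^bsub>Phi_cat C AA\<^esub> a) = scomp C AA i j k t s"
        using A.phi_cmp[of a b] a b by (simp_all add: Hom_def s_def t_def)
      have hp: "B.psec ?i ?j h" and lp: "B.psec ?j ?k l"
        using src[OF i j a] src[OF j k b] by (simp_all add: h_def l_def s_def t_def)
      \<comment> \<open>The domain of the composite in \<open>BB\<close> is read off from the
        assumption on composites: it is the domain of the image of the composite section.\<close>
      have "Rst C (l \<cdot> tgt BB ?i ?j \<cdot> h) = Rst C (scomp C BB ?i ?j ?k l h)"
        using B.scomp_simps(4)[OF _ _ _ hp lp] by simp
      also have "... = Rst C (fsec C AA F i k (sect AA (b \<cdot>\<^bsub>Phi_cat C AA\<^esub> a)))"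
        using cmp[OF i j k a b] ba(2) by (simp add: s_def t_def l_def h_def)
      also have "... = y" using src[OF i k ba(1)] unfolding ba(2) K(2) by simp
      finally have Ry: "Rst C (l \<cdot> tgt BB ?i ?j \<cdot> h) = y" .
      have "gmul C BB ?i ?j ?k c2 c \<cdot> (q \<cdot> p) = gmul C BB ?i ?j ?k (c2 \<cdot> (q \<cdot> p)) (c \<cdot> (q \<cdot> p))"
        by (rule B.gmul_cmp[OF cidx_in[OF i] cidx_in[OF j] cidx_in[OF k] c2(1) _ _ c2(3) _ s2]) (use c2 in simp_all)
      also have "... = scomp C BB ?i ?j ?k l h" unfolding c2q cq scomp_def Ry ..
      finally show "capp C AA F i k g z \<cdot> (case ab of (a, b) \<Rightarrow> pull_section C (src AA j k) ?g (sect AA b) \<cdot> pull_section C (src AA i j) (cob F i) (sect AA a)) =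
          gmul C BB ?i ?j ?k c2 c \<cdot> (case ab of (a, b) \<Rightarrow> pull_section C (src AA j k) ?g (sect AA b) \<cdot> pull_section C (src AA i j) (cob F i) (sect AA a))"
        using L by (simp add: ab s_def t_def p_def q_def)
    qed
    then show "let \<pi>1 = pb1 C (src AA i j) (cob F i); \<pi>2 = pb2 C (src AA i j) (cob F i);
           \<rho>1 = pb1 C (src AA j k) (tgt AA i j \<cdot> \<pi>1); \<rho>2 = pb2 C (src AA j k) (tgt AA i j \<cdot> \<pi>1);
           i' = cidx F i; j' = cidx F j; k' = cidx F k
       in cmor F i k \<cdot> pair C (src AA i k) (cob F i)
            (mul AA i j k \<cdot> pair C (src AA j k) (tgt AA i j) \<rho>1 (\<pi>1 \<cdot> \<rho>2)) (\<pi>2 \<cdot> \<rho>2) =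
          mul BB i' j' k' \<cdot> pair C (src BB j' k') (tgt BB i' j')
            (cmor F j k \<cdot> pair C (src AA j k) (cob F j) \<rho>1 (tgt BB i' j' \<cdot> cmor F i j \<cdot> \<rho>2))
            (cmor F i j \<cdot> \<rho>2)"
      unfolding Let_def capp_def gmul_def g_def z_def c2_def tc_def c_def u_def .
  qed
qed

end

context internal_cofunctor
begin

lemma fsec_src:
  assumes ij [simp]: "i \<in> idx AA" "j \<in> idx AA" and s: "A.psec i j s"
  shows "Rst C (fsec C AA F i j s) = Rst C (s \<cdot> cob F i)"
    "B.psec (cidx F i) (cidx F j) (fsec C AA F i j s)"
    "cob F j \<cdot> tgt BB (cidx F i) (cidx F j) \<cdot> fsec C AA F i j s = tgt AA i j \<cdot> s \<cdot> cob F i"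
proof -
  note c = cdom_fsec[OF ij s]
  show R: "Rst C (fsec C AA F i j s) = Rst C (s \<cdot> cob F i)"
    using capp_rst[OF ij c] A.psecD(1-3)[OF s ij] by (simp add: fsec_capp)
  show "B.psec (cidx F i) (cidx F j) (fsec C AA F i j s)"
    using capp_src[OF ij c] fsec_mor[OF ij s] R by (intro A.partial_sectionI) (simp_all add: fsec_capp)
  show "cob F j \<cdot> tgt BB (cidx F i) (cidx F j) \<cdot> fsec C AA F i j s = tgt AA i j \<cdot> s \<cdot> cob F i"
    using capp_tgt[OF ij c] by (simp add: fsec_capp)
qed

lemma fsec_unt:
  assumes i [simp]: "i \<in> idx AA" and e: "e \<in> rst_idem C (obj AA i)"
  shows "fsec C AA F i i (unt AA i \<cdot> e) = unt BB (cidx F i) \<cdot> Rst C (e \<cdot> cob F i)"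
proof -
  note [simp] = A.rst_idem_simps(1-3)[OF e]
  have "e \<cdot> cob F i = cob F i \<cdot> Rst C (e \<cdot> cob F i)" by (rule A.idem_slide[OF e]) simp_all
  then have *: "(unt AA i \<cdot> e) \<cdot> cob F i = unt AA i \<cdot> cob F i \<cdot> Rst C (e \<cdot> cob F i)" by simp
  have "Rst C ((unt AA i \<cdot> e) \<cdot> cob F i) = Rst C (e \<cdot> cob F i)" by simp
  then show ?thesis unfolding fsec_capp * using capp_unt[OF i, of "Rst C (e \<cdot> cob F i)"] * by simp
qed

text \<open>This is \<open>capp_gmul\<close> at the elements \<open>b\<close> and
  \<open>x \<cdot> y\<close>, where \<open>y\<close> is the domain on which both sections can be
  applied. What remains is that \<open>y\<close> is also the domain of the composite formed in
  \<open>BB\<close>.\<close>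

lemma fsec_scomp:
  assumes ijk [simp]: "i \<in> idx AA" "j \<in> idx AA" "k \<in> idx AA" and s: "A.psec i j s" and t: "A.psec j k t"
  shows "fsec C AA F i k (scomp C AA i j k t s) =
    scomp C BB (cidx F i) (cidx F j) (cidx F k) (fsec C AA F j k t) (fsec C AA F i j s)"
proof -
  let ?i = "cidx F i" and ?j = "cidx F j" and ?k = "cidx F k"
  define x b y where "x = s \<cdot> cob F i" and "b = t \<cdot> tgt AA i j \<cdot> x" and "y = Rst C b"
  note K = scomp_cob[OF ijk s t x_def b_def y_def]
  note [simp] = K(5-14)
  define h where "h = fsec C AA F i j s"
  define l where "l = fsec C AA F j k t"
  have h [simp]: "h \<in> Mor C" "Dom h = obj BB ?i" "Cod h = mob BB ?i ?j" using fsec_mor[OF ijk(1,2) s] by (simp_all add: h_def)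
  have l [simp]: "l \<in> Mor C" "Dom l = obj BB ?j" "Cod l = mob BB ?j ?k" using fsec_mor[OF ijk(2,3) t] by (simp_all add: l_def)
  have cx: "cdom C AA BB F i j (x \<cdot> y) y" using K(15) by (simp add: cdom_def)
  have hy: "h \<cdot> y = capp C AA F i j (x \<cdot> y) y"
  proof -
    have "h \<cdot> y = capp C AA F i j (x \<cdot> y) (Rst C x \<cdot> y)"
      unfolding h_def fsec_capp x_def[symmetric]
      by (rule cdom_cmp(2)[OF ijk(1,2) cdom_fsec[OF ijk(1,2) s, folded x_def]]) simp_all
    then show ?thesis unfolding K(3) .
  qed
  have th: "cob F j \<cdot> tgt BB ?i ?j \<cdot> h = tgt AA i j \<cdot> x"
    using fsec_src(3)[OF ijk(1,2) s] by (simp add: h_def x_def)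
  have lth: "l \<cdot> tgt BB ?i ?j \<cdot> h = capp C AA F j k b (tgt BB ?i ?j \<cdot> h \<cdot> y)"
  proof -
    have "l \<cdot> (tgt BB ?i ?j \<cdot> h) = capp C AA F j k (t \<cdot> cob F j \<cdot> (tgt BB ?i ?j \<cdot> h))
        ((tgt BB ?i ?j \<cdot> h) \<cdot> Rst C (t \<cdot> cob F j \<cdot> (tgt BB ?i ?j \<cdot> h)))"
      unfolding l_def by (rule fsec_cmp[OF ijk(2,3) t]) simp_all
    then show ?thesis unfolding th b_def[symmetric] y_def[symmetric] by simp
  qed
  have cb: "cdom C AA BB F j k b (tgt BB ?i ?j \<cdot> h \<cdot> y)"
    using A.cmp_rw[OF th, of y] K(4) by (simp add: cdom_def)
  have "Rst C (l \<cdot> tgt BB ?i ?j \<cdot> h) = Rst C (h \<cdot> y)"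
    unfolding lth capp_rst[OF ijk(2,3) cb] by simp
  also have "... = y" unfolding hy capp_rst[OF ijk(1,2) cx] by simp
  finally have Ry: "Rst C (l \<cdot> tgt BB ?i ?j \<cdot> h) = y" .
  have "fsec C AA F i k (scomp C AA i j k t s) = capp C AA F i k (gmul C AA i j k b (x \<cdot> y)) y"
    unfolding fsec_capp K(1)[symmetric] K(2) ..
  also have "... = gmul C BB ?i ?j ?k (capp C AA F j k b (tgt BB ?i ?j \<cdot> h \<cdot> y)) (h \<cdot> y)"
    unfolding hy by (rule capp_gmul[OF ijk cx _ _ _ K(4)]) simp_all
  also have "... = scomp C BB ?i ?j ?k l h" unfolding scomp_def lth[symmetric] Ry ..
  finally show ?thesis by (simp only: h_def l_def)
qed

end

section \<open>The functor into the category over \<open>C\<close>\<close>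

abbreviation Phi_fun where "Phi_fun C AA F \<equiv> fst (Phi_map C AA F)"

lemma Phi_map_simps:
  "Phi_map C AA F = (fst (Phi_map C AA F), \<lambda>i \<in> idx AA. cob F i)"
  "fo (Phi_fun C AA F) = (\<lambda>i \<in> idx AA. cidx F i)"
  "fm (Phi_fun C AA F) = (\<lambda>a \<in> Mor (Phi_cat C AA).
     Arr (cidx F (Dom a)) (Lab (fsec C AA F (Dom a) (Cod a) (sect AA a))) (cidx F (Cod a)))"
  by (simp_all add: Phi_map_def fsec_def Let_def)

text \<open>That the target of the image is a partial isomorphism is seen by carrying the inverse of
  \<open>a\<close> along: the images \<open>h\<close> and \<open>l\<close> of \<open>a\<close> and
  its inverse have units cut down to idempotents as composites, so their targets are partial
  inverses of each other.\<close>

lemma phi_map_mor: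
  fixes C :: "('o, 'm) rcat" (structure)
  assumes GA: "internal_groupoid C AA \<iota>" and F: "internal_cofunctor C AA BB F"
    and a: "a \<in> Mor (Phi_cat C AA)"
  shows "fm (Phi_fun C AA F) a \<in> Mor (Phi_cat C BB)"
    "Dom (fm (Phi_fun C AA F) a) = cidx F (Dom a)" "Cod (fm (Phi_fun C AA F) a) = cidx F (Cod a)"
    "sect BB (fm (Phi_fun C AA F) a) = fsec C AA F (Dom a) (Cod a) (sect AA a)"
proof -
  interpret F: internal_cofunctor C AA BB F by fact
  interpret G: internal_groupoid C AA \<iota> by fact
  define i j s where "i = Dom a" and "j = Cod a" and "s = sect AA a"
  note A = F.A.phi_morD[OF a, folded i_def j_def, folded s_def]
  note ij [simp] = A(1,2) and S [simp] = F.A.psecD(1-3)[OF A(3) A(1,2)]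
  define h where "h = fsec C AA F i j s"
  note h = F.fsec_mor[OF ij A(3), folded h_def] and hs = F.fsec_src[OF ij A(3), folded h_def]
  define b where "b = cinv (Phi_cat C AA) a"
  have b: "b \<in> Mor (Phi_cat C AA)" "Dom b = j" "Cod b = i" using a by (simp_all add: b_def i_def j_def)
  define t where "t = sect AA b"
  have t: "F.A.psec j i t" using F.A.phi_morD(3)[OF b(1)] b by (simp add: t_def)
  define l where "l = fsec C AA F j i t"
  have ls: "F.B.psec (cidx F j) (cidx F i) l" using F.fsec_src(2)[OF ij(2,1) t] by (simp add: l_def)
  have inv: "tgt BB (cidx F j) (cidx F i) \<cdot> l \<cdot> tgt BB (cidx F i) (cidx F j) \<cdot> h = Rst C h"
    if "i \<in> idx AA" "j \<in> idx AA" "F.A.psec i j s" "F.A.psec j i t" "l = fsec C AA F j i t" "h = fsec C AA F i j s"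
      "scomp C AA i j i t s = unt AA i \<cdot> Rst C s" for i j s t l h
  proof -
    note [simp] = that(1,2) F.A.psecD(1-3)[OF that(3) that(1,2)]
    have "tgt BB (cidx F j) (cidx F i) \<cdot> l \<cdot> tgt BB (cidx F i) (cidx F j) \<cdot> h =
        tgt BB (cidx F i) (cidx F i) \<cdot> scomp C BB (cidx F i) (cidx F j) (cidx F i) l h"
      using F.B.scomp_simps(5)[of "cidx F i" "cidx F j" "cidx F i" h l] F.fsec_src(2) that by simp
    also have "... = tgt BB (cidx F i) (cidx F i) \<cdot> fsec C AA F i i (unt AA i \<cdot> Rst C s)"
      using F.fsec_scomp[OF that(1,2,1) that(3,4)] that by simp
    also have "... = Rst C (Rst C s \<cdot> cob F i)"
      using F.fsec_unt[OF that(1), of "Rst C s"] by simp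
    also have "... = Rst C (s \<cdot> cob F i)" by simp
    finally show ?thesis using F.fsec_src(1)[OF that(1-3)] that by simp
  qed
  have sect_cmp: "sect AA (b \<cdot>\<^bsub>Phi_cat C AA\<^esub> a) = scomp C AA i j i t s" "sect AA (a \<cdot>\<^bsub>Phi_cat C AA\<^esub> b) = scomp C AA j i j s t"
    using F.A.phi_cmp(4)[OF a b(1)] F.A.phi_cmp(4)[OF b(1) a] b by (simp_all add: i_def j_def s_def t_def)
  have ra: "b \<cdot>\<^bsub>Phi_cat C AA\<^esub> a = F.A.phi_rst a" unfolding b_def by (rule G.phi_cinv[OF a])
  have rb: "a \<cdot>\<^bsub>Phi_cat C AA\<^esub> b = F.A.phi_rst b" using G.phi_cinv[OF b(1)] a by (simp add: b_def)
  have sa: "scomp C AA i j i t s = unt AA i \<cdot> Rst C s"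
    using sect_cmp(1) F.A.phi_rst(4)[OF a] unfolding ra by (simp add: i_def s_def)
  have sb: "scomp C AA j i j s t = unt AA j \<cdot> Rst C t"
    using sect_cmp(2) F.A.phi_rst(4)[OF b(1)] b(2) unfolding rb by (simp add: t_def)
  have i1: "tgt BB (cidx F j) (cidx F i) \<cdot> l \<cdot> tgt BB (cidx F i) (cidx F j) \<cdot> h = Rst C h"
    by (rule inv[OF ij A(3) t l_def h_def sa])
  have i2: "tgt BB (cidx F i) (cidx F j) \<cdot> h \<cdot> tgt BB (cidx F j) (cidx F i) \<cdot> l = Rst C l"
    by (rule inv[OF ij(2,1) t A(3) h_def l_def sb])
  note L [simp] = F.B.psecD(1-3)[OF ls, simplified] and H [simp] = h
  have "partial_inverse C (tgt BB (cidx F i) (cidx F j) \<cdot> h) (tgt BB (cidx F j) (cidx F i) \<cdot> l)"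
    by (rule F.A.partial_inverseI) (use i1 i2 in simp_all)
  then have "partial_iso C (tgt BB (cidx F i) (cidx F j) \<cdot> h)" unfolding partial_iso_def by blast
  note R = F.B.phi_ArrI[OF F.cidx_in[OF ij(1)] F.cidx_in[OF ij(2)] hs(2) this]
  have e: "fm (Phi_fun C AA F) a = Arr (cidx F i) (Lab h) (cidx F j)"
    using a by (simp add: Phi_map_simps(3) i_def j_def s_def h_def)
  show "fm (Phi_fun C AA F) a \<in> Mor (Phi_cat C BB)"
    "Dom (fm (Phi_fun C AA F) a) = cidx F (Dom a)" "Cod (fm (Phi_fun C AA F) a) = cidx F (Cod a)"
    "sect BB (fm (Phi_fun C AA F) a) = fsec C AA F (Dom a) (Cod a) (sect AA a)"
    unfolding e using R by (simp_all add: i_def j_def h_def s_def)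
qed

lemma phi_map_over_hom:
  fixes C :: "('o, 'm) rcat" (structure)
  assumes GA: "internal_groupoid C AA \<iota>" and F: "internal_cofunctor C AA BB F"
  shows "over_hom C (Phi_obj C AA) (Phi_obj C BB) (Phi_map C AA F)"
proof -
  interpret F: internal_cofunctor C AA BB F by fact
  interpret G: internal_groupoid C AA \<iota> by fact
  note M = phi_map_mor[OF GA F]
  show ?thesis
    unfolding Phi_obj_def
  proof (subst Phi_map_simps(1), rule over_homI)
    show "is_functor (Phi_cat C AA) (Phi_cat C BB) (Phi_fun C AA F)"
      unfolding is_functor_def
    proof (intro conjI ballI impI)
      show "fo (Phi_fun C AA F) i \<in> Ob (Phi_cat C BB)" if "i \<in> Ob (Phi_cat C AA)" for i
        using that by (simp add: Phi_map_simps(2))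
      show "fm (Phi_fun C AA F) a \<in> Hom (Phi_cat C BB) (fo (Phi_fun C AA F) (Dom a)) (fo (Phi_fun C AA F) (Cod a))"
        if a: "a \<in> Mor (Phi_cat C AA)" for a
        using M[OF a] F.A.phi_morD(1,2)[OF a] by (simp add: Hom_def Phi_map_simps(2))
      show "fm (Phi_fun C AA F) (Idt (Phi_cat C AA) i) = Idt (Phi_cat C BB) (fo (Phi_fun C AA F) i)"
        if "i \<in> Ob (Phi_cat C AA)" for i
      proof (rule F.B.sect_inj)
        have i [simp]: "i \<in> idx AA" using that by simp
        have I: "Idt (Phi_cat C AA) i \<in> Mor (Phi_cat C AA)" by simp
        have "fsec C AA F i i (unt AA i \<cdot> Idt C (obj AA i)) = unt BB (cidx F i) \<cdot> Rst C (Idt C (obj AA i) \<cdot> cob F i)"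
          by (rule F.fsec_unt) simp_all
        then have u: "fsec C AA F i i (unt AA i) = unt BB (cidx F i)" by simp
        note P = F.A.phi_idt[of i] F.B.phi_idt[of "cidx F i"]
        show "Dom (fm (Phi_fun C AA F) (Idt (Phi_cat C AA) i)) = Dom (Idt (Phi_cat C BB) (fo (Phi_fun C AA F) i))"
          "Cod (fm (Phi_fun C AA F) (Idt (Phi_cat C AA) i)) = Cod (Idt (Phi_cat C BB) (fo (Phi_fun C AA F) i))"
          "sect BB (fm (Phi_fun C AA F) (Idt (Phi_cat C AA) i)) = sect BB (Idt (Phi_cat C BB) (fo (Phi_fun C AA F) i))"
          using M[OF I] P u by (simp_all add: Phi_map_simps(2))
      qed
      show "fm (Phi_fun C AA F) (b \<cdot>\<^bsub>Phi_cat C AA\<^esub> a) = fm (Phi_fun C AA F) b \<cdot>\<^bsub>Phi_cat C BB\<^esub> fm (Phi_fun C AA F) a"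
        if a: "a \<in> Mor (Phi_cat C AA)" and b: "b \<in> Mor (Phi_cat C AA)" and ab: "Cod a = Dom b" for a b
      proof (rule F.B.sect_inj)
        note ba = F.A.phi_cmp[OF a b ab] and Ma = M[OF a] and Mb = M[OF b]
        have "Cod (fm (Phi_fun C AA F) a) = Dom (fm (Phi_fun C AA F) b)" using Ma(3) Mb(2) ab by simp
        note c = F.B.phi_cmp[OF Ma(1) Mb(1) this] and Mba = M[OF ba(1)]
        have p: "F.A.psec (Dom a) (Cod a) (sect AA a)" "F.A.psec (Cod a) (Cod b) (sect AA b)"
          using F.A.phi_morD(3)[OF a] F.A.phi_morD(3)[OF b] ab by simp_all
        show "sect BB (fm (Phi_fun C AA F) (b \<cdot>\<^bsub>Phi_cat C AA\<^esub> a)) = sect BB (fm (Phi_fun C AA F) b \<cdot>\<^bsub>Phi_cat C BB\<^esub> fm (Phi_fun C AA F) a)"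
          unfolding Mba(4) c(4) ba(2-4) Ma(2-4) Mb(3,4)
          using F.fsec_scomp[OF F.A.phi_morD(1,2)[OF a] F.A.phi_morD(2)[OF b] p] ab by simp
        show "Dom (fm (Phi_fun C AA F) (b \<cdot>\<^bsub>Phi_cat C AA\<^esub> a)) = Dom (fm (Phi_fun C AA F) b \<cdot>\<^bsub>Phi_cat C BB\<^esub> fm (Phi_fun C AA F) a)"
          "Cod (fm (Phi_fun C AA F) (b \<cdot>\<^bsub>Phi_cat C AA\<^esub> a)) = Cod (fm (Phi_fun C AA F) b \<cdot>\<^bsub>Phi_cat C BB\<^esub> fm (Phi_fun C AA F) a)"
          unfolding Mba(2,3) c(2,3) ba(2,3) Ma(2) Mb(3) by simp_all
      qed
    qed
    show "(\<lambda>i\<in>idx AA. cob F i) i \<in> Mor C \<and> Dom ((\<lambda>i\<in>idx AA. cob F i) i) = fo (Phi_proj C BB) (fo (Phi_fun C AA F) i) \<and>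
        Cod ((\<lambda>i\<in>idx AA. cob F i) i) = fo (Phi_proj C AA) i \<and>
        Rst C ((\<lambda>i\<in>idx AA. cob F i) i) = Idt C (fo (Phi_proj C BB) (fo (Phi_fun C AA F) i))"
      if "i \<in> Ob (Phi_cat C AA)" for i
      using that by (simp add: Phi_map_simps(2) Phi_proj_def)
    show "fm (Phi_proj C AA) a \<cdot> (\<lambda>i\<in>idx AA. cob F i) (Dom a) =
        (\<lambda>i\<in>idx AA. cob F i) (Cod a) \<cdot> fm (Phi_proj C BB) (fm (Phi_fun C AA F) a)"
      if a: "a \<in> Mor (Phi_cat C AA)" for a
      using M[OF a] F.fsec_src(3)[OF F.A.phi_morD(1,2,3)[OF a]] F.A.phi_morD[OF a]
      by (simp add: Phi_proj_def)
  qed (simp_all add: Phi_map_simps(2,3))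
qed

section \<open>Functoriality and full faithfulness\<close>

context join_restriction_category
begin

lemma Phi_g_functor:
  assumes ls: "locally_small \<kappa> C"
  shows "is_functor (peGpd \<kappa> C :: (('i, 'o, 'm) pcat, ('i, 'o, 'm) cofunctor) cat) (jiCat_over \<kappa> C) (Phi_g C)"
proof -
  have ob: "over_object \<kappa> C (Phi_obj C AA)" if e: "etale_groupoid \<kappa> C AA" for AA :: "('i, 'o, 'm) pcat"
  proof -
    obtain \<iota> where "internal_groupoid C AA \<iota>" using etale_groupoid_internal[OF e join_restriction_category_axioms] .
    then interpret internal_groupoid C AA \<iota> .
    show ?thesis using phi_over_object[OF _ ls] e by (simp add: etale_groupoid_def)
  qed
  show ?thesis
    unfolding is_functor_def
  proof (intro conjI ballI impI)
    show "fo (Phi_g C) AA \<in> Ob (jiCat_over \<kappa> C)" if "AA \<in> Ob (peGpd \<kappa> C)" for AA :: "('i, 'o, 'm) pcat"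
      using ob that by (simp add: Phi_g_def)
    fix f :: "(('i, 'o, 'm) pcat, ('i, 'o, 'm) cofunctor) arr" assume "f \<in> Mor (peGpd \<kappa> C)"
    then obtain AA F BB where f: "f = Arr AA F BB" "etale_groupoid \<kappa> C AA" "etale_groupoid \<kappa> C BB" "internal_cofunctor C AA BB F"
      by (rule peGpd_mor[OF _ join_restriction_category_axioms])
    obtain \<iota> where GA: "internal_groupoid C AA \<iota>" using etale_groupoid_internal[OF f(2) join_restriction_category_axioms] .
    show "fm (Phi_g C) f \<in> Hom (jiCat_over \<kappa> C) (fo (Phi_g C) (Dom f)) (fo (Phi_g C) (Cod f))"
      using ob f phi_map_over_hom[OF GA f(4)] by (simp add: Phi_g_def Hom_def)
    fix g :: "(('i, 'o, 'm) pcat, ('i, 'o, 'm) cofunctor) arr" assume "g \<in> Mor (peGpd \<kappa> C)" and fg: "Cod f = Dom g"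
    then obtain DD G where g: "g = Arr BB G DD" "etale_groupoid \<kappa> C DD" "internal_cofunctor C BB DD G"
      using f(1) by (elim peGpd_mor[OF _ join_restriction_category_axioms]) auto
    obtain \<iota>' where GB: "internal_groupoid C BB \<iota>'" using etale_groupoid_internal[OF f(3) join_restriction_category_axioms] .
    interpret F: internal_cofunctor C AA BB F by (rule f(4))
    interpret G: internal_cofunctor C BB DD G by (rule g(3))
    note K = cof_comp_internal[OF f(4) g(3)]
    interpret K: internal_cofunctor C AA DD "cof_comp C AA BB G F" by (rule K(1))
    have Ks: "cidx (cof_comp C AA BB G F) i = cidx G (cidx F i)" "cob (cof_comp C AA BB G F) i = cob F i \<cdot> cob G (cidx F i)"
      if "i \<in> idx AA" for i using that by (simp_all add: cof_comp_def)
    \<comment> \<open>On sections, the composite acts by \<open>F\<close> and then by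
      \<open>G\<close>; the point to check is that both sides have the same domain
      \<open>y\<close>.\<close>
    have fs: "fsec C AA (cof_comp C AA BB G F) i j s = fsec C BB G (cidx F i) (cidx F j) (fsec C AA F i j s)"
      if ij [simp]: "i \<in> idx AA" "j \<in> idx AA" and s: "F.A.psec i j s" for i j s
    proof -
      note S [simp] = F.A.psecD(1-3)[OF s ij]
      define y where "y = Rst C (s \<cdot> cob F i \<cdot> cob G (cidx F i))"
      define h where "h = fsec C AA F i j s"
      note h = F.fsec_mor[OF ij s, folded h_def] and hs = F.fsec_src[OF ij s, folded h_def]
      have y [simp]: "y \<in> Mor C" "Dom y = obj DD (cidx G (cidx F i))" "Cod y = obj DD (cidx G (cidx F i))" by (simp_all add: y_def)
      have hg: "h \<cdot> cob G (cidx F i) = capp C AA F i j (s \<cdot> cob F i \<cdot> cob G (cidx F i)) (cob G (cidx F i) \<cdot> y)"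
        unfolding h_def y_def by (rule F.fsec_cmp[OF ij s]) simp_all
      have "Rst C (h \<cdot> cob G (cidx F i)) = Rst C (Rst C h \<cdot> cob G (cidx F i))" using h by simp
      also have "... = Rst C ((s \<cdot> cob F i) \<cdot> cob G (cidx F i))" unfolding hs(1) by (rule rst_rst_cmp) simp_all
      finally have Ry: "Rst C (h \<cdot> cob G (cidx F i)) = y" by (simp add: y_def)
      have eq: "s \<cdot> cob (cof_comp C AA BB G F) i = s \<cdot> cob F i \<cdot> cob G (cidx F i)" using Ks by simp
      have "fsec C AA (cof_comp C AA BB G F) i j s = capp C AA (cof_comp C AA BB G F) i j (s \<cdot> cob F i \<cdot> cob G (cidx F i)) y"
        unfolding K.fsec_capp eq y_def ..
      also have "... = capp C BB G (cidx F i) (cidx F j) (h \<cdot> cob G (cidx F i)) y"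
        unfolding hg by (rule K(2)[OF ij]) (use K.cdom_fsec[OF ij s, unfolded eq, folded y_def] in simp)
      also have "... = fsec C BB G (cidx F i) (cidx F j) h" unfolding G.fsec_capp Ry ..
      finally show ?thesis by (simp only: h_def)
    qed
    have "Phi_map C AA (cof_comp C AA BB G F) = over_comp C (Phi_obj C AA) (Phi_map C BB G) (Phi_map C AA F)"
    proof -
      have 1: "fo (fst (Phi_map C AA (cof_comp C AA BB G F))) =
          (\<lambda>i\<in>idx AA. fo (fst (Phi_map C BB G)) (fo (Phi_fun C AA F) i))"
        by (rule ext) (simp add: Phi_map_simps(2) Ks restrict_def)
      have 2: "fm (fst (Phi_map C AA (cof_comp C AA BB G F))) =
          (\<lambda>s\<in>Mor (Phi_cat C AA). fm (fst (Phi_map C BB G)) (fm (Phi_fun C AA F) s))"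
      proof (rule ext)
        fix a
        show "fm (fst (Phi_map C AA (cof_comp C AA BB G F))) a =
            (\<lambda>s\<in>Mor (Phi_cat C AA). fm (fst (Phi_map C BB G)) (fm (Phi_fun C AA F) s)) a"
        proof (cases "a \<in> Mor (Phi_cat C AA)")
          case True
          note MF = phi_map_mor[OF GA f(4) True] and MK = phi_map_mor[OF GA K(1) True]
          note MG = phi_map_mor[OF GB g(3) MF(1)]
          note D = F.A.phi_morD(1-3)[OF True]
          have "fm (fst (Phi_map C AA (cof_comp C AA BB G F))) a = fm (fst (Phi_map C BB G)) (fm (Phi_fun C AA F) a)"
            by (rule G.B.sect_inj) (use MF MK MG fs[OF D] Ks D in simp_all)
          then show ?thesis using True by simp
        qed (simp add: Phi_map_simps(3))
      qed
      have 3: "(\<lambda>i\<in>idx AA. cob (cof_comp C AA BB G F) i) = (\<lambda>i\<in>idx AA. (\<lambda>i\<in>idx AA. cob F i) i \<cdot> (\<lambda>i\<in>idx BB. cob G i) (fo (Phi_fun C AA F) i))"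
        by (rule ext) (simp add: Phi_map_simps(2) Ks restrict_def)
      have "over_comp C (Phi_obj C AA) (Phi_map C BB G) (Phi_map C AA F) =
          (\<lparr>fo = fo (fst (Phi_map C AA (cof_comp C AA BB G F))), fm = fm (fst (Phi_map C AA (cof_comp C AA BB G F)))\<rparr>,
            \<lambda>i\<in>idx AA. cob (cof_comp C AA BB G F) i)"
        unfolding 1 2 3
        by (subst (1) Phi_map_simps(1), subst (2) Phi_map_simps(1)) (simp add: over_comp_def Phi_obj_def)
      also have "... = Phi_map C AA (cof_comp C AA BB G F)"
        by (subst (3) Phi_map_simps(1)) simp
      finally show ?thesis by simp
    qed
    then show "fm (Phi_g C) (g \<cdot>\<^bsub>peGpd \<kappa> C\<^esub> f) = fm (Phi_g C) g \<cdot>\<^bsub>jiCat_over \<kappa> C\<^esub> fm (Phi_g C) f"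
      by (simp add: f g Phi_g_def)
  next
    fix AA :: "('i, 'o, 'm) pcat" assume "AA \<in> Ob (peGpd \<kappa> C)"
    then have e: "etale_groupoid \<kappa> C AA" by simp
    obtain \<iota> where GA: "internal_groupoid C AA \<iota>" using etale_groupoid_internal[OF e join_restriction_category_axioms] .
    interpret A: internal_category C AA by (rule etale_internal[OF e])
    note I = cof_id_internal[OF etale_internal[OF e]]
    interpret I: internal_cofunctor C AA AA "cof_id C AA" by (rule I(1))
    have Is: "cidx (cof_id C AA) i = i" "cob (cof_id C AA) i = Idt C (obj AA i)" if "i \<in> idx AA" for i
      using that by (simp_all add: cof_id_def)
    have "Phi_map C AA (cof_id C AA) = over_id C (Phi_obj C AA)"
    proof -
      have 1: "fo (fst (Phi_map C AA (cof_id C AA))) = (\<lambda>i\<in>idx AA. i)"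
        by (rule ext) (simp add: Phi_map_simps(2) Is restrict_def)
      have 2: "fm (fst (Phi_map C AA (cof_id C AA))) = (\<lambda>s\<in>Mor (Phi_cat C AA). s)"
      proof (rule ext)
        fix a
        show "fm (fst (Phi_map C AA (cof_id C AA))) a = (\<lambda>s\<in>Mor (Phi_cat C AA). s) a"
        proof (cases "a \<in> Mor (Phi_cat C AA)")
          case True
          note M = phi_map_mor[OF GA I(1) True] and D = A.phi_morD[OF True]
          have "fsec C AA (cof_id C AA) (Dom a) (Cod a) (sect AA a) = sect AA a"
            using I(2)[OF D(1,2) I.cdom_fsec[OF D(1-3)]] Is D by (simp add: I.fsec_capp)
          then have "fm (fst (Phi_map C AA (cof_id C AA))) a = a"
            by (intro A.sect_inj) (use M D Is in simp_all)
          then show ?thesis using True by simp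
        qed (simp add: Phi_map_simps(3))
      qed
      have 3: "(\<lambda>i\<in>idx AA. cob (cof_id C AA) i) = (\<lambda>i\<in>idx AA. Idt C (obj AA i))"
        by (rule ext) (simp add: Is restrict_def)
      have "over_id C (Phi_obj C AA) = (\<lparr>fo = fo (fst (Phi_map C AA (cof_id C AA))), fm = fm (fst (Phi_map C AA (cof_id C AA)))\<rparr>,
            \<lambda>i\<in>idx AA. cob (cof_id C AA) i)"
        unfolding 1 2 3 by (simp add: over_id_def Phi_obj_def Phi_proj_def)
      also have "... = Phi_map C AA (cof_id C AA)"
        by (subst (3) Phi_map_simps(1)) simp
      finally show ?thesis by simp
    qed
    then show "fm (Phi_g C) (Idt (peGpd \<kappa> C) AA) = Idt (jiCat_over \<kappa> C) (fo (Phi_g C) AA)"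
      by (simp add: Phi_g_def)
  qed
qed

text \<open>The cover by sections, pulled back along \<open>cob F i\<close>, shows that
  \<open>cmor F i j\<close> is determined by its values on sections, and these are what
  \<open>Phi_map\<close> records.\<close>

lemma Phi_faithful:
  assumes GA: "internal_groupoid C AA \<iota>" and F: "internal_cofunctor C AA BB F" and G: "internal_cofunctor C AA BB G"
    and eq: "Phi_map C AA F = Phi_map C AA G"
  shows "F = G"
proof -
  interpret GA: internal_groupoid C AA \<iota> by fact
  interpret F: internal_cofunctor C AA BB F by fact
  interpret G: internal_cofunctor C AA BB G by fact
  have ci: "cidx F i = cidx G i" if "i \<in> idx AA" for i
  proof -
    have "fo (Phi_fun C AA F) i = fo (fst (Phi_map C AA G)) i" using eq by simp
    then show ?thesis using that by (simp add: Phi_map_simps(2))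
  qed
  have cb: "cob F i = cob G i" if "i \<in> idx AA" for i
  proof -
    have "snd (Phi_map C AA F) i = snd (Phi_map C AA G) i" using eq by simp
    then show ?thesis using that by (simp add: Phi_map_def)
  qed
  show ?thesis
  proof (rule cofunctor_eqI[OF F G ci cb])
    fix i j u y assume ij: "i \<in> idx AA" "j \<in> idx AA"
    have "cmor F i j = cmor G i j"
    proof (rule cover_eq[OF cover_pullback[OF GA.section_cover[OF ij] F.pbF[OF ij]]])
      show "cmor F i j \<in> Hom C (Dom (pb2 C (src AA i j) (cob F i))) (mob BB (cidx F i) (cidx F j))"
        "cmor G i j \<in> Hom C (Dom (pb2 C (src AA i j) (cob F i))) (mob BB (cidx F i) (cidx F j))"
        using F.cmor_F[OF ij] G.cmor_F[OF ij] pb_simps(4)[OF F.pbF[OF ij]] ci[OF ij(1)] ci[OF ij(2)] cb[OF ij(1)] by simp_all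
      fix a assume a: "a \<in> Hom (Phi_cat C AA) i j"
      then have a': "a \<in> Mor (Phi_cat C AA)" "Dom a = i" "Cod a = j" by (auto simp: Hom_def)
      have "sect BB (fm (Phi_fun C AA F) a) = sect BB (fm (fst (Phi_map C AA G)) a)" using eq by simp
      then have "fsec C AA F i j (sect AA a) = fsec C AA G i j (sect AA a)"
        using phi_map_mor(4)[OF GA F a'(1)] phi_map_mor(4)[OF GA G a'(1)] a' by simp
      then show "cmor F i j \<cdot> pull_section C (src AA i j) (cob F i) (sect AA a) =
          cmor G i j \<cdot> pull_section C (src AA i j) (cob F i) (sect AA a)"
        using cb[OF ij(1)] by (simp add: fsec_def)
    qed
    then show "capp C AA F i j u y = capp C AA G i j u y" using cb[OF ij(1)] by (simp add: capp_def)
  qed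
qed

text \<open>The arrow part is glued, over the section cover pulled back along
  \<open>\<alpha> i\<close>, from the images \<open>h a\<close> of the maps \<open>a\<close>. The
  obstacle is agreement on overlaps: a functor preserves agreement on idempotents of
  \<open>obj AA i\<close>, whereas overlaps of the pulled back cover are idempotents on an object of
  \<open>BB\<close>.\<close>

lemma Phi_full:
  assumes GA: "internal_groupoid C AA \<iota>" and GB: "internal_groupoid C BB \<iota>'"
    and H: "over_hom C (Phi_obj C AA) (Phi_obj C BB) (H, \<alpha>)"
  shows "\<exists>F. internal_cofunctor C AA BB F \<and> Phi_map C AA F = (H, \<alpha>)"
proof -
  interpret A: internal_groupoid C AA \<iota> by fact
  interpret B: internal_groupoid C BB \<iota>' by fact
  note H' = over_homD[OF H[unfolded Phi_obj_def]]
  note Hf = functorD[OF H'(1)]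
  have Hidx [simp]: "fo H i \<in> idx BB" if "i \<in> idx AA" for i using Hf(1)[of i] that by simp
  have \<alpha> [simp]: "\<alpha> i \<in> Mor C" "Dom (\<alpha> i) = obj BB (fo H i)" "Cod (\<alpha> i) = obj AA i" "Rst C (\<alpha> i) = Idt C (obj BB (fo H i))"
    if "i \<in> idx AA" for i using H'(5-8)[of i] that by simp_all
  have pb [simp]: "has_pb C (src AA i j) (\<alpha> i)" if "i \<in> idx AA" "j \<in> idx AA" for i j
    by (rule A.src_has_pb) (use that in simp_all)
  define h where "h a = sect BB (fm H a)" for a
  have h: "h a \<in> Mor C" "Dom (h a) = obj BB (fo H i)" "Cod (h a) = mob BB (fo H i) (fo H j)" "B.psec (fo H i) (fo H j) (h a)"
      "\<alpha> j \<cdot> tgt BB (fo H i) (fo H j) \<cdot> h a = tgt AA i j \<cdot> sect AA a \<cdot> \<alpha> i"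
      "Rst C (h a) = Rst C (sect AA a \<cdot> \<alpha> i)"
    if ij [simp]: "i \<in> idx AA" "j \<in> idx AA" and a: "a \<in> Hom (Phi_cat C AA) i j" for i j a
  proof -
    note a' = HomD[OF a]
    have m: "fm H a \<in> Mor (Phi_cat C BB)" "Dom (fm H a) = fo H i" "Cod (fm H a) = fo H j" using Hf(2-4)[OF a'(1)] a' by simp_all
    note AM = A.phi_morD[OF a'(1)] and BM = B.phi_morD[OF m(1)]
    show 1: "h a \<in> Mor C" "Dom (h a) = obj BB (fo H i)" "Cod (h a) = mob BB (fo H i) (fo H j)" "B.psec (fo H i) (fo H j) (h a)"
      using BM m by (simp_all add: h_def)
    show 2: "\<alpha> j \<cdot> tgt BB (fo H i) (fo H j) \<cdot> h a = tgt AA i j \<cdot> sect AA a \<cdot> \<alpha> i"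
      using H'(9)[OF a'(1)] a' m AM by (simp add: h_def)
    have "Rst C (h a) = Rst C (tgt BB (fo H i) (fo H j) \<cdot> h a)" using 1 by simp
    also have "... = Rst C (\<alpha> j \<cdot> tgt BB (fo H i) (fo H j) \<cdot> h a)" using 1 by (subst rst_cmp_total[of _ "\<alpha> j"]) simp_all
    also have "... = Rst C (sect AA a \<cdot> \<alpha> i)" unfolding 2 using AM a' by simp
    finally show "Rst C (h a) = Rst C (sect AA a \<cdot> \<alpha> i)" .
  qed
  \<comment> \<open>A functor preserves idempotents, so the image is a unit cut down to some
    \<open>e'\<close>; naturality of \<open>\<alpha>\<close> fixes its domain and therefore
    \<open>e'\<close>.\<close>
  have hunt: "h (A.phi_unt i e) = unt BB (fo H i) \<cdot> Rst C (e \<cdot> \<alpha> i)"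
    if i [simp]: "i \<in> idx AA" and e: "e \<in> rst_idem C (obj AA i)" for i e
  proof -
    note E = rst_idem_simps(1-4)[OF e]
    let ?a = "A.phi_unt i e"
    note ua = A.phi_unt[OF i e]
    have aH: "?a \<in> Hom (Phi_cat C AA) i i" using ua by (simp add: Hom_def)
    have "A.Phi.idem i ?a" unfolding A.Phi.rst_idem_inv[symmetric] A.phi_idem[OF i] using e by blast
    then have "B.Phi.idem (fo H i) (fm H ?a)"
      using Hf(2-4)[OF ua(1)] Hf(6)[OF ua(1,1)] ua unfolding A.Phi.idem_def B.Phi.idem_def by simp
    then obtain e' where e': "e' \<in> rst_idem C (obj BB (fo H i))" "fm H ?a = B.phi_unt (fo H i) e'"
      unfolding B.Phi.rst_idem_inv[symmetric] using B.phi_idem[of "fo H i"] by auto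
    note E' = rst_idem_simps(1-4)[OF e'(1)]
    have hu: "h ?a = unt BB (fo H i) \<cdot> e'" using B.phi_unt(4)[OF _ e'(1)] e'(2) by (simp add: h_def)
    have "e' = Rst C (unt BB (fo H i) \<cdot> e')" using E' B.rst_unt_cmp[of "fo H i" e'] by simp
    also have "... = Rst C ((unt AA i \<cdot> e) \<cdot> \<alpha> i)" using h(6)[OF i i aH] unfolding hu ua(4) .
    also have "... = Rst C (unt AA i \<cdot> e \<cdot> \<alpha> i)" using E by simp
    also have "... = Rst C (e \<cdot> \<alpha> i)" by (rule A.rst_unt_cmp) (use E in simp_all)
    finally show ?thesis unfolding hu by simp
  qed
  have hcmp: "h (b \<cdot>\<^bsub>Phi_cat C AA\<^esub> a) = scomp C BB (fo H i) (fo H j) (fo H k) (h b) (h a)"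
    if a: "a \<in> Hom (Phi_cat C AA) i j" and b: "b \<in> Hom (Phi_cat C AA) j k" for a b i j k
  proof -
    note a' = HomD[OF a] and b' = HomD[OF b]
    show ?thesis
      using Hf(6)[OF a'(1) b'(1)] B.phi_cmp(4)[OF Hf(2)[OF a'(1)] Hf(2)[OF b'(1)]] Hf(3,4)[OF a'(1)] Hf(3,4)[OF b'(1)] a' b'
      by (simp add: h_def)
  qed
  have hres: "h a \<cdot> Rst C (e \<cdot> \<alpha> i) = h b \<cdot> Rst C (e \<cdot> \<alpha> i)"
    if ij [simp]: "i \<in> idx AA" "j \<in> idx AA" and a: "a \<in> Hom (Phi_cat C AA) i j" and b: "b \<in> Hom (Phi_cat C AA) i j"
      and e: "e \<in> rst_idem C (obj AA i)" and eq: "sect AA a \<cdot> e = sect AA b \<cdot> e" for i j a b e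
  proof -
    note a' = HomD[OF a] and b' = HomD[OF b]
    note u = A.phi_unt[OF ij(1) e]
    have uH: "A.phi_unt i e \<in> Hom (Phi_cat C AA) i i" using u by (simp add: Hom_def)
    have "a \<cdot>\<^bsub>Phi_cat C AA\<^esub> A.phi_unt i e = b \<cdot>\<^bsub>Phi_cat C AA\<^esub> A.phi_unt i e"
      by (rule A.sect_inj)
        (use A.phi_cmp_unt[OF a'(1)] A.phi_cmp_unt[OF b'(1)] a' b' e eq u A.phi_cmp(2,3)[OF u(1) a'(1)] A.phi_cmp(2,3)[OF u(1) b'(1)] in simp_all)
    then have "scomp C BB (fo H i) (fo H i) (fo H j) (h a) (h (A.phi_unt i e)) = scomp C BB (fo H i) (fo H i) (fo H j) (h b) (h (A.phi_unt i e))"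
      using hcmp[OF uH a] hcmp[OF uH b] by simp
    moreover have "Rst C (e \<cdot> \<alpha> i) \<in> rst_idem C (obj BB (fo H i))" using rst_idem_simps(1-3)[OF e] by simp
    ultimately show ?thesis
      unfolding hunt[OF ij(1) e]
      using B.scomp_unt_right[OF Hidx[OF ij(1)] Hidx[OF ij(2)] h(4)[OF ij a]]
        B.scomp_unt_right[OF Hidx[OF ij(1)] Hidx[OF ij(2)] h(4)[OF ij b]] by simp
  qed
  have ex: "\<exists>!c. c \<in> Hom C (pbo C (src AA i j) (\<alpha> i)) (mob BB (fo H i) (fo H j)) \<and>
      (\<forall>a \<in> Hom (Phi_cat C AA) i j. c \<cdot> pull_section C (src AA i j) (\<alpha> i) (sect AA a) = h a)"
    if ij [simp]: "i \<in> idx AA" "j \<in> idx AA" for i j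
  proof -
    let ?p = "pb2 C (src AA i j) (\<alpha> i)"
    note pbs [simp] = pb_simps[OF pb[OF ij]]
    have ps: "A.psec i j (sect AA a)" if "a \<in> Hom (Phi_cat C AA) i j" for a
      using A.phi_morD(3)[of a] that by (auto simp: Hom_def)
    note P = pull_section_props[OF pb[OF ij] ps]
    have cov: "cover C ?p (Hom (Phi_cat C AA) i j) (\<lambda>a. pull_section C (src AA i j) (\<alpha> i) (sect AA a))"
      by (rule cover_pullback[OF A.section_cover[OF ij] pb[OF ij]])
    obtain d where "covering C (src AA i j) (Hom (Phi_cat C AA) i j) (sect AA) d"
      using A.section_cover[OF ij] by (rule coverE)
    then interpret D: covering C "src AA i j" "Hom (Phi_cat C AA) i j" "sect AA" d .
    have "\<exists>!c. c \<in> Hom C (Dom ?p) (mob BB (fo H i) (fo H j)) \<and>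
      (\<forall>a \<in> Hom (Phi_cat C AA) i j. c \<cdot> pull_section C (src AA i j) (\<alpha> i) (sect AA a) = h a)"
    proof (rule cover_glue_unique(1)[OF cov])
      show "h a \<in> Hom C (Cod ?p) (mob BB (fo H i) (fo H j))" if "a \<in> Hom (Phi_cat C AA) i j" for a
        using h(1-3)[OF ij that] by (simp add: Hom_def)
      show "Rst C (h a) = Rst C (pull_section C (src AA i j) (\<alpha> i) (sect AA a))" if "a \<in> Hom (Phi_cat C AA) i j" for a
        using h(6)[OF ij that] P(6)[OF that] by simp
      show "mob BB (fo H i) (fo H j) \<in> Ob C" by simp
      fix a b e assume a: "a \<in> Hom (Phi_cat C AA) i j" and b: "b \<in> Hom (Phi_cat C AA) i j"
        and e0: "e \<in> rst_idem C (Cod ?p)" and e1: "Rst C (pull_section C (src AA i j) (\<alpha> i) (sect AA a)) \<cdot> e = e"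
        and e2: "pull_section C (src AA i j) (\<alpha> i) (sect AA a) \<cdot> e = pull_section C (src AA i j) (\<alpha> i) (sect AA b) \<cdot> e"
      have e: "e \<in> rst_idem C (obj BB (fo H i))" using e0 by simp
      note E [simp] = rst_idem_simps(1-4)[OF e]
      define s t where "s = sect AA a" and "t = sect AA b"
      note S [simp] = A.psecD(1-3)[OF ps[OF a] ij, folded s_def] and T [simp] = A.psecD(1-3)[OF ps[OF b] ij, folded t_def]
      note Pa = P[OF a, folded s_def] and Pb = P[OF b, folded t_def]
      have "s \<cdot> \<alpha> i \<cdot> e = pb1 C (src AA i j) (\<alpha> i) \<cdot> pull_section C (src AA i j) (\<alpha> i) s \<cdot> e"
        using cmp_rw[OF Pa(4), of e] Pa(1-3) by simp
      also have "... = pb1 C (src AA i j) (\<alpha> i) \<cdot> pull_section C (src AA i j) (\<alpha> i) t \<cdot> e"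
        using e2 by (simp only: s_def t_def)
      also have "... = t \<cdot> \<alpha> i \<cdot> e" using cmp_rw[OF Pb(4), of e] Pb(1-3) by simp
      finally have st: "s \<cdot> \<alpha> i \<cdot> e = t \<cdot> \<alpha> i \<cdot> e" .
      \<comment> \<open>The part of \<open>obj AA i\<close> that \<open>s\<close> sends into the
        sheet of \<open>t\<close>, over which \<open>s\<close> and \<open>t\<close> agree. Its
        inverse image along \<open>\<alpha> i\<close> contains \<open>e\<close>, so agreement over
        \<open>f\<close>, which the functor preserves, restricts to \<open>e\<close>.\<close>
      define f where "f = Rst C (d b \<cdot> s)"
      note Db [simp] = D.d_simps(1-3)[OF b]
      have f [simp]: "f \<in> Mor C" "Dom f = obj AA i" "Cod f = obj AA i" by (simp_all add: f_def)
      have fi: "f \<in> rst_idem C (obj AA i)" by (simp add: f_def)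
      have sf: "d b \<cdot> s = s \<cdot> f" unfolding f_def by (rule idem_slide[OF D.d_idem[OF b]]) simp_all
      have pf: "src AA i j \<cdot> d b \<cdot> s = f"
      proof -
        have "src AA i j \<cdot> d b \<cdot> s = Rst C s \<cdot> f" unfolding sf using D.s_simps(5)[OF a, folded s_def, of f] by simp
        also have "... = f" unfolding f_def by (rule rst_absorb(2)) simp_all
        finally show ?thesis .
      qed
      have tf: "t \<cdot> f = s \<cdot> f"
      proof -
        have "t \<cdot> f = t \<cdot> src AA i j \<cdot> d b \<cdot> s" by (simp only: pf)
        also have "... = d b \<cdot> s" using D.spd_assoc[OF b, folded t_def, of s] by simp
        finally show ?thesis unfolding sf .
      qed
      have "Rst C (f \<cdot> \<alpha> i) \<cdot> e = Rst C (f \<cdot> \<alpha> i \<cdot> e)" using rst_cmp_idem[of e "f \<cdot> \<alpha> i"] by simp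
      also have "... = Rst C ((d b \<cdot> s) \<cdot> \<alpha> i \<cdot> e)" unfolding f_def by (rule rst_rst_cmp) simp_all
      also have "(d b \<cdot> s) \<cdot> \<alpha> i \<cdot> e = d b \<cdot> t \<cdot> \<alpha> i \<cdot> e" unfolding st[symmetric] by simp
      also have "... = s \<cdot> \<alpha> i \<cdot> e" using D.ds_assoc[OF b, folded t_def, of "\<alpha> i \<cdot> e"] st by simp
      also have "Rst C \<dots> = e"
        using e1 rst_cmp_idem[of e "s \<cdot> \<alpha> i"] Pa(6) by (simp add: s_def[symmetric])
      finally have fe: "Rst C (f \<cdot> \<alpha> i) \<cdot> e = e" .
      have "h a \<cdot> Rst C (f \<cdot> \<alpha> i) = h b \<cdot> Rst C (f \<cdot> \<alpha> i)"
        by (rule hres[OF ij a b fi]) (use tf in \<open>simp only: s_def t_def\<close>)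
      then have "(h a \<cdot> Rst C (f \<cdot> \<alpha> i)) \<cdot> e = (h b \<cdot> Rst C (f \<cdot> \<alpha> i)) \<cdot> e" by simp
      moreover have "(h x \<cdot> Rst C (f \<cdot> \<alpha> i)) \<cdot> e = h x \<cdot> e" if "x \<in> Hom (Phi_cat C AA) i j" for x
        using h(1-3)[OF ij that] fe by simp
      ultimately show "h a \<cdot> e = h b \<cdot> e" using a b by simp
    qed
    then show ?thesis by simp
  qed
  define F where "F = \<lparr>cidx = fo H, cob = \<alpha>, cmor = (\<lambda>i j. if i \<in> idx AA \<and> j \<in> idx AA
      then THE c. c \<in> Hom C (pbo C (src AA i j) (\<alpha> i)) (mob BB (fo H i) (fo H j)) \<and>
        (\<forall>a \<in> Hom (Phi_cat C AA) i j. c \<cdot> pull_section C (src AA i j) (\<alpha> i) (sect AA a) = h a)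
      else undefined)\<rparr>"
  have Fs [simp]: "cidx F = fo H" "cob F = \<alpha>" by (simp_all add: F_def)
  have Fm: "cmor F i j \<in> Hom C (pbo C (src AA i j) (\<alpha> i)) (mob BB (fo H i) (fo H j)) \<and>
        (\<forall>a \<in> Hom (Phi_cat C AA) i j. cmor F i j \<cdot> pull_section C (src AA i j) (\<alpha> i) (sect AA a) = h a)"
    if "i \<in> idx AA" "j \<in> idx AA" for i j
    using theI'[OF ex[OF that]] that by (simp add: F_def)
  interpret F: cofunctor_data C AA BB F
  proof
    show "cidx F \<in> idx AA \<rightarrow>\<^sub>E idx BB" using H'(2) by (auto simp: PiE_def)
    show "cob F \<in> extensional (idx AA)" using H'(4) by simp
    show "cmor F i j = undefined" if "\<not> (i \<in> idx AA \<and> j \<in> idx AA)" for i j using that by (auto simp: F_def)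
    show "cob F i \<in> Hom C (obj BB (cidx F i)) (obj AA i) \<and> total_map C (cob F i)" if "i \<in> idx AA" for i
      using that by (simp add: Hom_def total_iff)
    show "cmor F i j \<in> Hom C (pbo C (src AA i j) (cob F i)) (mob BB (cidx F i) (cidx F j))"
      if "i \<in> idx AA" "j \<in> idx AA" for i j using Fm[OF that] by simp
  qed
  have fs: "fsec C AA F i j (sect AA a) = h a" if "i \<in> idx AA" "j \<in> idx AA" "a \<in> Hom (Phi_cat C AA) i j" for i j a
    using Fm[OF that(1,2)] that(3) by (simp add: fsec_def)
  have IF: "internal_cofunctor C AA BB F"
  proof (rule F.internal_cofunctor_by_sections[OF GA])
    fix i j a assume i: "i \<in> idx AA" and j: "j \<in> idx AA" and a: "a \<in> Hom (Phi_cat C AA) i j"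
    show "B.psec (cidx F i) (cidx F j) (fsec C AA F i j (sect AA a)) \<and>
      Rst C (fsec C AA F i j (sect AA a)) = Rst C (sect AA a \<cdot> cob F i)"
      using h(4,6)[OF i j a] fs[OF i j a] by simp
    show "cob F j \<cdot> tgt BB (cidx F i) (cidx F j) \<cdot> fsec C AA F i j (sect AA a) = tgt AA i j \<cdot> sect AA a \<cdot> cob F i"
      using h(5)[OF i j a] fs[OF i j a] by simp
    fix k b assume k: "k \<in> idx AA" and b: "b \<in> Hom (Phi_cat C AA) j k"
    have ba: "b \<cdot>\<^bsub>Phi_cat C AA\<^esub> a \<in> Hom (Phi_cat C AA) i k" "sect AA (b \<cdot>\<^bsub>Phi_cat C AA\<^esub> a) = scomp C AA i j k (sect AA b) (sect AA a)"
      using A.phi_cmp[of a b] a b by (simp_all add: Hom_def)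
    show "fsec C AA F i k (scomp C AA i j k (sect AA b) (sect AA a)) =
        scomp C BB (cidx F i) (cidx F j) (cidx F k) (fsec C AA F j k (sect AA b)) (fsec C AA F i j (sect AA a))"
      using fs[OF i k ba(1)] fs[OF i j a] fs[OF j k b] hcmp[OF a b] unfolding ba(2) by simp
  next
    fix i assume i: "i \<in> idx AA"
    have I: "Idt (Phi_cat C AA) i \<in> Hom (Phi_cat C AA) i i" using A.Phi.idt_hom[of i] i by simp
    have "h (Idt (Phi_cat C AA) i) = unt BB (fo H i)"
      using Hf(5)[of i] i B.phi_idt(1)[of "fo H i"] by (simp add: h_def)
    then show "fsec C AA F i i (unt AA i) = unt BB (cidx F i)"
      using fs[OF i i I] A.phi_idt(1)[OF i] by simp
  qed
  have "Phi_fun C AA F = H"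
  proof (rule fnct.equality)
    show "fo (Phi_fun C AA F) = fo H"
      using H'(2) by (simp add: Phi_map_simps(2) extensional_restrict)
    show "fm (Phi_fun C AA F) = fm H"
    proof (rule ext)
      fix a show "fm (Phi_fun C AA F) a = fm H a"
      proof (cases "a \<in> Mor (Phi_cat C AA)")
        case True
        note D = A.phi_morD(1,2)[OF True] and M = phi_map_mor[OF GA IF True]
        have "a \<in> Hom (Phi_cat C AA) (Dom a) (Cod a)" using True by (simp add: Hom_def)
        then have "sect BB (fm (Phi_fun C AA F) a) = sect BB (fm H a)" using M(4) fs[OF D] by (simp add: h_def)
        then show ?thesis
          by (intro B.sect_inj) (use M(2,3) Hf(3,4)[OF True] in simp_all)
      next
        case False
        then show ?thesis using H'(3) by (simp add: Phi_map_simps(3) extensional_def)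
      qed
    qed
  qed simp
  moreover have "(\<lambda>i\<in>idx AA. cob F i) = \<alpha>" using H'(4) by (simp add: extensional_restrict)
  ultimately have "Phi_map C AA F = (H, \<alpha>)" using Phi_map_simps(1)[of C AA F] by simp
  then show ?thesis using IF by blast
qed

lemma Phi_g_fully_faithful:
  assumes ls: "locally_small \<kappa> C"
  shows "fully_faithful (peGpd \<kappa> C :: (('i, 'o, 'm) pcat, ('i, 'o, 'm) cofunctor) cat) (jiCat_over \<kappa> C) (Phi_g C)"
  unfolding fully_faithful_def
proof (intro ballI)
  fix AA BB :: "('i, 'o, 'm) pcat"
  assume "AA \<in> Ob (peGpd \<kappa> C)" "BB \<in> Ob (peGpd \<kappa> C)"
  then have e: "etale_groupoid \<kappa> C AA" "etale_groupoid \<kappa> C BB" by auto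
  obtain \<iota> where GA: "internal_groupoid C AA \<iota>" using etale_groupoid_internal[OF e(1) join_restriction_category_axioms] .
  obtain \<iota>' where GB: "internal_groupoid C BB \<iota>'" using etale_groupoid_internal[OF e(2) join_restriction_category_axioms] .
  let ?X = "Hom (peGpd \<kappa> C) AA BB" and ?Y = "Hom (jiCat_over \<kappa> C) (fo (Phi_g C) AA) (fo (Phi_g C) BB)"
  show "bij_betw (fm (Phi_g C)) ?X ?Y"
    unfolding bij_betw_def
  proof
    show "inj_on (fm (Phi_g C)) ?X"
    proof (rule inj_onI)
      fix f g assume "f \<in> ?X" "g \<in> ?X" and eq: "fm (Phi_g C) f = fm (Phi_g C) g"
      then obtain F G where f: "f = Arr AA F BB" "internal_cofunctor C AA BB F" and g: "g = Arr AA G BB" "internal_cofunctor C AA BB G"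
        by (metis peGpd_HomE)
      have "Phi_map C AA F = Phi_map C AA G" using eq by (simp add: f g Phi_g_def)
      then show "f = g" using Phi_faithful[OF GA f(2) g(2)] f g by simp
    qed
    show "fm (Phi_g C) ` ?X = ?Y"
    proof (intro equalityI subsetI)
      fix k assume "k \<in> fm (Phi_g C) ` ?X"
      then obtain f where "f \<in> ?X" "k = fm (Phi_g C) f" by blast
      then show "k \<in> ?Y" using functorD(2-4)[OF Phi_g_functor[OF ls], of f] by (auto simp: Hom_def)
    next
      fix k assume k: "k \<in> ?Y"
      then have "k \<in> Mor (jiCat_over \<kappa> C)" "Dom k = Phi_obj C AA" "Cod k = Phi_obj C BB"
        by (auto simp: Hom_def Phi_g_def)
      then obtain H \<alpha> where H: "k = Arr (Phi_obj C AA) (H, \<alpha>) (Phi_obj C BB)"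
        "over_hom C (Phi_obj C AA) (Phi_obj C BB) (H, \<alpha>)" by (auto elim: jiCat_mor)
      obtain F where F: "internal_cofunctor C AA BB F" "Phi_map C AA F = (H, \<alpha>)"
        using Phi_full[OF GA GB H(2)] by blast
      have "fm (Phi_g C) (Arr AA F BB) = k" using F(2) H(1) by (simp add: Phi_g_def)
      then show "k \<in> fm (Phi_g C) ` ?X" using peGpd_ArrI[OF e F(1)] by blast
    qed
  qed
qed

end

section \<open>The groupoid of a category over \<open>C\<close>\<close>

lemma glueing_sections_cong:
  "glueing C X I \<phi> p q s \<Longrightarrow> (\<And>a. a \<in> I \<Longrightarrow> s' a = s a) \<Longrightarrow> glueing C X I \<phi> p q s'"
  by (simp add: glueing_def)

locale over_category = join_restriction_category C for C :: "('o, 'm) rcat" (structure) +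
  fixes \<kappa> :: "'k rel" and A :: "('i, 'm) cat" and P :: "('i, 'm, 'o, 'm) fnct"
  assumes over: "over_object \<kappa> C (A, P)" and local_glueings: "has_local_glueings \<kappa> C"
begin

sublocale A: join_inverse_category A by (rule over_objectD(1)[OF over])
sublocale R: bounded_join_category "inv_rcat A" by (rule A.bounded_join_category)

abbreviation acmp (infixr "\<star>" 70) where "g \<star> f \<equiv> g \<cdot>\<^bsub>A\<^esub> f"

definition rs where "rs f = cinv A f \<star> f"

lemma rs_simps [simp]:
  assumes "f \<in> Mor A"
  shows "rs f \<in> Mor A" "Dom (rs f) = Dom f" "Cod (rs f) = Dom f" "f \<star> rs f = f" "rs (rs f) = rs f"
    "rs f \<star> rs f = rs f"
  using assms R.cmp_rst'[of f] R.rst_rst[of f] R.rst_cmp_same[of f] by (simp_all add: rs_def)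

lemma rs_idem: "f \<in> Mor A \<Longrightarrow> Dom f = i \<Longrightarrow> A.idem i (rs f)"
  by (simp add: rs_def)

lemma rs_slide: "f \<in> Mor A \<Longrightarrow> g \<in> Mor A \<Longrightarrow> Cod f = Dom g \<Longrightarrow> rs g \<star> f = f \<star> rs (g \<star> f)"
  using R.rst_slide[of f g] by (simp add: rs_def)

lemma rs_of_idem: "A.idem i e \<Longrightarrow> rs e = e"
  using A.cinv_idem[of i e] A.idem_simps(4)[of i e] by (simp add: rs_def)

lemma rs_cmp_idem: "A.idem i e \<Longrightarrow> g \<in> Mor A \<Longrightarrow> Dom g = i \<Longrightarrow> rs (g \<star> e) = rs g \<star> e"
  using R.rst_cmp_idem[of e g] A.idem_simps[of i e] rs_of_idem[of i e] by (simp add: rs_def)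

lemma rs_inv: "f \<in> Mor A \<Longrightarrow> rs (cinv A f) = f \<star> cinv A f"
  by (simp add: rs_def)

lemma P_simps [simp]:
  "i \<in> Ob A \<Longrightarrow> fo P i \<in> Ob C" "f \<in> Mor A \<Longrightarrow> fm P f \<in> Mor C"
  "f \<in> Mor A \<Longrightarrow> Dom (fm P f) = fo P (Dom f)" "f \<in> Mor A \<Longrightarrow> Cod (fm P f) = fo P (Cod f)"
  "i \<in> Ob A \<Longrightarrow> fm P (Idt A i) = Idt C (fo P i)"
  "f \<in> Mor A \<Longrightarrow> g \<in> Mor A \<Longrightarrow> Cod f = Dom g \<Longrightarrow> fm P (g \<star> f) = fm P g \<cdot> fm P f"
  using functorD[OF over_objectD(3)[OF over]] by auto

lemma P_rs [simp]: "f \<in> Mor A \<Longrightarrow> fm P (rs f) = Rst C (fm P f)"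
  using over_objectD(6)[OF over] by (simp add: restriction_functor_def rs_def)

lemma P_idem:
  assumes "A.idem i e" shows "fm P e \<in> rst_idem C (fo P i)"
  using A.idem_simps[OF assms] P_rs[of e] rs_of_idem[OF assms] by (intro rst_idemI) simp_all

lemma P_bij:
  assumes "i \<in> Ob A" shows "bij_betw (fm P) {e. A.idem i e} (rst_idem C (fo P i))"
proof -
  have "rst_idem (inv_rcat A) i = {e. A.idem i e}" using A.rst_idem_inv by blast
  moreover have "bij_betw (fm P) (rst_idem (inv_rcat A) i) (rst_idem C (fo P i))"
    using over_objectD(7)[OF over] assms unfolding hyperconnected_def inv_rcat_simps by blast
  ultimately show ?thesis by (simp only:)
qed

lemma idem_Hom: "A.idem i e \<Longrightarrow> e \<in> Hom A i i"
  using A.idem_simps[of i e] by (simp add: Hom_def)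

lemma P_idem_Hom: "A.idem i e \<Longrightarrow> fm P e \<in> Hom C (fo P i) (fo P i)"
  using A.idem_simps[of i e] by (simp add: Hom_def)

lemma idem_ob: "A.idem i e \<Longrightarrow> i \<in> Ob A"
  using A.idem_simps[of i e] A.dom_ob[of e] by simp

lemma P_inj: "A.idem i e \<Longrightarrow> A.idem i e' \<Longrightarrow> fm P e = fm P e' \<Longrightarrow> e = e'"
  using P_bij[OF idem_ob] by (auto simp: bij_betw_def inj_on_def)

lemma P_surj:
  assumes "x \<in> rst_idem C (fo P i)" "i \<in> Ob A"
  obtains e where "A.idem i e" "fm P e = x"
proof -
  have "x \<in> fm P ` {e. A.idem i e}" using P_bij[OF assms(2)] assms(1) by (simp add: bij_betw_def)
  then show ?thesis using that by blast
qed

text \<open>Injectivity on idempotents, applied to \<open>e' \<star> e\<close> and \<open>e\<close>;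
  equations between idempotents are brought back from \<open>C\<close> to \<open>A\<close> by
  this.\<close>

lemma P_le:
  assumes e: "A.idem i e" and e': "A.idem i e'" "fm P e' \<cdot> fm P e = fm P e"
  shows "e' \<star> e = e"
  by (rule P_inj[OF A.idem_idem_cmp[OF e'(1) e] e]) (use e' A.idem_simps[OF e] A.idem_simps[OF e'(1)] in simp)

lemma idem_rle: "A.idem i e \<Longrightarrow> A.idem i e' \<Longrightarrow> rle (inv_rcat A) e e' \<longleftrightarrow> e' \<star> e = e"
  using R.rle_idem_iff[of e i e'] by (simp add: A.rst_idem_inv)

text \<open>Since \<open>P\<close> is an order isomorphism on idempotents, it preserves their joins.\<close>

lemma P_join:
  assumes j: "is_join (inv_rcat A) i i D d" and D: "\<And>e. e \<in> D \<Longrightarrow> A.idem i e"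
  shows "is_join C (fo P i) (fo P i) (fm P ` D) (fm P d)"
proof -
  have d: "A.idem i d" using R.join_idem[OF j] D by (simp add: A.rst_idem_inv)
  note i = idem_ob[OF d] and Dd = A.idem_simps(1-4)[OF d]
  have ub: "rle C (fm P e) (fm P d)" if e: "e \<in> D" for e
  proof -
    have "d \<star> e = e" using R.is_joinD(5)[OF j e] idem_rle[OF D[OF e] d] by simp
    then have "fm P d \<cdot> fm P e = fm P e" using P_simps(6)[of e d] A.idem_simps(1-3)[OF D[OF e]] Dd by simp
    then show ?thesis using rle_idem_iff[OF P_idem[OF D[OF e]] P_idem[OF d]] by simp
  qed
  have "fm P ` D \<subseteq> Hom C (fo P i) (fo P i)" "fm P d \<in> Hom C (fo P i) (fo P i)"
    using P_idem_Hom[OF D] P_idem_Hom[OF d] by blast+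
  then obtain x where x: "is_join C (fo P i) (fo P i) (fm P ` D) x"
    using bounded_join[of "fm P ` D" "fo P i" "fo P i" "fm P d"] ub by blast
  have xi: "x \<in> rst_idem C (fo P i)" by (rule join_idem[OF x]) (use P_idem[OF D] in blast)
  obtain x0 where x0: "A.idem i x0" "fm P x0 = x" using P_surj[OF xi i] .
  have "rle (inv_rcat A) e x0" if e: "e \<in> D" for e
  proof -
    have "rle C (fm P e) x" using is_joinD(5)[OF x] e by blast
    then have "fm P x0 \<cdot> fm P e = fm P e" using rle_idem_iff[OF P_idem[OF D[OF e]] xi] x0 by simp
    then show ?thesis using P_le[OF D[OF e] x0(1)] idem_rle[OF D[OF e] x0(1)] by simp
  qed
  moreover have "x0 \<in> Hom (inv_rcat A) i i" using A.idem_simps[OF x0(1)] by (simp add: Hom_def)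
  ultimately have "rle (inv_rcat A) d x0" by (intro R.is_joinD(6)[OF j])
  then have x0d: "x0 \<star> d = d" using idem_rle[OF d x0(1)] by simp
  have "fm P x0 \<cdot> fm P d = fm P d"
    using P_simps(6)[of d x0, unfolded x0d] A.idem_simps(1-3)[OF x0(1)] Dd by simp
  then have 1: "rle C (fm P d) x" using rle_idem_iff[OF P_idem[OF d] xi] x0(2) by simp
  have 2: "rle C x (fm P d)"
    by (rule is_joinD(6)[OF x]) (use ub P_idem_Hom[OF d] in blast)+
  show ?thesis using x rle_antisym[OF 1 2] by simp
qed

text \<open>\<open>eq_idem\<close> is the image of the join \<open>d\<close> of all idempotents on
  which \<open>f\<close> and \<open>g\<close> agree. Postcomposition respects joins, so
  \<open>f\<close> and \<open>g\<close> agree on \<open>d\<close> too, which is thus the largest.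
  Questions about the atlas become equations in \<open>A\<close> by this.\<close>

lemma eq_idem_char:
  assumes f: "f \<in> Hom A i j" and g: "g \<in> Hom A i j"
  shows "\<exists>d. A.idem i d \<and> eq_idem C (A, P) f g = fm P d \<and>
    (\<forall>e. A.idem i e \<longrightarrow> (d \<star> e = e \<longleftrightarrow> rs f \<star> e = e \<and> f \<star> e = g \<star> e))"
proof -
  note F [simp] = HomD[OF f] and G [simp] = HomD[OF g]
  define k where "k = rs f \<star> rs g"
  note fi = rs_idem[OF F(1,2)] and gi = rs_idem[OF G(1,2)]
  have k: "A.idem i k" unfolding k_def by (rule A.idem_idem_cmp[OF fi gi])
  note K [simp] = A.idem_simps(1-3)[OF k]
  define D where "D = {e. A.idem i e \<and> rle (inv_rcat A) e k \<and> f \<star> e = g \<star> e}"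
  have "D \<subseteq> Hom (inv_rcat A) i i" "k \<in> Hom (inv_rcat A) i i"
    using idem_Hom idem_Hom[OF k] unfolding inv_rcat_simps D_def by blast+
  then obtain d where d: "is_join (inv_rcat A) i i D d"
    using R.bounded_join[of D i i k] unfolding D_def by blast
  have Di: "A.idem i e" if "e \<in> D" for e using that by (simp add: D_def)
  have di: "A.idem i d" using R.join_idem[OF d] Di by (simp add: A.rst_idem_inv)
  note Dd [simp] = A.idem_simps(1-3)[OF di]
  have "{fm P e |e. e \<in> rst_idem (inv_rcat A) (Dom f) \<and>
        rle (inv_rcat A) e (Rst (inv_rcat A) f \<star> Rst (inv_rcat A) g) \<and> f \<star> e = g \<star> e} = fm P ` D"
    by (auto simp: D_def A.rst_idem_inv k_def rs_def)
  then have eq: "eq_idem C (A, P) f g = fm P d"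
    using Join_eq[OF P_join[OF d Di]] by (simp add: eq_idem_def)
  have fd: "f \<star> d = g \<star> d"
    using R.join_eq[OF d, of f j g] f g by (simp add: D_def)
  have "rle (inv_rcat A) d k" by (rule R.is_joinD(6)[OF d]) (simp_all add: D_def Hom_def)
  then have kd: "k \<star> d = d" using idem_rle[OF di k] by simp
  have char: "d \<star> e = e \<longleftrightarrow> rs f \<star> e = e \<and> f \<star> e = g \<star> e" if e: "A.idem i e" for e
  proof
    note E [simp] = A.idem_simps(1-4)[OF e]
    assume de: "d \<star> e = e"
    have "k \<star> e = e" using A.cmp_rw[OF kd, of e] de by simp
    moreover have "rs f \<star> k = k" using A.idem_simps(5)[OF fi, of "rs g"] by (simp add: k_def)
    ultimately have "rs f \<star> e = e" using A.cmp_rw[of "rs f" k k e] by simp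
    moreover have "f \<star> e = g \<star> e" using A.cmp_rw[OF fd, of e] de by simp
    ultimately show "rs f \<star> e = e \<and> f \<star> e = g \<star> e" ..
  next
    note E [simp] = A.idem_simps(1-4)[OF e]
    assume a: "rs f \<star> e = e \<and> f \<star> e = g \<star> e"
    have "rs g \<star> e = rs f \<star> e"
      using rs_cmp_idem[OF e F(1,2)] rs_cmp_idem[OF e G(1,2)] a by simp
    then have "k \<star> e = e" using a by (simp add: k_def)
    then have "e \<in> D" using a e idem_rle[OF e k] by (simp add: D_def)
    then show "d \<star> e = e" using R.is_joinD(5)[OF d] idem_rle[OF e di] by simp
  qed
  show ?thesis using di eq char by blast
qed

lemma small_Hom: "i \<in> Ob A \<Longrightarrow> j \<in> Ob A \<Longrightarrow> small \<kappa> (Hom A i j)"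
  using over_objectD(5)[OF over] by (simp add: locally_small_def)

text \<open>With endpoints fixed, maps are told apart by their labels; so hom-sets are admissible
  index sets for \<open>small_glueing\<close>.\<close>

lemma inj_Lab: "inj_on Lab (Hom A i j)"
  by (auto simp: inj_on_def Hom_def intro: arr.expand)

text \<open>Each entry is the largest idempotent of agreement, so the two axioms are symmetry and
  transitivity of agreement.\<close>

lemma eq_idem_atlas:
  assumes i: "i \<in> Ob A" and j: "j \<in> Ob A"
  shows "local_atlas C (fo P i) (Hom A i j) (eq_idem C (A, P))"
  unfolding local_atlas_def
proof (intro conjI ballI)
  show "fo P i \<in> Ob C" using i by simp
  fix f g assume f: "f \<in> Hom A i j" and g: "g \<in> Hom A i j"
  obtain d where d: "A.idem i d" "eq_idem C (A, P) f g = fm P d"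
    "\<And>e. A.idem i e \<Longrightarrow> d \<star> e = e \<longleftrightarrow> rs f \<star> e = e \<and> f \<star> e = g \<star> e" using eq_idem_char[OF f g] by blast
  obtain d' where d': "A.idem i d'" "eq_idem C (A, P) g f = fm P d'"
    "\<And>e. A.idem i e \<Longrightarrow> d' \<star> e = e \<longleftrightarrow> rs g \<star> e = e \<and> g \<star> e = f \<star> e" using eq_idem_char[OF g f] by blast
  show "eq_idem C (A, P) f g \<in> rst_idem C (fo P i)" using d P_idem by simp
  have F: "f \<in> Mor A" "Dom f = i" and G: "g \<in> Mor A" "Dom g = i" using f g by (auto simp: Hom_def)
  have "d' \<star> d = d"
    using d'(3)[OF d(1)] d(3)[OF d(1)] A.idem_simps(4)[OF d(1)] rs_cmp_idem[OF d(1) F] rs_cmp_idem[OF d(1) G] by simp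
  moreover have "d \<star> d' = d'"
    using d(3)[OF d'(1)] d'(3)[OF d'(1)] A.idem_simps(4)[OF d'(1)] rs_cmp_idem[OF d'(1) F] rs_cmp_idem[OF d'(1) G] by simp
  ultimately have "d = d'" using A.idem_commute[OF d(1) d'(1)] by simp
  then show "eq_idem C (A, P) f g = eq_idem C (A, P) g f" using d(2) d'(2) by simp
  fix h assume h: "h \<in> Hom A i j"
  obtain b where b: "A.idem i b" "eq_idem C (A, P) g h = fm P b"
    "\<And>e. A.idem i e \<Longrightarrow> b \<star> e = e \<longleftrightarrow> rs g \<star> e = e \<and> g \<star> e = h \<star> e" using eq_idem_char[OF g h] by blast
  obtain c where c: "A.idem i c" "eq_idem C (A, P) f h = fm P c"
    "\<And>e. A.idem i e \<Longrightarrow> c \<star> e = e \<longleftrightarrow> rs f \<star> e = e \<and> f \<star> e = h \<star> e" using eq_idem_char[OF f h] by blast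
  define e where "e = b \<star> d"
  have e: "A.idem i e" unfolding e_def by (rule A.idem_idem_cmp[OF b(1) d(1)])
  note s [simp] = A.idem_simps[OF b(1)] A.idem_simps[OF d(1)] A.idem_simps[OF c(1)]
  have "b \<star> e = e" by (simp add: e_def)
  moreover have "d \<star> e = e" using A.idem_commute[OF b(1) d(1)] by (simp add: e_def)
  ultimately have "c \<star> e = e" using b(3)[OF e] c(3)[OF e] d(3)[OF e] by simp
  then have ce: "fm P c \<cdot> fm P e = fm P e" using P_simps(6)[of e c] A.idem_simps(1-3)[OF e] by simp
  have "eq_idem C (A, P) g h \<cdot> eq_idem C (A, P) f g = fm P e" using b(2) d(2) by (simp add: e_def)
  then show "rle C (eq_idem C (A, P) g h \<cdot> eq_idem C (A, P) f g) (eq_idem C (A, P) f h)"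
    using rle_idem_iff[OF P_idem[OF e] P_idem[OF c(1)]] ce c(2) by simp
qed

section \<open>The sections of the glued arrow objects\<close>

abbreviation S where "S \<equiv> Psi_sec C (A, P)"
abbreviation src' where "src' \<equiv> Psi_src C (A, P)"

lemma Psi_glueing:
  assumes i: "i \<in> Ob A" and j: "j \<in> Ob A"
  shows "\<exists>q. glueing C (fo P i) (Hom A i j) (eq_idem C (A, P)) (src' i j) q S"
proof -
  let ?Q = "\<lambda>(p, q, s). glueing C (fo P i) (Hom A i j) (eq_idem C (A, P)) p q s"
  obtain p q s where "glueing C (fo P i) (Hom A i j) (eq_idem C (A, P)) p q s"
    using small_glueing[OF local_glueings small_Hom[OF i j] inj_Lab eq_idem_atlas[OF i j]] by blast
  then have "?Q (p, q, s)" by simp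
  then have "?Q (SOME x. ?Q x)" by (rule someI)
  then have "?Q (Psi_glueing C (A, P) i j)" by (simp add: Psi_glueing_def)
  then have "glueing C (fo P i) (Hom A i j) (eq_idem C (A, P)) (src' i j)
      (fst (snd (Psi_glueing C (A, P) i j))) (snd (snd (Psi_glueing C (A, P) i j)))"
    by (simp add: Psi_src_def case_prod_beta)
  \<comment> \<open>\<open>Psi_sec\<close> consults the glueing at the endpoints of its argument, so
    on \<open>Hom A i j\<close> it gives the sections chosen there.\<close>
  then show ?thesis
    by (intro exI, rule glueing_sections_cong) (auto simp: Psi_sec_def Hom_def)
qed

lemma sec_cover:
  assumes "i \<in> Ob A" "j \<in> Ob A" shows "cover C (src' i j) (Hom A i j) S"
  using Psi_glueing[OF assms] glueing_cover(1) by blast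

lemma src'_simps [simp]:
  assumes "i \<in> Ob A" "j \<in> Ob A"
  shows "src' i j \<in> Mor C" "Cod (src' i j) = fo P i" "Rst C (src' i j) = Idt C (Dom (src' i j))"
    "Dom (src' i j) \<in> Ob C"
  using Psi_glueing[OF assms] glueing_cover(2) cover_total[OF sec_cover[OF assms]] dom_ob[of "src' i j"] by blast+

lemma sec_psec: "f \<in> Mor A \<Longrightarrow> partial_section C (src' (Dom f) (Cod f)) (S f)"
  using cover_section[OF sec_cover[of "Dom f" "Cod f"], of f] by (simp add: Hom_def)

lemma sec_rst [simp]:
  assumes f [simp]: "f \<in> Mor A" shows "Rst C (S f) = Rst C (fm P f)"
proof -
  have h: "f \<in> Hom A (Dom f) (Cod f)" by (simp add: Hom_def)
  obtain q where "glueing C (fo P (Dom f)) (Hom A (Dom f) (Cod f)) (eq_idem C (A, P)) (src' (Dom f) (Cod f)) q S"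
    using Psi_glueing[of "Dom f" "Cod f"] by auto
  then have r: "Rst C (S f) = eq_idem C (A, P) f f" by (rule glueing_cover(3)) (rule h)
  obtain d where d: "A.idem (Dom f) d" "eq_idem C (A, P) f f = fm P d"
    "\<And>e. A.idem (Dom f) e \<Longrightarrow> d \<star> e = e \<longleftrightarrow> rs f \<star> e = e \<and> f \<star> e = f \<star> e" using eq_idem_char[OF h h] by blast
  have i: "A.idem (Dom f) (rs f)" by (rule rs_idem) simp_all
  have "d \<star> rs f = rs f" "rs f \<star> d = d"
    using d(3)[OF i] d(3)[OF d(1)] A.idem_simps(4)[OF d(1)] by simp_all
  then have "d = rs f" using A.idem_commute[OF d(1) i] by simp
  then show ?thesis using r d(2) by simp
qed

lemma sec_simps [simp]:
  assumes "f \<in> Mor A"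
  shows "S f \<in> Mor C" "Dom (S f) = fo P (Dom f)" "Cod (S f) = Dom (src' (Dom f) (Cod f))"
    "src' (Dom f) (Cod f) \<cdot> S f = Rst C (fm P f)"
  using partial_sectionD(1-4)[OF sec_psec[OF assms]] assms by simp_all

text \<open>Two sections of a glueing agree over an idempotent of their domain exactly when it lies
  below the entry of the atlas, and that entry is the largest idempotent on which the maps agree.
  The agreement conditions for the glued target, multiplication and inversion are checked through
  this.\<close>

lemma sec_eq:
  assumes f: "f \<in> Hom A i j" and g: "g \<in> Hom A i j" and e: "A.idem i e" "rs f \<star> e = e"
  shows "S f \<cdot> fm P e = S g \<cdot> fm P e \<longleftrightarrow> f \<star> e = g \<star> e"
proof -
  note F [simp] = HomD[OF f] and G [simp] = HomD[OF g]
  have ij: "i \<in> Ob A" "j \<in> Ob A" using A.dom_ob[OF F(1)] A.cod_ob[OF F(1)] by simp_all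
  obtain q where gl: "glueing C (fo P i) (Hom A i j) (eq_idem C (A, P)) (src' i j) q S"
    using Psi_glueing[OF ij] by auto
  obtain d where d: "A.idem i d" "eq_idem C (A, P) f g = fm P d"
    "\<And>e. A.idem i e \<Longrightarrow> d \<star> e = e \<longleftrightarrow> rs f \<star> e = e \<and> f \<star> e = g \<star> e" using eq_idem_char[OF f g] by blast
  note E [simp] = A.idem_simps(1-3)[OF e(1)] and D [simp] = A.idem_simps(1-3)[OF d(1)]
  show ?thesis
  proof
    assume "S f \<cdot> fm P e = S g \<cdot> fm P e"
    moreover have "Rst C (S f) \<cdot> fm P e = fm P e" using P_simps(6)[of e "rs f"] e(2) by simp
    ultimately have "fm P d \<cdot> fm P e = fm P e"
      using glueing_cover(5)[OF gl f g P_idem[OF e(1)]] d(2) by simp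
    then have "d \<star> e = e" by (rule P_le[OF e(1) d(1)])
    then show "f \<star> e = g \<star> e" using d(3)[OF e(1)] by simp
  next
    assume "f \<star> e = g \<star> e"
    then have "d \<star> e = e" using d(3)[OF e(1)] e(2) by simp
    then have de: "fm P d \<cdot> fm P e = fm P e" using P_simps(6)[of e d] by simp
    have "S f \<cdot> fm P d = S g \<cdot> fm P d" using glueing_cover(4)[OF gl f g] d(2) by simp
    from cmp_right[OF this, of "fm P e"] show "S f \<cdot> fm P e = S g \<cdot> fm P e" using de by simp
  qed
qed

text \<open>\<open>f \<star> e\<close> and \<open>f\<close> agree on the domain \<open>r\<close> of
  the former, so \<open>sec_eq\<close> compares their sections there.\<close>

lemma sec_cmp_idem:
  assumes f [simp]: "f \<in> Mor A" and e: "A.idem (Dom f) e"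
  shows "S (f \<star> e) = S f \<cdot> fm P e"
proof -
  note E [simp] = A.idem_simps(1-3)[OF e]
  define r where "r = rs f \<star> e"
  have ri: "A.idem (Dom f) r" unfolding r_def by (rule A.idem_idem_cmp[OF rs_idem e]) simp_all
  note Rr [simp] = A.idem_simps(1-4)[OF ri]
  have rf: "rs (f \<star> e) = r" unfolding r_def by (rule rs_cmp_idem[OF e]) simp_all
  have fr: "f \<star> r = f \<star> e" using A.cmp_rw[of f "rs f" f e] by (simp add: r_def)
  have "(f \<star> e) \<star> r = f \<star> r" unfolding rf[symmetric] fr[unfolded rf[symmetric]] by (rule rs_simps(4)) simp
  then have "S (f \<star> e) \<cdot> fm P r = S f \<cdot> fm P r"
    using sec_eq[of "f \<star> e" "Dom f" "Cod f" f r] ri by (simp add: Hom_def rf)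
  moreover have "fm P r = Rst C (S (f \<star> e))" using P_rs[of "f \<star> e"] by (simp only: rf) simp
  moreover have "S (f \<star> e) \<cdot> Rst C (S (f \<star> e)) = S (f \<star> e)" by (rule cmp_rst') simp
  ultimately have "S (f \<star> e) = S f \<cdot> fm P r" by (simp only:)
  also have "... = S f \<cdot> Rst C (S f) \<cdot> fm P e" by (simp add: r_def)
  also have "... = S f \<cdot> fm P e" using cmp_rst_assoc[of "S f" "fm P e"] by simp
  finally show ?thesis .
qed

text \<open>Equal sections have equal domains; injectivity of \<open>P\<close> on idempotents gives
  \<open>rs f = rs g\<close>, and on this common domain \<open>sec_eq\<close> applies.\<close>

lemma sec_inj:
  assumes f: "f \<in> Hom A i j" and g: "g \<in> Hom A i j" and eq: "S f = S g"
  shows "f = g"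
proof -
  note F [simp] = HomD[OF f] and G [simp] = HomD[OF g]
  have "rs f = rs g"
    by (rule P_inj[OF rs_idem rs_idem]) (use sec_rst[of f] sec_rst[of g] eq in simp_all)
  moreover have "f \<star> rs f = g \<star> rs f"
    using sec_eq[OF f g rs_idem[OF F(1,2)]] eq by simp
  ultimately show ?thesis using rs_simps(4)[OF F(1)] rs_simps(4)[OF G(1)] by metis
qed

lemma sec_rs: "f \<in> Mor A \<Longrightarrow> g \<in> Mor A \<Longrightarrow> Dom f = Dom g \<Longrightarrow> S (g \<star> rs f) = S g \<cdot> Rst C (fm P f)"
  using sec_cmp_idem[OF _ rs_idem, of g f] by simp

section \<open>The glued target and multiplication maps\<close>

abbreviation tgt' where "tgt' \<equiv> Psi_tgt C (A, P)"

text \<open>The target is glued from the maps \<open>fm P f\<close>. For agreement, an idempotent of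
  \<open>C\<close> is lifted along \<open>P\<close> to one of \<open>A\<close>, where equality of
  sections is equality of maps.\<close>

lemma Psi_tgt_props:
  assumes [simp]: "i \<in> Ob A" "j \<in> Ob A"
  shows "tgt' i j \<in> Hom C (Dom (src' i j)) (fo P j) \<and> (\<forall>f \<in> Hom A i j. tgt' i j \<cdot> S f = fm P f)"
    and "Rst C (tgt' i j) = Idt C (Dom (src' i j))"
proof -
  note c = sec_cover[OF assms]
  have h: "\<And>f. f \<in> Hom A i j \<Longrightarrow> fm P f \<in> Hom C (Cod (src' i j)) (fo P j)"
    "\<And>f. f \<in> Hom A i j \<Longrightarrow> Rst C (fm P f) = Rst C (S f)" by (auto simp: Hom_def)
  have agree: "fm P f \<cdot> e = fm P g \<cdot> e"
    if f: "f \<in> Hom A i j" and g: "g \<in> Hom A i j" and e: "e \<in> rst_idem C (Cod (src' i j))" "Rst C (S f) \<cdot> e = e"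
      "S f \<cdot> e = S g \<cdot> e" for f g e
  proof -
    note F [simp] = HomD[OF f] and G [simp] = HomD[OF g]
    have "e \<in> rst_idem C (fo P i)" using e(1) by simp
    then obtain e0 where e0: "A.idem i e0" "fm P e0 = e" by (rule P_surj) simp
    note E [simp] = A.idem_simps(1-3)[OF e0(1)]
    have "rs f \<star> e0 = e0" by (rule P_le[OF e0(1) rs_idem]) (use e0(2) e(2) in simp_all)
    then have "f \<star> e0 = g \<star> e0" using sec_eq[OF f g e0(1)] e(3) e0(2) by simp
    then show ?thesis using P_simps(6)[of e0 f] P_simps(6)[of e0 g] e0(2) by simp
  qed
  note ex = cover_glue_unique[OF c h agree P_simps(1)[OF assms(2)]]
  have "\<exists>!k. k \<in> Hom C (Dom (src' i j)) (fo P j) \<and> (\<forall>f \<in> Hom A i j. k \<cdot> S f = fm P f)"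
    by (rule ex(1)) simp_all
  from theI'[OF this] show t: "tgt' i j \<in> Hom C (Dom (src' i j)) (fo P j) \<and> (\<forall>f \<in> Hom A i j. tgt' i j \<cdot> S f = fm P f)"
    by (simp add: Psi_tgt_def)
  show "Rst C (tgt' i j) = Idt C (Dom (src' i j))"
    by (rule ex(2)) (use t in simp_all)
qed

lemma tgt'_simps [simp]:
  assumes "i \<in> Ob A" "j \<in> Ob A"
  shows "tgt' i j \<in> Mor C" "Dom (tgt' i j) = Dom (src' i j)" "Cod (tgt' i j) = fo P j"
    "Rst C (tgt' i j) = Idt C (Dom (src' i j))"
  using Psi_tgt_props[OF assms] by (auto simp: Hom_def)

lemma tgt'_sec [simp]: "f \<in> Mor A \<Longrightarrow> tgt' (Dom f) (Cod f) \<cdot> S f = fm P f"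
  using Psi_tgt_props(1)[of "Dom f" "Cod f"] by (simp add: Hom_def)

lemma src'_has_pb:
  assumes "i \<in> Ob A" "j \<in> Ob A" "g \<in> Mor C" "Rst C g = Idt C (Dom g)" "Cod g = fo P i"
  shows "has_pb C (src' i j) g"
  by (rule cover_has_pb[OF sec_cover[OF assms(1,2)] local_glueings small_Hom[OF assms(1,2)] inj_Lab])
    (use assms in simp_all)

lemma mul_pb' [simp]: "i \<in> Ob A \<Longrightarrow> j \<in> Ob A \<Longrightarrow> k \<in> Ob A \<Longrightarrow> has_pb C (src' j k) (tgt' i j)"
  by (rule src'_has_pb) simp_all

abbreviation mul' where "mul' \<equiv> Psi_mul C (A, P)"

lemma rst_sec_cmp [simp]:
  assumes [simp]: "f \<in> Mor A" "x \<in> Mor C" "Cod x = fo P (Dom f)"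
  shows "Rst C (S f \<cdot> x) = Rst C (fm P f \<cdot> x)"
  using rst_rst_cmp[of x "S f"] rst_rst_cmp[of x "fm P f"] by simp

lemma tgt'_sec_assoc [simp]:
  "f \<in> Mor A \<Longrightarrow> x \<in> Mor C \<Longrightarrow> Cod x = fo P (Dom f) \<Longrightarrow> tgt' (Dom f) (Cod f) \<cdot> S f \<cdot> x = fm P f \<cdot> x"
  using cmp_rw[OF tgt'_sec, of f x] by simp

lemma src'_sec_assoc [simp]:
  "f \<in> Mor A \<Longrightarrow> x \<in> Mor C \<Longrightarrow> Cod x = fo P (Dom f) \<Longrightarrow> src' (Dom f) (Cod f) \<cdot> S f \<cdot> x = Rst C (fm P f) \<cdot> x"
  using cmp_rw[OF sec_simps(4), of f x] by simp

lemma sec_cmp_rst [simp]: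
  assumes "f \<in> Mor A" shows "S f \<cdot> Rst C (fm P f) = S f"
  using cmp_rst'[of "S f"] assms by simp

text \<open>\<open>w\<close> is the point of the pullback given by a composable pair:
  \<open>S g\<close> at the target of \<open>S f\<close>, together with \<open>S f\<close>, both on
  the domain of the composite. Maps out of the domain of \<open>mul'\<close> are tested on these
  points.\<close>

lemma mul_section:
  assumes f [simp]: "f \<in> Mor A" "Dom f = i" "Cod f = j" and g [simp]: "g \<in> Mor A" "Dom g = j" "Cod g = k"
  defines "w \<equiv> pull_section C (src' j k) (tgt' i j) (S g) \<cdot> S f"
  shows "w \<in> Mor C" "Dom w = fo P i" "Cod w = pbo C (src' j k) (tgt' i j)"
    "pb1 C (src' j k) (tgt' i j) \<cdot> w = S g \<cdot> fm P f"
    "pb2 C (src' j k) (tgt' i j) \<cdot> w = S f \<cdot> Rst C (fm P g \<cdot> fm P f)"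
    "Rst C w = Rst C (fm P g \<cdot> fm P f)"
proof -
  have ob [simp]: "i \<in> Ob A" "j \<in> Ob A" "k \<in> Ob A" using A.dom_ob[OF f(1)] A.dom_ob[OF g(1)] A.cod_ob[OF g(1)] by simp_all
  have pb: "has_pb C (src' j k) (tgt' i j)" by simp
  have ps: "partial_section C (src' j k) (S g)" using sec_psec[OF g(1)] by simp
  note F [simp] = sec_simps[OF f(1), unfolded f(2,3)] and G [simp] = sec_simps[OF g(1), unfolded g(2,3)]
  note q = pull_section_props(1-6)[OF pb ps]
  note t = tgt'_sec[OF f(1), unfolded f(2,3)]
  show "w \<in> Mor C" "Dom w = fo P i" "Cod w = pbo C (src' j k) (tgt' i j)"
    using q(1-3) by (simp_all add: w_def)
  show "pb1 C (src' j k) (tgt' i j) \<cdot> w = S g \<cdot> fm P f"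
    using cmp_rw[OF q(4), of "S f"] q(1-3) pb_simps[OF pb] t by (simp add: w_def)
  have r: "Rst C (S g \<cdot> tgt' i j \<cdot> S f) = Rst C (fm P g \<cdot> fm P f)" unfolding t by simp
  have "pb2 C (src' j k) (tgt' i j) \<cdot> w = Rst C (S g \<cdot> tgt' i j) \<cdot> S f"
    using cmp_rw[OF q(5), of "S f"] q(1-3) pb_simps[OF pb] by (simp add: w_def)
  also have "... = S f \<cdot> Rst C ((S g \<cdot> tgt' i j) \<cdot> S f)" by (rule rst_slide) simp_all
  also have "(S g \<cdot> tgt' i j) \<cdot> S f = S g \<cdot> tgt' i j \<cdot> S f" by (rule assoc) simp_all
  finally show "pb2 C (src' j k) (tgt' i j) \<cdot> w = S f \<cdot> Rst C (fm P g \<cdot> fm P f)" unfolding r .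
  have "Rst C w = Rst C (Rst C (S g \<cdot> tgt' i j) \<cdot> S f)"
    using rst_rst_cmp[of "S f" "pull_section C (src' j k) (tgt' i j) (S g)"] q by (simp add: w_def)
  also have "... = Rst C ((S g \<cdot> tgt' i j) \<cdot> S f)" by (rule rst_rst_cmp) simp_all
  also have "(S g \<cdot> tgt' i j) \<cdot> S f = S g \<cdot> tgt' i j \<cdot> S f" by (rule assoc) simp_all
  finally show "Rst C w = Rst C (fm P g \<cdot> fm P f)" unfolding r .
qed

lemma mul_cover:
  assumes [simp]: "i \<in> Ob A" "j \<in> Ob A" "k \<in> Ob A"
  shows "cover C (src' i j \<cdot> pb2 C (src' j k) (tgt' i j)) (Hom A i j \<times> Hom A j k)
    (\<lambda>(f, g). pull_section C (src' j k) (tgt' i j) (S g) \<cdot> S f)"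
  by (rule cover_cmp[OF sec_cover cover_pullback[OF sec_cover]]) (simp_all add: pb_simps[OF mul_pb'])

text \<open>The multiplication is glued from the sections of composites. When the points of two
  pairs agree over \<open>e\<close>, their first members agree on it, while the second members need
  only agree on the range of the common restriction \<open>x\<close>; that suffices for the
  composites to agree.\<close>

lemma Psi_mul_props:
  assumes ob [simp]: "i \<in> Ob A" "j \<in> Ob A" "k \<in> Ob A"
  shows "mul' i j k \<in> Hom C (pbo C (src' j k) (tgt' i j)) (Dom (src' i k)) \<and>
    (\<forall>f \<in> Hom A i j. \<forall>g \<in> Hom A j k.
      mul' i j k \<cdot> pull_section C (src' j k) (tgt' i j) (S g) \<cdot> S f = S (g \<star> f))"
proof -
  note pb [simp] = pb_simps[OF mul_pb'[OF ob]]
  let ?p = "src' i j \<cdot> pb2 C (src' j k) (tgt' i j)" and ?I = "Hom A i j \<times> Hom A j k"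
  let ?w = "\<lambda>(f, g). pull_section C (src' j k) (tgt' i j) (S g) \<cdot> S f"
  let ?h = "\<lambda>(f, g). S (g \<star> f)"
  have I: "fst a \<in> Mor A" "Dom (fst a) = i" "Cod (fst a) = j" "snd a \<in> Mor A" "Dom (snd a) = j" "Cod (snd a) = k"
    if "a \<in> ?I" for a using that by (auto simp: Hom_def)
  have "\<exists>!m. m \<in> Hom C (Dom ?p) (Dom (src' i k)) \<and> (\<forall>a \<in> ?I. m \<cdot> ?w a = ?h a)"
  proof (rule cover_glue_unique(1)[OF mul_cover[OF ob]])
    show "?h a \<in> Hom C (Cod ?p) (Dom (src' i k))" if "a \<in> ?I" for a
      using I[OF that] sec_simps(1-3)[of "snd a \<star> fst a"] by (simp add: Hom_def case_prod_beta)
    show "Rst C (?h a) = Rst C (?w a)" if "a \<in> ?I" for a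
      using I[OF that] mul_section(6)[of "fst a" i j "snd a" k] by (simp add: case_prod_beta)
    show "Dom (src' i k) \<in> Ob C" by simp
    fix a b e assume a: "a \<in> ?I" and b: "b \<in> ?I" and e: "e \<in> rst_idem C (Cod ?p)" "Rst C (?w a) \<cdot> e = e" "?w a \<cdot> e = ?w b \<cdot> e"
    obtain f g where a': "a = (f, g)" by (cases a)
    obtain f' g' where b': "b = (f', g')" by (cases b)
    note F = I[OF a, unfolded a' fst_conv snd_conv] and F' = I[OF b, unfolded b' fst_conv snd_conv]
    note [simp] = F(1,2,4,5) F'(1,2,4,5)
    note [simp] = F(3,6) F'(3,6)
    have "e \<in> rst_idem C (fo P i)" using e(1) by simp
    then obtain e0 where e0: "A.idem i e0" "fm P e0 = e" by (rule P_surj) simp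
    note E [simp] = A.idem_simps(1-4)[OF e0(1)]
    have ei [simp]: "e \<in> Mor C" "Dom e = fo P i" "Cod e = fo P i" using P_idem_Hom[OF e0(1)] e0(2) by (auto simp: Hom_def)
    define w w' where "w = pull_section C (src' j k) (tgt' i j) (S g) \<cdot> S f"
      and "w' = pull_section C (src' j k) (tgt' i j) (S g') \<cdot> S f'"
    note W = mul_section[OF F, folded w_def] and W' = mul_section[OF F', folded w'_def]
    note [simp] = W(1-3) W'(1-3)
    have we: "w \<cdot> e = w' \<cdot> e" and re: "Rst C w \<cdot> e = e" using e(2,3) by (simp_all add: a' b' w_def w'_def)
    have "Rst C w' \<cdot> e = Rst C (w' \<cdot> e)" using rst_cmp_idem[of e w'] P_idem[OF e0(1)] e0(2) by simp
    also have "... = Rst C w \<cdot> e" using rst_cmp_idem[of e w] P_idem[OF e0(1)] e0(2) we by simp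
    finally have re': "Rst C w' \<cdot> e = e" using re by simp
    have key: "rs (g \<star> f) \<star> e0 = e0 \<and> rs f \<star> e0 = e0 \<and> pb2 C (src' j k) (tgt' i j) \<cdot> w \<cdot> e = S f \<cdot> e \<and>
        pb1 C (src' j k) (tgt' i j) \<cdot> w \<cdot> e = S g \<cdot> fm P f \<cdot> e"
      if F: "f \<in> Mor A" "Dom f = i" "Cod f = j" "g \<in> Mor A" "Dom g = j" "Cod g = k"
        and w: "w = pull_section C (src' j k) (tgt' i j) (S g) \<cdot> S f" and re: "Rst C w \<cdot> e = e" for f g w
    proof (intro conjI)
      note W = mul_section[OF F, folded w]
      note [simp] = F(1,2,4,5) W(1-3)
      note [simp] = F(3,6)
      have r: "Rst C (fm P g \<cdot> fm P f) \<cdot> e = e" using re unfolding W(6) .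
      show r1: "rs (g \<star> f) \<star> e0 = e0"
        by (rule P_le[OF e0(1) rs_idem]) (use r e0(2) in simp_all)
      have "rs f \<star> rs (g \<star> f) = rs (g \<star> f)"
        using R.rst_absorb(2)[of f g] by (simp add: rs_def)
      from A.cmp_rw[OF this, of e0] show "rs f \<star> e0 = e0" using r1 by simp
      show "pb2 C (src' j k) (tgt' i j) \<cdot> w \<cdot> e = S f \<cdot> e"
        using cmp_rw[OF W(5), of e] r by simp
      show "pb1 C (src' j k) (tgt' i j) \<cdot> w \<cdot> e = S g \<cdot> fm P f \<cdot> e"
        using cmp_rw[OF W(4), of e] by simp
    qed
    note K = key[OF F w_def re] and K' = key[OF F' w'_def re']
    have "S f \<cdot> fm P e0 = S f' \<cdot> fm P e0" using K K' we e0(2) by simp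
    then have x: "f \<star> e0 = f' \<star> e0"
      using sec_eq[of f i j f' e0] K e0(1) by (simp add: Hom_def)
    define x where "x = f \<star> e0"
    have X [simp]: "x \<in> Mor A" "Dom x = i" "Cod x = j" by (simp_all add: x_def)
    \<comment> \<open>The range idempotent of \<open>x\<close>. Composing with the inverse of
      \<open>x\<close> turns agreement of \<open>S g\<close> and \<open>S g'\<close> after
      \<open>fm P x\<close> into agreement over \<open>y\<close>, to which \<open>sec_eq\<close>
      applies.\<close>
    define y where "y = x \<star> cinv A x"
    have y: "A.idem j y" by (simp add: y_def)
    note Y [simp] = A.idem_simps(1-3)[OF y]
    have px: "fm P f \<cdot> e = fm P x" "fm P f' \<cdot> e = fm P x"
      using P_simps(6)[of e0 f] P_simps(6)[of e0 f'] x e0(2) by (simp_all add: x_def del: P_simps(6))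
    have gx: "S g \<cdot> fm P x = S g' \<cdot> fm P x" using K K' we px by simp
    have "rs g \<star> x = (rs g \<star> f) \<star> e0" by (simp add: x_def)
    also have "... = (f \<star> rs (g \<star> f)) \<star> e0" using rs_slide[of f g] by (simp only: F)
    also have "... = x" using K by (simp add: x_def)
    finally have rx: "rs g \<star> x = x" .
    have ry: "rs g \<star> y = y" using A.cmp_rw[OF rx, of "cinv A x"] by (simp add: y_def)
    have "S g \<cdot> fm P y = S g' \<cdot> fm P y"
      using cmp_reassoc[OF gx, of "fm P (cinv A x)"] by (simp add: y_def)
    then have gy: "g \<star> y = g' \<star> y" using sec_eq[of g j k g' y] y ry by (simp add: Hom_def)
    have yx: "y \<star> x = x" by (simp add: y_def)
    have "g \<star> x = g' \<star> x" using A.cmp_reassoc[OF gy, of x] yx by simp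
    then have "(g \<star> f) \<star> e0 = (g' \<star> f') \<star> e0" using x by (simp add: x_def)
    then have "S (g \<star> f) \<cdot> fm P e0 = S (g' \<star> f') \<cdot> fm P e0"
      using sec_eq[of "g \<star> f" i k "g' \<star> f'" e0] K e0(1) by (simp add: Hom_def)
    then show "?h a \<cdot> e = ?h b \<cdot> e" by (simp add: a' b' e0(2))
  qed
  then have "\<exists>!m. m \<in> Hom C (pbo C (src' j k) (tgt' i j)) (Dom (src' i k)) \<and>
    (\<forall>f \<in> Hom A i j. \<forall>g \<in> Hom A j k.
      m \<cdot> pull_section C (src' j k) (tgt' i j) (S g) \<cdot> S f = S (g \<star> f))" by (simp add: Ball_def imp_conjL)
  from theI'[OF this] show ?thesis by (simp add: Psi_mul_def)
qed

lemma mul'_simps [simp]: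
  assumes "i \<in> Ob A" "j \<in> Ob A" "k \<in> Ob A"
  shows "mul' i j k \<in> Mor C" "Dom (mul' i j k) = pbo C (src' j k) (tgt' i j)" "Cod (mul' i j k) = Dom (src' i k)"
  using Psi_mul_props[OF assms] by (auto simp: Hom_def)

text \<open>Since \<open>y\<close> lands in the domain of \<open>g\<close>, the point in
  \<open>mul_section\<close> has \<open>S y\<close> itself as second component. The factor
  \<open>z\<close> lets the formula be used after a further precomposition.\<close>

lemma mul_point:
  assumes y [simp]: "y \<in> Mor A" "Dom y = i" "Cod y = j" and g [simp]: "g \<in> Mor A" "Dom g = j" "Cod g = k"
    and gy: "rs g \<star> y = y" and z [simp]: "z \<in> Mor C" "Cod z = fo P i"
  shows "mul' i j k \<cdot> pair C (src' j k) (tgt' i j) (S g \<cdot> fm P y \<cdot> z) (S y \<cdot> z) = S (g \<star> y) \<cdot> z"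
    "src' j k \<cdot> S g \<cdot> fm P y \<cdot> z = tgt' i j \<cdot> S y \<cdot> z"
proof -
  have ob [simp]: "i \<in> Ob A" "j \<in> Ob A" "k \<in> Ob A" using A.dom_ob[OF y(1)] A.dom_ob[OF g(1)] A.cod_ob[OF g(1)] by simp_all
  define w where "w = pull_section C (src' j k) (tgt' i j) (S g) \<cdot> S y"
  note W = mul_section[OF y g, folded w_def] and pb = pb_simps[OF mul_pb'[OF ob]]
  note [simp] = W(1-3) pb
  note F [simp] = sec_simps[OF y(1), unfolded y(2,3)] and G [simp] = sec_simps[OF g(1), unfolded g(2,3)]
  have "Rst C (fm P g) \<cdot> fm P y = fm P y" using P_simps(6)[of y "rs g"] gy by simp
  then have ry: "Rst C (fm P g \<cdot> fm P y) = Rst C (fm P y)" using rst_rst_cmp[of "fm P y" "fm P g"] by simp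
  have w2: "pb2 C (src' j k) (tgt' i j) \<cdot> w = S y" using W(5) unfolding ry by simp
  have "w \<cdot> z = pair C (src' j k) (tgt' i j) (S g \<cdot> fm P y \<cdot> z) (S y \<cdot> z)"
    by (rule pair_unique[OF mul_pb'[OF ob]]) (use cmp_rw[OF W(4), of z] cmp_rw[OF w2, of z] in simp_all)
  moreover have "mul' i j k \<cdot> w = S (g \<star> y)" using Psi_mul_props[OF ob] by (simp add: w_def Hom_def)
  ultimately show "mul' i j k \<cdot> pair C (src' j k) (tgt' i j) (S g \<cdot> fm P y \<cdot> z) (S y \<cdot> z) = S (g \<star> y) \<cdot> z"
    using cmp_rw[of "mul' i j k" w "S (g \<star> y)" z] by simp
  show "src' j k \<cdot> S g \<cdot> fm P y \<cdot> z = tgt' i j \<cdot> S y \<cdot> z"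
    using src'_sec_assoc[OF g(1), of "fm P y \<cdot> z"] tgt'_sec_assoc[OF y(1), of z]
      cmp_rw[OF \<open>Rst C (fm P g) \<cdot> fm P y = fm P y\<close>, of z] by simp
qed

section \<open>The groupoid axioms for the glued structure\<close>

abbreviation BB where "BB \<equiv> Psi_obj C (A, P)"

lemma Psi_obj_simps:
  "idx BB = Ob A" "obj BB = fo P"
  "mob BB i j = Dom (src' i j)" "src BB = src'"
  "tgt BB = tgt'" "unt BB i = S (Idt A i)" "mul BB = mul'"
  by (simp_all add: Psi_obj_def)

lemma Psi_src_mul:
  assumes ob [simp]: "i \<in> Ob A" "j \<in> Ob A" "k \<in> Ob A"
  shows "src' i k \<cdot> mul' i j k = src' i j \<cdot> pb2 C (src' j k) (tgt' i j)"
    and "tgt' i k \<cdot> mul' i j k = tgt' j k \<cdot> pb1 C (src' j k) (tgt' i j)"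
proof -
  note pb [simp] = pb_simps[OF mul_pb'[OF ob]]
  have "src' i k \<cdot> mul' i j k \<cdot> w = src' i j \<cdot> pb2 C (src' j k) (tgt' i j) \<cdot> w \<and>
      tgt' i k \<cdot> mul' i j k \<cdot> w = tgt' j k \<cdot> pb1 C (src' j k) (tgt' i j) \<cdot> w"
    if f: "f \<in> Hom A i j" and g: "g \<in> Hom A j k" and w: "w = pull_section C (src' j k) (tgt' i j) (S g) \<cdot> S f" for f g w
  proof -
    note F [simp] = HomD[OF f] and G [simp] = HomD[OF g]
    note W = mul_section[OF F G, folded w]
    have m: "mul' i j k \<cdot> w = S (g \<star> f)" using Psi_mul_props[OF ob] f g by (simp add: w)
    show ?thesis
      unfolding m W(4,5)
      using sec_simps(4)[of "g \<star> f"] tgt'_sec[of "g \<star> f"] src'_sec_assoc[of f "Rst C (fm P g \<cdot> fm P f)"]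
        tgt'_sec_assoc[of g "fm P f"] rst_absorb(2)[of "fm P f" "fm P g"] by simp
  qed
  note eq = this
  let ?w = "\<lambda>a. case a of (f, g) \<Rightarrow> pull_section C (src' j k) (tgt' i j) (S g) \<cdot> S f"
  show "src' i k \<cdot> mul' i j k = src' i j \<cdot> pb2 C (src' j k) (tgt' i j)"
  proof (rule cover_eq[OF mul_cover[OF ob], where B = "fo P i"])
    fix a assume "a \<in> Hom A i j \<times> Hom A j k"
    then obtain f g where a: "a = (f, g)" "f \<in> Hom A i j" "g \<in> Hom A j k" by blast
    then have FG: "f \<in> Mor A" "Dom f = i" "Cod f = j" "g \<in> Mor A" "Dom g = j" "Cod g = k" by (auto simp: Hom_def)
    define w where "w = pull_section C (src' j k) (tgt' i j) (S g) \<cdot> S f"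
    note [simp] = mul_section(1-3)[OF FG, folded w_def]
    show "(src' i k \<cdot> mul' i j k) \<cdot> ?w a =
      (src' i j \<cdot> pb2 C (src' j k) (tgt' i j)) \<cdot> ?w a"
      using eq[OF a(2,3) w_def] by (simp add: a(1) w_def[symmetric])
  qed (simp_all add: Hom_def)
  show "tgt' i k \<cdot> mul' i j k = tgt' j k \<cdot> pb1 C (src' j k) (tgt' i j)"
  proof (rule cover_eq[OF mul_cover[OF ob], where B = "fo P k"])
    fix a assume "a \<in> Hom A i j \<times> Hom A j k"
    then obtain f g where a: "a = (f, g)" "f \<in> Hom A i j" "g \<in> Hom A j k" by blast
    then have FG: "f \<in> Mor A" "Dom f = i" "Cod f = j" "g \<in> Mor A" "Dom g = j" "Cod g = k" by (auto simp: Hom_def)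
    define w where "w = pull_section C (src' j k) (tgt' i j) (S g) \<cdot> S f"
    note [simp] = mul_section(1-3)[OF FG, folded w_def]
    show "(tgt' i k \<cdot> mul' i j k) \<cdot> ?w a =
      (tgt' j k \<cdot> pb1 C (src' j k) (tgt' i j)) \<cdot> ?w a"
      using eq[OF a(2,3) w_def] by (simp add: a(1) w_def[symmetric])
  qed (simp_all add: Hom_def)
qed

lemma unt'_simps [simp]:
  assumes [simp]: "i \<in> Ob A"
  shows "S (Idt A i) \<in> Mor C" "Dom (S (Idt A i)) = fo P i" "Cod (S (Idt A i)) = Dom (src' i i)"
    "src' i i \<cdot> S (Idt A i) = Idt C (fo P i)" "tgt' i i \<cdot> S (Idt A i) = Idt C (fo P i)"
  using sec_simps[of "Idt A i"] tgt'_sec[of "Idt A i"] by simp_all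

lemma sec_rs_unt:
  assumes "f \<in> Mor A" "Dom f = i"
  shows "S (rs f) = S (Idt A i) \<cdot> Rst C (fm P f)"
  using sec_rs[of f "Idt A i"] A.dom_ob[OF assms(1)] assms by simp

text \<open>Tested on \<open>S f\<close>, the laws become \<open>f \<star> rs f = f\<close> and
  \<open>Idt A j \<star> f = f\<close>; in the first the domain of the section has been moved into
  the unit.\<close>

lemma Psi_mul_unt:
  assumes ob [simp]: "i \<in> Ob A" "j \<in> Ob A"
  shows "mul' i i j \<cdot> pair C (src' i j) (tgt' i i) (Idt C (Dom (src' i j))) (S (Idt A i) \<cdot> src' i j) =
      Idt C (Dom (src' i j))"
    and "mul' i j j \<cdot> pair C (src' j j) (tgt' i j) (S (Idt A j) \<cdot> tgt' i j) (Idt C (Dom (src' i j))) =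
      Idt C (Dom (src' i j))"
proof -
  define X where "X = Dom (src' i j)"
  have X [simp]: "X \<in> Ob C" "Dom (src' i j) = X" by (simp_all add: X_def)
  note pr = pair_props[OF mul_pb'] and pc = pair_cmp[OF mul_pb']
  have p1: "src' i j \<cdot> Idt C X = tgt' i i \<cdot> S (Idt A i) \<cdot> src' i j"
    using cmp_rw[OF unt'_simps(5)[OF ob(1)], of "src' i j"] by simp
  have p2: "src' j j \<cdot> S (Idt A j) \<cdot> tgt' i j = tgt' i j \<cdot> Idt C X"
    using cmp_rw[OF unt'_simps(4)[OF ob(2)], of "tgt' i j"] by simp
  note q1 [simp] = pr[OF ob(1,1,2) _ _ _ _ _ p1, simplified] and q2 [simp] = pr[OF ob(1,2,2) _ _ _ _ _ p2, simplified]
  show "mul' i i j \<cdot> pair C (src' i j) (tgt' i i) (Idt C (Dom (src' i j))) (S (Idt A i) \<cdot> src' i j) = Idt C (Dom (src' i j))"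
    unfolding X
  proof (rule cover_eq[OF sec_cover[OF ob], where B = X])
    fix f assume "f \<in> Hom A i j"
    then have F [simp]: "f \<in> Mor A" "Dom f = i" "Cod f = j" by (auto simp: Hom_def)
    note Sf [simp] = sec_simps[OF F(1), unfolded F(2,3) X]
    have "pair C (src' i j) (tgt' i i) (Idt C X) (S (Idt A i) \<cdot> src' i j) \<cdot> S f =
        pair C (src' i j) (tgt' i i) (Idt C X \<cdot> S f) ((S (Idt A i) \<cdot> src' i j) \<cdot> S f)"
      by (rule pc[OF ob(1,1,2) _ _ _ _ _ p1]) simp_all
    also have "... = pair C (src' i j) (tgt' i i) (S f \<cdot> fm P (rs f) \<cdot> Idt C (fo P i)) (S (rs f) \<cdot> Idt C (fo P i))"
      using sec_rs_unt[OF F(1,2)] by simp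
    finally show "(mul' i i j \<cdot> pair C (src' i j) (tgt' i i) (Idt C X) (S (Idt A i) \<cdot> src' i j)) \<cdot> S f = Idt C X \<cdot> S f"
      using mul_point(1)[of "rs f" i i f j "Idt C (fo P i)"] by simp
  qed (simp_all add: Hom_def)
  show "mul' i j j \<cdot> pair C (src' j j) (tgt' i j) (S (Idt A j) \<cdot> tgt' i j) (Idt C (Dom (src' i j))) = Idt C (Dom (src' i j))"
    unfolding X
  proof (rule cover_eq[OF sec_cover[OF ob], where B = X])
    fix f assume "f \<in> Hom A i j"
    then have F [simp]: "f \<in> Mor A" "Dom f = i" "Cod f = j" by (auto simp: Hom_def)
    note Sf [simp] = sec_simps[OF F(1), unfolded F(2,3) X]
    have "pair C (src' j j) (tgt' i j) (S (Idt A j) \<cdot> tgt' i j) (Idt C X) \<cdot> S f =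
        pair C (src' j j) (tgt' i j) ((S (Idt A j) \<cdot> tgt' i j) \<cdot> S f) (Idt C X \<cdot> S f)"
      by (rule pc[OF ob(1,2,2) _ _ _ _ _ p2]) simp_all
    also have "... = pair C (src' j j) (tgt' i j) (S (Idt A j) \<cdot> fm P f \<cdot> Idt C (fo P i)) (S f \<cdot> Idt C (fo P i))"
      using tgt'_sec[OF F(1)] by simp
    finally show "(mul' i j j \<cdot> pair C (src' j j) (tgt' i j) (S (Idt A j) \<cdot> tgt' i j) (Idt C X)) \<cdot> S f = Idt C X \<cdot> S f"
      using mul_point(1)[of f i j "Idt A j" j "Idt C (fo P i)"] rs_of_idem[of j "Idt A j"] by (simp add: A.idem_def)
  qed (simp_all add: Hom_def)
qed

text \<open>Both sides are tested on triples of sections. At the point given by \<open>f\<close>,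
  \<open>g\<close>, \<open>h\<close> everything lives on the domain \<open>e\<close> of the triple
  composite, and with \<open>x = f \<star> e\<close> both sides become the section of
  \<open>h \<star> g \<star> x\<close>.\<close>

lemma Psi_mul_assoc:
  assumes ob [simp]: "i \<in> Ob A" "j \<in> Ob A" "k \<in> Ob A" "l \<in> Ob A"
  defines "\<pi>1 \<equiv> pb1 C (src' j k) (tgt' i j)" and "\<pi>2 \<equiv> pb2 C (src' j k) (tgt' i j)"
  defines "\<rho>1 \<equiv> pb1 C (src' k l) (tgt' j k \<cdot> \<pi>1)" and "\<rho>2 \<equiv> pb2 C (src' k l) (tgt' j k \<cdot> \<pi>1)"
  shows "mul' i k l \<cdot> pair C (src' k l) (tgt' i k) \<rho>1 (mul' i j k \<cdot> \<rho>2) =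
    mul' i j l \<cdot> pair C (src' j l) (tgt' i j) (mul' j k l \<cdot> pair C (src' k l) (tgt' j k) \<rho>1 (\<pi>1 \<cdot> \<rho>2)) (\<pi>2 \<cdot> \<rho>2)"
proof -
  note pb1' = mul_pb'[OF ob(1,2,3)]
  define Z where "Z = pbo C (src' j k) (tgt' i j)"
  note p [simp] = pb_simps[OF pb1', folded \<pi>1_def \<pi>2_def Z_def] and
    pt = pb_total[OF pb1', folded \<pi>1_def \<pi>2_def Z_def] and pcm = pb_commutes[OF pb1', folded \<pi>1_def \<pi>2_def]
  define g0 where "g0 = tgt' j k \<cdot> \<pi>1"
  have g0 [simp]: "g0 \<in> Mor C" "Dom g0 = Z" "Cod g0 = fo P k" by (simp_all add: g0_def)
  have g0r: "Rst C g0 = Idt C Z" using pt rst_cmp_total[of \<pi>1 "tgt' j k"] by (simp add: g0_def)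
  have pb2': "has_pb C (src' k l) g0" by (rule src'_has_pb) (use g0r in simp_all)
  define Q where "Q = pbo C (src' k l) g0"
  note r [simp] = pb_simps[OF pb2', folded \<rho>1_def[folded g0_def] \<rho>2_def[folded g0_def] Q_def, unfolded g0(2)]
  have r1: "src' k l \<cdot> \<rho>1 = tgt' j k \<cdot> \<pi>1 \<cdot> \<rho>2"
    using pb_commutes[OF pb2', folded \<rho>1_def[folded g0_def] \<rho>2_def[folded g0_def]] by (simp add: g0_def)
  have [simp]: "Dom (mul' i j k) = Z" by (simp add: Z_def)
  have st1: "src' k l \<cdot> \<rho>1 = tgt' i k \<cdot> mul' i j k \<cdot> \<rho>2"
    using r1 cmp_reassoc[OF Psi_src_mul(2)[OF ob(1,2,3), folded \<pi>1_def], of \<rho>2] by simp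
  note q1 = pair_props[OF mul_pb'[OF ob(1,3,4)] _ _ _ _ _ st1, simplified]
  note q2 = pair_props[OF mul_pb'[OF ob(2,3,4)] _ _ _ _ _ r1, simplified]
  define N where "N = mul' j k l \<cdot> pair C (src' k l) (tgt' j k) \<rho>1 (\<pi>1 \<cdot> \<rho>2)"
  note [simp] = q1(1-3) q2(1-3)
  have N [simp]: "N \<in> Mor C" "Dom N = Q" "Cod N = Dom (src' j l)" by (simp_all add: N_def)
  have "src' j l \<cdot> N = (src' j k \<cdot> pb2 C (src' k l) (tgt' j k)) \<cdot> pair C (src' k l) (tgt' j k) \<rho>1 (\<pi>1 \<cdot> \<rho>2)"
    unfolding N_def by (rule cmp_rw[OF Psi_src_mul(1)[OF ob(2,3,4)]]) simp_all
  also have "... = src' j k \<cdot> \<pi>1 \<cdot> \<rho>2"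
    using q2(5) pb_simps[OF mul_pb'[OF ob(2,3,4)]] by simp
  also have "... = tgt' i j \<cdot> \<pi>2 \<cdot> \<rho>2" using cmp_reassoc[OF pcm, of \<rho>2] by simp
  finally have st2: "src' j l \<cdot> N = tgt' i j \<cdot> \<pi>2 \<cdot> \<rho>2" .
  note q3 = pair_props[OF mul_pb'[OF ob(1,2,4)] _ _ _ _ _ st2, simplified]
  note [simp] = q3(1-3)
  let ?w = "\<lambda>(f, g). pull_section C (src' j k) (tgt' i j) (S g) \<cdot> S f"
  have cov: "cover C ((src' i j \<cdot> \<pi>2) \<cdot> \<rho>2) ((Hom A i j \<times> Hom A j k) \<times> Hom A k l)
      (\<lambda>(a, h). pull_section C (src' k l) g0 (S h) \<cdot> ?w a)"
    by (rule cover_cmp[OF mul_cover[OF ob(1,2,3), folded \<pi>2_def] cover_pullback[OF sec_cover[OF ob(3,4)] pb2', folded \<rho>2_def[folded g0_def]]])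
      simp
  have "mul' i k l \<cdot> pair C (src' k l) (tgt' i k) \<rho>1 (mul' i j k \<cdot> \<rho>2) =
      mul' i j l \<cdot> pair C (src' j l) (tgt' i j) N (\<pi>2 \<cdot> \<rho>2)"
  proof (rule cover_eq[OF cov, where B = "Dom (src' i l)"])
    fix a assume "a \<in> (Hom A i j \<times> Hom A j k) \<times> Hom A k l"
    then obtain f g h where a: "a = ((f, g), h)" "f \<in> Hom A i j" "g \<in> Hom A j k" "h \<in> Hom A k l" by blast
    have F: "f \<in> Mor A" "Dom f = i" "Cod f = j" and G: "g \<in> Mor A" "Dom g = j" "Cod g = k"
      and H: "h \<in> Mor A" "Dom h = k" "Cod h = l" using a by (auto simp: Hom_def)
    note [simp] = F G H
    define w where "w = pull_section C (src' j k) (tgt' i j) (S g) \<cdot> S f"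
    note w [simp] = mul_section(1-3)[OF F G, folded w_def Z_def] and w4 = mul_section(4,5)[OF F G, folded w_def \<pi>1_def \<pi>2_def]
    define t where "t = pull_section C (src' k l) g0 (S h)"
    have psh: "partial_section C (src' k l) (S h)" using sec_psec[OF H(1)] by simp
    note t [simp] = pull_section_props(1-3)[OF pb2' psh, folded t_def Q_def, unfolded g0(2)]
    note t4 = pull_section_props(4,5)[OF pb2' psh, folded t_def \<rho>1_def[folded g0_def] \<rho>2_def[folded g0_def]]
    note Sf [simp] = sec_simps(1-3)[OF F(1), unfolded F(2,3)] and Sg [simp] = sec_simps(1-3)[OF G(1), unfolded G(2,3)]
      and Sh [simp] = sec_simps(1-3)[OF H(1), unfolded H(2,3)]
    define W where "W = t \<cdot> w"
    have W [simp]: "W \<in> Mor C" "Dom W = fo P i" "Cod W = Q" by (simp_all add: W_def)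
    define e where "e = rs (h \<star> g \<star> f)"
    have e: "A.idem i e" unfolding e_def by (rule rs_idem) simp_all
    note E [simp] = A.idem_simps(1-4)[OF e]
    have Pe: "fm P e = Rst C (fm P h \<cdot> fm P g \<cdot> fm P f)" by (simp add: e_def)
    have g0w: "g0 \<cdot> w = fm P g \<cdot> fm P f"
      using w4(1) tgt'_sec_assoc[OF G(1), of "fm P f"] by (simp add: g0_def)
    define x where "x = f \<star> e"
    have x [simp]: "x \<in> Mor A" "Dom x = i" "Cod x = j" by (simp_all add: x_def)
    have "rs (h \<star> g) \<star> f = f \<star> e" using rs_slide[of f "h \<star> g"] by (simp add: e_def)
    then have x1: "rs (h \<star> g) \<star> x = x" using A.cmp_reassoc[of "rs (h \<star> g)" f f e e] by (simp add: x_def)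
    have "rs g \<star> rs (h \<star> g) = rs (h \<star> g)" using R.rst_absorb(2)[of g h] by (simp add: rs_def)
    from A.cmp_rw[OF this, of x] have x2: "rs g \<star> x = x" using x1 by simp
    have hg: "rs h \<star> g = g \<star> rs (h \<star> g)" by (rule rs_slide) simp_all
    have x3: "rs h \<star> g \<star> x = g \<star> x" using A.cmp_reassoc[OF hg, of x] x1 by simp
    have Px: "fm P f \<cdot> fm P e = fm P x" by (simp add: x_def)
    have \<rho>1W: "\<rho>1 \<cdot> W = S h \<cdot> fm P (g \<star> x)"
    proof -
      have "\<rho>1 \<cdot> W = (S h \<cdot> g0) \<cdot> w" unfolding W_def by (rule cmp_rw[OF t4(1)]) simp_all
      also have "... = S h \<cdot> fm P g \<cdot> fm P f" using g0w by simp
      also have "... = (S h \<cdot> fm P g \<cdot> fm P f) \<cdot> Rst C (S h \<cdot> fm P g \<cdot> fm P f)" by (rule cmp_rst'[symmetric]) simp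
      also have "... = (S h \<cdot> fm P g \<cdot> fm P f) \<cdot> fm P e" unfolding Pe by simp
      also have "... = S h \<cdot> fm P (g \<star> x)" by (simp add: x_def)
      finally show ?thesis .
    qed
    have \<rho>2W: "\<rho>2 \<cdot> W = w \<cdot> fm P e"
    proof -
      have "\<rho>2 \<cdot> W = Rst C (S h \<cdot> g0) \<cdot> w" unfolding W_def by (rule cmp_rw[OF t4(2)]) simp_all
      also have "... = w \<cdot> Rst C ((S h \<cdot> g0) \<cdot> w)" by (rule rst_slide) simp_all
      also have "(S h \<cdot> g0) \<cdot> w = S h \<cdot> fm P g \<cdot> fm P f" using g0w by simp
      finally show ?thesis unfolding Pe by simp
    qed
    have 1: "\<pi>1 \<cdot> \<rho>2 \<cdot> W = S g \<cdot> fm P x"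
      unfolding \<rho>2W using cmp_rw[OF w4(1), of "fm P e"] Px by simp
    have 2: "\<pi>2 \<cdot> \<rho>2 \<cdot> W = S x"
    proof -
      have "\<pi>2 \<cdot> \<rho>2 \<cdot> W = S f \<cdot> Rst C (fm P g \<cdot> fm P f) \<cdot> fm P e"
        unfolding \<rho>2W using cmp_rw[OF w4(2), of "fm P e"] by simp
      also have "Rst C (fm P g \<cdot> fm P f) \<cdot> fm P e = fm P e"
        unfolding Pe using rst_absorb(2)[of "fm P g \<cdot> fm P f" "fm P h"] by simp
      also have "S f \<cdot> fm P e = S x" unfolding x_def by (rule sec_cmp_idem[symmetric]) (use e in simp_all)
      finally show ?thesis .
    qed
    have 3: "mul' i j k \<cdot> \<rho>2 \<cdot> W = S (g \<star> x)"
    proof -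
      have "mul' i j k \<cdot> w = S (g \<star> f)" using Psi_mul_props[OF ob(1,2,3)] a by (simp add: w_def)
      from cmp_rw[OF this, of "fm P e"] have "mul' i j k \<cdot> \<rho>2 \<cdot> W = S (g \<star> f) \<cdot> fm P e"
        unfolding \<rho>2W using sec_simps(1-3)[of "g \<star> f"] by simp
      also have "... = S ((g \<star> f) \<star> e)" by (rule sec_cmp_idem[symmetric]) (use e in simp_all)
      finally show ?thesis by (simp add: x_def)
    qed
    note Sx [simp] = sec_simps(1-3)[OF x(1), unfolded x(2,3)]
    have hgx: "h \<star> g \<star> x \<in> Mor A" by simp
    have lhs: "(mul' i k l \<cdot> pair C (src' k l) (tgt' i k) \<rho>1 (mul' i j k \<cdot> \<rho>2)) \<cdot> W = S (h \<star> g \<star> x)"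
    proof -
      have "pair C (src' k l) (tgt' i k) \<rho>1 (mul' i j k \<cdot> \<rho>2) \<cdot> W =
          pair C (src' k l) (tgt' i k) (\<rho>1 \<cdot> W) ((mul' i j k \<cdot> \<rho>2) \<cdot> W)"
        by (rule pair_cmp[OF mul_pb'[OF ob(1,3,4)] _ _ _ _ _ st1]) simp_all
      also have "(mul' i j k \<cdot> \<rho>2) \<cdot> W = S (g \<star> x)" using 3 by simp
      finally show ?thesis
        using mul_point(1)[of "g \<star> x" i k h l "Idt C (fo P i)"] x3 sec_simps(1-3)[of "g \<star> x"] sec_simps(1-3)[OF hgx]
        unfolding \<rho>1W by simp
    qed
    \<comment> \<open>\<open>mul_point\<close> asks for a map landing in the domain of
      \<open>h\<close>. The part of \<open>g\<close> that does so replaces it, which changes neither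
      \<open>g \<star> x\<close> nor \<open>h \<star> g\<close>.\<close>
    define g' where "g' = rs h \<star> g"
    have g' [simp]: "g' \<in> Mor A" "Dom g' = j" "Cod g' = k" by (simp_all add: g'_def)
    have "S g' = S g \<cdot> Rst C (fm P (h \<star> g))" unfolding g'_def hg by (rule sec_rs) simp_all
    moreover have "Rst C (fm P (h \<star> g)) \<cdot> fm P x = fm P x" using P_simps(6)[of x "rs (h \<star> g)"] x1 by simp
    ultimately have Sg': "S g' \<cdot> fm P x = S g \<cdot> fm P x" by simp
    have gx: "g' \<star> x = g \<star> x" using x3 by (simp add: g'_def)
    have hg': "h \<star> g' = h \<star> g" using A.cmp_rw[of h "rs h" h g] by (simp add: g'_def)
    have rg': "rs h \<star> g' = g'" using A.cmp_rw[of "rs h" "rs h" "rs h" g] by (simp add: g'_def)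
    have NW: "N \<cdot> W = S (h \<star> g) \<cdot> fm P x"
    proof -
      have "pair C (src' k l) (tgt' j k) \<rho>1 (\<pi>1 \<cdot> \<rho>2) \<cdot> W = pair C (src' k l) (tgt' j k) (\<rho>1 \<cdot> W) ((\<pi>1 \<cdot> \<rho>2) \<cdot> W)"
        by (rule pair_cmp[OF mul_pb'[OF ob(2,3,4)] _ _ _ _ _ r1]) simp_all
      also have "(\<pi>1 \<cdot> \<rho>2) \<cdot> W = S g' \<cdot> fm P x" using 1 Sg' by simp
      also have "\<rho>1 \<cdot> W = S h \<cdot> fm P g' \<cdot> fm P x" unfolding \<rho>1W gx[symmetric] by simp
      finally have "N \<cdot> W = mul' j k l \<cdot> pair C (src' k l) (tgt' j k) (S h \<cdot> fm P g' \<cdot> fm P x) (S g' \<cdot> fm P x)"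
        by (simp add: N_def)
      also have "... = S (h \<star> g') \<cdot> fm P x" by (rule mul_point(1)) (use rg' in simp_all)
      finally show ?thesis unfolding hg' .
    qed
    have rhs: "(mul' i j l \<cdot> pair C (src' j l) (tgt' i j) N (\<pi>2 \<cdot> \<rho>2)) \<cdot> W = S (h \<star> g \<star> x)"
    proof -
      have "pair C (src' j l) (tgt' i j) N (\<pi>2 \<cdot> \<rho>2) \<cdot> W = pair C (src' j l) (tgt' i j) (N \<cdot> W) ((\<pi>2 \<cdot> \<rho>2) \<cdot> W)"
        by (rule pair_cmp[OF mul_pb'[OF ob(1,2,4)] _ _ _ _ _ st2]) simp_all
      also have "(\<pi>2 \<cdot> \<rho>2) \<cdot> W = S x" using 2 by simp
      finally show ?thesis
        using mul_point(1)[of x i j "h \<star> g" l "Idt C (fo P i)"] x1 sec_simps(1-3)[of "h \<star> g"] sec_simps(1-3)[OF hgx]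
        unfolding NW by simp
    qed
    show "(mul' i k l \<cdot> pair C (src' k l) (tgt' i k) \<rho>1 (mul' i j k \<cdot> \<rho>2)) \<cdot>
        (case a of (a, h) \<Rightarrow> pull_section C (src' k l) g0 (S h) \<cdot> ?w a) =
      (mul' i j l \<cdot> pair C (src' j l) (tgt' i j) N (\<pi>2 \<cdot> \<rho>2)) \<cdot>
        (case a of (a, h) \<Rightarrow> pull_section C (src' k l) g0 (S h) \<cdot> ?w a)"
      using lhs rhs by (simp add: a(1) W_def t_def w_def)
  qed (simp_all add: Hom_def)
  then show ?thesis by (simp add: N_def)
qed

lemma Psi_internal: "internal_category C BB"
proof (intro internal_category.intro join_restriction_category_axioms partite_category.intro)
  have "\<exists>p q. is_pullback C (src' i j) g p q"
    if "i \<in> Ob A" "j \<in> Ob A" "total_map C g" "Cod g = fo P i" for i j g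
    using src'_has_pb[of i j g] that by (simp add: has_pb_def total_iff)
  then show "i \<in> idx BB \<Longrightarrow> j \<in> idx BB \<Longrightarrow> total_map C g \<Longrightarrow>
    Cod g = obj BB i \<Longrightarrow> \<exists>p q. is_pullback C (src BB i j) g p q" for i j g
    by (simp only: Psi_obj_simps)
qed (simp_all only: Psi_obj_simps Psi_mul_unt Psi_src_mul Psi_mul_assoc Let_def, simp_all add: Hom_def total_iff)

text \<open>The arrow \<open>S f\<close> over a point is sent to the section of the inverse of
  \<open>f\<close> over the image of that point. The glueing condition holds because maps agreeing
  on \<open>e0\<close> have inverses agreeing on the range \<open>y\<close> of their common
  restriction.\<close>

lemma Psi_inverse:
  assumes ob [simp]: "i \<in> Ob A" "j \<in> Ob A"
  shows "\<exists>\<iota>. \<iota> \<in> Hom C (Dom (src' i j)) (Dom (src' j i)) \<and> Rst C \<iota> = Idt C (Dom (src' i j)) \<and>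
    (\<forall>f \<in> Hom A i j. \<iota> \<cdot> S f = S (cinv A f) \<cdot> fm P f)"
proof -
  note c = sec_cover[OF ob]
  have pp: "fm P (cinv A f) \<cdot> fm P f = Rst C (fm P f)" if "f \<in> Mor A" for f
    using that P_rs[of f] unfolding rs_def by simp
  have h: "S (cinv A f) \<cdot> fm P f \<in> Hom C (Cod (src' i j)) (Dom (src' j i))"
      "Rst C (S (cinv A f) \<cdot> fm P f) = Rst C (S f)" if f: "f \<in> Hom A i j" for f
  proof -
    note F [simp] = HomD[OF f]
    show "S (cinv A f) \<cdot> fm P f \<in> Hom C (Cod (src' i j)) (Dom (src' j i))"
      using sec_simps(1-3)[of "cinv A f"] by (simp add: Hom_def)
    show "Rst C (S (cinv A f) \<cdot> fm P f) = Rst C (S f)"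
      using rst_sec_cmp[of "cinv A f" "fm P f"] pp[OF F(1)] by simp
  qed
  have agree: "(S (cinv A f) \<cdot> fm P f) \<cdot> e = (S (cinv A g) \<cdot> fm P g) \<cdot> e"
    if f: "f \<in> Hom A i j" and g: "g \<in> Hom A i j" and e: "e \<in> rst_idem C (Cod (src' i j))" "Rst C (S f) \<cdot> e = e"
      "S f \<cdot> e = S g \<cdot> e" for f g e
  proof -
    note F [simp] = HomD[OF f] and G [simp] = HomD[OF g]
    have "e \<in> rst_idem C (fo P i)" using e(1) by simp
    then obtain e0 where e0: "A.idem i e0" "fm P e0 = e" by (rule P_surj) simp
    note E [simp] = A.idem_simps(1-3)[OF e0(1)]
    have rf: "rs f \<star> e0 = e0" by (rule P_le[OF e0(1) rs_idem]) (use e0(2) e(2) in simp_all)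
    then have fg: "f \<star> e0 = g \<star> e0" using sec_eq[OF f g e0(1)] e(3) e0(2) by simp
    have rg: "rs g \<star> e0 = e0" using rs_cmp_idem[OF e0(1) F(1,2)] rs_cmp_idem[OF e0(1) G(1,2)] fg rf by simp
    define x where "x = f \<star> e0"
    define y where "y = x \<star> cinv A x"
    have x [simp]: "x \<in> Mor A" "Dom x = i" "Cod x = j" by (simp_all add: x_def)
    have y: "A.idem j y" by (simp add: y_def)
    note Y [simp] = A.idem_simps(1-3)[OF y]
    have yx: "y \<star> x = x" by (simp add: y_def)
    have inv: "cinv A h \<star> x = e0" if "h \<in> Mor A" "Dom h = i" "Cod h = j" "x = h \<star> e0" "rs h \<star> e0 = e0" for h
      using that by (simp add: rs_def)
    have fx: "cinv A f \<star> x = e0" and gx: "cinv A g \<star> x = e0"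
      by (rule inv; use rf rg fg in \<open>simp add: x_def\<close>)+
    have fy: "cinv A f \<star> y = e0 \<star> cinv A x" and gy: "cinv A g \<star> y = e0 \<star> cinv A x"
      using A.cmp_rw[OF fx, of "cinv A x"] A.cmp_rw[OF gx, of "cinv A x"] by (simp_all add: y_def)
    have "rs (cinv A f) \<star> x = f \<star> cinv A f \<star> x" by (simp add: rs_inv)
    also have "... = x" unfolding fx by (simp add: x_def)
    finally have "rs (cinv A f) \<star> y = y" using A.cmp_rw[of "rs (cinv A f)" x x "cinv A x"] by (simp add: y_def)
    then have "S (cinv A f) \<cdot> fm P y = S (cinv A g) \<cdot> fm P y"
      using sec_eq[of "cinv A f" j i "cinv A g" y] y fy gy by (simp add: Hom_def)
    note eq = cmp_reassoc[OF this, of "fm P x"]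
    have px: "fm P f \<cdot> e = fm P x" "fm P g \<cdot> e = fm P x" "fm P y \<cdot> fm P x = fm P x"
      using P_simps(6)[of e0 f] P_simps(6)[of e0 g] P_simps(6)[of x y] fg yx e0(2)
      by (simp_all add: x_def del: P_simps(6))
    have ei [simp]: "e \<in> Mor C" "Dom e = fo P i" "Cod e = fo P i" using P_idem_Hom[OF e0(1)] e0(2) by (auto simp: Hom_def)
    show ?thesis using eq px sec_simps(1-3)[of "cinv A f"] sec_simps(1-3)[of "cinv A g"] by simp
  qed
  have B: "Dom (src' j i) \<in> Ob C" by simp
  note g = cover_glue_unique[OF c h agree B]
  have "\<exists>!k. k \<in> Hom C (Dom (src' i j)) (Dom (src' j i)) \<and> (\<forall>f \<in> Hom A i j. k \<cdot> S f = S (cinv A f) \<cdot> fm P f)"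
    by (rule g(1)) simp_all
  then obtain k where k: "k \<in> Hom C (Dom (src' i j)) (Dom (src' j i))" "\<And>f. f \<in> Hom A i j \<Longrightarrow> k \<cdot> S f = S (cinv A f) \<cdot> fm P f"
    by blast
  have "Rst C k = Idt C (Dom (src' i j))" by (rule g(2)) (use k in simp_all)
  then show ?thesis using k by blast
qed

text \<open>Tested on \<open>S f\<close>, the inverse law is
  \<open>cinv A f \<star> f = rs f\<close>, whose section is the unit cut down to the domain of
  \<open>f\<close>.\<close>

lemma Psi_groupoid: "etale_groupoid \<kappa> C BB"
proof -
  define \<iota> where "\<iota> i j = (SOME \<iota>. \<iota> \<in> Hom C (Dom (src' i j)) (Dom (src' j i)) \<and> Rst C \<iota> = Idt C (Dom (src' i j)) \<and>
    (\<forall>f \<in> Hom A i j. \<iota> \<cdot> S f = S (cinv A f) \<cdot> fm P f))" for i j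
  have \<iota>0: "\<iota> i j \<in> Hom C (Dom (src' i j)) (Dom (src' j i)) \<and> Rst C (\<iota> i j) = Idt C (Dom (src' i j)) \<and>
    (\<forall>f \<in> Hom A i j. \<iota> i j \<cdot> S f = S (cinv A f) \<cdot> fm P f)" if "i \<in> Ob A" "j \<in> Ob A" for i j
    unfolding \<iota>_def by (rule someI_ex[OF Psi_inverse[OF that]])
  have \<iota> [simp]: "\<iota> i j \<in> Mor C" "Dom (\<iota> i j) = Dom (src' i j)" "Cod (\<iota> i j) = Dom (src' j i)"
    "Rst C (\<iota> i j) = Idt C (Dom (src' i j))" if "i \<in> Ob A" "j \<in> Ob A" for i j
    using \<iota>0[OF that] by (auto simp: Hom_def)
  have \<iota>S: "\<iota> i j \<cdot> S f = S (cinv A f) \<cdot> fm P f" if "i \<in> Ob A" "j \<in> Ob A" "f \<in> Hom A i j" for i j f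
    using \<iota>0[OF that(1,2)] that(3) by blast
  have pp: "fm P (cinv A f) \<cdot> fm P f = Rst C (fm P f)" if "f \<in> Mor A" for f
    using that P_rs[of f] unfolding rs_def by simp
  have src_\<iota>: "src' j i \<cdot> \<iota> i j = tgt' i j" if ob [simp]: "i \<in> Ob A" "j \<in> Ob A" for i j
  proof (rule cover_eq[OF sec_cover[OF ob], where B = "fo P j"])
    fix f assume f: "f \<in> Hom A i j"
    then have F [simp]: "f \<in> Mor A" "Dom f = i" "Cod f = j" by (auto simp: Hom_def)
    have "Rst C (fm P (cinv A f)) \<cdot> fm P f = fm P f"
      using P_rs[of "cinv A f"] cmp_rw[of "fm P (rs (cinv A f))" "fm P f"] P_simps(6)[of f "rs (cinv A f)"]
      by (simp add: rs_inv)
    then show "(src' j i \<cdot> \<iota> i j) \<cdot> S f = tgt' i j \<cdot> S f"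
      using \<iota>S[OF ob f] src'_sec_assoc[of "cinv A f" "fm P f"] tgt'_sec[of f] sec_simps(1-3)[of f] by simp
  qed (simp_all add: Hom_def)
  have "\<iota> i j \<in> Hom C (Dom (src' i j)) (Dom (src' j i)) \<and> total_map C (\<iota> i j) \<and> \<iota> i j \<cdot> \<iota> j i = Idt C (Dom (src' j i)) \<and>
      src' j i \<cdot> \<iota> i j = tgt' i j \<and>
      mul' i j i \<cdot> pair C (src' j i) (tgt' i j) (\<iota> i j) (Idt C (Dom (src' i j))) = S (Idt A i) \<cdot> src' i j"
    if ob [simp]: "i \<in> Ob A" "j \<in> Ob A" for i j
  proof (intro conjI)
    show "\<iota> i j \<in> Hom C (Dom (src' i j)) (Dom (src' j i))" "total_map C (\<iota> i j)" by (simp_all add: Hom_def total_iff)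
    show "src' j i \<cdot> \<iota> i j = tgt' i j" by (rule src_\<iota>) simp_all
    show "\<iota> i j \<cdot> \<iota> j i = Idt C (Dom (src' j i))"
    proof (rule cover_eq[OF sec_cover[OF ob(2,1)], where B = "Dom (src' j i)"])
      fix f assume f: "f \<in> Hom A j i"
      then have F [simp]: "f \<in> Mor A" "Dom f = j" "Cod f = i" by (auto simp: Hom_def)
      note [simp] = sec_simps(1-3)[OF F(1), unfolded F(2,3)]
      have f': "cinv A f \<in> Hom A i j" by (simp add: Hom_def)
      have "\<iota> i j \<cdot> S (cinv A f) = S f \<cdot> fm P (cinv A f)" using \<iota>S[OF ob f'] by simp
      from cmp_reassoc[OF this, of "fm P f"] have "\<iota> i j \<cdot> S (cinv A f) \<cdot> fm P f = S f"
        using sec_simps(1-3)[of "cinv A f"] pp[of f] by simp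
      then show "(\<iota> i j \<cdot> \<iota> j i) \<cdot> S f = Idt C (Dom (src' j i)) \<cdot> S f"
        using \<iota>S[OF ob(2,1) f] by simp
    qed (simp_all add: Hom_def)
    have st: "src' j i \<cdot> \<iota> i j = tgt' i j \<cdot> Idt C (Dom (src' i j))" using src_\<iota>[OF ob] by simp
    define X where "X = Dom (src' i j)"
    have X [simp]: "X \<in> Ob C" "Dom (src' i j) = X" by (simp_all add: X_def)
    note q [simp] = pair_props(1-3)[OF mul_pb'[OF ob(1,2,1)] _ _ _ _ _ st, simplified]
    show "mul' i j i \<cdot> pair C (src' j i) (tgt' i j) (\<iota> i j) (Idt C (Dom (src' i j))) = S (Idt A i) \<cdot> src' i j"
    proof (rule cover_eq[OF sec_cover[OF ob], where B = "Dom (src' i i)"])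
      fix f assume f: "f \<in> Hom A i j"
      then have F [simp]: "f \<in> Mor A" "Dom f = i" "Cod f = j" by (auto simp: Hom_def)
      note [simp] = sec_simps(1-3)[OF F(1), unfolded F(2,3) X]
      have "pair C (src' j i) (tgt' i j) (\<iota> i j) (Idt C (Dom (src' i j))) \<cdot> S f =
          pair C (src' j i) (tgt' i j) (\<iota> i j \<cdot> S f) (Idt C (Dom (src' i j)) \<cdot> S f)"
        by (rule pair_cmp[OF mul_pb'[OF ob(1,2,1)] _ _ _ _ _ st]) simp_all
      also have "... = pair C (src' j i) (tgt' i j) (S (cinv A f) \<cdot> fm P f \<cdot> Idt C (fo P i)) (S f \<cdot> Idt C (fo P i))"
        using \<iota>S[OF ob f] by simp
      finally have "(mul' i j i \<cdot> pair C (src' j i) (tgt' i j) (\<iota> i j) (Idt C (Dom (src' i j)))) \<cdot> S f =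
          mul' i j i \<cdot> pair C (src' j i) (tgt' i j) (S (cinv A f) \<cdot> fm P f \<cdot> Idt C (fo P i)) (S f \<cdot> Idt C (fo P i))"
        by simp
      also have "... = S (cinv A f \<star> f) \<cdot> Idt C (fo P i)"
        by (rule mul_point(1)) (simp_all add: rs_inv)
      also have "... = S (rs f)" using sec_simps(1,2)[of "rs f"] by (simp add: rs_def)
      also have "... = S (Idt A i) \<cdot> Rst C (fm P f)" by (rule sec_rs_unt) simp_all
      also have "... = (S (Idt A i) \<cdot> src' i j) \<cdot> S f" using sec_simps(4)[of f] by simp
      finally show "(mul' i j i \<cdot> pair C (src' j i) (tgt' i j) (\<iota> i j) (Idt C (Dom (src' i j)))) \<cdot> S f =
        (S (Idt A i) \<cdot> src' i j) \<cdot> S f" .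
    qed (simp_all add: Hom_def)
  qed
  then have "partite_groupoid C BB"
    unfolding partite_groupoid_def Psi_obj_simps
    using internal_category.axioms(2)[OF Psi_internal] by blast
  then show ?thesis
    unfolding etale_groupoid_def Psi_obj_simps
    using over_objectD(4)[OF over] cover_local_homeo[OF sec_cover] by blast
qed

section \<open>Invertibility of the unit\<close>

abbreviation U where "U f \<equiv> Arr (Dom f) (Lab (S f)) (Cod f)"

lemma P_partial_inverse:
  assumes "f \<in> Mor A" shows "partial_inverse C (fm P f) (fm P (cinv A f))"
  using assms P_rs[of f] P_rs[of "cinv A f"] by (intro partial_inverseI) (simp_all add: rs_def)

lemma unit_mor:
  assumes f [simp]: "f \<in> Mor A"
  shows "U f \<in> Mor (Phi_cat C BB)" "sect BB (U f) = S f"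
proof -
  interpret B: internal_category C BB by (rule Psi_internal)
  have "partial_iso C (tgt' (Dom f) (Cod f) \<cdot> S f)"
    using P_partial_inverse[OF f] by (auto simp: partial_iso_def)
  then show "U f \<in> Mor (Phi_cat C BB)" "sect BB (U f) = S f"
    using B.phi_ArrI[of "Dom f" "Cod f" "S f", unfolded Psi_obj_simps] sec_psec[OF f] by simp_all
qed

text \<open>This is the defining equation of \<open>mul'\<close>, once the point of the pullback
  used there is recognised as the pairing in \<open>scomp\<close>.\<close>

lemma unit_cmp:
  assumes f [simp]: "f \<in> Mor A" and g [simp]: "g \<in> Mor A" and fg: "Cod f = Dom g"
  shows "U (g \<star> f) = U g \<cdot>\<^bsub>Phi_cat C BB\<^esub> U f"
proof -
  interpret B: internal_category C BB by (rule Psi_internal)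
  define i j k where "i = Dom f" and "j = Dom g" and "k = Cod g"
  have F: "f \<in> Mor A" "Dom f = i" "Cod f = j" and G: "g \<in> Mor A" "Dom g = j" "Cod g = k"
    using fg by (simp_all add: i_def j_def k_def)
  have ob: "i \<in> Ob A" "j \<in> Ob A" "k \<in> Ob A" by (simp_all add: i_def j_def k_def)
  note [simp] = F(2,3) G(2,3)
  define w where "w = pull_section C (src' j k) (tgt' i j) (S g) \<cdot> S f"
  note W = mul_section[OF F G, folded w_def]
  have t: "tgt' i j \<cdot> S f = fm P f" using tgt'_sec[OF f] by simp
  have r: "Rst C (S g \<cdot> fm P f) = Rst C (fm P g \<cdot> fm P f)" by simp
  have "w = pair C (src' j k) (tgt' i j) (S g \<cdot> tgt' i j \<cdot> S f) (S f \<cdot> Rst C (S g \<cdot> tgt' i j \<cdot> S f))"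
    unfolding t r by (rule pair_unique[OF mul_pb'[OF ob] W(1,3,4,5)])
  moreover have "mul' i j k \<cdot> w = S (g \<star> f)" using Psi_mul_props[OF ob] by (simp add: w_def Hom_def)
  ultimately have sc: "scomp C BB i j k (S g) (S f) = S (g \<star> f)"
    by (simp add: scomp_def gmul_def Psi_obj_simps)
  note M = unit_mor[OF f] unit_mor[OF g] and Mc = unit_mor[of "g \<star> f"]
  note c = B.phi_cmp[OF M(1,3)]
  show ?thesis
    by (rule B.sect_inj) (use c sc M Mc in simp_all)
qed

lemma unit_idt:
  assumes [simp]: "i \<in> Ob A" shows "U (Idt A i) = Idt (Phi_cat C BB) i"
proof -
  interpret B: internal_category C BB by (rule Psi_internal)
  show ?thesis
    by (rule B.sect_inj) (use unit_mor[of "Idt A i"] B.phi_idt[of i] in \<open>simp_all add: Psi_obj_simps\<close>)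
qed

text \<open>On the part \<open>e f\<close> of the base that \<open>s\<close> sends into the sheet of
  \<open>S f\<close> it equals \<open>S f\<close>, so \<open>s\<close> is locally the section of a
  map \<open>b f\<close> of \<open>A\<close>. These maps are compatible because their sections are
  restrictions of \<open>s\<close>, and their inverses because the \<open>fm P (b f)\<close> are
  restrictions of the one partial isomorphism \<open>tgt' i j \<cdot> s\<close>. Hence the join
  \<open>h\<close> exists; \<open>S h\<close> has the domain of \<open>s\<close> since
  \<open>P\<close> preserves joins of idempotents.\<close>

lemma unit_surj:
  assumes ij [simp]: "i \<in> Ob A" "j \<in> Ob A" and s: "partial_section C (src' i j) s"
    and ts: "partial_iso C (tgt' i j \<cdot> s)"
  shows "\<exists>h \<in> Hom A i j. S h = s"
proof -
  define X where "X = Dom (src' i j)"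
  have X [simp]: "Dom (src' i j) = X" by (simp add: X_def)
  note Sp = partial_sectionD[OF s src'_simps(1)[OF ij]]
  have s1 [simp]: "s \<in> Mor C" "Dom s = fo P i" "Cod s = X" using Sp by simp_all
  obtain d where "covering C (src' i j) (Hom A i j) S d" using sec_cover[OF ij] by (rule coverE)
  then interpret D: covering C "src' i j" "Hom A i j" S d .
  define e where "e f = Rst C (d f \<cdot> s)" for f
  have H: "f \<in> Mor A" "Dom f = i" "Cod f = j" if "f \<in> Hom A i j" for f using that by (auto simp: Hom_def)
  have D1 [simp]: "d f \<in> Mor C" "Dom (d f) = X" "Cod (d f) = X" if "f \<in> Hom A i j" for f
    using D.d_simps(1-3)[OF that] by simp_all
  have e1 [simp]: "e f \<in> Mor C" "Dom (e f) = fo P i" "Cod (e f) = fo P i" "Rst C (e f) = e f" "e f \<in> rst_idem C (fo P i)"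
    if "f \<in> Hom A i j" for f using that by (simp_all add: e_def)
  have ds: "d f \<cdot> s = s \<cdot> e f" if f: "f \<in> Hom A i j" for f
    unfolding e_def by (rule idem_slide[OF D.d_idem[OF f]]) simp_all
  have se: "Rst C s \<cdot> e f = e f" if f: "f \<in> Hom A i j" for f
  proof -
    have "e f = Rst C (s \<cdot> e f)" unfolding ds[OF f, symmetric] by (simp add: e_def)
    also have "... = Rst C s \<cdot> e f" by (rule rst_cmp_idem) (use f in simp_all)
    finally show ?thesis by simp
  qed
  have fe: "S f \<cdot> e f = s \<cdot> e f" if f: "f \<in> Hom A i j" for f
  proof -
    have "src' i j \<cdot> d f \<cdot> s = e f" unfolding ds[OF f] using Sp(5)[of "e f"] se[OF f] f by simp
    then have "S f \<cdot> e f = S f \<cdot> src' i j \<cdot> d f \<cdot> s" by simp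
    also have "... = d f \<cdot> s" using D.spd_assoc[OF f, of s] by simp
    finally show ?thesis unfolding ds[OF f] .
  qed
  have "\<forall>f \<in> Hom A i j. \<exists>u. A.idem i u \<and> fm P u = e f"
    using P_surj[OF e1(5) ij(1)] by metis
  then obtain u where u: "\<And>f. f \<in> Hom A i j \<Longrightarrow> A.idem i (u f)" "\<And>f. f \<in> Hom A i j \<Longrightarrow> fm P (u f) = e f"
    by metis
  have u1 [simp]: "u f \<in> Mor A" "Dom (u f) = i" "Cod (u f) = i" if "f \<in> Hom A i j" for f
    using A.idem_simps(1-3)[OF u(1)[OF that]] .
  define b where "b f = f \<star> u f" for f
  have b [simp]: "b f \<in> Mor A" "Dom (b f) = i" "Cod (b f) = j" if "f \<in> Hom A i j" for f
    using H[OF that] that by (simp_all add: b_def)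
  have Sb: "S (b f) = s \<cdot> e f" if f: "f \<in> Hom A i j" for f
    using sec_cmp_idem[of f "u f"] H[OF f] u[OF f] fe[OF f] by (simp add: b_def)
  have Pb: "Rst C (fm P (b f)) = e f" if f: "f \<in> Hom A i j" for f
    using sec_rst[of "b f"] rst_cmp_idem[of "e f" s] se[OF f] f by (simp add: Sb)
  define t where "t = tgt' i j \<cdot> s"
  obtain t' where t': "partial_inverse C t t'" using ts by (auto simp: t_def partial_iso_def)
  note T [simp] = partial_inverseD(1-5)[OF t']
  have t1 [simp]: "Dom t = fo P i" "Cod t = fo P j" by (simp_all add: t_def)
  define F where "F = b ` Hom A i j"
  have FA [simp]: "c \<in> Mor A" "Dom c = i" "Cod c = j" and FS: "S c = s \<cdot> Rst C (fm P c)" if "c \<in> F" for c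
    using that Sb Pb by (auto simp: F_def)
  have tP: "fm P c = t \<cdot> Rst C (fm P c)" if c: "c \<in> F" for c
    using tgt'_sec[of c] FS[OF c] c by (simp add: t_def)
  have comp: "c \<star> rs c' = c' \<star> rs c" if c: "c \<in> F" and c': "c' \<in> F" for c c'
  proof (rule sec_inj)
    show "c \<star> rs c' \<in> Hom A i j" "c' \<star> rs c \<in> Hom A i j" using c c' by (simp_all add: Hom_def)
    show "S (c \<star> rs c') = S (c' \<star> rs c)"
      using sec_rs[of c' c] sec_rs[of c c'] FS[OF c] FS[OF c'] rst_comm[of "fm P c" "fm P c'"] c c' by simp
  qed
  \<comment> \<open>\<open>P\<close> is injective on idempotents only, so from
    \<open>fm P z = fm P r\<close> just \<open>rs z = r\<close> is inferred; compatibility of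
    \<open>c\<close> and \<open>c'\<close> then turns \<open>z = z \<star> r\<close> into
    \<open>z = r\<close>.\<close>
  have inv: "cinv A c \<star> c' = rs c \<star> rs c'" if c: "c \<in> F" and c': "c' \<in> F" for c c'
  proof -
    note [simp] = FA[OF c] FA[OF c']
    define z where "z = cinv A c \<star> c'"
    define r where "r = rs c \<star> rs c'"
    have r: "A.idem i r" unfolding r_def by (rule A.idem_idem_cmp[OF rs_idem rs_idem]) simp_all
    have z [simp]: "z \<in> Mor A" "Dom z = i" "Cod z = i" by (simp_all add: z_def)
    have "partial_inverse C (t \<cdot> Rst C (fm P c)) (Rst C (fm P c) \<cdot> t')"
      by (rule partial_inverse_cmp[OF partial_inverse_idem t', of _ "fo P i"]) simp_all
    then have Pc: "fm P (cinv A c) = Rst C (fm P c) \<cdot> t'"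
      using P_partial_inverse[of c] tP[OF c] partial_inverse_unique by simp
    have "Rst C (fm P c') = Rst C (t \<cdot> Rst C (fm P c'))" using tP[OF c'] by simp
    also have "... = Rst C t \<cdot> Rst C (fm P c')" by (rule rst_cmp_rst') simp_all
    finally have rt: "Rst C t \<cdot> Rst C (fm P c') = Rst C (fm P c')" by simp
    have "fm P z = (Rst C (fm P c) \<cdot> t') \<cdot> t \<cdot> Rst C (fm P c')" using tP[OF c'] Pc by (simp add: z_def)
    also have "... = Rst C (fm P c) \<cdot> Rst C t \<cdot> Rst C (fm P c')"
      using cmp_rw[OF T(5), of "Rst C (fm P c')"] by simp
    also have "... = fm P r" unfolding rt by (simp add: r_def)
    finally have "fm P z = fm P r" .
    then have "fm P (rs z) = fm P r" using P_idem[OF r] by simp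
    then have "rs z = r" by (rule P_inj[OF rs_idem r, rotated -1]) simp_all
    then have "z = z \<star> r" using rs_simps(4)[OF z(1)] by simp
    also have "... = cinv A c \<star> (c' \<star> rs c) \<star> rs c'" by (simp add: z_def r_def)
    also have "... = rs c \<star> rs c'" unfolding comp[OF c' c] by (simp add: rs_def[of c])
    finally show ?thesis by (simp add: z_def)
  qed
  have inv2: "cinv A c \<star> c' \<star> cinv A c' = rs c \<star> cinv A c'" if c: "c \<in> F" and c': "c' \<in> F" for c c'
  proof -
    note [simp] = FA[OF c] FA[OF c']
    have "cinv A c \<star> c' \<star> cinv A c' = (rs c \<star> rs c') \<star> cinv A c'"
      using A.cmp_rw[OF inv[OF c c'], of "cinv A c'"] by simp
    also have "... = rs c \<star> cinv A c'" by (simp add: rs_def[of c'])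
    finally show ?thesis .
  qed
  have bic: "bicompat A c c'" if c: "c \<in> F" and c': "c' \<in> F" for c c'
  proof -
    note [simp] = FA[OF c] FA[OF c']
    have cr: "cinv A (rs x) = rs x" if "x \<in> Mor A" for x by (rule A.cinv_idem[OF rs_idem]) (use that in simp_all)
    have "rs c \<star> cinv A c' = cinv A (c' \<star> rs c)" using A.cinv_cmp[of "rs c" c'] cr[of c] by simp
    also have "... = rs c' \<star> cinv A c" unfolding comp[OF c' c] using A.cinv_cmp[of "rs c'" c] cr[of c'] by simp
    finally have "cinv A c \<star> c' \<star> cinv A c' = cinv A c' \<star> c \<star> cinv A c"
      unfolding inv2[OF c c'] inv2[OF c' c] .
    then show ?thesis
      using comp[OF c c'] by (simp add: bicompat_def R.compat_iff rs_def)
  qed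
  have "F \<subseteq> Hom A i j" using FA by (auto simp: Hom_def)
  then obtain h where h: "is_join (inv_rcat A) i j F h" using A.join_exists[OF ij _ bic] by blast
  have h1 [simp]: "h \<in> Mor A" "Dom h = i" "Cod h = j" using R.is_joinD(2-4)[OF h] by simp_all
  have hS: "S h \<cdot> e f = s \<cdot> e f" if f: "f \<in> Hom A i j" for f
  proof -
    have bF: "b f \<in> F" using f by (simp add: F_def)
    have "h \<star> rs (b f) = b f" using R.rleD(5)[OF R.is_joinD(5)[OF h bF]] by (simp add: rs_def)
    then have "S (b f) = S h \<cdot> Rst C (fm P (b f))" using sec_rs[of "b f" h] f by simp
    then show ?thesis using Sb[OF f] Pb[OF f] by simp
  qed
  have Rh: "Rst (inv_rcat A) = rs" by (rule ext) (simp add: rs_def)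
  have "is_join (inv_rcat A) i i (rs ` F) (rs h)" using R.join_rst[OF h] unfolding Rh .
  then have "is_join C (fo P i) (fo P i) (fm P ` rs ` F) (fm P (rs h))"
    by (rule P_join) (use FA rs_idem in blast)
  moreover have "fm P ` rs ` F = e ` Hom A i j"
    unfolding F_def image_image by (rule image_cong) (use Pb in simp_all)
  ultimately have j1: "is_join C (fo P i) (fo P i) (e ` Hom A i j) (Rst C (fm P h))" by simp
  have "is_join C (fo P i) X ((\<lambda>f. f \<cdot> s) ` d ` Hom A i j) (Idt C X \<cdot> s)"
    using is_join_precomp[OF D.join_d, of s "fo P i"] by (simp add: Hom_def)
  then have j2: "is_join C (fo P i) X ((\<lambda>f. d f \<cdot> s) ` Hom A i j) s" by (simp add: image_image)
  have "is_join C (fo P i) (fo P i) (e ` Hom A i j) (Rst C s)"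
    using join_rst[OF j2] by (simp add: image_image e_def)
  with j1 have R: "Rst C (fm P h) = Rst C s" by (rule join_unique)
  have "S h \<cdot> Rst C s = s \<cdot> Rst C s"
  proof (rule join_eq_rst[OF j2, of _ X])
    show "S h \<in> Hom C (fo P i) X" "s \<in> Hom C (fo P i) X" using sec_simps(1-3)[of h] by (simp_all add: Hom_def)
    fix k assume "k \<in> (\<lambda>f. d f \<cdot> s) ` Hom A i j"
    then obtain f where f: "f \<in> Hom A i j" "k = d f \<cdot> s" by blast
    show "S h \<cdot> Rst C k = s \<cdot> Rst C k" using hS[OF f(1)] unfolding f(2) e_def .
  qed
  moreover have "S h \<cdot> Rst C s = S h" using sec_cmp_rst[OF h1(1)] R by simp
  ultimately have "S h = s" by simp
  moreover have "h \<in> Hom A i j" by (simp add: Hom_def)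
  ultimately show ?thesis by blast
qed

lemma unit_bij: "bij_betw (\<lambda>f. U f) (Mor A) (Mor (Phi_cat C BB))"
  unfolding bij_betw_def
proof
  interpret B: internal_category C BB by (rule Psi_internal)
  show "inj_on (\<lambda>f. U f) (Mor A)"
  proof (rule inj_onI)
    fix f g assume fg: "f \<in> Mor A" "g \<in> Mor A" "U f = U g"
    then have "S f = S g" using unit_mor(2)[OF fg(1)] unit_mor(2)[OF fg(2)] by metis
    then show "f = g" using sec_inj[of f "Dom f" "Cod f" g] fg by (simp add: Hom_def)
  qed
  show "(\<lambda>f. U f) ` Mor A = Mor (Phi_cat C BB)"
  proof (intro equalityI subsetI)
    fix a assume a: "a \<in> Mor (Phi_cat C BB)"
    note D = B.phi_morD[OF a, unfolded Psi_obj_simps]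
    obtain h where h: "h \<in> Hom A (Dom a) (Cod a)" "S h = sect BB a"
      using unit_surj[OF D(1-4)] by blast
    then have h': "h \<in> Mor A" "Dom h = Dom a" "Cod h = Cod a" by (auto simp: Hom_def)
    have "U h = a"
      by (rule B.sect_inj) (use h' h(2) unit_mor(2)[of h] in simp_all)
    then show "a \<in> (\<lambda>f. U f) ` Mor A" using h'(1) by blast
  qed (use unit_mor(1) in blast)
qed

lemma unit_over_hom:
  "over_hom C (A, P) (Phi_obj C BB)
    (\<lparr>fo = (\<lambda>i \<in> Ob A. i), fm = (\<lambda>f \<in> Mor A. U f)\<rparr>, \<lambda>i \<in> Ob A. Idt C (fo P i))"
  (is "over_hom C _ _ (?F, _)")
  unfolding Phi_obj_def
proof (rule over_homI)
  interpret B: internal_category C BB by (rule Psi_internal)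
  show "is_functor A (Phi_cat C BB) ?F"
    unfolding is_functor_def
  proof (intro conjI ballI impI)
    fix f g assume f: "f \<in> Mor A" and g: "g \<in> Mor A" and fg: "Cod f = Dom g"
    have gf: "g \<star> f \<in> Mor A" using f g fg by simp
    show "fm ?F (g \<star> f) =
      fm ?F g \<cdot>\<^bsub>Phi_cat C BB\<^esub>
      fm ?F f"
      using unit_cmp[OF f g fg] f g gf by (simp only: fnct.simps restrict_apply')
  next
    fix i assume i: "i \<in> Ob A"
    show "fm ?F (Idt A i) =
      Idt (Phi_cat C BB) (fo ?F i)"
      using unit_idt[OF i] i A.idt_simps(1)[OF i] by (simp only: fnct.simps restrict_apply')
  next
    fix f assume f: "f \<in> Mor A"
    show "fm ?F f \<in> Hom (Phi_cat C BB)
      (fo ?F (Dom f))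
      (fo ?F (Cod f))"
      using unit_mor(1)[OF f] f by (simp add: Hom_def)
  qed (simp add: Psi_obj_simps)
  show "fm P f \<cdot> (\<lambda>i \<in> Ob A. Idt C (fo P i)) (Dom f) = (\<lambda>i \<in> Ob A. Idt C (fo P i)) (Cod f) \<cdot>
      fm (Phi_proj C BB) (fm ?F f)"
    if f: "f \<in> Mor A" for f
    using unit_mor(2)[OF f] f by (simp add: Phi_proj_def Psi_obj_simps)
qed (simp_all add: Phi_proj_def Psi_obj_simps)

end

text \<open>With the identity on objects and identities as components, naturality says that
  \<open>fm P\<close> and \<open>fm Q\<close> correspond under \<open>fm F\<close>; so the inverse
  bijection on maps is again a map over \<open>C\<close>.\<close>

lemma (in restriction_category) over_isoI:
  fixes A B :: "('i, 'm) cat" and P Q :: "('i, 'm, 'o, 'm) fnct" and F :: "('i, 'm, 'i, 'm) fnct"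
  assumes X: "over_object \<kappa> C (A, P)" and Y: "over_object \<kappa> C (B, Q)" and H: "over_hom C (A, P) (B, Q) (F, \<alpha>)"
    and ob: "Ob B = Ob A" "\<And>i. i \<in> Ob A \<Longrightarrow> fo F i = i" "\<And>i. i \<in> Ob A \<Longrightarrow> fo Q i = fo P i"
    and \<alpha>: "\<And>i. i \<in> Ob A \<Longrightarrow> \<alpha> i = Idt C (fo P i)" and bij: "bij_betw (fm F) (Mor A) (Mor B)"
  shows "iso (jiCat_over \<kappa> C) (Arr (A, P) (F, \<alpha>) (B, Q))"
proof -
  interpret A: category A using over_objectD(2)[OF X] .
  interpret B: category B using over_objectD(2)[OF Y] .
  note Fd = functorD[OF over_homD(1)[OF H]] and Pd = functorD[OF over_objectD(3)[OF X]] and Qd = functorD[OF over_objectD(3)[OF Y]]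
  define g where "g = inv_into (Mor A) (fm F)"
  define G where "G = \<lparr>fo = (\<lambda>i \<in> Ob B. i), fm = (\<lambda>s \<in> Mor B. g s)\<rparr>"
  have g1: "g s \<in> Mor A" and g2: "fm F (g s) = s" if "s \<in> Mor B" for s
    using that bij by (auto simp: g_def bij_betw_def inv_into_into f_inv_into_f)
  have g3: "g (fm F s) = s" if "s \<in> Mor A" for s
    using that bij by (auto simp: g_def bij_betw_def)
  have g4: "Dom (g s) = Dom s" "Cod (g s) = Cod s" if "s \<in> Mor B" for s
    using Fd(3,4)[OF g1[OF that]] g2[OF that] ob(2)[OF A.dom_ob[OF g1[OF that]]] ob(2)[OF A.cod_ob[OF g1[OF that]]] by simp_all
  have G: "is_functor B A G"
    unfolding is_functor_def
  proof (intro conjI ballI impI)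
    show "fo G i \<in> Ob A" if "i \<in> Ob B" for i using that ob(1) by (simp add: G_def)
    show "fm G s \<in> Hom A (fo G (Dom s)) (fo G (Cod s))" if "s \<in> Mor B" for s
      using that g1[OF that] g4[OF that] by (simp add: G_def Hom_def)
    show "fm G (Idt B i) = Idt A (fo G i)" if i: "i \<in> Ob B" for i
      using g3[of "Idt A i"] Fd(5)[of i] i ob(1) ob(2)[of i] by (simp add: G_def)
    show "fm G (t \<cdot>\<^bsub>B\<^esub> s) = fm G t \<cdot>\<^bsub>A\<^esub> fm G s" if s: "s \<in> Mor B" and t: "t \<in> Mor B" and st: "Cod s = Dom t" for s t
      using g3[of "g t \<cdot>\<^bsub>A\<^esub> g s"] Fd(6)[of "g s" "g t"] g1[OF s] g1[OF t] g2[OF s] g2[OF t] g4[OF s] g4[OF t] s t st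
      by (simp add: G_def)
  qed
  have nat: "fm Q s = fm P (g s)" if s: "s \<in> Mor B" for s
    using over_homD(9)[OF H g1[OF s]] \<alpha>[of "Dom s"] \<alpha>[of "Cod s"] g2[OF s] g4[OF s] A.dom_ob[OF g1[OF s]] A.cod_ob[OF g1[OF s]]
      Pd(2-4)[OF g1[OF s]] Qd(2-4)[OF s] ob(3) by simp
  have K: "over_hom C (B, Q) (A, P) (G, \<alpha>)"
  proof (rule over_homI[OF G])
    show "\<alpha> \<in> extensional (Ob B)" using over_homD(4)[OF H] ob(1) by simp
    show "\<alpha> i \<in> Mor C \<and> Dom (\<alpha> i) = fo P (fo G i) \<and> Cod (\<alpha> i) = fo Q i \<and> Rst C (\<alpha> i) = Idt C (fo P (fo G i))"
      if "i \<in> Ob B" for i using that ob(1,3) \<alpha> Pd(1)[of i] by (simp add: G_def)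
    show "fm Q s \<cdot> \<alpha> (Dom s) = \<alpha> (Cod s) \<cdot> fm P (fm G s)" if s: "s \<in> Mor B" for s
      using nat[OF s] \<alpha>[of "Dom s"] \<alpha>[of "Cod s"] Pd(2-4)[OF g1[OF s]] g4[OF s] A.dom_ob[OF g1[OF s]] A.cod_ob[OF g1[OF s]] s
      by (simp add: G_def)
  qed (simp_all add: G_def)
  have e1: "over_comp C (A, P) (G, \<alpha>) (F, \<alpha>) = over_id C (A, P)"
    unfolding over_comp_def over_id_def
    using g3 \<alpha> ob Fd(2) Pd(1) by (auto simp: G_def intro!: restrict_ext)
  have e2: "over_comp C (B, Q) (F, \<alpha>) (G, \<alpha>) = over_id C (B, Q)"
    unfolding over_comp_def over_id_def
    using g2 \<alpha> ob Pd(1) by (auto simp: G_def intro!: restrict_ext)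
  show ?thesis
    unfolding iso_def
    by (intro conjI bexI[of _ "Arr (B, Q) (G, \<alpha>) (A, P)"]) (use X Y H K e1 e2 in \<open>simp_all add: Hom_def\<close>)
qed

lemma (in join_restriction_category) etale_groupoid_Psi:
  assumes "over_object \<kappa> C X" "has_local_glueings \<kappa> C"
  shows "etale_groupoid \<kappa> C (Psi_obj C X)"
proof -
  obtain A P where X: "X = (A, P)" by (cases X)
  interpret over_category C \<kappa> A P by unfold_locales (use assms X in simp_all)
  show ?thesis using Psi_groupoid X by simp
qed

lemma (in join_restriction_category) Phi_over_object:
  assumes "etale_groupoid \<kappa> C AA" "locally_small \<kappa> C"
  shows "over_object \<kappa> C (Phi_obj C AA)"
proof -
  obtain \<iota> where "internal_groupoid C AA \<iota>" using etale_groupoid_internal[OF assms(1) join_restriction_category_axioms] .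
  then interpret internal_groupoid C AA \<iota> .
  show ?thesis using phi_over_object[OF _ assms(2)] assms(1) by (simp add: etale_groupoid_def)
qed

lemma (in join_restriction_category) Psi_unit_iso:
  fixes X :: "('i, 'o, 'm) over_obj"
  assumes X0: "over_object \<kappa> C X" and gl: "has_local_glueings \<kappa> C" and ls: "locally_small \<kappa> C"
  shows "Psi_unit C X \<in> Hom (jiCat_over \<kappa> C) X (Phi_obj C (Psi_obj C X)) \<and> iso (jiCat_over \<kappa> C) (Psi_unit C X)"
proof -
  obtain A P where X: "X = (A, P)" by (cases X)
  interpret over_category C \<kappa> A P by unfold_locales (use X0 gl X in simp_all)
  interpret B: internal_category C "Psi_obj C (A, P)" by (rule Psi_internal)
  have Y: "over_object \<kappa> C (Phi_obj C (Psi_obj C (A, P)))" by (rule Phi_over_object[OF Psi_groupoid ls])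
  let ?F = "\<lparr>fo = (\<lambda>i \<in> Ob A. i), fm = (\<lambda>f \<in> Mor A. U f)\<rparr>"
  have u: "Psi_unit C X = Arr (A, P) (?F, \<lambda>i \<in> Ob A. Idt C (fo P i)) (Phi_obj C (Psi_obj C (A, P)))"
    by (simp add: X Psi_unit_def)
  have "iso (jiCat_over \<kappa> C) (Psi_unit C X)"
    unfolding u Phi_obj_def
  proof (rule over_isoI[OF over Y[unfolded Phi_obj_def] unit_over_hom[unfolded Phi_obj_def]])
    have "bij_betw (fm ?F) (Mor A) (Mor (Phi_cat C (Psi_obj C (A, P)))) \<longleftrightarrow>
        bij_betw (\<lambda>f. U f) (Mor A) (Mor (Phi_cat C (Psi_obj C (A, P))))"
      by (rule bij_betw_cong) simp
    then show "bij_betw (fm ?F) (Mor A) (Mor (Phi_cat C (Psi_obj C (A, P))))" using unit_bij by blast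
  qed (simp_all add: Phi_proj_def Psi_obj_simps)
  moreover have "Psi_unit C X \<in> Hom (jiCat_over \<kappa> C) X (Phi_obj C (Psi_obj C X))"
    unfolding u using over Y unit_over_hom by (simp add: Hom_def X)
  ultimately show ?thesis by blast
qed

text \<open>On maps \<open>Psi\<close> is a definite description. \<open>transport_unique\<close>
  shows that it is satisfied, and naturality of the unit, which it expresses, is all that
  \<open>adjoint_equivalenceI\<close> asks of the map part.\<close>

theorem (in join_restriction_category) Phi_Psi_equivalence:
  assumes ls: "locally_small \<kappa> C" and gl: "has_local_glueings \<kappa> C"
  shows "adjoint_equivalence (peGpd \<kappa> C :: (('i, 'o, 'm) pcat, ('i, 'o, 'm) cofunctor) cat)
    (jiCat_over \<kappa> C) (Phi_g C) (Psi \<kappa> C) (Psi_unit C)"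
proof -
  let ?X = "peGpd \<kappa> C :: (('i, 'o, 'm) pcat, ('i, 'o, 'm) cofunctor) cat"
  let ?Y = "jiCat_over \<kappa> C :: (('i, 'o, 'm) over_obj, ('i, 'o, 'm) over_map) cat"
  note X = peGpd_category[where 'i = 'i and \<kappa> = \<kappa>] and Y = jiCat_category[where 'i = 'i and \<kappa> = \<kappa>]
  note F = Phi_g_functor[OF ls, where 'i = 'i] and ff = Phi_g_fully_faithful[OF ls, where 'i = 'i]
  have G: "fo (Psi \<kappa> C) B \<in> Ob ?X" if "B \<in> Ob ?Y" for B :: "('i, 'o, 'm) over_obj"
    using etale_groupoid_Psi[OF _ gl] that by (simp add: Psi_def)
  have \<eta>: "Psi_unit C B \<in> Hom ?Y B (fo (Phi_g C) (fo (Psi \<kappa> C) B)) \<and> iso ?Y (Psi_unit C B)"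
    if "B \<in> Ob ?Y" for B :: "('i, 'o, 'm) over_obj"
    using Psi_unit_iso[OF _ gl ls] that by (simp add: Psi_def Phi_g_def)
  show ?thesis
  proof (rule adjoint_equivalenceI[OF X Y F ff G \<eta>])
    fix h assume h: "h \<in> Mor ?Y"
    interpret Y: category ?Y by (rule Y)
    have D: "Dom h \<in> Ob ?Y" "Cod h \<in> Ob ?Y" using Y.dom_ob[OF h] Y.cod_ob[OF h] .
    have "h \<in> Hom ?Y (Dom h) (Cod h)" using h by (simp add: Hom_def)
    then have "\<exists>!g. g \<in> Hom ?X (fo (Psi \<kappa> C) (Dom h)) (fo (Psi \<kappa> C) (Cod h)) \<and>
        fm (Phi_g C) g \<cdot>\<^bsub>?Y\<^esub> Psi_unit C (Dom h) = Psi_unit C (Cod h) \<cdot>\<^bsub>?Y\<^esub> h"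
      using \<eta>[OF D(1)] \<eta>[OF D(2)] by (intro transport_unique[OF X Y F ff G[OF D(1)] G[OF D(2)]]) blast+
    from theI'[OF this] show "fm (Psi \<kappa> C) h \<in> Hom ?X (fo (Psi \<kappa> C) (Dom h)) (fo (Psi \<kappa> C) (Cod h)) \<and>
        fm (Phi_g C) (fm (Psi \<kappa> C) h) \<cdot>\<^bsub>?Y\<^esub> Psi_unit C (Dom h) = Psi_unit C (Cod h) \<cdot>\<^bsub>?Y\<^esub> h"
      by (simp add: Psi_def Psi_map_def)
  qed
qed

section \<open>One-object restrictions\<close>

lemma eGpd_full:
  assumes "category (peGpd \<kappa> D :: (('i, 'p, 'n) pcat, ('i, 'p, 'n) cofunctor) cat)"
  shows "full_subcategory (eGpd \<kappa> D :: (('i, 'p, 'n) pcat, ('i, 'p, 'n) cofunctor) cat) (peGpd \<kappa> D)"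
  using category.dom_cod_ob[OF assms] by (auto simp: full_subcategory_def eGpd_def)

context restriction_category
begin

text \<open>The partial inverse \<open>e'\<close> gives
  \<open>Rst C e = e' \<cdot> e \<cdot> e = Rst C e \<cdot> e\<close>, and by sliding this is
  \<open>e \<cdot> Rst C (e \<cdot> e) = e\<close>.\<close>

lemma partial_iso_idempotent:
  assumes e: "partial_iso C e" "Dom e = X" "Cod e = X" "e \<cdot> e = e"
  shows "e \<in> rst_idem C X"
proof -
  obtain e' where e': "partial_inverse C e e'" using e(1) by (auto simp: partial_iso_def)
  note E = partial_inverseD(1-5)[OF e']
  have "Rst C e = e' \<cdot> e \<cdot> e" using E e by simp
  also have "... = (e' \<cdot> e) \<cdot> e" by (rule assoc[symmetric]) (use E e in simp_all)
  also have "... = e \<cdot> Rst C (e \<cdot> e)" unfolding E(5) by (rule rst_slide) (use E e in simp_all)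
  also have "... = e" using E e by simp
  finally show ?thesis using E e by (intro rst_idemI) simp_all
qed

lemma piso_idem:
  "{e \<in> piso_monoid C X. e \<cdot> e = e} = rst_idem C X"
proof (intro equalityI subsetI)
  fix e assume "e \<in> {e \<in> piso_monoid C X. e \<cdot> e = e}"
  then show "e \<in> rst_idem C X" using partial_iso_idempotent[of e X] by (simp add: piso_monoid_def Hom_def)
next
  fix e assume "e \<in> rst_idem C X"
  then show "e \<in> {e \<in> piso_monoid C X. e \<cdot> e = e}"
    using partial_iso_idem[of e X] rst_idem_simps[of e X] by (simp add: piso_monoid_def Hom_def)
qed

text \<open>Forwards, preservation of restrictions has to be derived from the homomorphism property.
  Backwards, \<open>fm \<theta> (cinv A s)\<close> is a partial inverse of
  \<open>fm \<theta> s\<close>, and the two descriptions of the idempotents are matched by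
  \<open>piso_idem\<close>.\<close>

lemma complete_pseudogroup_over_object:
  assumes \<kappa>: "Cinfinite \<kappa>"
  shows "complete_pseudogroup \<kappa> C (A, \<theta>) \<longleftrightarrow> over_object \<kappa> C (A, \<theta>) \<and> is_singleton (Ob A)"
proof
  assume "complete_pseudogroup \<kappa> C (A, \<theta>)"
  then obtain i where i: "Ob A = {i}" "join_inverse_category A" "small \<kappa> (Mor A)" "fo \<theta> i \<in> Ob C"
    "\<And>s. s \<in> Mor A \<Longrightarrow> fm \<theta> s \<in> piso_monoid C (fo \<theta> i)" "fm \<theta> (Idt A i) = Idt C (fo \<theta> i)"
    "\<And>s t. s \<in> Mor A \<Longrightarrow> t \<in> Mor A \<Longrightarrow> fm \<theta> (s \<cdot>\<^bsub>A\<^esub> t) = fm \<theta> s \<cdot> fm \<theta> t"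
    "bij_betw (fm \<theta>) {e \<in> Mor A. e \<cdot>\<^bsub>A\<^esub> e = e} {e \<in> piso_monoid C (fo \<theta> i). e \<cdot> e = e}"
    by (auto simp: complete_pseudogroup_def)
  interpret A: join_inverse_category A by (rule i(2))
  have DC: "Dom s = i" "Cod s = i" if "s \<in> Mor A" for s using A.dom_ob[OF that] A.cod_ob[OF that] i(1) by simp_all
  have \<theta>: "fm \<theta> s \<in> Mor C" "Dom (fm \<theta> s) = fo \<theta> i" "Cod (fm \<theta> s) = fo \<theta> i" "partial_iso C (fm \<theta> s)" if "s \<in> Mor A" for s
    using i(5)[OF that] by (auto simp: piso_monoid_def Hom_def)
  \<comment> \<open>A single object forms a small set because \<open>\<kappa>\<close> is
    infinite.\<close>
  have "small \<kappa> (Ob A)"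
    unfolding small_def i(1) by (rule Cfinite_ordLess_Cinfinite) (use \<kappa> in \<open>simp_all add: cfinite_def Field_card_of card_of_card_order_on\<close>)
  moreover have "locally_small \<kappa> A"
    unfolding locally_small_def small_def
  proof (intro ballI)
    fix a b
    have "Hom A a b \<subseteq> Mor A" by (auto simp: Hom_def)
    then show "(card_of (Hom A a b), \<kappa>) \<in> ordLess"
      using i(3)[unfolded small_def] card_of_mono1 ordLeq_ordLess_trans by blast
  qed
  moreover have F: "is_functor A C \<theta>"
    unfolding is_functor_def using i(1,4,6,7) \<theta> DC by (simp add: Hom_def)
  moreover have "fm \<theta> (Rst (inv_rcat A) s) = Rst C (fm \<theta> s)" if s: "s \<in> Mor A" for s
  proof -
    define x y where "x = fm \<theta> s" and "y = fm \<theta> (cinv A s)"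
    \<comment> \<open>\<open>e\<close> is an idempotent partial isomorphism, hence a restriction
      idempotent. The equation \<open>x \<cdot> e = x\<close> puts the domain of \<open>x\<close>
      below \<open>e\<close>, and \<open>e = y \<cdot> x\<close> puts \<open>e\<close> below the
      domain of \<open>x\<close>.\<close>
    define e where "e = y \<cdot> x"
    have s': "cinv A s \<in> Mor A" using s by simp
    note X [simp] = \<theta>(1-3)[OF s, folded x_def] and Y [simp] = \<theta>(1-3)[OF s', folded y_def]
    have m: "cinv A s \<cdot>\<^bsub>A\<^esub> s \<in> Mor A" using s by simp
    have "fm \<theta> (s \<cdot>\<^bsub>A\<^esub> cinv A s \<cdot>\<^bsub>A\<^esub> s) = x \<cdot> y \<cdot> x" unfolding i(7)[OF s m] i(7)[OF s' s] x_def y_def ..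
    then have xe: "x \<cdot> e = x" unfolding A.cinv_simps(4)[OF s] by (simp add: x_def e_def)
    have e: "e \<in> rst_idem C (fo \<theta> i)"
    proof (rule partial_iso_idempotent)
      show "partial_iso C e" unfolding e_def
        by (rule partial_iso_cmp[OF \<theta>(4)[OF s, folded x_def] \<theta>(4)[OF s', folded y_def]]) simp
      show "e \<cdot> e = e" using xe by (simp add: e_def)
    qed (simp_all add: e_def)
    have "Rst C x = Rst C x \<cdot> e" using rst_cmp_idem[of e x] xe rst_idem_simps(1,2,4)[OF e] by simp
    also have "... = e \<cdot> Rst C x" by (rule idem_comm[OF _ e]) simp
    also have "... = e"
      using rst_absorb(1)[of x y] rst_idem_simps(4)[OF e] by (simp add: e_def)
    finally show ?thesis using i(7)[OF s' s] by (simp add: x_def y_def e_def)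
  qed
  moreover have "hyperconnected (inv_rcat A) C \<theta>"
  proof -
    have "rst_idem (inv_rcat A) i = {e \<in> Mor A. e \<cdot>\<^bsub>A\<^esub> e = e}"
      using A.rst_idem_inv DC by (auto simp: A.idem_def)
    then show ?thesis using i(1,8) piso_idem by (simp add: hyperconnected_def)
  qed
  moreover have "is_functor (inv_rcat A) C \<theta>" using F by (simp add: is_functor_def)
  ultimately show "over_object \<kappa> C (A, \<theta>) \<and> is_singleton (Ob A)"
    using i(1,2) by (simp add: over_object_def restriction_functor_def del: inv_rcat_simps) (simp add: is_singleton_def)
next
  assume "over_object \<kappa> C (A, \<theta>) \<and> is_singleton (Ob A)"
  then obtain i where X: "over_object \<kappa> C (A, \<theta>)" and i: "Ob A = {i}" by (auto simp: is_singleton_def)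
  interpret A: join_inverse_category A by (rule over_objectD(1)[OF X])
  have DC: "Dom s = i" "Cod s = i" if "s \<in> Mor A" for s using A.dom_ob[OF that] A.cod_ob[OF that] i by simp_all
  note F = functorD[OF over_objectD(3)[OF X]]
  have rst: "fm \<theta> (cinv A s) \<cdot> fm \<theta> s = Rst C (fm \<theta> s)" if s: "s \<in> Mor A" for s
    using over_objectD(6)[OF X] F(6)[of s "cinv A s"] s by (simp add: restriction_functor_def)
  have "fm \<theta> s \<in> piso_monoid C (fo \<theta> i)" if s: "s \<in> Mor A" for s
  proof -
    have "partial_inverse C (fm \<theta> s) (fm \<theta> (cinv A s))"
      by (rule partial_inverseI) (use F(2-4)[OF s] F(2-4)[of "cinv A s"] rst[OF s] rst[of "cinv A s"] s in simp_all)
    then show ?thesis using F(2-4)[OF s] DC[OF s] by (auto simp: piso_monoid_def Hom_def partial_iso_def)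
  qed
  moreover have "Hom A i i = Mor A" using DC by (auto simp: Hom_def)
  then have "small \<kappa> (Mor A)" using over_objectD(5)[OF X] i by (simp add: locally_small_def)
  moreover have "fm \<theta> (s \<cdot>\<^bsub>A\<^esub> t) = fm \<theta> s \<cdot> fm \<theta> t" if "s \<in> Mor A" "t \<in> Mor A" for s t
    using F(6)[OF that(2,1)] DC that by simp
  moreover have "rst_idem (inv_rcat A) i = {e \<in> Mor A. e \<cdot>\<^bsub>A\<^esub> e = e}"
    using A.rst_idem_inv DC by (auto simp: A.idem_def)
  then have "bij_betw (fm \<theta>) {e \<in> Mor A. e \<cdot>\<^bsub>A\<^esub> e = e} {e \<in> piso_monoid C (fo \<theta> i). e \<cdot> e = e}"
    using over_objectD(7)[OF X] i piso_idem by (simp add: hyperconnected_def)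
  ultimately show "complete_pseudogroup \<kappa> C (A, \<theta>)"
    unfolding complete_pseudogroup_def using i over_objectD(1)[OF X] F(1,5)[of i] by auto
qed

text \<open>With one object on each side all maps are composable and \<open>\<alpha> i\<close> is
  the only component, so the two lists of conditions coincide, extensionality included.\<close>

lemma pseudogroup_hom_over_hom:
  assumes X: "over_object \<kappa> C (A, P)" "is_singleton (Ob A)" and Y: "over_object \<kappa> C (B, Q)" "is_singleton (Ob B)"
  shows "pseudogroup_hom C (A, P) (B, Q) (F, \<alpha>) \<longleftrightarrow> over_hom C (A, P) (B, Q) (F, \<alpha>)"
proof -
  obtain i j where i: "Ob A = {i}" and j: "Ob B = {j}" using X(2) Y(2) by (auto simp: is_singleton_def)
  interpret A: category A by (rule over_objectD(2)[OF X(1)])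
  interpret B: category B by (rule over_objectD(2)[OF Y(1)])
  have DA: "Dom s = i" "Cod s = i" if "s \<in> Mor A" for s using A.dom_ob[OF that] A.cod_ob[OF that] i by simp_all
  have DB: "Dom s = j" "Cod s = j" if "s \<in> Mor B" for s using B.dom_ob[OF that] B.cod_ob[OF that] j by simp_all
  show ?thesis
  proof
    assume "pseudogroup_hom C (A, P) (B, Q) (F, \<alpha>)"
    then have F: "fo F = (\<lambda>x \<in> {i}. j)" "fm F \<in> Mor A \<rightarrow>\<^sub>E Mor B" "fm F (Idt A i) = Idt B j"
      "\<And>s t. s \<in> Mor A \<Longrightarrow> t \<in> Mor A \<Longrightarrow> fm F (s \<cdot>\<^bsub>A\<^esub> t) = fm F s \<cdot>\<^bsub>B\<^esub> fm F t"
      "\<alpha> \<in> extensional {i}" "\<alpha> i \<in> Hom C (fo Q j) (fo P i)" "total_map C (\<alpha> i)"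
      "\<And>s. s \<in> Mor A \<Longrightarrow> fm P s \<cdot> \<alpha> i = \<alpha> i \<cdot> fm Q (fm F s)"
      using i j by (auto simp: pseudogroup_hom_def)
    have Fm: "fm F s \<in> Mor B" if "s \<in> Mor A" for s using F(2) that by blast
    have "is_functor A B F"
      unfolding is_functor_def using F(1,3,4) Fm DA DB[OF Fm] i j by (simp add: Hom_def)
    then show "over_hom C (A, P) (B, Q) (F, \<alpha>)"
      unfolding over_hom_def using F(1,2,5-8) DA i by (simp add: PiE_def)
  next
    assume H: "over_hom C (A, P) (B, Q) (F, \<alpha>)"
    note Hd = over_homD[OF H] and Fd = functorD[OF over_homD(1)[OF H]]
    have fi: "fo F i = j" using Fd(1)[of i] i j by simp
    have f: "fo F = (\<lambda>x \<in> {i}. j)"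
      using Hd(2) fi i by (intro extensionalityI[of _ "{i}"]) simp_all
    have "fm F \<in> Mor A \<rightarrow>\<^sub>E Mor B" using Hd(3) Fd(2) by (auto simp: PiE_def)
    moreover have "fm F (s \<cdot>\<^bsub>A\<^esub> t) = fm F s \<cdot>\<^bsub>B\<^esub> fm F t" if "s \<in> Mor A" "t \<in> Mor A" for s t
      using Fd(6)[OF that(2,1)] DA that by simp
    moreover have "fm P s \<cdot> \<alpha> i = \<alpha> i \<cdot> fm Q (fm F s)" if "s \<in> Mor A" for s using Hd(9)[OF that] DA[OF that] by simp
    ultimately show "pseudogroup_hom C (A, P) (B, Q) (F, \<alpha>)"
      unfolding pseudogroup_hom_def using i j f fi Hd(4) Hd(5-8)[of i] Fd(5)[of i] by (auto simp: Hom_def total_iff)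
  qed
qed

lemma PsGrp_full:
  assumes \<kappa>: "Cinfinite \<kappa>"
  shows "full_subcategory (PsGrp \<kappa> C :: (('i, 'o, 'm) over_obj, ('i, 'o, 'm) over_map) cat) (jiCat_over \<kappa> C)"
proof -
  have c: "complete_pseudogroup \<kappa> C X \<longleftrightarrow> over_object \<kappa> C X \<and> is_singleton (Ob (fst X))" for X :: "('i, 'o, 'm) over_obj"
    using complete_pseudogroup_over_object[OF \<kappa>] by (cases X) simp
  have p: "pseudogroup_hom C X Y f \<longleftrightarrow> over_hom C X Y f"
    if "complete_pseudogroup \<kappa> C X" "complete_pseudogroup \<kappa> C Y" for X Y :: "('i, 'o, 'm) over_obj" and f
    using pseudogroup_hom_over_hom[of \<kappa> "fst X" "snd X" "fst Y" "snd Y" "fst f" "snd f"] that unfolding c by simp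
  have "Mor (PsGrp \<kappa> C) = {f \<in> Mor (jiCat_over \<kappa> C :: (('i, 'o, 'm) over_obj, ('i, 'o, 'm) over_map) cat).
      Dom f \<in> Ob (PsGrp \<kappa> C) \<and> Cod f \<in> Ob (PsGrp \<kappa> C)}"
  proof (rule set_eqI)
    fix a :: "(('i, 'o, 'm) over_obj, ('i, 'o, 'm) over_map) arr"
    obtain X f Y where a: "a = Arr X f Y" by (cases a)
    show "a \<in> Mor (PsGrp \<kappa> C) \<longleftrightarrow> a \<in> {f \<in> Mor (jiCat_over \<kappa> C). Dom f \<in> Ob (PsGrp \<kappa> C) \<and> Cod f \<in> Ob (PsGrp \<kappa> C)}"
      using p[of X Y f] c[of X] c[of Y] unfolding a by (simp add: PsGrp_def del: split_paired_Ex) blast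
  qed
  then show ?thesis
    using c by (simp add: full_subcategory_def) (auto simp: PsGrp_def jiCat_over_def)
qed

end

theorem theorem6p13:
  fixes \<kappa> :: "'k rel" and C :: "('o, 'm) rcat"
  assumes "Cinfinite \<kappa>"
    and "join_restriction_category C"
    and "locally_small \<kappa> C"
    and "has_local_glueings \<kappa> C"
  shows "adjoint_equivalence
           (peGpd \<kappa> C :: (('i, 'o, 'm) pcat, ('i, 'o, 'm) cofunctor) cat)
           (jiCat_over \<kappa> C) (Phi_g C) (Psi \<kappa> C) (Psi_unit C) \<and>
         full_subcategory
           (eGpd \<kappa> C :: (('i, 'o, 'm) pcat, ('i, 'o, 'm) cofunctor) cat) (peGpd \<kappa> C) \<and>
         full_subcategory
           (PsGrp \<kappa> C :: (('i, 'o, 'm) over_obj, ('i, 'o, 'm) over_map) cat) (jiCat_over \<kappa> C) \<and>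
         adjoint_equivalence
           (eGpd \<kappa> C :: (('i, 'o, 'm) pcat, ('i, 'o, 'm) cofunctor) cat)
           (PsGrp \<kappa> C) (Phi_g C) (Psi \<kappa> C) (Psi_unit C)"
proof -
  interpret join_restriction_category C by (rule assms(2))
  let ?X = "peGpd \<kappa> C :: (('i, 'o, 'm) pcat, ('i, 'o, 'm) cofunctor) cat"
  let ?Y = "jiCat_over \<kappa> C :: (('i, 'o, 'm) over_obj, ('i, 'o, 'm) over_map) cat"
  have E: "adjoint_equivalence ?X ?Y (Phi_g C) (Psi \<kappa> C) (Psi_unit C)"
    by (rule Phi_Psi_equivalence[OF assms(3,4)])
  have fX: "full_subcategory (eGpd \<kappa> C) ?X" by (rule eGpd_full[OF peGpd_category])
  have fY: "full_subcategory (PsGrp \<kappa> C) ?Y" by (rule PsGrp_full[OF assms(1)])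
  have "adjoint_equivalence (eGpd \<kappa> C :: (('i, 'o, 'm) pcat, ('i, 'o, 'm) cofunctor) cat) (PsGrp \<kappa> C) (Phi_g C) (Psi \<kappa> C) (Psi_unit C)"
  proof (rule adjoint_equivalence_restrict[OF E fX fY])
    fix AA :: "('i, 'o, 'm) pcat" assume "AA \<in> Ob (eGpd \<kappa> C)"
    then have "etale_groupoid \<kappa> C AA" "is_singleton (idx AA)" by (auto simp: eGpd_def peGpd_def)
    then show "fo (Phi_g C) AA \<in> Ob (PsGrp \<kappa> C)"
      using complete_pseudogroup_over_object[OF assms(1), of "Phi_cat C AA" "Phi_proj C AA"]
        Phi_over_object[OF _ assms(3), of AA, unfolded Phi_obj_def]
      by (simp add: PsGrp_def Phi_g_def Phi_obj_def) (simp add: Phi_cat_def)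
  next
    fix X :: "('i, 'o, 'm) over_obj" assume X: "X \<in> Ob (PsGrp \<kappa> C)"
    obtain A P where [simp]: "X = (A, P)" by (cases X)
    have "over_object \<kappa> C X" "is_singleton (Ob A)"
      using X complete_pseudogroup_over_object[OF assms(1), of A P] by (simp_all add: PsGrp_def)
    then show "fo (Psi \<kappa> C) X \<in> Ob (eGpd \<kappa> C)"
      using etale_groupoid_Psi[OF _ assms(4), of X] by (simp add: eGpd_def peGpd_def Psi_def) (simp add: Psi_obj_def)
  qed
  with E fX fY show ?thesis by blast
qed

end
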